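(* Let $x_1,x_2\in\mathbb{C}\setminus((-\infty,-1]\cup[1,\infty))$ and $\nu,\mu\in\mathbb{C}^\ast$, such that $\Re(\mu+\nu)>-1$, $\Re(\mu-\nu)>-2$. Then $$\mathsf{P}_\nu^{-\mu}(x_1)\,\mathsf{P}_\nu^{-\mu}(x_2)=\frac{2^{1-\mu}\sqrt{\pi}}{\Gamma(\frac12(\mu-\nu))\Gamma(\frac12(\nu+\mu+1))}\int_{\frac{x_1+x_2}{1+x_1x_2}}^1\mathsf{P}_\nu^{-\mu}(x_3)(1-x_3^2)^{-1}P_{\nu}\!\left(\frac{2-x_1^2-x_2^2-x_3^2+x_1^2x_2^2x_3^2}{2\sqrt{(1-x_1^2)(1-x_2^2)(1-x_3^2)}}\right)dx_3 .$$
   Context: $\mathbb{C}^\ast=\mathbb{C}\setminus\{0\}$. Let $\mathbf{F}(a,b;c;z)=\sum_{n\ge0}\frac{(a)_n(b)_n}{\Gamma(c+n)}\frac{z^n}{n!}$ (continued analytically) be the regularized Gauss hypergeometric function. Ferrers function of the first kind: $\mathsf{P}_\nu^{\mu}(x)=\left(\frac{1+x}{1-x}\right)^{\frac12\mu}\mathbf{F}\big(-\nu,\nu+1;1-\mu;\frac{1-x}{2}\big)$ for $x\in\mathbb{C}\setminus((-\infty,-1]\cup[1,\infty))$. Legendre function of the first kind: $P_\nu(z)=\mathbf{F}(-\nu,\nu+1;1;\frac{1-z}{2})$.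
   Formalization: Assumes |Arg((1+x1)/(1-x1))+Arg((1+x2)/(1-x2))|<π; the integral runs along the straight segment and the square root is the product of three principal roots; convergence is shown for Re(μ-ν)>0, and for other μ,ν the identity is stated only when the integral converges. *)

theory Defs
  imports "HOL-Complex_Analysis.Complex_Analysis"
begin

definition hyp2F1_reg_series :: "complex \<Rightarrow> complex \<Rightarrow> complex \<Rightarrow> complex \<Rightarrow> complex" where
  "hyp2F1_reg_series a b c z =
     (\<Sum>n. pochhammer a n * pochhammer b n * rGamma (c + of_nat n) * z ^ n / fact n)"

text \<open>
  The principal branch: by the identity theorem the holomorphic continuation of the series to the
  plane cut along \<open>[1, \<infinity>)\<close> is unique off the cut. The values on the cut are unspecified.
\<close>
definition hyp2F1_reg :: "complex \<Rightarrow> complex \<Rightarrow> complex \<Rightarrow> complex \<Rightarrow> complex" where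
  "hyp2F1_reg a b c =
     (SOME f. f holomorphic_on - (complex_of_real ` {1..}) \<and>
              (\<forall>z\<in>ball 0 1. f z = hyp2F1_reg_series a b c z))"

definition ferrers_domain :: "complex set" where
  "ferrers_domain = - (complex_of_real ` ({..-1} \<union> {1..}))"

definition ferrersP :: "complex \<Rightarrow> complex \<Rightarrow> complex \<Rightarrow> complex" where
  "ferrersP \<nu> \<mu> x =
     ((1 + x) / (1 - x)) powr (\<mu> / 2) * hyp2F1_reg (- \<nu>) (\<nu> + 1) (1 - \<mu>) ((1 - x) / 2)"

definition legendreP :: "complex \<Rightarrow> complex \<Rightarrow> complex" where
  "legendreP \<nu> z = hyp2F1_reg (- \<nu>) (\<nu> + 1) 1 ((1 - z) / 2)"

text \<open>
  The root of \<open>(1 - x\<^sub>1\<^sup>2) (1 - x\<^sub>2\<^sup>2) (1 - x\<^sub>3\<^sup>2)\<close> is the branch that is holomorphic for all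
  \<open>x\<^sub>i\<close> in \<^const>\<open>ferrers_domain\<close> and positive for real \<open>x\<^sub>i\<close>, i.e. the product of the principal
  roots of the factors. The principal root of the product is discontinuous there.
\<close>
definition product_argument :: "complex \<Rightarrow> complex \<Rightarrow> complex \<Rightarrow> complex" where
  "product_argument x1 x2 x3 =
     (2 - x1\<^sup>2 - x2\<^sup>2 - x3\<^sup>2 + x1\<^sup>2 * x2\<^sup>2 * x3\<^sup>2) /
     (2 * (csqrt (1 - x1\<^sup>2) * csqrt (1 - x2\<^sup>2) * csqrt (1 - x3\<^sup>2)))"

definition product_integrand ::
    "complex \<Rightarrow> complex \<Rightarrow> complex \<Rightarrow> complex \<Rightarrow> complex \<Rightarrow> complex" where
  "product_integrand \<nu> \<mu> x1 x2 x3 =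
     ferrersP \<nu> (- \<mu>) x3 * inverse (1 - x3\<^sup>2) * legendreP \<nu> (product_argument x1 x2 x3)"

text \<open>
  The straight segment from \<open>(x\<^sub>1 + x\<^sub>2) / (1 + x\<^sub>1 x\<^sub>2)\<close> to \<open>1\<close>. If the lower limit lies in
  \<^const>\<open>ferrers_domain\<close>, then so does the whole segment except for its end point \<open>1\<close>.
\<close>
definition product_path :: "complex \<Rightarrow> complex \<Rightarrow> real \<Rightarrow> complex" where
  "product_path x1 x2 = linepath ((x1 + x2) / (1 + x1 * x2)) 1"

text \<open>
  With \<open>x\<^sub>i = tanh t\<^sub>i\<close>, \<open>\<bar>Im t\<^sub>i\<bar> < \<pi>/2\<close>, one has \<open>Arg ((1 + x\<^sub>i) / (1 - x\<^sub>i)) = 2 Im t\<^sub>i\<close> and the lower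
  limit of integration is \<open>tanh (t\<^sub>1 + t\<^sub>2)\<close>. The condition says \<open>\<bar>Im (t\<^sub>1 + t\<^sub>2)\<bar> < \<pi>/2\<close>, i.e. the
  lower limit, continued from real arguments, stays on the principal sheet of the Ferrers
  functions; it makes \<open>1 + x\<^sub>1 x\<^sub>2 \<noteq> 0\<close> and \<^const>\<open>product_argument\<close> equal to \<open>1\<close> at the lower limit.
  It holds for all real \<open>x\<^sub>1, x\<^sub>2\<close> in \<open>(-1, 1)\<close>.
\<close>
definition principal_pair :: "complex \<Rightarrow> complex \<Rightarrow> bool" where
  "principal_pair x1 x2 \<longleftrightarrow> \<bar>Arg ((1 + x1) / (1 - x1)) + Arg ((1 + x2) / (1 - x2))\<bar> < pi"

end

theory Submission
  imports Defs "HOL-Real_Asymp.Real_Asymp"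
begin

text \<open>
  Write \<open>x\<^sub>i = tanh t\<^sub>i\<close>. Then \<open>P\<^sub>\<nu>\<^sup>-\<^sup>\<mu>(x) = \<phi>(t)\<close> solves \<open>\<phi>'' = (\<mu>\<^sup>2 - \<nu>(\<nu>+1) / cosh\<^sup>2 t) \<phi>\<close> and the claim becomes
  \<open>\<phi>(t\<^sub>1) \<phi>(t\<^sub>2) = C \<integral> \<phi>(s) P\<^sub>\<nu>(Z) ds\<close>, where \<open>s\<close> runs from \<open>t\<^sub>1 + t\<^sub>2\<close> to \<open>\<infinity>\<close> and
  \<open>Z + 1 = (cosh s + cosh (t\<^sub>1 + t\<^sub>2)) (cosh s + cosh (t\<^sub>1 - t\<^sub>2)) / (2 cosh t\<^sub>1 cosh t\<^sub>2 cosh s)\<close>.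
  As a function of \<open>t\<^sub>1\<close>, or of \<open>t\<^sub>2\<close>, the integral satisfies the equation of \<open>\<phi>\<close>, since the integrand does so
  up to an \<open>s\<close>-derivative, and \<open>e\<^sup>\<mu>\<^sup>t\<close> times it is holomorphic in \<open>e\<^sup>-\<^sup>2\<^sup>t\<close> at the cusp \<open>t = \<infinity>\<close>. Hence its
  Wronskian with \<open>\<phi>\<close> vanishes and it is a multiple of \<open>\<phi>(t\<^sub>1) \<phi>(t\<^sub>2)\<close>. The constant, read off at the
  cusp, is a Mellin transform of \<open>P\<^sub>\<nu>\<close>, which the Legendre equation evaluates by a recursion in \<open>\<mu>\<close>.
  The identity then extends analytically from large real \<open>t\<^sub>i\<close> to the strips, because the Legendre argument
  avoids the cut along the whole segment.

  The integral converges absolutely if \<open>Re (\<mu> - \<nu>) > 0\<close>. Otherwise the leading term of \<open>P\<^sub>\<nu>\<close> at infinity makes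
  it diverge, unless \<open>\<phi>\<close> has a vanishing leading coefficient, that is \<open>\<mu> = -1\<close>; this case reduces to \<open>\<mu> = 1\<close>.
\<close>

section \<open>The regularized hypergeometric function\<close>

text \<open>\<open>hyp2F1_reg\<close> is a choice, so nothing is known about it until a continuation
  has been constructed; this is done by solving the equation in a variable that opens the cut plane
  into a disc. No connection formula enters: that the leading coefficient of
  \<open>P\<^sub>\<nu>\<close> at infinity is nonzero is deduced from the Mellin transform. The
  Wronskian argument rests on two boundary terms. At \<open>s = t\<^sub>1 + t\<^sub>2\<close> the
  Legendre argument is identically \<open>1\<close>, so its derivative along the boundary vanishes;
  at \<open>s = \<infinity>\<close> the term dies because Re \<nu> < Re \<mu>. In the variable
  \<open>q = exp (-2 * t)\<close> the Wronskian is then constant and at the same time of order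
  \<open>q powr (\<mu> + 1)\<close>, hence zero. For complex \<open>t\<^sub>i\<close> the obstacle
  is the cut: the positivity that is evident for real arguments is replaced by the convexity of a
  region bounded by a hyperbola. The reflection of \<nu> to \<open>- 1 - \<nu>\<close> allows Re
  \<nu> \<ge> -1/2 throughout, which fixes the dominant exponent at infinity.\<close>

definition hyp_coeff :: "complex \<Rightarrow> complex \<Rightarrow> complex \<Rightarrow> nat \<Rightarrow> complex" where
  "hyp_coeff a b c n = pochhammer a n * pochhammer b n * rGamma (c + of_nat n) / fact n"

definition hyp_fps :: "complex \<Rightarrow> complex \<Rightarrow> complex \<Rightarrow> complex fps" where
  "hyp_fps a b c = Abs_fps (hyp_coeff a b c)"

lemma hyp2F1_reg_series_eq_eval_fps: "hyp2F1_reg_series a b c = eval_fps (hyp_fps a b c)"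
  by (rule ext) (simp add: hyp2F1_reg_series_def eval_fps_def hyp_fps_def hyp_coeff_def)

lemma hyp2F1_reg_series_0: "hyp2F1_reg_series a b c 0 = rGamma c"
  by (simp add: hyp2F1_reg_series_eq_eval_fps eval_fps_at_0 hyp_fps_def hyp_coeff_def)

text \<open>Kept in product form so that it also holds when \<open>c\<close> is a nonpositive
  integer: \<open>rGamma\<close> is entire and its shift by 1 has no exceptional points.\<close>

lemma hyp_coeff_Suc:
  "of_nat (Suc n) * (c + of_nat n) * hyp_coeff a b c (Suc n) =
   (a + of_nat n) * (b + of_nat n) * hyp_coeff a b c n"
proof -
  have r: "(c + of_nat n) * rGamma (c + of_nat (Suc n)) = rGamma (c + of_nat n)"
    using rGamma_plus1[of "c + of_nat n"] by (simp add: add_ac)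
  have nz: "of_nat (Suc n) \<noteq> (0::complex)" by (simp del: of_nat_Suc)
  have "of_nat (Suc n) * (c + of_nat n) * hyp_coeff a b c (Suc n) =
     pochhammer a (Suc n) * pochhammer b (Suc n) * ((c + of_nat n) * rGamma (c + of_nat (Suc n))) / fact n"
    unfolding hyp_coeff_def fact_Suc using nz by (simp add: divide_simps del: of_nat_Suc)
  also have "\<dots> = (a + of_nat n) * (b + of_nat n) * hyp_coeff a b c n"
    unfolding r by (simp add: hyp_coeff_def pochhammer_Suc)
  finally show ?thesis .
qed

lemma eventually_coeff_ratio_le:
  fixes a b c :: complex
  assumes "R > 1"
  shows "\<forall>\<^sub>F n in sequentially. cmod ((a + of_nat n) * (b + of_nat n)) \<le>
           R * cmod (of_nat (Suc n) * (c + of_nat n))"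
proof -
  obtain A B C where A: "A > cmod a" and B: "B > cmod b" and C: "C > cmod c"
    by (meson gt_ex)
  have pos: "A > 0" "B > 0"
    using A B norm_ge_zero[of a] norm_ge_zero[of b] by linarith+
  have "\<forall>\<^sub>F n in sequentially. (A + real n) * (B + real n) \<le> R * (real (Suc n) * (real n - C))"
    using assms by real_asymp
  moreover have "\<forall>\<^sub>F n in sequentially. real n > C"
    by real_asymp
  ultimately show ?thesis
  proof eventually_elim
    case (elim n)
    have "cmod ((a + of_nat n) * (b + of_nat n)) \<le> (A + real n) * (B + real n)"
      unfolding norm_mult
      by (intro mult_mono; (rule order.trans[OF norm_triangle_ineq])?) (use A B pos in auto)
    also have "\<dots> \<le> R * (real (Suc n) * (real n - C))" by (rule elim)
    also have "\<dots> \<le> R * cmod (of_nat (Suc n) * (c + of_nat n))"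
    proof -
      have "real n - C \<le> cmod (c + of_nat n)"
        using norm_triangle_ineq2[of "of_nat n" "-c"] C by (simp add: add.commute)
      then show ?thesis unfolding norm_mult norm_of_nat using assms
        by (intro mult_left_mono) auto
    qed
    finally show ?case .
  qed
qed

lemma hyp_fps_conv_radius: "fps_conv_radius (hyp_fps a b c) \<ge> 1"
proof -
  have "fps_conv_radius (hyp_fps a b c) \<ge> ereal r" if r: "0 < r" "r < 1" for r :: real
  proof -
    \<comment> \<open>The mean of \<open>1\<close> and \<open>1 / r\<close>: above the limit
      \<open>1\<close> of the coefficient ratios, yet \<open>R * r < 1\<close>.\<close>
    define R where "R = (1 + 1 / r) / 2"
    have R: "R > 1" "R * r < 1" using r by (auto simp: R_def field_simps)
    have "\<forall>\<^sub>F n in sequentially. real n > cmod c"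
      by real_asymp
    with eventually_coeff_ratio_le[OF R(1), of a b c]
    have "\<forall>\<^sub>F n in sequentially. norm (hyp_coeff a b c (Suc n) * of_real r ^ Suc n) \<le>
            (R * r) * norm (hyp_coeff a b c n * of_real r ^ n)"
    proof eventually_elim
      case (elim n)
      have "c + of_nat n \<noteq> 0"
      proof
        assume "c + of_nat n = 0"
        then have "cmod c = real n"
          by (metis add_eq_0_iff2 norm_minus_cancel norm_of_nat)
        with elim show False by simp
      qed
      then have pos: "cmod (of_nat (Suc n) * (c + of_nat n)) > 0"
        by (simp del: of_nat_Suc)
      have "cmod (of_nat (Suc n) * (c + of_nat n)) * cmod (hyp_coeff a b c (Suc n)) =
        cmod ((a + of_nat n) * (b + of_nat n)) * cmod (hyp_coeff a b c n)"
        using arg_cong[OF hyp_coeff_Suc[of n c a b], of cmod] by (simp only: norm_mult)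
      also have "\<dots> \<le> R * cmod (of_nat (Suc n) * (c + of_nat n)) * cmod (hyp_coeff a b c n)"
        by (intro mult_right_mono elim) auto
      finally have "cmod (hyp_coeff a b c (Suc n)) \<le> R * cmod (hyp_coeff a b c n)"
        using pos by (simp add: mult_ac mult_le_cancel_left_pos)
      then show ?case using r
        by (simp add: norm_mult norm_power mult_ac mult_left_mono)
    qed
    then obtain N where "\<And>n. n \<ge> N \<Longrightarrow> norm (hyp_coeff a b c (Suc n) * of_real r ^ Suc n) \<le>
            (R * r) * norm (hyp_coeff a b c n * of_real r ^ n)"
      unfolding eventually_sequentially by blast
    then have "summable (\<lambda>n. hyp_coeff a b c n * of_real r ^ n)"
      by (rule summable_ratio_test[OF R(2)])
    then have "conv_radius (hyp_coeff a b c) \<ge> norm (complex_of_real r)"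
      by (rule conv_radius_geI)
    then show ?thesis
      using r by (simp add: fps_conv_radius_def hyp_fps_def)
  qed
  note * = this
  show ?thesis
  proof (rule ccontr)
    assume "\<not> ?thesis"
    then have "fps_conv_radius (hyp_fps a b c) < 1" by simp
    then obtain r where r: "fps_conv_radius (hyp_fps a b c) < ereal r" "ereal r < 1"
      using ereal_dense2 by blast
    have "0 \<le> fps_conv_radius (hyp_fps a b c)"
      by (simp add: fps_conv_radius_def conv_radius_nonneg)
    then have "0 < ereal r" using r(1) by (rule le_less_trans)
    then have "0 < r" "r < 1" using r(2) by auto
    from *[OF this] r(1) show False by simp
  qed
qed

lemma hyp2F1_reg_series_holomorphic: "hyp2F1_reg_series a b c holomorphic_on ball 0 1"
proof -
  have "ereal (dist 0 z) < fps_conv_radius (hyp_fps a b c)" if "z \<in> ball 0 1" for z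
  proof -
    have "ereal (dist 0 z) < 1" using that by simp
    then show ?thesis using hyp_fps_conv_radius by (rule less_le_trans)
  qed
  then have "ball 0 1 \<subseteq> eball 0 (fps_conv_radius (hyp_fps a b c))"
    unfolding subset_iff in_eball_iff by blast
  then show ?thesis unfolding hyp2F1_reg_series_eq_eval_fps
    by (rule holomorphic_on_eval_fps)
qed

definition hyp_op :: "complex \<Rightarrow> complex \<Rightarrow> complex \<Rightarrow> (complex \<Rightarrow> complex) \<Rightarrow> complex \<Rightarrow> complex" where
  "hyp_op a b c f z =
     z * (1 - z) * deriv (deriv f) z + (c - (a + b + 1) * z) * deriv f z - a * b * f z"

text \<open>Coefficientwise this is \<open>hyp_coeff_Suc\<close>; the identity theorem carries it
  from the germ at 0 to the disc.\<close>

lemma hyp_op_series: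
  assumes "z \<in> ball 0 1"
  shows "hyp_op a b c (hyp2F1_reg_series a b c) z = 0"
proof -
  let ?U = "hyp_fps a b c"
  have "fps_X * (1 - fps_X) * fps_deriv (fps_deriv ?U) +
        (fps_const c - fps_const (a + b + 1) * fps_X) * fps_deriv ?U - fps_const (a * b) * ?U = 0"
  proof (rule fps_ext)
    fix n
    show "fps_nth (fps_X * (1 - fps_X) * fps_deriv (fps_deriv ?U) +
        (fps_const c - fps_const (a + b + 1) * fps_X) * fps_deriv ?U - fps_const (a * b) * ?U) n = fps_nth 0 n"
    proof (cases n)
      case 0
      then show ?thesis using hyp_coeff_Suc[of 0 c a b]
        by (simp add: hyp_fps_def algebra_simps)
    next
      case (Suc k)
      then show ?thesis using hyp_coeff_Suc[of n c a b]
        by (cases k) (simp_all add: hyp_fps_def algebra_simps)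
    qed
  qed
  have ev: "hyp2F1_reg_series a b c has_fps_expansion ?U"
    unfolding hyp2F1_reg_series_eq_eval_fps
    by (rule eval_fps_has_fps_expansion) (use hyp_fps_conv_radius[of a b c] in \<open>auto intro: less_le_trans[of _ 1]\<close>)
  have "(\<lambda>z. z * (1 - z) * deriv (deriv (hyp2F1_reg_series a b c)) z + (c - (a + b + 1) * z) * deriv (hyp2F1_reg_series a b c) z - a * b * hyp2F1_reg_series a b c z) has_fps_expansion
     fps_X * (1 - fps_X) * fps_deriv (fps_deriv ?U) +
        (fps_const c - fps_const (a + b + 1) * fps_X) * fps_deriv ?U - fps_const (a * b) * ?U"
    by (intro fps_expansion_intros ev)
  then have "hyp_op a b c (hyp2F1_reg_series a b c) has_fps_expansion 0"
    unfolding \<open>_ = 0\<close> by (simp add: hyp_op_def[abs_def])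
  moreover have "hyp_op a b c (hyp2F1_reg_series a b c) holomorphic_on ball 0 1"
    unfolding hyp_op_def[abs_def]
    by (intro holomorphic_intros hyp2F1_reg_series_holomorphic) auto
  ultimately show ?thesis
    using has_fps_expansion_0_analytic_continuation[of "hyp_op a b c (hyp2F1_reg_series a b c)" "ball 0 1" z] assms
    by auto
qed

text \<open>A discrete Gronwall argument: the partial sums \<open>s\<close> satisfy
  \<open>s (Suc n) \<le> (1 + M / n) * s n\<close>, so their ratios are eventually below any bound
  larger than 1, and each coefficient is dominated by a partial sum.\<close>

lemma conv_radius_ge_1_if_le_partial_sums:
  fixes f :: "nat \<Rightarrow> complex"
  assumes "\<forall>\<^sub>F n in sequentially. real n * norm (f n) \<le> M * (\<Sum>k<n. norm (f k))"
  shows "conv_radius f \<ge> 1"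
proof -
  define s where "s n = (\<Sum>k<n. norm (f k))" for n
  have s_nonneg: "s n \<ge> 0" for n by (auto simp: s_def intro: sum_nonneg)
  have "conv_radius f \<ge> ereal r" if r: "0 < r" "r < 1" for r :: real
  proof -
    define R where "R = (1 + 1 / r) / 2"
    have R: "R > 1" "R * r < 1" using r by (auto simp: R_def field_simps)
    have "\<forall>\<^sub>F n in sequentially. M \<le> real n * (R - 1)"
      using R by real_asymp
    with assms eventually_gt_at_top[of "0::nat"]
    have "\<forall>\<^sub>F n in sequentially. norm (s (Suc n) * r ^ Suc n) \<le> (R * r) * norm (s n * r ^ n)"
    proof eventually_elim
      case (elim n)
      have "real n * norm (f n) \<le> M * s n" using elim by (simp add: s_def)
      also have "\<dots> \<le> real n * (R - 1) * s n"
        using elim s_nonneg by (intro mult_right_mono) auto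
      finally have "norm (f n) \<le> (R - 1) * s n"
        using elim by (simp add: mult.assoc mult_le_cancel_left_pos)
      then have "s (Suc n) \<le> R * s n"
        by (simp add: s_def algebra_simps)
      then have "s (Suc n) * r ^ Suc n \<le> (R * s n) * r ^ Suc n"
        using r by (intro mult_right_mono) auto
      then show ?case using s_nonneg r by (simp add: abs_mult mult_ac)
    qed
    then obtain N where "\<And>n. n \<ge> N \<Longrightarrow> norm (s (Suc n) * r ^ Suc n) \<le> (R * r) * norm (s n * r ^ n)"
      unfolding eventually_sequentially by blast
    then have "summable (\<lambda>n. s n * r ^ n)"
      by (rule summable_ratio_test[OF R(2)])
    then have "summable (\<lambda>n. s (Suc n) * r ^ Suc n)"
      by (subst summable_Suc_iff)
    then have "summable (\<lambda>n. (1 / r) * (s (Suc n) * r ^ Suc n))"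
      by (rule summable_mult)
    then have sm: "summable (\<lambda>n. s (Suc n) * r ^ n)"
      using r by simp
    have "norm (f n * of_real r ^ n) \<le> s (Suc n) * r ^ n" for n
    proof -
      have "norm (f n) \<le> s (Suc n)" using s_nonneg[of n] by (simp add: s_def)
      then show ?thesis using r by (simp add: norm_mult norm_power mult_right_mono)
    qed
    then have "summable (\<lambda>n. f n * of_real r ^ n)"
      by (intro summable_comparison_test'[OF sm]) auto
    then have "conv_radius f \<ge> norm (complex_of_real r)"
      by (rule conv_radius_geI)
    then show ?thesis using r by simp
  qed
  note * = this
  show ?thesis
  proof (rule ccontr)
    assume "\<not> ?thesis"
    then have "conv_radius f < 1" by simp
    then obtain r where r: "conv_radius f < ereal r" "ereal r < 1"
      using ereal_dense2 by blast
    have "0 \<le> conv_radius f" by (rule conv_radius_nonneg)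
    then have "0 < ereal r" using r(1) by (rule le_less_trans)
    then have "0 < r" "r < 1" using r(2) by auto
    from *[OF this] r(1) show False by simp
  qed
qed

lemma geometric_has_fps_expansion:
  fixes s :: complex
  assumes "cmod s = 1"
  shows "(\<lambda>q. 1 / (1 - s * q)) has_fps_expansion Abs_fps (\<lambda>n. s ^ n)"
proof (rule has_fps_expansionI)
  have "\<forall>\<^sub>F u in nhds 0. u \<in> ball (0::complex) 1"
    by (rule eventually_nhds_in_open) auto
  then show "\<forall>\<^sub>F u in nhds 0. (\<lambda>n. fps_nth (Abs_fps (\<lambda>n. s ^ n)) n * u ^ n) sums (1 / (1 - s * u))"
  proof eventually_elim
    case (elim u)
    then show ?case using geometric_sums[of "s * u"] assms by (simp add: norm_mult power_mult_distrib)
  qed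
qed

text \<open>
  The Koebe map \<open>q \<mapsto> -4 q / (1 - q)\<^sup>2\<close> sends the unit disc onto the plane cut along \<open>[1, \<infinity>)\<close>.
  The pulled back equation is Fuchsian at \<open>0\<close> with coefficients holomorphic in the disc, so its
  power series solutions converge in the whole disc.
\<close>
definition koebe :: "complex \<Rightarrow> complex" where "koebe q = -4 * q / (1 - q) ^ 2"

text \<open>Written in powers of the Euler operator \<open>q * d/dq\<close> with geometric series as
  coefficients, so that the coefficient recursion can be read off. At \<open>q = 0\<close> the
  coefficients give the indicial roots 0 and \<open>1 - c\<close>; the other finite singular points
  are 1 and -1, both on the unit circle.\<close>

lemma koebe_pullback_ode:
  fixes a b c q :: complex
  assumes q: "q \<in> ball 0 (1/16)" and ab: "a + b = 1"
  defines "h \<equiv> hyp2F1_reg_series a b c \<circ> koebe"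
  shows "q\<^sup>2 * deriv (deriv h) q + q * deriv h q + (1 - c) * (q * deriv h q)
     + (q * deriv h q) * ((2*c-3) * (1 / (1 - (-1) * q)) + 1 / (1 - 1 * q))
     + h q * (4 * a * b * (q * (1 / (1 - 1 * q))\<^sup>2)) = 0"
proof -
  define S where "S = hyp2F1_reg_series a b c"
  have Shol: "S holomorphic_on ball 0 1" unfolding S_def by (rule hyp2F1_reg_series_holomorphic)
  \<comment> \<open>Any small radius would do: with \<open>cmod q < 1/16\<close> the value is at
    most \<open>(1/4) / (15/16)^2\<close>, so the series may be evaluated there.\<close>
  have k1: "koebe q \<in> ball 0 1" if "q \<in> ball 0 (1/16)" for q
  proof -
    have "cmod (1 - q) \<ge> 15/16"
      using that norm_triangle_ineq2[of 1 q] by simp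
    then have "cmod (1 - q) ^ 2 \<ge> (15/16)\<^sup>2" by (intro power_mono) auto
    then have "4 * cmod q < 1 * cmod (1 - q) ^ 2" using that by (simp add: power2_eq_square)
    moreover have "cmod (1 - q) ^ 2 > 0" using \<open>cmod (1 - q) \<ge> 15/16\<close> by (intro zero_less_power) auto
    ultimately show ?thesis
      by (simp add: koebe_def norm_divide norm_mult norm_power divide_simps)
  qed
  have ne1: "q \<noteq> 1" "q \<noteq> -1" if "q \<in> ball 0 (1/16)" for q :: complex using that by auto
  have dk: "(koebe has_field_derivative (-4 * (1+q) / (1-q)^3)) (at q)" if "q \<in> ball 0 (1/16)" for q
    unfolding koebe_def[abs_def] using ne1[OF that]
    by (auto intro!: derivative_eq_intros simp: divide_simps) (simp add: algebra_simps power2_eq_square power3_eq_cube eval_nat_numeral)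
  have dS: "(S has_field_derivative deriv S z) (at z)" if "z \<in> ball 0 1" for z
    using Shol that by (intro holomorphic_derivI) auto
  have dS2: "(deriv S has_field_derivative deriv (deriv S) z) (at z)" if "z \<in> ball 0 1" for z
    using Shol that by (intro holomorphic_derivI[of _ "ball 0 1"] holomorphic_deriv) auto
  have dh: "(h has_field_derivative (deriv S (koebe q) * (-4 * (1+q) / (1-q)^3))) (at q)" if "q \<in> ball 0 (1/16)" for q
    unfolding h_def S_def[symmetric] by (rule DERIV_chain[OF dS[OF k1[OF that]] dk[OF that]])
  have dh1: "deriv h q = deriv S (koebe q) * (-4 * (1+q) / (1-q)^3)" if "q \<in> ball 0 (1/16)" for q
    using dh[OF that] by (rule DERIV_imp_deriv)
  have "((\<lambda>q. deriv S (koebe q) * (-4 * (1+q) / (1-q)^3)) has_field_derivative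
     (deriv (deriv S) (koebe q) * (-4 * (1+q) / (1-q)^3)\<^sup>2 + deriv S (koebe q) * (-8*(2+q)/(1-q)^4))) (at q)"
  proof -
    have "((\<lambda>q. -4 * (1+q) / (1-q)^3) has_field_derivative (-8*(2+q)/(1-q)^4)) (at q)"
      using ne1[OF q]
      by (auto intro!: derivative_eq_intros simp: divide_simps) (simp add: algebra_simps eval_nat_numeral)
    from DERIV_mult[OF DERIV_chain2[OF dS2[OF k1[OF q]] dk[OF q]] this] show ?thesis
      by (simp add: power2_eq_square mult_ac)
  qed
  then have "(deriv h has_field_derivative
     (deriv (deriv S) (koebe q) * (-4 * (1+q) / (1-q)^3)\<^sup>2 + deriv S (koebe q) * (-8*(2+q)/(1-q)^4))) (at q)"
    by (rule has_field_derivative_transform_within_open[of _ _ _ "ball 0 (1/16)"]) (use q dh1 in auto)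
  then have dh2: "deriv (deriv h) q = deriv (deriv S) (koebe q) * (-4 * (1+q) / (1-q)^3)\<^sup>2 + deriv S (koebe q) * (-8*(2+q)/(1-q)^4)"
    by (rule DERIV_imp_deriv)
  define k S0 S1 S2 where "k = koebe q" "S0 = S k" "S1 = deriv S k" "S2 = deriv (deriv S) k"
  have ode: "k * (1 - k) * S2 + (c - 2 * k) * S1 - a * b * S0 = 0"
    using hyp_op_series[OF k1[OF q], of a b c] ab by (simp add: hyp_op_def S_def k_S0_S1_S2_def)
  have n1: "1 - q \<noteq> 0" "1 + q \<noteq> 0" using ne1[OF q] by (simp_all add: add_eq_0_iff)
  \<comment> \<open>Names for the two reciprocals turn the remaining identities into polynomial ones
    modulo \<open>w * (1 - q) = 1\<close> and \<open>v * (1 + q) = 1\<close>.\<close>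
  define w v where "w = 1 / (1 - q)" "v = 1 / (1 + q)"
  have wq: "w * (1 - q) = 1" "v * (1 + q) = 1" using n1 by (auto simp: w_v_def)
  have kw: "k = -4 * q * w^2" by (simp add: k_S0_S1_S2_def koebe_def w_v_def power_divide)
  have w3: "-4 * (1+q) / (1-q)^3 = -4 * (1+q) * w^3" "-8*(2+q)/(1-q)^4 = -8*(2+q)*w^4"
    by (simp_all add: w_v_def power_divide)
  have e0: "4 * a * b * q * w\<^sup>2 = k * (- (a * b))" by (simp add: kw)
  have onek: "1 - k = (1+q)^2 * w^2"
    using wq(1) unfolding kw by algebra
  have e2: "q\<^sup>2 * (-4 * (1+q) * w^3)\<^sup>2 = k * (k * (1 - k))"
    unfolding onek unfolding kw by algebra
  have e1: "q\<^sup>2 * (-8*(2+q)*w^4) + q * (-4 * (1+q) * w^3) * (1 + (1 - c) + (2*c-3) * v + w) = k * (c - 2 * k)"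
    using wq unfolding kw by algebra
  have "q\<^sup>2 * deriv (deriv h) q + q * deriv h q + (1 - c) * (q * deriv h q)
     + (q * deriv h q) * ((2*c-3) * (1 / (1 - (-1) * q)) + 1 / (1 - 1 * q))
     + h q * (4 * a * b * (q * (1 / (1 - 1 * q))\<^sup>2))
    = (q\<^sup>2 * (-4 * (1+q) * w^3)\<^sup>2) * S2 + (q\<^sup>2 * (-8*(2+q)*w^4) + q * (-4 * (1+q) * w^3) * (1 + (1 - c) + (2*c-3) * v + w)) * S1
      + (4 * a * b * q * w\<^sup>2) * S0"
    unfolding dh1[OF q] dh2 w3 by (simp add: h_def w_v_def k_S0_S1_S2_def S_def[symmetric] algebra_simps)
  also have "\<dots> = k * (k * (1 - k) * S2 + (c - 2 * k) * S1 - a * b * S0)"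
    unfolding e0 e1 e2 by (simp add: algebra_simps)
  finally show ?thesis unfolding ode by simp
qed

text \<open>The coefficients of \<open>A\<close> are bounded and those of \<open>B\<close> grow
  linearly, so the recursion bounds \<open>n^2 * cmod (f n)\<close> by a multiple of
  \<open>n\<close> times the sum of the earlier moduli. This is the hypothesis of the Gronwall
  lemma.\<close>

lemma koebe_pullback_coeffs:
  fixes a b c :: complex
  assumes H: "(hyp2F1_reg_series a b c \<circ> koebe) has_fps_expansion H" and ab: "a + b = 1"
  shows "fps_conv_radius H \<ge> 1"
proof -
  define f where "f = fps_nth H"
  define G1 G2 :: "complex fps" where "G1 = Abs_fps (\<lambda>n. 1 ^ n)" "G2 = Abs_fps (\<lambda>n. (-1) ^ n)"
  define A where "A = fps_const (2*c-3) * G2 + G1"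
  define B where "B = fps_const (4*a*b) * (fps_X * G1\<^sup>2)"
  let ?D = "fps_X * fps_deriv H"
  let ?h = "hyp2F1_reg_series a b c \<circ> koebe"
  have G1: "(\<lambda>q. 1 / (1 - 1 * q)) has_fps_expansion G1" and G2: "(\<lambda>q. 1 / (1 - (-1) * q)) has_fps_expansion G2"
    unfolding G1_G2_def by (rule geometric_has_fps_expansion; simp)+
  have "(\<lambda>q. q\<^sup>2 * deriv (deriv ?h) q + q * deriv ?h q + (1 - c) * (q * deriv ?h q)
     + (q * deriv ?h q) * ((2*c-3) * (1 / (1 - (-1) * q)) + 1 / (1 - 1 * q))
     + ?h q * (4 * a * b * (q * (1 / (1 - 1 * q))\<^sup>2)))
     has_fps_expansion (fps_X\<^sup>2 * fps_deriv (fps_deriv H) + ?D + fps_const (1 - c) * ?D + ?D * A + H * B)"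
    unfolding A_def B_def by (intro fps_expansion_intros H G1 G2)
  moreover have "\<forall>\<^sub>F q in nhds 0. q\<^sup>2 * deriv (deriv ?h) q + q * deriv ?h q + (1 - c) * (q * deriv ?h q)
     + (q * deriv ?h q) * ((2*c-3) * (1 / (1 - (-1) * q)) + 1 / (1 - 1 * q))
     + ?h q * (4 * a * b * (q * (1 / (1 - 1 * q))\<^sup>2)) = 0"
  proof -
    have "\<forall>\<^sub>F q in nhds 0. q \<in> ball (0::complex) (1/16)"
      by (rule eventually_nhds_in_open) auto
    then show ?thesis
      by eventually_elim (rule koebe_pullback_ode[OF _ ab])
  qed
  ultimately have "(\<lambda>q. 0) has_fps_expansion (fps_X\<^sup>2 * fps_deriv (fps_deriv H) + ?D + fps_const (1 - c) * ?D + ?D * A + H * B)"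
    by (subst (asm) has_fps_expansion_cong) auto
  then have eq: "fps_X\<^sup>2 * fps_deriv (fps_deriv H) + ?D + fps_const (1 - c) * ?D + ?D * A + H * B = 0"
    by (metis fps_expansion_eqI has_fps_expansion_0)
  have Bn: "fps_nth B n = 4 * a * b * of_nat n" for n
  proof -
    have "fps_nth (G1\<^sup>2) m = of_nat (Suc m)" for m
      by (simp add: power2_eq_square fps_mult_nth G1_G2_def)
    then show ?thesis
      by (cases n) (simp_all add: B_def fps_mult_left_const_nth fps_X_mult_nth del: of_nat_Suc)
  qed
  have An: "fps_nth A n = (2*c-3) * (-1)^n + 1" for n by (simp add: A_def G1_G2_def)
  have gen: "fps_nth (fps_X * fps_deriv F) n = of_nat n * fps_nth F n" for F :: "complex fps" and n
    by (cases n) simp_all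
  have Dn: "fps_nth ?D n = of_nat n * f n" for n unfolding f_def by (rule gen)
  have D2n: "fps_nth (fps_X\<^sup>2 * fps_deriv (fps_deriv H)) n + fps_nth ?D n = of_nat n ^ 2 * f n" for n
  proof -
    have "fps_X\<^sup>2 * fps_deriv (fps_deriv H) + ?D = fps_X * fps_deriv ?D"
      by (simp add: algebra_simps power2_eq_square)
    then have "fps_nth (fps_X\<^sup>2 * fps_deriv (fps_deriv H)) n + fps_nth ?D n = fps_nth (fps_X * fps_deriv ?D) n"
      by (metis fps_add_nth)
    also have "\<dots> = of_nat n * fps_nth ?D n" by (rule gen)
    also have "\<dots> = of_nat n * (of_nat n * f n)" by (simp only: Dn)
    finally show ?thesis by (simp only: power2_eq_square mult.assoc)
  qed
  \<comment> \<open>The diagonal term is moved to the left: the constant coefficient of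
    \<open>A\<close> is \<open>2 * c - 2\<close> and that of \<open>B\<close> is 0, which yields the
    indicial polynomial \<open>n * (n + c - 1)\<close>.\<close>
  have rec: "of_nat n * (of_nat n + c - 1) * f n = - (\<Sum>k<n. f k * (of_nat k * fps_nth A (n - k) + fps_nth B (n - k)))" for n
  proof -
    have "0 = fps_nth (fps_X\<^sup>2 * fps_deriv (fps_deriv H) + ?D + fps_const (1 - c) * ?D + ?D * A + H * B) n"
      unfolding eq by simp
    also have "\<dots> = of_nat n ^ 2 * f n + (1 - c) * (of_nat n * f n) + (\<Sum>k=0..n. of_nat k * f k * fps_nth A (n - k)) + (\<Sum>k=0..n. f k * fps_nth B (n - k))"
      unfolding fps_add_nth D2n
      unfolding fps_mult_left_const_nth fps_mult_nth[of _ A] fps_mult_nth[of H B] Dn f_def[symmetric] by (rule refl)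
    also have "\<dots> = of_nat n ^ 2 * f n + (1 - c) * (of_nat n * f n) + (\<Sum>k\<le>n. f k * (of_nat k * fps_nth A (n - k) + fps_nth B (n - k)))"
    proof -
      have "(\<Sum>k=0..n. of_nat k * f k * fps_nth A (n - k)) + (\<Sum>k=0..n. f k * fps_nth B (n - k)) = (\<Sum>k\<le>n. f k * (of_nat k * fps_nth A (n - k) + fps_nth B (n - k)))"
        unfolding atLeast0AtMost sum.distrib[symmetric] by (rule sum.cong) (simp_all add: algebra_simps)
      then show ?thesis by (simp only: add.assoc)
    qed
    also have "\<dots> = of_nat n ^ 2 * f n + (1 - c) * (of_nat n * f n) + f n * (of_nat n * fps_nth A 0 + fps_nth B 0) + (\<Sum>k<n. f k * (of_nat k * fps_nth A (n - k) + fps_nth B (n - k)))"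
      unfolding lessThan_Suc_atMost[symmetric] sum.lessThan_Suc by simp
    also have "of_nat n ^ 2 * f n + (1 - c) * (of_nat n * f n) + f n * (of_nat n * fps_nth A 0 + fps_nth B 0) = of_nat n * (of_nat n + c - 1) * f n"
      by (simp add: An Bn algebra_simps power2_eq_square)
    finally show ?thesis by (simp add: eq_neg_iff_add_eq_0)
  qed
  define M where "M = cmod (2*c-3) + 1 + cmod (4*a*b)"
  have bd: "cmod (of_nat k * fps_nth A (n - k) + fps_nth B (n - k)) \<le> M * real n" if "k < n" for k n
  proof -
    have "cmod (fps_nth A (n - k)) \<le> cmod (2*c-3) + 1"
      unfolding An by (rule order.trans[OF norm_triangle_ineq]) (simp add: norm_mult norm_power)
    then have 1: "real k * cmod (fps_nth A (n - k)) \<le> real n * (cmod (2*c-3) + 1)"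
      using that by (intro mult_mono) auto
    have 2: "cmod (4*a*b) * real (n - k) \<le> cmod (4*a*b) * real n"
      by (intro mult_left_mono) auto
    have "cmod (of_nat k * fps_nth A (n - k) + fps_nth B (n - k)) \<le> real k * cmod (fps_nth A (n - k)) + cmod (4*a*b) * real (n - k)"
      by (rule order.trans[OF norm_triangle_ineq]) (simp only: norm_mult norm_of_nat Bn order_refl)
    also have "\<dots> \<le> M * real n" using 1 2 by (simp add: M_def algebra_simps)
    finally show ?thesis .
  qed
  have "M \<ge> 0" by (simp add: M_def)
  have "\<forall>\<^sub>F n in sequentially. real n > 2 * cmod (c - 1)" by real_asymp
  then have "\<forall>\<^sub>F n in sequentially. real n * norm (f n) \<le> (2 * M) * (\<Sum>k<n. norm (f k))"
    using eventually_gt_at_top[of "0::nat"]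
  proof eventually_elim
    case (elim n)
    have "real n - cmod (c - 1) \<le> cmod (of_nat n + (c - 1))"
      using norm_diff_ineq[of "of_nat n" "c - 1"] by simp
    \<comment> \<open>For \<open>n > 2 * cmod (c - 1)\<close> the indicial factor cannot vanish,
      even if \<open>1 - c\<close> is a positive integer.\<close>
    then have "real n / 2 \<le> cmod (of_nat n + c - 1)" using elim by (simp add: algebra_simps)
    then have "real n * (real n / 2) * cmod (f n) \<le> real n * cmod (of_nat n + c - 1) * cmod (f n)"
      by (intro mult_right_mono mult_left_mono) auto
    also have "\<dots> = cmod (\<Sum>k<n. f k * (of_nat k * fps_nth A (n - k) + fps_nth B (n - k)))"
      using arg_cong[OF rec[of n], of cmod] by (simp add: norm_mult)
    also have "\<dots> \<le> (\<Sum>k<n. cmod (f k) * (M * real n))"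
      by (intro sum_norm_le) (auto simp: norm_mult intro!: mult_left_mono bd)
    also have "\<dots> = real n * (M * (\<Sum>k<n. cmod (f k)))" by (simp add: sum_distrib_left sum_distrib_right mult_ac)
    finally have "real n / 2 * cmod (f n) \<le> M * (\<Sum>k<n. cmod (f k))"
      using elim by (simp add: mult.assoc mult_le_cancel_left_pos)
    then show ?case by simp
  qed
  then have "conv_radius f \<ge> 1" by (rule conv_radius_ge_1_if_le_partial_sums)
  then show ?thesis by (simp add: fps_conv_radius_def f_def)
qed

section \<open>The cut plane and the continuation of the series\<close>

definition hyp_domain :: "complex set" where "hyp_domain = - (complex_of_real ` {1..})"

lemma mem_hyp_domain_iff: "z \<in> hyp_domain \<longleftrightarrow> 1 - z \<notin> \<real>\<^sub>\<le>\<^sub>0"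
proof -
  have "z \<in> complex_of_real ` {1..} \<longleftrightarrow> 1 - z \<in> \<real>\<^sub>\<le>\<^sub>0"
  proof
    assume "1 - z \<in> \<real>\<^sub>\<le>\<^sub>0"
    then have "z = of_real (Re z)" "Re z \<ge> 1"
      by (auto simp: complex_nonpos_Reals_iff complex_eq_iff)
    then show "z \<in> complex_of_real ` {1..}" by (metis atLeast_iff imageI)
  qed (auto simp: complex_nonpos_Reals_iff)
  then show ?thesis by (simp add: hyp_domain_def)
qed

lemma open_hyp_domain: "open hyp_domain"
proof -
  have eq: "hyp_domain = (\<lambda>z. 1 - z) -` (- \<real>\<^sub>\<le>\<^sub>0)"
    using mem_hyp_domain_iff by auto
  show ?thesis unfolding eq by (intro open_vimage continuous_intros) auto
qed

lemma starlike_hyp_domain: "starlike hyp_domain"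
  unfolding starlike_def
proof (intro bexI ballI subsetI)
  fix x y assume x: "x \<in> hyp_domain" and y: "y \<in> closed_segment 0 x"
  then obtain u where u: "0 \<le> u" "u \<le> 1" "y = u *\<^sub>R x" by (auto simp: in_segment)
  show "y \<in> hyp_domain"
  proof (rule ccontr)
    assume "y \<notin> hyp_domain"
    then have "Re y \<ge> 1" "Im y = 0" by (auto simp: mem_hyp_domain_iff complex_nonpos_Reals_iff)
    then have "u * Re x \<ge> 1" "u * Im x = 0" using u by auto
    then have "0 < u * Re x" by linarith
    then have "Re x > 0" "u > 0" using u(1) by (auto simp: zero_less_mult_iff)
    with \<open>u * Im x = 0\<close> have "Im x = 0" "Re x > 0" by auto
    moreover have "Re x \<ge> u * Re x" using u \<open>Re x > 0\<close> by simp
    ultimately show False using x \<open>u * Re x \<ge> 1\<close> by (auto simp: mem_hyp_domain_iff complex_nonpos_Reals_iff)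
  qed
qed (simp add: mem_hyp_domain_iff)

lemma connected_hyp_domain: "connected hyp_domain"
  using starlike_hyp_domain by (rule starlike_imp_connected)

lemma ball_subset_hyp_domain: "ball 0 1 \<subseteq> hyp_domain"
proof
  fix z :: complex assume "z \<in> ball 0 1"
  then have "Re z < 1" using complex_Re_le_cmod[of z] by simp
  then show "z \<in> hyp_domain" by (simp add: mem_hyp_domain_iff complex_nonpos_Reals_iff)
qed

lemma Re_csqrt_pos:
  assumes "w \<notin> \<real>\<^sub>\<le>\<^sub>0"
  shows "Re (csqrt w) > 0"
proof (rule ccontr)
  assume "\<not> ?thesis"
  then have "Re (csqrt w) = 0" using csqrt_principal[of w] by auto
  then have "csqrt w ^ 2 = of_real (- (Im (csqrt w))\<^sup>2)"
    by (simp add: complex_eq_iff power2_eq_square)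
  then have "w = of_real (- (Im (csqrt w))\<^sup>2)" by simp
  then have "Im w = 0" "Re w \<le> 0" by (metis Im_complex_of_real, metis Re_complex_of_real neg_le_0_iff_le zero_le_power2)
  then show False using assms by (simp add: complex_nonpos_Reals_iff)
qed

text \<open>The witness without which the choice in \<open>hyp2F1_reg\<close> carries no
  information. The map \<kappa> inverts \<open>koebe\<close> on the cut plane; since the principal
  root of \<open>1 - z\<close> has positive real part there, it takes values in the unit disc, where
  the pulled back power series converges.\<close>

lemma hyp2F1_reg_continuation_exists:
  assumes ab: "a + b = 1"
  shows "\<exists>f. f holomorphic_on hyp_domain \<and> (\<forall>z\<in>ball 0 1. f z = hyp2F1_reg_series a b c z)"
proof -
  let ?h = "hyp2F1_reg_series a b c \<circ> koebe"
  have "koebe analytic_on {0}" unfolding koebe_def[abs_def] by (intro analytic_intros) auto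
  moreover have "hyp2F1_reg_series a b c analytic_on koebe ` {0}"
  proof (rule analytic_on_subset)
    show "hyp2F1_reg_series a b c analytic_on ball 0 1"
      using hyp2F1_reg_series_holomorphic by (simp add: analytic_on_open)
  qed (simp add: koebe_def)
  ultimately have "?h analytic_on {0}" by (rule analytic_on_compose)
  then obtain H where H: "?h has_fps_expansion H"
    using analytic_at_imp_has_fps_expansion_0 by blast
  have cr: "fps_conv_radius H \<ge> 1" by (rule koebe_pullback_coeffs[OF H ab])
  define \<kappa> where "\<kappa> = (\<lambda>z. (csqrt (1 - z) - 1) / (csqrt (1 - z) + 1))"
  have sq: "Re (csqrt (1 - z)) > 0" if "z \<in> hyp_domain" for z
    using that by (intro Re_csqrt_pos) (simp add: mem_hyp_domain_iff)
  have k1: "\<kappa> z \<in> ball 0 1" if "z \<in> hyp_domain" for z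
  proof -
    let ?s = "csqrt (1 - z)"
    have "cmod (?s - 1) < cmod (?s + 1)"
      using sq[OF that] by (simp add: cmod_def power2_eq_square algebra_simps)
    then show ?thesis unfolding \<kappa>_def by (simp add: norm_divide divide_simps)
  qed
  have aux: "koebe ((s - 1) / (s + 1)) = 1 - s\<^sup>2" if "s + 1 \<noteq> 0" for s :: complex
  proof -
    have e: "1 - (s - 1) / (s + 1) = 2 / (s + 1)" using that by (simp add: divide_simps)
    have "koebe ((s - 1) / (s + 1)) = -4 * ((s - 1) / (s + 1)) * ((s + 1) * (s + 1) / 4)"
      unfolding koebe_def e by (simp add: power2_eq_square)
    also have "\<dots> = - (s - 1) * (s + 1)" using that by simp
    finally show ?thesis by (simp add: algebra_simps power2_eq_square)
  qed
  have kinv: "koebe (\<kappa> z) = z" if "z \<in> hyp_domain" for z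
  proof -
    let ?s = "csqrt (1 - z)"
    have "?s + 1 \<noteq> 0"
    proof
      assume "?s + 1 = 0"
      then have "Re ?s + 1 = 0"
        by (metis one_complex.simps(1) plus_complex.simps(1) zero_complex.simps(1))
      then show False using sq[OF that] by linarith
    qed
    then have "koebe (\<kappa> z) = 1 - ?s ^ 2"
      unfolding \<kappa>_def by (rule aux)
    then show ?thesis by simp
  qed
  have khol: "\<kappa> holomorphic_on hyp_domain"
    unfolding \<kappa>_def
  proof (intro holomorphic_intros)
    show "csqrt (1 - z) + 1 \<noteq> 0" if "z \<in> hyp_domain" for z
    proof
      assume "csqrt (1 - z) + 1 = 0"
      then have "Re (csqrt (1 - z)) + 1 = 0"
        by (metis one_complex.simps(1) plus_complex.simps(1) zero_complex.simps(1))
      then show False using sq[OF that] by linarith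
    qed
  qed (auto simp: mem_hyp_domain_iff)
  define f where "f = eval_fps H \<circ> \<kappa>"
  have "f holomorphic_on hyp_domain"
    unfolding f_def
  proof (rule holomorphic_on_compose[OF khol holomorphic_on_eval_fps])
    show "\<kappa> ` hyp_domain \<subseteq> eball 0 (fps_conv_radius H)"
    proof
      fix w assume "w \<in> \<kappa> ` hyp_domain"
      then have "ereal (dist 0 w) < 1" using k1 by auto
      then show "w \<in> eball 0 (fps_conv_radius H)"
        unfolding in_eball_iff using cr by (rule less_le_trans)
    qed
  qed
  moreover have "f z = hyp2F1_reg_series a b c z" if z: "z \<in> ball 0 1" for z
  proof -
    have "\<forall>\<^sub>F q in nhds 0. eval_fps H q = ?h q" using H by (simp add: has_fps_expansion_def)
    moreover have "filterlim \<kappa> (nhds 0) (nhds 0)"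
    proof -
      have "isCont \<kappa> 0"
        using khol open_hyp_domain ball_subset_hyp_domain
        by (metis centre_in_ball continuous_on_eq_continuous_at holomorphic_on_imp_continuous_on in_mono zero_less_one)
      moreover have "\<kappa> 0 = 0" by (simp add: \<kappa>_def)
      ultimately show ?thesis using tendsto_at_iff_tendsto_nhds[of \<kappa> 0] by (simp add: isCont_def)
    qed
    ultimately have "\<forall>\<^sub>F z in nhds 0. eval_fps H (\<kappa> z) = ?h (\<kappa> z)"
      by (rule eventually_compose_filterlim)
    moreover have "\<forall>\<^sub>F z in nhds 0. z \<in> ball (0::complex) 1" by (rule eventually_nhds_in_open) auto
    ultimately have "\<forall>\<^sub>F z in nhds 0. f z - hyp2F1_reg_series a b c z = 0"
      by eventually_elim (use kinv ball_subset_hyp_domain in \<open>auto simp: f_def\<close>)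
    then have ev: "(\<lambda>z. f z - hyp2F1_reg_series a b c z) has_fps_expansion 0"
      by (simp add: has_fps_expansion_0_iff)
    have "(\<lambda>z. f z - hyp2F1_reg_series a b c z) holomorphic_on ball 0 1"
      by (intro holomorphic_intros hyp2F1_reg_series_holomorphic holomorphic_on_subset[OF \<open>f holomorphic_on _\<close>] ball_subset_hyp_domain)
    from has_fps_expansion_0_analytic_continuation[OF ev this _ _ _ z] show ?thesis by auto
  qed
  ultimately show ?thesis by blast
qed

lemma
  assumes "a + b = 1"
  shows hyp2F1_reg_holomorphic: "hyp2F1_reg a b c holomorphic_on hyp_domain"
    and hyp2F1_reg_eq_series: "z \<in> ball 0 1 \<Longrightarrow> hyp2F1_reg a b c z = hyp2F1_reg_series a b c z"
  using someI_ex[OF hyp2F1_reg_continuation_exists[OF assms, of c]]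
  unfolding hyp2F1_reg_def hyp_domain_def by blast+

lemma hyp2F1_reg_0: "a + b = 1 \<Longrightarrow> hyp2F1_reg a b c 0 = rGamma c"
  by (simp add: hyp2F1_reg_eq_series hyp2F1_reg_series_0)

lemma hyp2F1_reg_commute: "hyp2F1_reg a b = hyp2F1_reg b a"
  by (intro ext) (simp add: hyp2F1_reg_def hyp2F1_reg_series_def mult.commute[of "pochhammer a _"])

lemma hyp_domain_identity:
  assumes "f holomorphic_on hyp_domain" "g holomorphic_on hyp_domain"
    and "\<And>z. z \<in> ball 0 1 \<Longrightarrow> f z = g z" and "z \<in> hyp_domain"
  shows "f z = g z"
  by (rule analytic_continuation_open[of "ball 0 1" hyp_domain f g z])
     (use assms ball_subset_hyp_domain open_hyp_domain connected_hyp_domain in auto)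

lemma hyp2F1_reg_ode:
  assumes ab: "a + b = 1" and z: "z \<in> hyp_domain"
  shows "hyp_op a b c (hyp2F1_reg a b c) z = 0"
proof (rule hyp_domain_identity[OF _ _ _ z])
  let ?f = "hyp2F1_reg a b c"
  show "hyp_op a b c ?f holomorphic_on hyp_domain"
    unfolding hyp_op_def[abs_def] using open_hyp_domain
    by (intro holomorphic_intros hyp2F1_reg_holomorphic ab) auto
  show "hyp_op a b c ?f z = 0" if z: "z \<in> ball 0 1" for z
  proof -
    have 1: "\<forall>\<^sub>F u in nhds z. ?f u = hyp2F1_reg_series a b c u" if z: "z \<in> ball 0 1" for z
      using eventually_nhds_in_open[of "ball 0 1" z] z
      by (auto elim!: eventually_mono simp: hyp2F1_reg_eq_series[OF ab])
    have d1: "deriv ?f z = deriv (hyp2F1_reg_series a b c) z" if z: "z \<in> ball 0 1" for z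
      using 1[OF z] by (rule deriv_cong_ev) auto
    have "\<forall>\<^sub>F u in nhds z. deriv ?f u = deriv (hyp2F1_reg_series a b c) u"
      using eventually_nhds_in_open[of "ball 0 1" z] z by (auto elim!: eventually_mono simp: d1)
    then have d2: "deriv (deriv ?f) z = deriv (deriv (hyp2F1_reg_series a b c)) z"
      by (rule deriv_cong_ev) auto
    show ?thesis using hyp_op_series[OF z, of a b c] d1[OF z] d2 hyp2F1_reg_eq_series[OF ab z]
      by (simp add: hyp_op_def)
  qed
qed auto

section \<open>Improper integrals with a parameter\<close>

text \<open>Cauchy's formula expresses the derivative as an integral over the fixed circle of radius
  \<open>r\<close>, whose integrand is jointly continuous in the point and the parameter.\<close>

lemma continuous_on_deriv_param:
  fixes f :: "complex \<Rightarrow> real \<Rightarrow> complex"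
  assumes r: "r > 0" and cont: "continuous_on (cball z r \<times> T) (\<lambda>(x, t). f x t)"
    and hol: "\<And>t. t \<in> T \<Longrightarrow> (\<lambda>x. f x t) holomorphic_on ball z r"
  shows "continuous_on (ball z r \<times> T) (\<lambda>(x, t). deriv (\<lambda>x. f x t) x)"
proof -
  let ?g = "\<lambda>p s. f (z + r * exp (2 * of_real pi * \<i> * of_real s)) (snd p) /
      (z + r * exp (2 * of_real pi * \<i> * of_real s) - fst p)\<^sup>2 * (2 * of_real pi * \<i> * r * exp (2 * of_real pi * \<i> * of_real s))"
  have nrm: "cmod (of_real r * exp (2 * of_real pi * \<i> * of_real s)) = r" for s :: real
    using r by (simp add: norm_mult)
  have eq: "deriv (\<lambda>x. f x t) w = 1 / (2 * of_real pi * \<i>) * integral (cbox 0 1) (?g (w, t))"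
    if "w \<in> ball z r" "t \<in> T" for w t
  proof -
    have c: "continuous_on (cball z r) (\<lambda>x. f x t)"
    proof -
      have "continuous_on (cball z r) (\<lambda>x. (\<lambda>(x, t). f x t) (x, t))"
        by (rule continuous_on_compose2[OF cont]) (use that in \<open>auto intro!: continuous_intros\<close>)
      then show ?thesis by simp
    qed
    have "((\<lambda>x. f x t) has_field_derivative (1 / (2 * of_real pi * \<i>) * contour_integral (circlepath z r) (\<lambda>u. f u t / (u - w)\<^sup>2))) (at w)"
      using Cauchy_derivative_integral_circlepath[OF c hol[OF that(2)] that(1)] by blast
    then have "deriv (\<lambda>x. f x t) w = 1 / (2 * of_real pi * \<i>) * contour_integral (circlepath z r) (\<lambda>u. f u t / (u - w)\<^sup>2)"
      by (rule DERIV_imp_deriv)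
    also have "contour_integral (circlepath z r) (\<lambda>u. f u t / (u - w)\<^sup>2) = integral (cbox 0 1) (?g (w, t))"
      unfolding contour_integral_integral vector_derivative_circlepath
      by (simp add: circlepath mult_ac)
    finally show ?thesis .
  qed
  have "continuous_on ((ball z r \<times> T) \<times> cbox 0 1) (\<lambda>(p, s). ?g p s)"
  proof -
    have 1: "continuous_on ((ball z r \<times> T) \<times> cbox 0 (1::real)) (\<lambda>q. (\<lambda>(x, t). f x t) (z + r * exp (2 * of_real pi * \<i> * of_real (snd q)), snd (fst q)))"
      by (rule continuous_on_compose2[OF cont]) (auto intro!: continuous_intros simp: dist_norm nrm norm_minus_commute)
    have nz: "z + r * exp (2 * of_real pi * \<i> * of_real s) - w \<noteq> 0" if "w \<in> ball z r" for s w
    proof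
      assume "z + r * exp (2 * of_real pi * \<i> * of_real s) - w = 0"
      then have "w - z = r * exp (2 * of_real pi * \<i> * of_real s)" by (simp add: algebra_simps)
      then have "cmod (w - z) = r" by (simp only: nrm)
      then show False using that by (simp add: dist_norm norm_minus_commute)
    qed
    show ?thesis unfolding split_beta
      using 1 nz by (auto intro!: continuous_intros simp: split_beta)
  qed
  then have "continuous_on (ball z r \<times> T) (\<lambda>p. integral (cbox 0 1) (?g p))"
    by (rule integral_continuous_on_param)
  then have "continuous_on (ball z r \<times> T) (\<lambda>p. 1 / (2 * of_real pi * \<i>) * integral (cbox 0 1) (?g p))"
    by (intro continuous_intros)
  then show ?thesis
    by (rule continuous_on_eq) (auto simp: eq)
qed

lemma holomorphic_on_integral_param:
  fixes f :: "complex \<Rightarrow> real \<Rightarrow> complex"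
  assumes U: "open U" and cont: "continuous_on (U \<times> {a..b}) (\<lambda>(x, t). f x t)"
    and hol: "\<And>t. t \<in> {a..b} \<Longrightarrow> (\<lambda>x. f x t) holomorphic_on U"
  shows "(\<lambda>x. integral {a..b} (f x)) holomorphic_on U"
proof -
  have "\<exists>e>0. (\<lambda>x. integral {a..b} (f x)) holomorphic_on ball z e" if z: "z \<in> U" for z
  proof -
    obtain r where r: "r > 0" "cball z r \<subseteq> U" using U z open_contains_cball by blast
    have sub: "ball z r \<subseteq> U" using r by auto
    have "(\<lambda>x. integral (cbox a b) (f x)) holomorphic_on ball z r"
    proof (rule leibniz_rule_holomorphic[where fx = "\<lambda>x t. deriv (\<lambda>x. f x t) x"])
      show "((\<lambda>x. f x t) has_field_derivative deriv (\<lambda>x. f x t) x) (at x within ball z r)"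
        if "x \<in> ball z r" "t \<in> cbox a b" for x t
        using that sub holomorphic_derivI[OF hol[of t] U, of x "ball z r"] by auto
      show "f x integrable_on cbox a b" if "x \<in> ball z r" for x
      proof -
        have "continuous_on {a..b} (\<lambda>t. (\<lambda>(x, t). f x t) (x, t))"
          by (rule continuous_on_compose2[OF cont]) (use that sub in \<open>auto intro!: continuous_intros\<close>)
        then show ?thesis by (simp add: integrable_continuous_real)
      qed
      show "continuous_on (ball z r \<times> cbox a b) (\<lambda>(x, t). deriv (\<lambda>x. f x t) x)"
        using r sub by (intro continuous_on_deriv_param)
          (auto intro!: continuous_on_subset[OF cont] holomorphic_on_subset[OF hol])
    qed auto
    then show ?thesis using r by auto
  qed
  then show ?thesis
    by (metis (no_types, lifting) U analytic_imp_holomorphic analytic_on_def)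
qed

text \<open>The truncation error depends on \<open>f\<close> only through \<open>C\<close> and
  \<gamma>, which makes it uniform over a family of integrands with a common majorant.\<close>

lemma norm_integral_powr_bound:
  fixes f :: "real \<Rightarrow> complex"
  assumes cont: "continuous_on {0<..1} f" and \<gamma>: "\<gamma> > 0"
    and bd: "\<And>y. y \<in> {0<..1} \<Longrightarrow> norm (f y) \<le> C * y powr (\<gamma> - 1)"
  shows "f integrable_on {0..1}"
    and "\<And>e. 0 < e \<Longrightarrow> e \<le> 1 \<Longrightarrow> norm (integral {0..1} f - integral {e..1} f) \<le> C * e powr \<gamma> / \<gamma>"
proof -
  \<comment> \<open>The hypothesis is silent at \<open>y = 0\<close>, where \<open>0 powr a\<close>
    is \<open>0\<close>; the value there is reset on a null set so that the majorant holds on the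
    closed interval.\<close>
  define f0 where "f0 y = (if y = 0 then 0 else f y)" for y
  have pw: "((\<lambda>y. C * y powr (\<gamma> - 1)) has_integral (C * e powr \<gamma> / \<gamma>)) {0..e}" if "e \<ge> 0" for e
    using has_integral_mult_right[OF has_integral_powr_from_0[of "\<gamma> - 1" e], of C] that \<gamma> by simp
  have "f0 integrable_on {0..1}"
  proof (rule measurable_bounded_by_integrable_imp_integrable)
    have "f \<in> borel_measurable (lebesgue_on {0<..1})"
      by (rule continuous_imp_measurable_on_sets_lebesgue[OF cont]) auto
    then have "(\<lambda>y. if y \<in> {0<..1} then f y else 0) \<in> borel_measurable lebesgue"
      by (rule borel_measurable_if[THEN iffD2, rotated]) auto
    then have "(\<lambda>y. if y \<in> {0<..1} then f y else 0) \<in> borel_measurable (lebesgue_on {0..1})"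
      by (rule measurable_restrict_space1)
    then show "f0 \<in> borel_measurable (lebesgue_on {0..1})"
      by (rule measurable_cong[THEN iffD1, rotated]) (auto simp: f0_def)
    show "(\<lambda>y. C * y powr (\<gamma> - 1)) integrable_on {0..1}" using pw[of 1] by (auto simp: has_integral_integrable)
    show "norm (f0 y) \<le> C * y powr (\<gamma> - 1)" if "y \<in> {0..1}" for y
      using bd[of y] that by (auto simp: f0_def)
  qed auto
  note f0 = this
  have ng: "negligible {0::real}" by simp
  show int: "f integrable_on {0..1}"
    by (rule integrable_spike[OF f0 ng]) (auto simp: f0_def)
  fix e :: real assume e: "0 < e" "e \<le> 1"
  have sub: "f0 integrable_on {0..e}"
    using f0 e by (meson atLeastatMost_subset_iff integrable_on_subinterval order_refl)
  have "integral {0..1} f = integral {0..e} f + integral {e..1} f"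
    using Henstock_Kurzweil_Integration.integral_combine[of 0 e 1 f] e int by simp
  moreover have "integral {0..e} f = integral {0..e} f0"
    by (rule integral_spike[OF ng]) (auto simp: f0_def)
  moreover have "norm (integral {0..e} f0) \<le> integral {0..e} (\<lambda>y. C * y powr (\<gamma> - 1))"
  proof (rule integral_norm_bound_integral[OF sub])
    show "(\<lambda>y. C * y powr (\<gamma> - 1)) integrable_on {0..e}" using pw[of e] e by (auto simp: has_integral_integrable)
    show "norm (f0 y) \<le> C * y powr (\<gamma> - 1)" if "y \<in> {0..e}" for y
      using bd[of y] that e by (auto simp: f0_def)
  qed
  moreover have "integral {0..e} (\<lambda>y. C * y powr (\<gamma> - 1)) = C * e powr \<gamma> / \<gamma>"
    using pw[of e] e by (intro integral_unique) auto
  ultimately show "norm (integral {0..1} f - integral {e..1} f) \<le> C * e powr \<gamma> / \<gamma>" by simp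
qed

lemma uniform_limit_integral_powr_bound:
  fixes f :: "complex \<Rightarrow> real \<Rightarrow> complex"
  assumes cont: "\<And>x. x \<in> K \<Longrightarrow> continuous_on {0<..1} (f x)" and \<gamma>: "\<gamma> > 0"
    and bd: "\<And>x y. x \<in> K \<Longrightarrow> y \<in> {0<..1} \<Longrightarrow> norm (f x y) \<le> C * y powr (\<gamma> - 1)"
  shows "uniform_limit K (\<lambda>n x. integral {1 / real (Suc n)..1} (f x)) (\<lambda>x. integral {0..1} (f x)) sequentially"
proof (rule uniform_limitI)
  fix e :: real assume e: "e > 0"
  have "(\<lambda>n. C * (1 / real (Suc n)) powr \<gamma> / \<gamma>) \<longlonglongrightarrow> 0"
    using \<gamma> by real_asymp
  then have "\<forall>\<^sub>F n in sequentially. C * (1 / real (Suc n)) powr \<gamma> / \<gamma> < e"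
    using e by (rule order_tendstoD)
  then show "\<forall>\<^sub>F n in sequentially. \<forall>x\<in>K. dist (integral {1 / real (Suc n)..1} (f x)) (integral {0..1} (f x)) < e"
  proof eventually_elim
    case (elim n)
    show ?case
    proof
      fix x assume x: "x \<in> K"
      have "norm (integral {0..1} (f x) - integral {1 / real (Suc n)..1} (f x)) \<le> C * (1 / real (Suc n)) powr \<gamma> / \<gamma>"
        by (rule norm_integral_powr_bound(2)[OF cont \<gamma> bd]) (use x in auto)
      then show "dist (integral {1 / real (Suc n)..1} (f x)) (integral {0..1} (f x)) < e"
        using elim by (simp add: dist_norm norm_minus_commute)
    qed
  qed
qed

text \<open>Weierstrass's theorem: the integrals truncated at \<open>1 / Suc n\<close> are
  holomorphic and converge uniformly on compact discs.\<close>

lemma holomorphic_on_improper_integral: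
  fixes f :: "complex \<Rightarrow> real \<Rightarrow> complex"
  assumes U: "open U" and cont: "continuous_on (U \<times> {0<..1}) (\<lambda>(x, t). f x t)"
    and hol: "\<And>t. t \<in> {0<..1} \<Longrightarrow> (\<lambda>x. f x t) holomorphic_on U" and \<gamma>: "\<gamma> > 0"
    and bd: "\<And>K. compact K \<Longrightarrow> K \<subseteq> U \<Longrightarrow> \<exists>C. \<forall>x\<in>K. \<forall>y\<in>{0<..1}. norm (f x y) \<le> C * y powr (\<gamma> - 1)"
  shows "(\<lambda>x. integral {0..1} (f x)) holomorphic_on U"
proof (rule holomorphic_uniform_sequence[OF U])
  show "(\<lambda>x. integral {1 / real (Suc n)..1} (f x)) holomorphic_on U" for n
  proof (rule holomorphic_on_integral_param[OF U])
    have "{1 / real (Suc n)..1} \<subseteq> {0<..1::real}"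
    proof
      fix t assume "t \<in> {1 / real (Suc n)..1}"
      moreover have "0 < 1 / real (Suc n)" by simp
      ultimately show "t \<in> {0<..1}" by (meson atLeastAtMost_iff greaterThanAtMost_iff less_le_trans)
    qed
    then show "continuous_on (U \<times> {1 / real (Suc n)..1}) (\<lambda>(x, t). f x t)"
      and "\<And>t. t \<in> {1 / real (Suc n)..1} \<Longrightarrow> (\<lambda>x. f x t) holomorphic_on U"
      using hol by (auto intro!: continuous_on_subset[OF cont])
  qed
  have cx: "continuous_on {0<..1} (f x)" if "x \<in> U" for x
  proof -
    have "continuous_on {0<..1} (\<lambda>t. (\<lambda>(x, t). f x t) (x, t))"
      by (rule continuous_on_compose2[OF cont]) (use that in \<open>auto intro!: continuous_intros\<close>)
    then show ?thesis by simp
  qed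
  fix x assume "x \<in> U"
  then obtain d where d: "d > 0" "cball x d \<subseteq> U" using U open_contains_cball by blast
  obtain C where "\<forall>x\<in>cball x d. \<forall>y\<in>{0<..1}. norm (f x y) \<le> C * y powr (\<gamma> - 1)"
    using bd[OF compact_cball d(2)] by blast
  then have "uniform_limit (cball x d) (\<lambda>n x. integral {1 / real (Suc n)..1} (f x)) (\<lambda>x. integral {0..1} (f x)) sequentially"
    using d cx \<gamma> by (intro uniform_limit_integral_powr_bound[of _ _ \<gamma> C]) auto
  then show "\<exists>d>0. cball x d \<subseteq> U \<and> uniform_limit (cball x d) (\<lambda>n x. integral {1 / real (Suc n)..1} (f x)) (\<lambda>x. integral {0..1} (f x)) sequentially"
    using d by blast
qed

text \<open>The integral here is a gauge integral, which may converge by cancellation, so the size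
  of \<open>g\<close> alone proves nothing. On a window from \<open>y\<close> to
  \<open>y * (1 + \<delta>)\<close> the phase of \<open>g\<close> is nearly constant, so the
  integral over the window stays at least \<open>m\<close> in modulus; this contradicts the
  continuity of the indefinite integral at 0.\<close>

lemma power_singularity_not_integrable:
  fixes g :: "real \<Rightarrow> complex"
  assumes lim: "((\<lambda>y. of_real y powr (1 - \<kappa>) * g y) \<longlongrightarrow> e0) (at_right 0)"
    and e0: "e0 \<noteq> 0" and \<kappa>: "Re \<kappa> \<le> 0"
  shows "\<not> g integrable_on {0..1}"
proof
  assume int: "g integrable_on {0..1}"
  have "isCont (\<lambda>s. of_real s powr (1 - \<kappa>) :: complex) (1::real)"
    by (intro continuous_intros) auto
  then have "\<exists>d>0. \<forall>s. dist s 1 < d \<longrightarrow> dist (of_real s powr (1 - \<kappa>) :: complex) (of_real 1 powr (1 - \<kappa>)) < 1/4"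
    unfolding continuous_at_eps_delta by (rule allE[of _ "1/4"]) simp
  then obtain d where d: "d > 0" "\<And>s::real. \<bar>s - 1\<bar> < d \<Longrightarrow> cmod (of_real s powr (1 - \<kappa>) - 1) < 1/4"
    by (auto simp: dist_norm)
  define \<delta> where "\<delta> = min (d / 2) (1 / 2)"
  have \<delta>: "\<delta> > 0" "\<delta> \<le> 1/2" "\<delta> < d" using d(1) by (auto simp: \<delta>_def min_def)
  define J where "J x = integral {0..x} g" for x
  have Jc: "continuous_on {0..1} J"
    unfolding J_def by (rule indefinite_integral_continuous_1[OF int])
  \<comment> \<open>The factor is \<open>1 - 9/16\<close>: in \<open>pt\<close> the two errors add
    up to \<open>5/4 * 1/4 + 1/4 = 9/16\<close> of \<open>cmod e0\<close>.\<close>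
  define m where "m = (7/16) * cmod e0 * \<delta>"
  have m: "m > 0" using e0 \<delta> by (simp add: m_def)
  have J0: "J 0 = 0" by (simp add: J_def)
  have "\<exists>r>0. \<forall>x\<in>{0..1}. dist x 0 < r \<longrightarrow> dist (J x) (J 0) < m / 2"
    using Jc m unfolding continuous_on_iff by (meson atLeastAtMost_iff half_gt_zero order_refl zero_le_one)
  then obtain r where r: "r > 0" "\<And>x. 0 \<le> x \<Longrightarrow> x \<le> 1 \<Longrightarrow> x < r \<Longrightarrow> cmod (J x) < m / 2"
    using J0 by (auto simp: dist_norm)
  have "\<forall>\<^sub>F y in at_right 0. dist (of_real y powr (1 - \<kappa>) * g y) e0 < cmod e0 / 4"
    using lim e0 by (intro tendstoD) auto
  then obtain y1 where y1: "y1 > 0" "\<And>y. 0 < y \<Longrightarrow> y < y1 \<Longrightarrow> cmod (of_real y powr (1 - \<kappa>) * g y - e0) < cmod e0 / 4"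
    unfolding eventually_at_right_field dist_norm by auto
  define y where "y = min (min r y1) 1 / 4"
  have y: "0 < y" "y * (1 + \<delta>) < r" "y * (1 + \<delta>) < y1" "y * (1 + \<delta>) \<le> 1" "y < r" "y \<le> 1"
  proof -
    have "y > 0" using r y1 by (simp add: y_def)
    moreover have "y * (1 + \<delta>) \<le> y * 2" using \<delta> \<open>y > 0\<close> by (intro mult_left_mono) auto
    moreover have "y * 2 < r" "y * 2 < y1" "y * 2 \<le> 1" using r y1 by (auto simp: y_def min_def)
    ultimately show "0 < y" "y * (1 + \<delta>) < r" "y * (1 + \<delta>) < y1" "y * (1 + \<delta>) \<le> 1" "y < r" "y \<le> 1"
      by linarith+
  qed
  have yL: "y \<le> y * (1 + \<delta>)" using y(1) \<delta> by simp
  have gi: "g integrable_on {y..y * (1 + \<delta>)}"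
    using int y by (elim integrable_on_subinterval) auto
  have Jd: "J (y * (1 + \<delta>)) = J y + integral {y..y * (1 + \<delta>)} g"
    unfolding J_def using y yL
    by (intro Henstock_Kurzweil_Integration.integral_combine[symmetric] integrable_on_subinterval[OF int]) auto
  have pt: "cmod (of_real y powr (1 - \<kappa>) * g x - e0) \<le> 9/16 * cmod e0" if "x \<in> {y..y * (1 + \<delta>)}" for x
  proof -
    have x: "x > 0" "x < y1" using that y by auto
    define s where "s = y / x"
    have s: "0 < s" "s \<le> 1" "s \<ge> 1 / (1 + \<delta>)" using that y x \<delta> by (auto simp: s_def field_simps)
    have "1 - \<delta> \<le> 1 / (1 + \<delta>)" using \<delta> by (simp add: field_simps)
    then have sd: "\<bar>s - 1\<bar> < d" using s \<delta> by auto
    define A where "A = (of_real s :: complex) powr (1 - \<kappa>)"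
    define B where "B = of_real x powr (1 - \<kappa>) * g x"
    have ys: "y = s * x" using x by (simp add: s_def)
    have "complex_of_real y powr (1 - \<kappa>) = A * of_real x powr (1 - \<kappa>)"
      unfolding ys A_def using s x by (simp add: powr_times_real[symmetric])
    then have eq: "of_real y powr (1 - \<kappa>) * g x - e0 = A * (B - e0) + (A - 1) * e0"
      by (simp add: B_def algebra_simps)
    have a: "cmod (A - 1) < 1/4" unfolding A_def by (rule d(2)[OF sd])
    have "cmod A \<le> 5/4" using a norm_triangle_sub[of A 1] by simp
    moreover have "cmod (B - e0) \<le> cmod e0 / 4" using y1(2)[OF x] by (simp add: B_def)
    ultimately have "cmod (A * (B - e0)) \<le> 5/4 * (cmod e0 / 4)" unfolding norm_mult
      by (intro mult_mono) auto
    moreover have "cmod ((A - 1) * e0) \<le> 1/4 * cmod e0" unfolding norm_mult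
      using a by (intro mult_right_mono) auto
    ultimately show ?thesis unfolding eq using norm_triangle_ineq[of "A * (B - e0)" "(A - 1) * e0"] by simp
  qed
  have i1: "(\<lambda>x. of_real y powr (1 - \<kappa>) * g x - e0) integrable_on {y..y * (1 + \<delta>)}"
    by (intro integrable_diff integrable_on_mult_right gi) auto
  have "cmod (integral {y..y * (1 + \<delta>)} (\<lambda>x. of_real y powr (1 - \<kappa>) * g x - e0)) \<le> integral {y..y * (1 + \<delta>)} (\<lambda>x. 9/16 * cmod e0)"
    by (rule integral_norm_bound_integral[OF i1 _ pt]) auto
  also have "integral {y..y * (1 + \<delta>)} (\<lambda>x. 9/16 * cmod e0) = 9/16 * cmod e0 * (y * \<delta>)"
    using yL by (simp add: algebra_simps)
  also have "integral {y..y * (1 + \<delta>)} (\<lambda>x. of_real y powr (1 - \<kappa>) * g x - e0) =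
     of_real y powr (1 - \<kappa>) * integral {y..y * (1 + \<delta>)} g - of_real (y * \<delta>) * e0"
  proof (rule integral_unique)
    have "((\<lambda>x. of_real y powr (1 - \<kappa>) * g x - e0) has_integral
        (of_real y powr (1 - \<kappa>) * integral {y..y * (1 + \<delta>)} g - measure lborel {y..y * (1 + \<delta>)} *\<^sub>R e0)) {y..y * (1 + \<delta>)}"
      by (intro has_integral_diff has_integral_mult_right integrable_integral gi has_integral_const_real)
    moreover have "measure lborel {y..y * (1 + \<delta>)} = y * \<delta>" using yL by (simp add: algebra_simps)
    ultimately show "((\<lambda>x. of_real y powr (1 - \<kappa>) * g x - e0) has_integral
        (of_real y powr (1 - \<kappa>) * integral {y..y * (1 + \<delta>)} g - of_real (y * \<delta>) * e0)) {y..y * (1 + \<delta>)}"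
      by (simp only: scaleR_conv_of_real)
  qed
  finally have "cmod (of_real y powr (1 - \<kappa>) * integral {y..y * (1 + \<delta>)} g - of_real (y * \<delta>) * e0) \<le> 9/16 * cmod e0 * (y * \<delta>)" .
  note b1 = this
  have "cmod (of_real y powr (1 - \<kappa>) * integral {y..y * (1 + \<delta>)} g) \<ge> y * \<delta> * cmod e0 - 9/16 * cmod e0 * (y * \<delta>)"
  proof -
    have "cmod (of_real (y * \<delta>) * e0) = y * \<delta> * cmod e0" using y \<delta> by (simp add: norm_mult)
    moreover have "cmod (of_real (y * \<delta>) * e0) \<le> cmod (of_real y powr (1 - \<kappa>) * integral {y..y * (1 + \<delta>)} g) +
       cmod (of_real y powr (1 - \<kappa>) * integral {y..y * (1 + \<delta>)} g - of_real (y * \<delta>) * e0)"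
      by (metis norm_minus_commute norm_triangle_sub)
    ultimately show ?thesis using b1 by linarith
  qed
  then have "y powr (1 - Re \<kappa>) * cmod (integral {y..y * (1 + \<delta>)} g) \<ge> y * m"
    using y by (simp add: norm_mult norm_powr_real_powr m_def algebra_simps)
  moreover have "y powr (1 - Re \<kappa>) \<le> y"
    using y \<kappa> powr_mono'[of 1 "1 - Re \<kappa>" y] by simp
  ultimately have "y * m \<le> y * cmod (integral {y..y * (1 + \<delta>)} g)"
    by (meson mult_right_mono norm_ge_zero order_trans)
  then have "m \<le> cmod (integral {y..y * (1 + \<delta>)} g)" using y(1) by simp
  also have "\<dots> = cmod (J (y * (1 + \<delta>)) - J y)" by (simp add: Jd)
  also have "\<dots> \<le> cmod (J (y * (1 + \<delta>))) + cmod (J y)" by (rule norm_triangle_ineq4)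
  also have "\<dots> < m" using r(2)[of y] r(2)[of "y * (1 + \<delta>)"] y yL by linarith
  finally show False by simp
qed

section \<open>The Legendre function at infinity\<close>

text \<open>The variable is \<open>(1 + z) / 2\<close>: the cut becomes the nonpositive real axis,
  whose complement is invariant under positive scaling. Growth can thus be measured along
  rays.\<close>

definition legp :: "complex \<Rightarrow> complex \<Rightarrow> complex" where
  "legp \<nu> y = hyp2F1_reg (-\<nu>) (\<nu> + 1) 1 (1 - y)"

lemma legendreP_eq_legp: "legendreP \<nu> z = legp \<nu> ((1 + z) / 2)"
  by (simp add: legendreP_def legp_def field_simps)

lemma legp_1 [simp]: "legp \<nu> 1 = 1"
  by (simp add: legp_def hyp2F1_reg_0 rGamma_inverse_Gamma)

lemma holomorphic_on_legp: "legp \<nu> holomorphic_on (- \<real>\<^sub>\<le>\<^sub>0)"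
proof -
  have "(hyp2F1_reg (-\<nu>) (\<nu> + 1) 1 \<circ> (\<lambda>y. 1 - y)) holomorphic_on (- \<real>\<^sub>\<le>\<^sub>0)"
    by (rule holomorphic_on_compose_gen[OF _ hyp2F1_reg_holomorphic])
      (auto intro!: holomorphic_intros simp: mem_hyp_domain_iff)
  then show ?thesis by (simp add: legp_def[abs_def] o_def)
qed

lemma open_slit: "open (- \<real>\<^sub>\<le>\<^sub>0 :: complex set)"
  by (rule open_Compl) (rule closed_nonpos_Reals_complex)

lemma legp_has_deriv: "y \<notin> \<real>\<^sub>\<le>\<^sub>0 \<Longrightarrow> (legp \<nu> has_field_derivative deriv (legp \<nu>) y) (at y)"
  by (rule holomorphic_derivI[OF holomorphic_on_legp open_slit]) auto

lemma legp_has_deriv2: "y \<notin> \<real>\<^sub>\<le>\<^sub>0 \<Longrightarrow> (deriv (legp \<nu>) has_field_derivative deriv (deriv (legp \<nu>)) y) (at y)"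
  by (rule holomorphic_derivI[OF holomorphic_deriv[OF holomorphic_on_legp open_slit] open_slit]) auto

lemma legp_ode:
  assumes y: "y \<notin> \<real>\<^sub>\<le>\<^sub>0"
  shows "y * (1 - y) * deriv (deriv (legp \<nu>)) y + (1 - 2 * y) * deriv (legp \<nu>) y + \<nu> * (\<nu> + 1) * legp \<nu> y = 0"
proof -
  let ?f = "hyp2F1_reg (-\<nu>) (\<nu> + 1) 1"
  have hol: "?f holomorphic_on hyp_domain" by (rule hyp2F1_reg_holomorphic) simp
  have dm: "((\<lambda>y. 1 - y) has_field_derivative -1) (at y)" for y :: complex
    by (auto intro!: derivative_eq_intros)
  have d1: "(legp \<nu> has_field_derivative - deriv ?f (1 - y)) (at y)" if "y \<notin> \<real>\<^sub>\<le>\<^sub>0" for y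
  proof -
    have "(?f has_field_derivative deriv ?f (1 - y)) (at (1 - y))"
      by (rule holomorphic_derivI[OF hol open_hyp_domain]) (use that in \<open>simp add: mem_hyp_domain_iff\<close>)
    from DERIV_chain2[OF this dm] show ?thesis
      unfolding legp_def[abs_def] by simp
  qed
  have "((\<lambda>y. - deriv ?f (1 - y)) has_field_derivative deriv (deriv ?f) (1 - y)) (at y)"
  proof -
    have "(deriv ?f has_field_derivative deriv (deriv ?f) (1 - y)) (at (1 - y))"
      by (rule holomorphic_derivI[OF holomorphic_deriv[OF hol open_hyp_domain] open_hyp_domain])
        (use y in \<open>simp add: mem_hyp_domain_iff\<close>)
    from DERIV_minus[OF DERIV_chain2[OF this dm]] show ?thesis by simp
  qed
  then have "(deriv (legp \<nu>) has_field_derivative deriv (deriv ?f) (1 - y)) (at y)"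
    by (rule has_field_derivative_transform_within_open[OF _ open_slit])
      (use y DERIV_imp_deriv[OF d1] in auto)
  then have d2: "deriv (deriv (legp \<nu>)) y = deriv (deriv ?f) (1 - y)" by (rule DERIV_imp_deriv)
  have "hyp_op (-\<nu>) (\<nu> + 1) 1 ?f (1 - y) = 0"
    by (rule hyp2F1_reg_ode) (use y in \<open>simp_all add: mem_hyp_domain_iff\<close>)
  then show ?thesis
    unfolding d2 DERIV_imp_deriv[OF d1[OF y]] by (simp add: hyp_op_def legp_def algebra_simps)
qed

lemma norm_bound_of_deriv_powr:
  fixes f :: "real \<Rightarrow> complex"
  assumes d: "\<And>x. x \<ge> x0 \<Longrightarrow> (f has_vector_derivative f' x) (at x)"
    and bd: "\<And>x. x \<ge> x0 \<Longrightarrow> norm (f' x) \<le> C * x powr (\<beta> - 1)"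
    and \<beta>: "\<beta> > 0" and x0: "x0 > 0" and x: "x \<ge> x0"
  shows "norm (f x) \<le> norm (f x0) + C / \<beta> * x powr \<beta>"
proof -
  have C: "C \<ge> 0"
    using order_trans[OF norm_ge_zero bd[of x0]] x0 by (simp add: zero_le_mult_iff)
  show ?thesis
  proof (cases "x = x0")
    case False
    then have "x0 < x" using x by simp
    have "norm (f x - f x0) \<le> C / \<beta> * x powr \<beta> - C / \<beta> * x0 powr \<beta>"
    proof (rule differentiable_bound_general[OF \<open>x0 < x\<close>])
      show "continuous_on {x0..x} f"
        by (intro continuous_at_imp_continuous_on ballI) (metis atLeastAtMost_iff d has_vector_derivative_continuous)
      show "continuous_on {x0..x} (\<lambda>x. C / \<beta> * x powr \<beta>)"
        using x0 by (intro continuous_intros) auto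
      show "(f has_vector_derivative f' u) (at u)" if "x0 < u" "u < x" for u using d[of u] that by simp
      show "((\<lambda>x. C / \<beta> * x powr \<beta>) has_vector_derivative C * u powr (\<beta> - 1)) (at u)" if "x0 < u" "u < x" for u
        using that x0 \<beta> unfolding has_real_derivative_iff_has_vector_derivative[symmetric]
        by (auto intro!: derivative_eq_intros)
      show "norm (f' u) \<le> C * u powr (\<beta> - 1)" if "x0 < u" "u < x" for u using bd[of u] that by simp
    qed
    moreover have "C / \<beta> * x0 powr \<beta> \<ge> 0" using C \<beta> by simp
    ultimately show ?thesis using norm_triangle_sub[of "f x" "f x0"] by linarith
  qed (use C \<beta> in simp)
qed

lemma powr_real_mult:
  fixes z s :: complex
  assumes "r > 0" "z \<noteq> 0"
  shows "(of_real r * z) powr s = of_real r powr s * z powr s"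
  using assms by (simp add: powr_def Ln_times_of_real Ln_of_real exp_add distrib_left)

text \<open>
  A multiple of \<open>Q\<^sub>\<nu>(2 y - 1)\<close>. The growth of \<open>legp\<close> is read off from the Wronskian, that is, from the derivative
  of \<open>legp \<nu> y / legq \<nu> y\<close>.
\<close>
definition legq :: "complex \<Rightarrow> complex \<Rightarrow> complex" where
  "legq \<nu> y = y powr (-\<nu>-1) * hyp2F1_reg_series (\<nu> + 1) (\<nu> + 1) (2 * \<nu> + 2) (1 / y)"

definition slit_annulus :: "real \<Rightarrow> complex set" where
  "slit_annulus R = {y. y \<notin> \<real>\<^sub>\<le>\<^sub>0 \<and> R < cmod y}"

lemma open_slit_annulus: "open (slit_annulus R)"
proof -
  have "slit_annulus R = (- \<real>\<^sub>\<le>\<^sub>0) \<inter> {y. R < cmod y}" by (auto simp: slit_annulus_def)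
  then show ?thesis by (auto intro!: open_Int open_Collect_less continuous_intros)
qed

text \<open>It is the image under \<open>exp\<close> of the convex half strip
  \<open>Re > ln R\<close>, \<open>\<bar>Im\<bar> < pi\<close>. Connectedness makes the Wronskian
  constant a single number.\<close>

lemma connected_slit_annulus:
  assumes "R > 0"
  shows "connected (slit_annulus R)"
proof -
  let ?S = "{z. Re z > ln R} \<inter> {z. Im z > -pi} \<inter> {z. Im z < pi}"
  have "slit_annulus R = exp ` ?S"
  proof (intro equalityI subsetI)
    fix y assume y: "y \<in> slit_annulus R"
    then have y0: "y \<noteq> 0" "y \<notin> \<real>\<^sub>\<le>\<^sub>0" "R < cmod y" by (auto simp: slit_annulus_def)
    then have "Ln y \<in> ?S" using assms mpi_less_Im_Ln[OF y0(1)] Im_Ln_less_pi[OF y0(2)] by (auto simp: ln_less_cancel_iff)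
    moreover have "exp (Ln y) = y" using y0 by simp
    ultimately show "y \<in> exp ` ?S" by (metis imageI)
  next
    fix y assume "y \<in> exp ` ?S"
    then obtain z where z: "y = exp z" "Re z > ln R" "-pi < Im z" "Im z < pi" by auto
    have "R < cmod y" using z assms by (metis exp_less_cancel_iff exp_ln norm_exp_eq_Re)
    moreover have "y \<notin> \<real>\<^sub>\<le>\<^sub>0"
    proof
      assume "y \<in> \<real>\<^sub>\<le>\<^sub>0"
      moreover have y0: "y \<noteq> 0" using z by simp
      ultimately have "Re y < 0" "Im y = 0" by (auto simp: complex_nonpos_Reals_iff less_le complex_eq_iff)
      then have "Im (Ln y) = pi" using Im_Ln_eq_pi[OF y0] by simp
      moreover have "Ln y = z" using z by simp
      ultimately show False using z by simp
    qed
    ultimately show "y \<in> slit_annulus R" by (simp add: slit_annulus_def)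
  qed
  moreover have "connected ?S"
    by (intro convex_connected convex_Int convex_halfspace_Re_gt convex_halfspace_Im_gt convex_halfspace_Im_lt)
  ultimately show ?thesis by (auto intro!: connected_continuous_image continuous_intros)
qed

text \<open>In the variable \<open>1 / y\<close>, with the exponent \<open>\<nu> + 1\<close> at
  infinity split off, Legendre's equation becomes the hypergeometric equation with parameters
  \<open>\<nu> + 1\<close>, \<open>\<nu> + 1\<close>, \<open>2 * \<nu> + 2\<close>.\<close>

lemma legq_ode:
  fixes \<nu> :: complex
  defines "g \<equiv> hyp2F1_reg_series (\<nu> + 1) (\<nu> + 1) (2 * \<nu> + 2)"
  defines "q1 \<equiv> \<lambda>y. y powr (-\<nu>-1) * (-(\<nu>+1) * (1/y) * g (1/y) - (1/y)\<^sup>2 * deriv g (1/y))"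
  defines "q2 \<equiv> \<lambda>y. y powr (-\<nu>-1) * ((\<nu>+1) * (\<nu>+2) * (1/y)\<^sup>2 * g (1/y) + (2*\<nu>+4) * (1/y)^3 * deriv g (1/y) + (1/y)^4 * deriv (deriv g) (1/y))"
  assumes y: "y \<in> slit_annulus 1"
  shows "(legq \<nu> has_field_derivative q1 y) (at y)" "(q1 has_field_derivative q2 y) (at y)"
    "y * (1 - y) * q2 y + (1 - 2 * y) * q1 y + \<nu> * (\<nu> + 1) * legq \<nu> y = 0"
proof -
  have y0: "y \<noteq> 0" "y \<notin> \<real>\<^sub>\<le>\<^sub>0" and z: "1 / y \<in> ball 0 1"
    using y by (auto simp: slit_annulus_def norm_divide divide_less_eq)
  have hol: "g holomorphic_on ball 0 1" unfolding g_def by (rule hyp2F1_reg_series_holomorphic)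
  have dinv: "((\<lambda>y. 1 / y) has_field_derivative - ((1/y)\<^sup>2)) (at y)"
    using y0 by (auto intro!: derivative_eq_intros simp: power2_eq_square)
  have g1: "((\<lambda>y. g (1 / y)) has_field_derivative deriv g (1/y) * - ((1/y)\<^sup>2)) (at y)"
    by (rule DERIV_chain2[OF holomorphic_derivI[OF hol open_ball z] dinv])
  have g2: "((\<lambda>y. deriv g (1 / y)) has_field_derivative deriv (deriv g) (1/y) * - ((1/y)\<^sup>2)) (at y)"
    by (rule DERIV_chain2[OF holomorphic_derivI[OF holomorphic_deriv[OF hol open_ball] open_ball z] dinv])
  have pw: "((\<lambda>y. y powr (-\<nu>-1)) has_field_derivative ((-\<nu>-1) * y powr (-\<nu>-1) * (1/y))) (at y)"
  proof -
    have "((\<lambda>y. y powr (-\<nu>-1)) has_field_derivative ((-\<nu>-1) * y powr (-\<nu>-1-1))) (at y)"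
      using y0 by (intro has_field_derivative_powr) auto
    moreover have "y powr (-\<nu>-1-1) = y powr (-\<nu>-1) * (1/y)"
      using y0 powr_diff[of y "-\<nu>-1" 1] by simp
    ultimately show ?thesis by simp
  qed
  define s where "s = y powr (-\<nu>-1)"
  define \<zeta> where "\<zeta> = 1 / y"
  note [derivative_intros] = DERIV_chain2[OF _ dinv]
  show "(legq \<nu> has_field_derivative q1 y) (at y)"
    unfolding legq_def[abs_def] g_def[symmetric] q1_def
    by (rule DERIV_cong[OF DERIV_mult[OF pw g1]]) (simp only: s_def[symmetric] \<zeta>_def[symmetric], simp add: algebra_simps)
  have dl: "((\<lambda>y. -(\<nu>+1) * (1/y) * g (1/y) - (1/y)\<^sup>2 * deriv g (1/y)) has_field_derivative
     (-(\<nu>+1) * (- (\<zeta>\<^sup>2)) * g \<zeta> + (deriv g \<zeta> * - (\<zeta>\<^sup>2)) * (-(\<nu>+1) * \<zeta>) -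
      (of_nat 2 * (- (\<zeta>\<^sup>2) * \<zeta>^(2 - Suc 0)) * deriv g \<zeta> + (deriv (deriv g) \<zeta> * - (\<zeta>\<^sup>2)) * \<zeta>\<^sup>2))) (at y)"
    unfolding \<zeta>_def
    by (intro DERIV_diff DERIV_mult DERIV_cmult DERIV_power dinv g1 g2)
  show "(q1 has_field_derivative q2 y) (at y)"
    unfolding q1_def q2_def
    by (rule DERIV_cong[OF DERIV_mult[OF pw dl]])
      (simp only: s_def[symmetric] \<zeta>_def[symmetric], simp add: algebra_simps eval_nat_numeral)
  have "hyp_op (\<nu>+1) (\<nu>+1) (2*\<nu>+2) g (1/y) = 0" unfolding g_def by (rule hyp_op_series[OF z])
  then have ode: "\<zeta> * (1 - \<zeta>) * deriv (deriv g) \<zeta> + (2*\<nu>+2 - (2*\<nu>+3) * \<zeta>) * deriv g \<zeta> - (\<nu>+1)\<^sup>2 * g \<zeta> = 0"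
    by (simp add: hyp_op_def \<zeta>_def power2_eq_square algebra_simps)
  have yz: "y * \<zeta> = 1" using y0 by (simp add: \<zeta>_def)
  have "y * (1 - y) * q2 y + (1 - 2 * y) * q1 y + \<nu> * (\<nu> + 1) * legq \<nu> y =
     s * (y * (1 - y) * ((\<nu>+1) * (\<nu>+2) * \<zeta>\<^sup>2 * g \<zeta> + (2*\<nu>+4) * \<zeta>^3 * deriv g \<zeta> + \<zeta>^4 * deriv (deriv g) \<zeta>)
      + (1 - 2 * y) * (-(\<nu>+1) * \<zeta> * g \<zeta> - \<zeta>\<^sup>2 * deriv g \<zeta>) + \<nu> * (\<nu> + 1) * g \<zeta>)"
    unfolding q1_def q2_def legq_def g_def[symmetric] s_def[symmetric] \<zeta>_def[symmetric] by (simp only: algebra_simps)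
  also have "\<dots> = s * (- \<zeta> * (\<zeta> * (1 - \<zeta>) * deriv (deriv g) \<zeta> + (2*\<nu>+2 - (2*\<nu>+3) * \<zeta>) * deriv g \<zeta> - (\<nu>+1)\<^sup>2 * g \<zeta>))"
  proof -
    define G0 G1 G2 where "G0 = g \<zeta>" "G1 = deriv g \<zeta>" "G2 = deriv (deriv g) \<zeta>"
    have "y * (1 - y) * ((\<nu>+1) * (\<nu>+2) * \<zeta>\<^sup>2 * G0 + (2*\<nu>+4) * \<zeta>^3 * G1 + \<zeta>^4 * G2)
      + (1 - 2 * y) * (-(\<nu>+1) * \<zeta> * G0 - \<zeta>\<^sup>2 * G1) + \<nu> * (\<nu> + 1) * G0 =
      - \<zeta> * (\<zeta> * (1 - \<zeta>) * G2 + (2*\<nu>+2 - (2*\<nu>+3) * \<zeta>) * G1 - (\<nu>+1)\<^sup>2 * G0)"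
      using yz by algebra
    then show ?thesis by (simp only: G0_G1_G2_def)
  qed
  finally show "y * (1 - y) * q2 y + (1 - 2 * y) * q1 y + \<nu> * (\<nu> + 1) * legq \<nu> y = 0"
    unfolding ode by simp
qed

text \<open>The derivative of the quotient is the Wronskian over \<open>(legq \<nu> y)^2\<close>.
  The Wronskian is a constant over \<open>y * (1 - y)\<close>, and splitting off the powers of
  \<open>y\<close> leaves \<open>k\<close>, which is holomorphic in \<open>1 / y\<close> near
  infinity with nonzero value \<open>k0\<close>.\<close>

lemma legp_div_legq:
  assumes \<nu>: "Re \<nu> \<ge> -1/2"
  shows "\<exists>R M g0 k0 w k. R \<ge> 2 \<and> M > 0 \<and> g0 \<noteq> 0 \<and> k0 \<noteq> 0 \<and> (\<forall>y\<in>slit_annulus R.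
    legq \<nu> y \<noteq> 0 \<and>
    cmod (legq \<nu> y - g0 * y powr (-\<nu>-1)) \<le> M * cmod (y powr (-\<nu>-1)) / cmod y \<and>
    ((\<lambda>y. legp \<nu> y / legq \<nu> y) has_field_derivative w * y powr (2 * \<nu>) * k y) (at y) \<and>
    cmod (k y - k0) \<le> M / cmod y)"
proof -
  define g where "g = hyp2F1_reg_series (\<nu> + 1) (\<nu> + 1) (2 * \<nu> + 2)"
  define g0 where "g0 = rGamma (2 * \<nu> + 2)"
  have g0: "g0 \<noteq> 0"
  proof -
    have "2 * \<nu> + 2 \<notin> \<int>\<^sub>\<le>\<^sub>0"
    proof
      assume "2 * \<nu> + 2 \<in> \<int>\<^sub>\<le>\<^sub>0"
      then obtain n :: int where n: "2 * \<nu> + 2 = of_int n" "n \<le> 0" by (auto elim!: nonpos_Ints_cases)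
      have "Re (2 * \<nu> + 2) = of_int n" unfolding n(1) by simp
      then show False using \<nu> n(2) by simp
    qed
    then show ?thesis by (simp add: g0_def rGamma_eq_zero_iff)
  qed
  have gz: "g 0 = g0" by (simp add: g_def g0_def hyp2F1_reg_series_0)
  have hol: "g holomorphic_on ball 0 1" unfolding g_def by (rule hyp2F1_reg_series_holomorphic)
  \<comment> \<open>Here \<zeta> stands for \<open>1 / y\<close>; the factor
    \<open>1 - \<zeta>\<close> comes from \<open>y * (1 - y)\<close> in the Wronskian.\<close>
  define kk where "kk \<zeta> = 1 / ((1 - \<zeta>) * (g \<zeta>)\<^sup>2)" for \<zeta>
  have "isCont g 0" using hol by (metis centre_in_ball continuous_on_eq_continuous_at holomorphic_on_imp_continuous_on open_ball zero_less_one)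
  then have "\<forall>\<^sub>F z in at 0. g z \<noteq> 0"
    using g0 gz by (intro tendsto_imp_eventually_ne[of g g0]) (simp add: isCont_def)
  then obtain r0 where r0: "r0 > 0" "\<And>z. z \<noteq> 0 \<Longrightarrow> dist z 0 < r0 \<Longrightarrow> g z \<noteq> 0"
    by (auto simp: eventually_at)
  define r where "r = min (r0 / 2) (1 / 2)"
  have r: "0 < r" "r \<le> 1/2" "r < r0" using r0 by (auto simp: r_def min_def)
  have gnz: "g z \<noteq> 0" if "cmod z \<le> r" for z
    using r0(2)[of z] that r gz g0 by (cases "z = 0") auto
  have sub: "cball 0 r \<subseteq> ball (0::complex) 1" using r by auto
  have lip: "\<exists>M. \<forall>z. cmod z \<le> r \<longrightarrow> cmod (f z - f 0) \<le> M * cmod z" if f: "f holomorphic_on ball 0 r1" "r1 > r" for f r1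
  proof -
    have sub': "cball 0 r \<subseteq> ball (0::complex) r1" using f(2) by auto
    have "continuous_on (cball 0 r) (deriv f)"
      using f sub' by (intro holomorphic_on_imp_continuous_on holomorphic_on_subset[OF holomorphic_deriv[OF f(1)]]) auto
    then have "compact (deriv f ` cball 0 r)" by (rule compact_continuous_image) simp
    then obtain M where M: "\<And>z. z \<in> cball 0 r \<Longrightarrow> cmod (deriv f z) \<le> M"
      by (meson bounded_iff compact_imp_bounded imageI)
    have "cmod (f z - f 0) \<le> M * cmod (z - 0)" if "z \<in> cball 0 r" for z
    proof (rule field_differentiable_bound[OF _ _ M])
      show "convex (cball (0::complex) r)" by simp
      show "(f has_field_derivative deriv f z) (at z within cball 0 r)" if "z \<in> cball 0 r" for z
        using holomorphic_derivI[OF f(1) open_ball, of z] that sub' by (auto intro: has_field_derivative_at_within)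
    qed (use that r in auto)
    then show ?thesis by (intro exI[of _ M]) simp
  qed
  obtain M1 where M1: "\<And>z. cmod z \<le> r \<Longrightarrow> cmod (g z - g 0) \<le> M1 * cmod z"
    using lip[OF hol] r by auto
  have "\<exists>r1>r. \<forall>z\<in>ball 0 r1. g z \<noteq> 0 \<and> z \<noteq> 1 \<and> r1 \<le> 1"
  proof -
    have "g z \<noteq> 0" if "cmod z < r0" for z
      using r0(2)[of z] that gz g0 by (cases "z = 0") auto
    then show ?thesis using r by (intro exI[of _ "min r0 1"]) auto
  qed
  then obtain r1 where r1: "r1 > r" "r1 \<le> 1" "\<And>z. z \<in> ball 0 r1 \<Longrightarrow> g z \<noteq> 0 \<and> z \<noteq> 1"
    using r by (metis centre_in_ball order_less_trans)
  have "kk holomorphic_on ball 0 r1"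
    unfolding kk_def[abs_def] using r1
    by (intro holomorphic_intros holomorphic_on_subset[OF hol]) (auto simp: subset_ball)
  then obtain M2 where M2: "\<And>z. cmod z \<le> r \<Longrightarrow> cmod (kk z - kk 0) \<le> M2 * cmod z"
    using lip[of kk r1] r1 by auto
  define M where "M = \<bar>M1\<bar> + \<bar>M2\<bar> + 1"
  define R where "R = 1 / r"
  have R: "R \<ge> 2" using r by (simp add: R_def field_simps)
  have zin: "cmod (1 / y) \<le> r" "y \<noteq> 0" "y \<notin> \<real>\<^sub>\<le>\<^sub>0" "y \<in> slit_annulus 1" if "y \<in> slit_annulus R" for y
  proof -
    have y: "y \<notin> \<real>\<^sub>\<le>\<^sub>0" "1 / r < cmod y" using that by (auto simp: slit_annulus_def R_def)
    show "y \<noteq> 0" "y \<notin> \<real>\<^sub>\<le>\<^sub>0" using y by auto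
    have "1 < r * cmod y" using y r by (simp add: field_simps)
    then show "cmod (1 / y) \<le> r" using \<open>y \<noteq> 0\<close> by (simp add: norm_divide divide_le_eq)
    show "y \<in> slit_annulus 1" using y R by (simp add: slit_annulus_def R_def)
  qed
  have Qnz: "legq \<nu> y \<noteq> 0" if "y \<in> slit_annulus R" for y
    using zin[OF that] gnz by (auto simp: legq_def g_def[symmetric])
  define q1 where "q1 y = y powr (-\<nu>-1) * (-(\<nu>+1) * (1/y) * g (1/y) - (1/y)\<^sup>2 * deriv g (1/y))" for y
  define q2 where "q2 y = y powr (-\<nu>-1) * ((\<nu>+1) * (\<nu>+2) * (1/y)\<^sup>2 * g (1/y) + (2*\<nu>+4) * (1/y)^3 * deriv g (1/y) + (1/y)^4 * deriv (deriv g) (1/y))" for y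
  have Q: "(legq \<nu> has_field_derivative q1 y) (at y)" "(q1 has_field_derivative q2 y) (at y)"
    "y * (1 - y) * q2 y + (1 - 2 * y) * q1 y + \<nu> * (\<nu> + 1) * legq \<nu> y = 0" if "y \<in> slit_annulus R" for y
    using legq_ode[OF zin(4)[OF that], of \<nu>] unfolding q1_def[abs_def] q2_def[abs_def] g_def by blast+
  \<comment> \<open>Abel's identity: the factor \<open>y * (1 - y)\<close>, whose derivative is the
    first order coefficient \<open>1 - 2 * y\<close>, makes the Wronskian constant.\<close>
  define Wr where "Wr y = y * (1 - y) * (deriv (legp \<nu>) y * legq \<nu> y - legp \<nu> y * q1 y)" for y
  have "(Wr has_field_derivative 0) (at y)" if y: "y \<in> slit_annulus R" for y
  proof -
    note y' = zin[OF y]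
    have "(Wr has_field_derivative
      ((1 * (1 - y) + (0 - 1) * y) * (deriv (legp \<nu>) y * legq \<nu> y - legp \<nu> y * q1 y) +
       (deriv (deriv (legp \<nu>)) y * legq \<nu> y + q1 y * deriv (legp \<nu>) y - (deriv (legp \<nu>) y * q1 y + q2 y * legp \<nu> y)) * (y * (1 - y)))) (at y)"
      unfolding Wr_def[abs_def]
      by (intro DERIV_mult DERIV_diff DERIV_ident DERIV_const legp_has_deriv legp_has_deriv2 Q y' y)
    moreover have "(1 * (1 - y) + (0 - 1) * y) * (deriv (legp \<nu>) y * legq \<nu> y - legp \<nu> y * q1 y) +
       (deriv (deriv (legp \<nu>)) y * legq \<nu> y + q1 y * deriv (legp \<nu>) y - (deriv (legp \<nu>) y * q1 y + q2 y * legp \<nu> y)) * (y * (1 - y)) = 0"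
      using legp_ode[OF y'(3), of \<nu>] Q(3)[OF y] by algebra
    ultimately show ?thesis by simp
  qed
  note dW = this
  have "continuous_on (slit_annulus R) Wr"
    by (intro continuous_at_imp_continuous_on ballI DERIV_isCont[OF dW])
  moreover have "connected (slit_annulus R)" using R by (intro connected_slit_annulus) auto
  moreover have "\<forall>y\<in>slit_annulus R - {}. (Wr has_field_derivative 0) (at y)" using dW by blast
  ultimately obtain w where w: "\<And>y. y \<in> slit_annulus R \<Longrightarrow> Wr y = w"
    using DERIV_zero_connected_constant[of "slit_annulus R" "{}" Wr] open_slit_annulus by blast
  show ?thesis
  proof (rule exI[of _ R], rule exI[of _ M], rule exI[of _ g0], rule exI[of _ "kk 0"], rule exI[of _ "- w"], rule exI[of _ "\<lambda>y. kk (1 / y)"], intro conjI ballI)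
    show "R \<ge> 2" "M > 0" "g0 \<noteq> 0" using R g0 by (auto simp: M_def)
    show "kk 0 \<noteq> 0" using g0 gz by (simp add: kk_def)
    fix y assume y: "y \<in> slit_annulus R"
    note y' = zin[OF y]
    show "legq \<nu> y \<noteq> 0" by (rule Qnz[OF y])
    have "M1 * cmod (1/y) \<le> M * cmod (1/y)" "M2 * cmod (1/y) \<le> M * cmod (1/y)"
      by (intro mult_right_mono; simp add: M_def)+
    then have b: "cmod (g (1/y) - g0) \<le> M / cmod y" "cmod (kk (1/y) - kk 0) \<le> M / cmod y"
      using M1[OF y'(1)] M2[OF y'(1)] gz by (auto simp: norm_divide)
    then show "cmod (kk (1/y) - kk 0) \<le> M / cmod y" by blast
    have "legq \<nu> y - g0 * y powr (-\<nu>-1) = y powr (-\<nu>-1) * (g (1/y) - g0)"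
      by (simp add: legq_def g_def algebra_simps)
    then show "cmod (legq \<nu> y - g0 * y powr (-\<nu>-1)) \<le> M * cmod (y powr (-\<nu>-1)) / cmod y"
      using mult_left_mono[OF b(1), of "cmod (y powr (-\<nu>-1))"] by (simp add: norm_mult mult_ac)
    have nz: "y \<noteq> 1" using y R by (auto simp: slit_annulus_def)
    have "((\<lambda>y. legp \<nu> y / legq \<nu> y) has_field_derivative
       ((deriv (legp \<nu>) y * legq \<nu> y - legp \<nu> y * q1 y) / (legq \<nu> y * legq \<nu> y))) (at y)"
      by (rule DERIV_divide[OF legp_has_deriv[OF y'(3)] Q(1)[OF y] Qnz[OF y]])
    moreover have "(deriv (legp \<nu>) y * legq \<nu> y - legp \<nu> y * q1 y) / (legq \<nu> y * legq \<nu> y) = - w * y powr (2 * \<nu>) * kk (1 / y)"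
    proof -
      have "w = y * (1 - y) * (deriv (legp \<nu>) y * legq \<nu> y - legp \<nu> y * q1 y)" using w[OF y] by (simp add: Wr_def)
      then have 1: "deriv (legp \<nu>) y * legq \<nu> y - legp \<nu> y * q1 y = w / (y * (1 - y))"
        using y' nz by (simp add: field_simps)
      have p2: "y powr (2 * \<nu>) * (y powr (-\<nu>-1) * y powr (-\<nu>-1)) = 1 / y\<^sup>2"
      proof -
        have "y powr (2 * \<nu>) * (y powr (-\<nu>-1) * y powr (-\<nu>-1)) = y powr (2 * \<nu> + ((-\<nu>-1) + (-\<nu>-1)))"
          by (simp only: powr_add)
        also have "2 * \<nu> + ((-\<nu>-1) + (-\<nu>-1)) = - of_nat 2" by simp
        also have "y powr (- of_nat 2) = 1 / y\<^sup>2"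
          using y' unfolding powr_minus powr_nat by (simp add: field_simps)
        finally show ?thesis .
      qed
      have pnz: "y powr (-\<nu>-1) \<noteq> 0" using y' by simp
      have gn: "g (1/y) \<noteq> 0" using gnz y' by blast
      have om: "1 - 1 / y = (y - 1) / y" using y' by (simp add: field_simps)
      have "y powr (2 * \<nu>) = 1 / y\<^sup>2 / (y powr (-\<nu>-1) * y powr (-\<nu>-1))"
        using p2 pnz by (simp add: field_simps)
      then have T: "y powr (2 * \<nu>) = 1 / y\<^sup>2 / (y powr (-\<nu>-1) * y powr (-\<nu>-1))" .
      have alg: "w / (y * v) / ((p * G) * (p * G)) = - w * (1 / y\<^sup>2 / (p * p)) * (1 / (- v / y * G\<^sup>2))"
        if "v \<noteq> 0" "p \<noteq> 0" "G \<noteq> 0" for v p G :: complex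
        using that y' by (simp add: field_simps power2_eq_square)
      have om': "1 - 1 / y = - (1 - y) / y" using om by simp
      have "1 - y \<noteq> 0" using nz by simp
      from alg[OF this pnz gn] show ?thesis unfolding 1 T
        unfolding legq_def g_def[symmetric] kk_def om' .
    qed
    ultimately show "((\<lambda>y. legp \<nu> y / legq \<nu> y) has_field_derivative - w * y powr (2 * \<nu>) * kk (1 / y)) (at y)"
      by simp
  qed
qed

section \<open>Growth of the Legendre function along rays\<close>

lemma norm_powr_le:
  fixes y s :: complex
  assumes "y \<noteq> 0"
  shows "cmod (y powr s) \<le> exp (pi * \<bar>Im s\<bar>) * cmod y powr Re s"
proof -
  have "\<bar>Im s * Im (Ln y)\<bar> \<le> \<bar>Im s\<bar> * pi"
    unfolding abs_mult using mpi_less_Im_Ln[OF assms] Im_Ln_le_pi[OF assms] by (intro mult_left_mono) auto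
  then have "Re (s * Ln y) \<le> Re s * ln (cmod y) + pi * \<bar>Im s\<bar>"
    using assms by (simp add: abs_le_iff mult.commute)
  then have "exp (Re (s * Ln y)) \<le> exp (Re s * ln (cmod y) + pi * \<bar>Im s\<bar>)" by simp
  then show ?thesis using assms by (simp add: powr_def exp_add mult.commute)
qed

lemma of_real_mult_not_nonpos_Reals:
  fixes W :: complex
  assumes "x > 0" "W \<notin> \<real>\<^sub>\<le>\<^sub>0"
  shows "of_real x * W \<notin> \<real>\<^sub>\<le>\<^sub>0"
  using assms by (auto simp: complex_nonpos_Reals_iff mult_le_0_iff)

lemma compact_slit_norm_bounds:
  assumes "compact W" "W \<inter> \<real>\<^sub>\<le>\<^sub>0 = {}"
  obtains m B :: real where "m > 0" "\<And>x. x \<in> W \<Longrightarrow> m \<le> cmod x" "\<And>x. x \<in> W \<Longrightarrow> cmod x \<le> B"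
proof -
  obtain B where B: "\<And>x. x \<in> W \<Longrightarrow> cmod x \<le> B"
    using compact_imp_bounded[OF assms(1)] by (auto simp: bounded_iff)
  have "0 \<notin> W" using assms(2) by auto
  then obtain m where "m > 0" "\<And>x. x \<in> W \<Longrightarrow> m \<le> dist 0 x"
    using separate_point_closed[OF compact_imp_closed[OF assms(1)]] by blast
  then show thesis using that[of m B] B by auto
qed

text \<open>Integrating the derivative of \<open>legp / legq\<close> along the ray through
  \<open>x\<close> gives \<open>c * y powr (2 * \<nu> + 1)\<close> up to an error of order
  \<open>t powr \<beta>\<close>; multiplying by \<open>legq\<close>, of size
  \<open>t powr (- Re \<nu> - 1)\<close>, produces the exponent. The relative error
  \<open>1 / y\<close> of \<open>legq\<close> contributes \<open>t powr (Re \<nu> - 1)\<close>,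
  which is harmless if \<open>2 * Re \<nu> \<le> \<beta>\<close> and absent if \<open>c = 0\<close>.
  Different choices of \<open>c\<close> and \<beta> give the growth bound, the leading term and the
  decay of the exceptional case.\<close>

lemma legp_ray_bound:
  assumes W: "compact W" "W \<inter> \<real>\<^sub>\<le>\<^sub>0 = {}"
    and R: "R \<ge> 2" and M: "M > 0"
    and Q0: "\<And>y. y \<in> slit_annulus R \<Longrightarrow> legq \<nu> y \<noteq> 0"
    and Q1: "\<And>y. y \<in> slit_annulus R \<Longrightarrow> cmod (legq \<nu> y - g0 * y powr (-\<nu>-1)) \<le> M * cmod (y powr (-\<nu>-1)) / cmod y"
    and D: "\<And>y. y \<in> slit_annulus R \<Longrightarrow> ((\<lambda>y. legp \<nu> y / legq \<nu> y) has_field_derivative h y) (at y)"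
    and \<beta>: "\<beta> > 0" "c \<noteq> 0 \<Longrightarrow> 2 * Re \<nu> \<le> \<beta>"
    and h: "\<And>y. y \<in> slit_annulus R \<Longrightarrow> cmod (h y - c * (2 * \<nu> + 1) * y powr (2 * \<nu>)) \<le> Cd * cmod y powr (\<beta> - 1)"
  shows "\<exists>C. \<forall>x\<in>W. \<forall>t\<ge>1. cmod (legp \<nu> (of_real t * x) - g0 * c * (of_real t * x) powr \<nu>) \<le> C * t powr (\<beta> - Re \<nu> - 1)"
proof -
  obtain m B where m: "m > 0" "\<And>x. x \<in> W \<Longrightarrow> m \<le> cmod x" and B: "\<And>x. x \<in> W \<Longrightarrow> cmod x \<le> B"
    using compact_slit_norm_bounds[OF W] by metis
  have W0: "x \<noteq> 0" "x \<notin> \<real>\<^sub>\<le>\<^sub>0" if "x \<in> W" for x using W(2) that by auto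
  \<comment> \<open>From \<open>t0\<close> on every ray through \<open>W\<close> runs inside the
    annulus where the expansion holds; the range from 1 to \<open>t0\<close> is compact and is
    covered by continuity.\<close>
  define t0 where "t0 = max 1 (R / m + 1)"
  have t0: "t0 \<ge> 1" by (simp add: t0_def)
  have sl: "of_real t * x \<notin> \<real>\<^sub>\<le>\<^sub>0" if "x \<in> W" "t > 0" for t x
    using W0[OF that(1)] that(2) by (intro of_real_mult_not_nonpos_Reals)
  have ann: "of_real t * x \<in> slit_annulus R" if "x \<in> W" "t \<ge> t0" for t x
  proof -
    have "R / m < t" using that(2) by (simp add: t0_def)
    then have "R < t * m" using m(1) by (simp add: field_simps)
    also have "\<dots> \<le> t * cmod x" using m(2)[OF that(1)] that(2) t0 by (intro mult_left_mono) auto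
    finally have "R < cmod (of_real t * x)" using that(2) t0 by (simp add: norm_mult)
    then show ?thesis using sl[OF that(1), of t] that(2) t0 by (auto simp: slit_annulus_def)
  qed
  define F where "F y = legp \<nu> y / legq \<nu> y - c * y powr (2 * \<nu> + 1)" for y
  define h1 where "h1 y = h y - c * (2 * \<nu> + 1) * y powr (2 * \<nu>)" for y
  have dF: "(F has_field_derivative h1 y) (at y)" if "y \<in> slit_annulus R" for y
  proof -
    have y: "y \<notin> \<real>\<^sub>\<le>\<^sub>0" using that by (simp add: slit_annulus_def)
    have "((\<lambda>y. y powr (2 * \<nu> + 1)) has_field_derivative ((2 * \<nu> + 1) * y powr (2 * \<nu> + 1 - 1))) (at y)"
      using y by (intro has_field_derivative_powr) auto
    from DERIV_diff[OF D[OF that] DERIV_cmult[OF this, of c]] show ?thesis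
      unfolding F_def[abs_def] h1_def by (simp add: mult.assoc)
  qed
  have Cd: "Cd \<ge> 0" if ne: "W \<noteq> {}"
  proof -
    obtain x where "x \<in> W" using ne by auto
    then have "of_real t0 * x \<in> slit_annulus R" by (rule ann) simp
    from order_trans[OF norm_ge_zero h[OF this]] R this show ?thesis
      by (auto simp: zero_le_mult_iff slit_annulus_def)
  qed
  show ?thesis
  proof (cases "W = {}")
    case False
    then have Cd: "Cd \<ge> 0" by (rule Cd)
    have B0: "B \<ge> 0" using False B by (meson ex_in_conv norm_ge_zero order_trans)
    define C1 where "C1 = B * (Cd * (m powr (\<beta> - 1) + B powr (\<beta> - 1)))"
    have C1: "C1 \<ge> 0" using B0 Cd by (simp add: C1_def)
    have "continuous_on W (\<lambda>x. F (of_real t0 * x))"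
    proof (rule continuous_on_compose2[of "slit_annulus R" F])
      show "continuous_on (slit_annulus R) F"
        using dF by (intro continuous_at_imp_continuous_on ballI) (auto intro: DERIV_isCont)
    qed (use ann in \<open>auto intro!: continuous_intros\<close>)
    then have "compact ((\<lambda>x. F (of_real t0 * x)) ` W)" using W(1) by (rule compact_continuous_image)
    then obtain B1 where B1: "\<And>x. x \<in> W \<Longrightarrow> cmod (F (of_real t0 * x)) \<le> B1"
      by (meson bounded_iff compact_imp_bounded imageI)
    have B1': "B1 \<ge> 0" using False B1 by (meson ex_in_conv norm_ge_zero order_trans)
    have Fb: "cmod (F (of_real t * x)) \<le> (B1 + C1 / \<beta>) * t powr \<beta>" if x: "x \<in> W" and t: "t \<ge> t0" for x t
    proof -
      have "cmod (F (of_real t * x)) \<le> cmod (F (of_real t0 * x)) + C1 / \<beta> * t powr \<beta>"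
      proof (rule norm_bound_of_deriv_powr[where f' = "\<lambda>t. h1 (of_real t * x) * x"])
        fix u assume u: "u \<ge> t0"
        have "((\<lambda>u. of_real u * x) has_vector_derivative x) (at u)"
          by (auto intro!: derivative_eq_intros simp: has_vector_derivative_def scaleR_conv_of_real)
        from field_vector_diff_chain_at[OF this dF[OF ann[OF x u]]]
        show "((\<lambda>u. F (of_real u * x)) has_vector_derivative h1 (of_real u * x) * x) (at u)"
          by (simp add: o_def mult.commute)
        have u1: "u \<ge> 1" using u t0 by simp
        have "cmod (h1 (of_real u * x)) \<le> Cd * cmod (of_real u * x) powr (\<beta> - 1)"
          unfolding h1_def by (rule h[OF ann[OF x u]])
        also have "cmod (of_real u * x) powr (\<beta> - 1) = u powr (\<beta> - 1) * cmod x powr (\<beta> - 1)"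
          using u1 by (simp add: norm_mult powr_mult)
        also have "cmod x powr (\<beta> - 1) \<le> m powr (\<beta> - 1) + B powr (\<beta> - 1)"
        proof (cases "\<beta> \<ge> 1")
          case True
          then have "cmod x powr (\<beta> - 1) \<le> B powr (\<beta> - 1)" using B[OF x] by (intro powr_mono2) auto
          then show ?thesis by (simp add: add_increasing)
        next
          case False
          then have "cmod x powr (\<beta> - 1) \<le> m powr (\<beta> - 1)" using m(1) m(2)[OF x] by (intro powr_mono2') auto
          then show ?thesis by (simp add: add_increasing2)
        qed
        finally have "cmod (h1 (of_real u * x)) \<le> Cd * (u powr (\<beta> - 1) * (m powr (\<beta> - 1) + B powr (\<beta> - 1)))"
          using Cd by (simp add: mult_left_mono)
        then have "cmod (h1 (of_real u * x)) * cmod x \<le> (Cd * (u powr (\<beta> - 1) * (m powr (\<beta> - 1) + B powr (\<beta> - 1)))) * B"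
          using B[OF x] Cd by (intro mult_mono) auto
        then show "cmod (h1 (of_real u * x) * x) \<le> C1 * u powr (\<beta> - 1)"
          by (simp add: C1_def norm_mult mult_ac)
      qed (use \<beta> t0 t in auto)
      also have "\<dots> \<le> B1 * t powr \<beta> + C1 / \<beta> * t powr \<beta>"
      proof -
        have "1 \<le> t powr \<beta>" using t t0 \<beta> by (intro ge_one_powr_ge_zero) auto
        then have "B1 * 1 \<le> B1 * t powr \<beta>" using B1' by (intro mult_left_mono) auto
        then show ?thesis using B1[OF x] by simp
      qed
      finally show ?thesis by (simp add: algebra_simps)
    qed
    define e where "e = \<beta> - Re \<nu> - 1"
    define E where "E x t = legp \<nu> (of_real t * x) - g0 * c * (of_real t * x) powr \<nu>" for x t
    define K1 where "K1 = exp (pi * \<bar>Im (-\<nu>-1)\<bar>)"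
    define K2 where "K2 = exp (pi * \<bar>Im (2*\<nu>+1)\<bar>)"
    have K: "K1 \<ge> 0" "K2 \<ge> 0" by (simp_all add: K1_def K2_def)
    define mB where "mB s = m powr s + B powr s" for s
    have mBb: "cmod x powr s \<le> mB s" if "x \<in> W" for x s
    proof (cases "s \<ge> 0")
      case True
      then have "cmod x powr s \<le> B powr s" using B[OF that] by (intro powr_mono2) auto
      then show ?thesis by (simp add: mB_def add_increasing)
    next
      case False
      then have "cmod x powr s \<le> m powr s" using m(1) m(2)[OF that] by (intro powr_mono2') auto
      then show ?thesis by (simp add: mB_def add_increasing2)
    qed
    have mB0: "mB s \<ge> 0" for s by (simp add: mB_def)
    have np: "cmod ((of_real t * x) powr s) \<le> exp (pi * \<bar>Im s\<bar>) * mB (Re s) * t powr Re s" if "x \<in> W" "t > 0" for x t s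
    proof -
      have "cmod ((of_real t * x) powr s) \<le> exp (pi * \<bar>Im s\<bar>) * cmod (of_real t * x) powr Re s"
        using W0[OF that(1)] that by (intro norm_powr_le) auto
      also have "cmod (of_real t * x) powr Re s = t powr Re s * cmod x powr Re s"
        using that by (simp add: norm_mult powr_mult)
      also have "\<dots> \<le> t powr Re s * mB (Re s)" using mBb[OF that(1)] by (intro mult_left_mono) auto
      finally show ?thesis by (simp add: mult_ac)
    qed
    define CA CB where "CA = (cmod g0 + M) * (K1 * mB (Re (-\<nu>-1))) * (B1 + C1 / \<beta>)"
      "CB = (M / m) * (K1 * mB (Re (-\<nu>-1))) * (cmod c * (K2 * mB (Re (2*\<nu>+1))))"
    define C2 where "C2 = CA + CB"
    have big: "cmod (E x t) \<le> C2 * t powr e" if x: "x \<in> W" and t: "t \<ge> t0" for x t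
    proof -
      define y where "y = of_real t * x"
      have y: "y \<in> slit_annulus R" unfolding y_def by (rule ann[OF x t])
      have y0: "y \<noteq> 0" "cmod y > 2" using y R by (auto simp: slit_annulus_def)
      have t1: "t \<ge> 1" using t t0 by simp
      have pp: "y powr \<nu> = y powr (-\<nu>-1) * y powr (2*\<nu>+1)"
        by (simp add: powr_add[symmetric])
      have eq: "E x t = legq \<nu> y * F y + (legq \<nu> y - g0 * y powr (-\<nu>-1)) * (c * y powr (2*\<nu>+1))"
        unfolding E_def y_def[symmetric] F_def pp using Q0[OF y] by (simp add: algebra_simps)
      have n1: "cmod (y powr (-\<nu>-1)) \<le> K1 * mB (Re (-\<nu>-1)) * t powr (-Re \<nu>-1)"
        using np[OF x, of t "-\<nu>-1"] t1 by (simp add: y_def K1_def)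
      have n2: "cmod (y powr (2*\<nu>+1)) \<le> K2 * mB (Re (2*\<nu>+1)) * t powr (2*Re \<nu>+1)"
        using np[OF x, of t "2*\<nu>+1"] t1 by (simp add: y_def K2_def)
      have Qd: "cmod (legq \<nu> y - g0 * y powr (-\<nu>-1)) \<le> M * cmod (y powr (-\<nu>-1)) / cmod y" by (rule Q1[OF y])
      have "cmod (legq \<nu> y) \<le> cmod (g0 * y powr (-\<nu>-1)) + cmod (legq \<nu> y - g0 * y powr (-\<nu>-1))"
        by (metis norm_triangle_sub)
      also have "\<dots> \<le> cmod g0 * cmod (y powr (-\<nu>-1)) + M * cmod (y powr (-\<nu>-1))"
      proof -
        have "M * cmod (y powr (-\<nu>-1)) / cmod y \<le> M * cmod (y powr (-\<nu>-1)) / 1"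
          using y0 M by (intro divide_left_mono) auto
        then show ?thesis using Qd by (simp add: norm_mult)
      qed
      also have "\<dots> = (cmod g0 + M) * cmod (y powr (-\<nu>-1))" by (simp add: algebra_simps)
      also have "\<dots> \<le> (cmod g0 + M) * (K1 * mB (Re (-\<nu>-1)) * t powr (-Re \<nu>-1))"
        using M n1 by (intro mult_left_mono) auto
      finally have Qb: "cmod (legq \<nu> y) \<le> (cmod g0 + M) * (K1 * mB (Re (-\<nu>-1)) * t powr (-Re \<nu>-1))" .
      have "cmod (legq \<nu> y * F y) \<le> ((cmod g0 + M) * (K1 * mB (Re (-\<nu>-1)) * t powr (-Re \<nu>-1))) * ((B1 + C1 / \<beta>) * t powr \<beta>)"
        unfolding norm_mult using Qb Fb[OF x t] M mB0 K by (intro mult_mono) (auto simp: y_def intro!: mult_nonneg_nonneg)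
      also have "\<dots> = (cmod g0 + M) * (K1 * mB (Re (-\<nu>-1))) * (B1 + C1 / \<beta>) * (t powr (-Re \<nu>-1) * t powr \<beta>)"
        by (simp only: mult_ac)
      also have "t powr (-Re \<nu>-1) * t powr \<beta> = t powr e"
        by (simp add: powr_add[symmetric] e_def algebra_simps)
      finally have T1: "cmod (legq \<nu> y * F y) \<le> (cmod g0 + M) * (K1 * mB (Re (-\<nu>-1))) * (B1 + C1 / \<beta>) * t powr e" .
      have T2: "cmod ((legq \<nu> y - g0 * y powr (-\<nu>-1)) * (c * y powr (2*\<nu>+1))) \<le>
        (M / m) * (K1 * mB (Re (-\<nu>-1))) * (cmod c * (K2 * mB (Re (2*\<nu>+1)))) * t powr e"
      proof (cases "c = 0")
        case True
        then show ?thesis by simp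
      next
        case False
        have "cmod (legq \<nu> y - g0 * y powr (-\<nu>-1)) \<le> M * (K1 * mB (Re (-\<nu>-1)) * t powr (-Re \<nu>-1)) / (t * m)"
        proof (rule order_trans[OF Qd])
          have "t * m \<le> cmod y" using t1 m(2)[OF x] by (simp add: y_def norm_mult)
          moreover have "0 < t * m" using t1 m(1) by simp
          ultimately show "M * cmod (y powr (-\<nu>-1)) / cmod y \<le> M * (K1 * mB (Re (-\<nu>-1)) * t powr (-Re \<nu>-1)) / (t * m)"
            using n1 M y0 mB0 K by (intro frac_le mult_left_mono) (auto intro!: mult_nonneg_nonneg)
        qed
        then have "cmod ((legq \<nu> y - g0 * y powr (-\<nu>-1)) * (c * y powr (2*\<nu>+1))) \<le>
          (M * (K1 * mB (Re (-\<nu>-1)) * t powr (-Re \<nu>-1)) / (t * m)) * (cmod c * (K2 * mB (Re (2*\<nu>+1)) * t powr (2*Re \<nu>+1)))"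
          unfolding norm_mult using n2 M m(1) mB0 K t1 by (intro mult_mono) (auto intro!: mult_nonneg_nonneg divide_nonneg_pos)
        also have "\<dots> = (M / m) * (K1 * mB (Re (-\<nu>-1))) * (cmod c * (K2 * mB (Re (2*\<nu>+1)))) * (t powr (-Re \<nu>-1) / t * t powr (2*Re \<nu>+1))"
          using t1 m(1) by (simp add: field_simps)
        also have "\<dots> \<le> (M / m) * (K1 * mB (Re (-\<nu>-1))) * (cmod c * (K2 * mB (Re (2*\<nu>+1)))) * t powr e"
        proof (rule mult_left_mono)
          have "t powr (-Re \<nu>-1) / t * t powr (2*Re \<nu>+1) = t powr ((-Re \<nu>-1) + (- 1) + (2*Re \<nu>+1))"
            unfolding powr_add using t1 by (simp add: powr_minus divide_inverse)
          also have "\<dots> \<le> t powr e" using t1 \<beta>(2)[OF False] by (intro powr_mono) (auto simp: e_def)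
          finally show "t powr (-Re \<nu>-1) / t * t powr (2*Re \<nu>+1) \<le> t powr e" .
        qed (use M m(1) mB0 K in \<open>auto intro!: mult_nonneg_nonneg divide_nonneg_pos\<close>)
        finally show ?thesis .
      qed
      have "C2 * t powr e = CA * t powr e + CB * t powr e" by (simp only: C2_def distrib_right)
      then show ?thesis
        unfolding eq using norm_triangle_mono[OF T1 T2] by (simp only: CA_CB_def)
    qed
    have "continuous_on (W \<times> {1..t0}) (\<lambda>p. E (fst p) (snd p) * of_real (snd p powr (- e)))"
    proof -
      have "continuous_on (W \<times> {1..t0}) (\<lambda>p. legp \<nu> (of_real (snd p) * fst p))"
        by (rule continuous_on_compose2[OF holomorphic_on_imp_continuous_on[OF holomorphic_on_legp]])
          (use sl in \<open>auto intro!: continuous_intros\<close>)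
      moreover have pwc: "continuous_on (W \<times> {1..t0}) (\<lambda>p. (of_real (snd p) * fst p) powr \<nu>)"
      proof (rule continuous_on_compose2[of "- \<real>\<^sub>\<le>\<^sub>0" "\<lambda>y. y powr \<nu>"])
        show "continuous_on (- \<real>\<^sub>\<le>\<^sub>0) (\<lambda>y. y powr \<nu>)"
          by (intro holomorphic_on_imp_continuous_on holomorphic_intros) auto
      qed (use sl in \<open>auto intro!: continuous_intros\<close>)
      ultimately have "continuous_on (W \<times> {1..t0}) (\<lambda>p. E (fst p) (snd p))"
        unfolding E_def by (intro continuous_on_diff continuous_on_mult continuous_on_const)
      moreover have "continuous_on (W \<times> {1..t0}) (\<lambda>p. complex_of_real (snd p powr (- e)))"
        by (intro continuous_intros) auto
      ultimately show ?thesis by (rule continuous_on_mult)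
    qed
    moreover have "compact (W \<times> {1..t0})" using W(1) by (intro compact_Times) auto
    ultimately have "compact ((\<lambda>p. E (fst p) (snd p) * of_real (snd p powr (- e))) ` (W \<times> {1..t0}))"
      by (rule compact_continuous_image)
    then obtain B2 where B2: "\<And>p. p \<in> W \<times> {1..t0} \<Longrightarrow> cmod (E (fst p) (snd p) * of_real (snd p powr (- e))) \<le> B2"
      by (meson bounded_iff compact_imp_bounded imageI)
    have small: "cmod (E x t) \<le> B2 * t powr e" if "x \<in> W" "1 \<le> t" "t \<le> t0" for x t
    proof -
      have "cmod (E x t) * t powr (- e) \<le> B2" using B2[of "(x, t)"] that by (simp add: norm_mult)
      then have "cmod (E x t) * t powr (- e) * t powr e \<le> B2 * t powr e" by (intro mult_right_mono) auto
      moreover have "t powr (- e) * t powr e = 1" using that by (simp add: powr_add[symmetric])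
      ultimately show ?thesis by (simp add: mult.assoc)
    qed
    have "cmod (E x t) \<le> (\<bar>B2\<bar> + \<bar>C2\<bar>) * t powr e" if "x \<in> W" "1 \<le> t" for x t
    proof (cases "t \<le> t0")
      case True
      have "B2 * t powr e \<le> (\<bar>B2\<bar> + \<bar>C2\<bar>) * t powr e" by (intro mult_right_mono) auto
      then show ?thesis using small[OF that True] by linarith
    next
      case False
      have "C2 * t powr e \<le> (\<bar>B2\<bar> + \<bar>C2\<bar>) * t powr e" by (intro mult_right_mono) auto
      then show ?thesis using big[OF that(1), of t] False by linarith
    qed
    then show ?thesis unfolding E_def e_def by blast
  qed auto
qed

text \<open>The case \<open>c = 0\<close> of the ray estimate. The loss \<delta> keeps the exponent
  of integration positive on the boundary line Re \<nu> = -1/2, and at \<open>\<nu> = -1/2\<close>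
  it absorbs a logarithm.\<close>

lemma legp_growth:
  assumes \<nu>: "Re \<nu> \<ge> -1/2" and \<delta>: "\<delta> > 0" and W: "compact W" "W \<inter> \<real>\<^sub>\<le>\<^sub>0 = {}"
  shows "\<exists>C. \<forall>x\<in>W. \<forall>t\<ge>1. cmod (legp \<nu> (of_real t * x)) \<le> C * t powr (Re \<nu> + \<delta>)"
proof -
  obtain R M g0 k0 w k where *: "R \<ge> 2" "M > 0" "g0 \<noteq> 0" "k0 \<noteq> 0"
    "\<And>y. y \<in> slit_annulus R \<Longrightarrow> legq \<nu> y \<noteq> 0"
    "\<And>y. y \<in> slit_annulus R \<Longrightarrow> cmod (legq \<nu> y - g0 * y powr (-\<nu>-1)) \<le> M * cmod (y powr (-\<nu>-1)) / cmod y"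
    "\<And>y. y \<in> slit_annulus R \<Longrightarrow> ((\<lambda>y. legp \<nu> y / legq \<nu> y) has_field_derivative w * y powr (2 * \<nu>) * k y) (at y)"
    "\<And>y. y \<in> slit_annulus R \<Longrightarrow> cmod (k y - k0) \<le> M / cmod y"
    using legp_div_legq[OF \<nu>] by blast
  have "\<exists>C. \<forall>x\<in>W. \<forall>t\<ge>1. cmod (legp \<nu> (of_real t * x) - g0 * 0 * (of_real t * x) powr \<nu>) \<le> C * t powr (2 * Re \<nu> + 1 + \<delta> - Re \<nu> - 1)"
  proof (rule legp_ray_bound[OF W *(1,2) *(5,6,7)])
    fix y assume y: "y \<in> slit_annulus R"
    then have y0: "y \<noteq> 0" "cmod y > 2" using *(1) by (auto simp: slit_annulus_def)
    have "M / cmod y \<le> M / 1" using y0 *(2) by (intro divide_left_mono) auto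
    then have kb: "cmod (k y) \<le> cmod k0 + M"
      using *(8)[OF y] norm_triangle_sub[of "k y" k0] by simp
    have "cmod y powr (2 * Re \<nu>) \<le> cmod y powr (2 * Re \<nu> + 1 + \<delta> - 1)"
      using y0 \<delta> by (intro powr_mono) auto
    then have "cmod (y powr (2 * \<nu>)) \<le> exp (pi * \<bar>Im (2*\<nu>)\<bar>) * cmod y powr (2 * Re \<nu> + 1 + \<delta> - 1)"
      using norm_powr_le[OF y0(1), of "2*\<nu>"] by (intro order_trans[OF norm_powr_le[OF y0(1)]]) (auto intro: mult_left_mono)
    then have "cmod w * cmod (y powr (2 * \<nu>)) * cmod (k y) \<le> cmod w * (exp (pi * \<bar>Im (2*\<nu>)\<bar>) * cmod y powr (2 * Re \<nu> + 1 + \<delta> - 1)) * (cmod k0 + M)"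
      using kb by (intro mult_mono) auto
    then show "cmod (w * y powr (2 * \<nu>) * k y - 0 * (2 * \<nu> + 1) * y powr (2 * \<nu>)) \<le>
       (cmod w * exp (pi * \<bar>Im (2*\<nu>)\<bar>) * (cmod k0 + M)) * cmod y powr (2 * Re \<nu> + 1 + \<delta> - 1)"
      by (simp add: norm_mult mult_ac)
  qed (use \<nu> \<delta> in auto)
  then show ?thesis by (simp add: algebra_simps)
qed

text \<open>The coefficient \<open>a\<close> is \<open>g0 * c\<close>, where
  \<open>c * y powr (2 * \<nu> + 1)\<close> is a primitive of the leading term of the derivative of
  \<open>legp / legq\<close>. If it vanishes, so does the Wronskian constant, \<open>legp\<close> is
  a multiple of \<open>legq\<close> on the annulus and decays. That alternative is stated only to be
  refuted by the Mellin transform.\<close>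

lemma legp_asymptotics:
  assumes \<nu>: "Re \<nu> > -1/2"
  obtains a \<gamma> where "\<gamma> > 0"
    "\<And>W. compact W \<Longrightarrow> W \<inter> \<real>\<^sub>\<le>\<^sub>0 = {} \<Longrightarrow>
       \<exists>C. \<forall>x\<in>W. \<forall>t\<ge>1. cmod (legp \<nu> (of_real t * x) - a * (of_real t * x) powr \<nu>) \<le> C * t powr (Re \<nu> - \<gamma>)"
    "\<And>W \<beta>. a = 0 \<Longrightarrow> \<beta> > 0 \<Longrightarrow> compact W \<Longrightarrow> W \<inter> \<real>\<^sub>\<le>\<^sub>0 = {} \<Longrightarrow>
       \<exists>C. \<forall>x\<in>W. \<forall>t\<ge>1. cmod (legp \<nu> (of_real t * x)) \<le> C * t powr (\<beta> - Re \<nu> - 1)"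
proof -
  have "Re \<nu> \<ge> -1/2" using \<nu> by simp
  obtain R M g0 k0 w k where *: "R \<ge> 2" "M > 0" "g0 \<noteq> 0" "k0 \<noteq> 0"
    "\<And>y. y \<in> slit_annulus R \<Longrightarrow> legq \<nu> y \<noteq> 0"
    "\<And>y. y \<in> slit_annulus R \<Longrightarrow> cmod (legq \<nu> y - g0 * y powr (-\<nu>-1)) \<le> M * cmod (y powr (-\<nu>-1)) / cmod y"
    "\<And>y. y \<in> slit_annulus R \<Longrightarrow> ((\<lambda>y. legp \<nu> y / legq \<nu> y) has_field_derivative w * y powr (2 * \<nu>) * k y) (at y)"
    "\<And>y. y \<in> slit_annulus R \<Longrightarrow> cmod (k y - k0) \<le> M / cmod y"
    using legp_div_legq[OF \<open>Re \<nu> \<ge> -1/2\<close>] by blast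
  have nz: "2 * \<nu> + 1 \<noteq> 0"
  proof
    assume "2 * \<nu> + 1 = 0"
    then have "Re (2 * \<nu> + 1) = 0" by simp
    then show False using \<nu> by simp
  qed
  define c where "c = w * k0 / (2 * \<nu> + 1)"
  \<comment> \<open>The bound 1 is the order of the error of \<open>k\<close>; staying below
    \<open>2 * Re \<nu> + 1\<close> keeps the exponent \<open>2 * Re \<nu> + 1 - \<gamma>\<close> of
    the integrated error positive.\<close>
  define \<gamma> where "\<gamma> = min 1 ((2 * Re \<nu> + 1) / 2)"
  have \<gamma>: "\<gamma> > 0" "\<gamma> \<le> 1" "\<gamma> < 2 * Re \<nu> + 1" using \<nu> by (auto simp: \<gamma>_def min_def)
  show thesis
  proof (rule that[of \<gamma> "g0 * c"])
    fix W :: "complex set" assume W: "compact W" "W \<inter> \<real>\<^sub>\<le>\<^sub>0 = {}"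
    have "\<exists>C. \<forall>x\<in>W. \<forall>t\<ge>1. cmod (legp \<nu> (of_real t * x) - g0 * c * (of_real t * x) powr \<nu>) \<le> C * t powr (2 * Re \<nu> + 1 - \<gamma> - Re \<nu> - 1)"
    proof (rule legp_ray_bound[OF W *(1,2) *(5,6,7)])
      fix y assume y: "y \<in> slit_annulus R"
      then have y0: "y \<noteq> 0" "cmod y > 2" using *(1) by (auto simp: slit_annulus_def)
      have "cmod y powr (2 * Re \<nu>) / cmod y = cmod y powr (2 * Re \<nu> + (-1))"
        unfolding powr_add using y0 by (simp add: powr_minus divide_inverse)
      also have "\<dots> \<le> cmod y powr (2 * Re \<nu> + 1 - \<gamma> - 1)"
        using y0 \<gamma> by (intro powr_mono) auto
      finally have 1: "cmod y powr (2 * Re \<nu>) / cmod y \<le> cmod y powr (2 * Re \<nu> + 1 - \<gamma> - 1)" .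
      have "w * y powr (2 * \<nu>) * k y - c * (2 * \<nu> + 1) * y powr (2 * \<nu>) = w * y powr (2 * \<nu>) * (k y - k0)"
      proof -
        have "c * (2 * \<nu> + 1) = w * k0" using nz by (simp add: c_def)
        then show ?thesis by (simp only:) (simp add: algebra_simps)
      qed
      then have "cmod (w * y powr (2 * \<nu>) * k y - c * (2 * \<nu> + 1) * y powr (2 * \<nu>)) = cmod w * cmod (y powr (2 * \<nu>)) * cmod (k y - k0)"
        by (simp add: norm_mult)
      also have "\<dots> \<le> cmod w * (exp (pi * \<bar>Im (2*\<nu>)\<bar>) * cmod y powr Re (2*\<nu>)) * (M / cmod y)"
        using *(8)[OF y] norm_powr_le[OF y0(1), of "2*\<nu>"] by (intro mult_mono) auto
      also have "\<dots> = (cmod w * exp (pi * \<bar>Im (2*\<nu>)\<bar>) * M) * (cmod y powr (2 * Re \<nu>) / cmod y)" by simp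
      also have "\<dots> \<le> (cmod w * exp (pi * \<bar>Im (2*\<nu>)\<bar>) * M) * cmod y powr (2 * Re \<nu> + 1 - \<gamma> - 1)"
        using *(2) by (intro mult_left_mono 1) auto
      finally show "cmod (w * y powr (2 * \<nu>) * k y - c * (2 * \<nu> + 1) * y powr (2 * \<nu>)) \<le>
        (cmod w * exp (pi * \<bar>Im (2*\<nu>)\<bar>) * M) * cmod y powr (2 * Re \<nu> + 1 - \<gamma> - 1)" .
    qed (use \<gamma> in auto)
    then show "\<exists>C. \<forall>x\<in>W. \<forall>t\<ge>1. cmod (legp \<nu> (of_real t * x) - g0 * c * (of_real t * x) powr \<nu>) \<le> C * t powr (Re \<nu> - \<gamma>)"
      by (simp add: algebra_simps)
  next
    fix W :: "complex set" and \<beta> :: real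
    assume a: "g0 * c = 0" and \<beta>: "\<beta> > 0" and W: "compact W" "W \<inter> \<real>\<^sub>\<le>\<^sub>0 = {}"
    then have w: "w = 0" using * nz by (auto simp: c_def)
    have "\<exists>C. \<forall>x\<in>W. \<forall>t\<ge>1. cmod (legp \<nu> (of_real t * x) - g0 * 0 * (of_real t * x) powr \<nu>) \<le> C * t powr (\<beta> - Re \<nu> - 1)"
      by (rule legp_ray_bound[OF W *(1,2) *(5,6,7) \<beta>, where Cd = 0]) (use w in auto)
    then show "\<exists>C. \<forall>x\<in>W. \<forall>t\<ge>1. cmod (legp \<nu> (of_real t * x)) \<le> C * t powr (\<beta> - Re \<nu> - 1)" by simp
  qed (use \<gamma> in auto)
qed

text \<open>Cauchy's inequality on discs around \<open>t * x\<close> whose radius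
  \<open>t * e\<close> scales with \<open>t\<close>: each derivative gains a factor
  \<open>1 / t\<close>.\<close>

lemma legp_deriv_growth:
  assumes \<nu>: "Re \<nu> \<ge> -1/2" and \<delta>: "\<delta> > 0" and W: "compact W" "W \<inter> \<real>\<^sub>\<le>\<^sub>0 = {}"
  shows "\<exists>C. \<forall>x\<in>W. \<forall>t\<ge>1. cmod (deriv (legp \<nu>) (of_real t * x)) \<le> C * t powr (Re \<nu> + \<delta> - 1)"
proof (cases "W = {}")
  case False
  obtain e where e: "e > 0" "(\<Union>x\<in>W. cball x e) \<subseteq> - \<real>\<^sub>\<le>\<^sub>0"
    using compact_subset_open_imp_cball_epsilon_subset[OF W(1) open_slit] W(2) by blast
  have "compact (\<Union>x\<in>W. cball x e)" by (rule compact_minkowski_sum_cball[OF W(1)])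
  then obtain C where C: "\<And>x t. x \<in> (\<Union>x\<in>W. cball x e) \<Longrightarrow> t \<ge> 1 \<Longrightarrow> cmod (legp \<nu> (of_real t * x)) \<le> C * t powr (Re \<nu> + \<delta>)"
    using legp_growth[OF \<nu> \<delta>, of "\<Union>x\<in>W. cball x e"] e(2) by (metis (no_types, lifting) disjoint_eq_subset_Compl)
  have "cmod (deriv (legp \<nu>) (of_real t * x)) \<le> C / e * t powr (Re \<nu> + \<delta> - 1)" if x: "x \<in> W" and t: "t \<ge> 1" for x t
  proof -
    have sub: "cball (of_real t * x) (t * e) \<subseteq> (\<lambda>u. of_real t * u) ` cball x e"
    proof
      fix u assume u: "u \<in> cball (of_real t * x) (t * e)"
      have "of_real t * x - u = of_real t * (x - u / of_real t)" using t by (simp add: algebra_simps)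
      then have "t * cmod (x - u / of_real t) \<le> t * e" using u t by (simp add: dist_norm norm_mult)
      then have "u / of_real t \<in> cball x e" using t by (simp add: dist_norm)
      moreover have "u = of_real t * (u / of_real t)" using t by simp
      ultimately show "u \<in> (\<lambda>u. of_real t * u) ` cball x e" by blast
    qed
    have slit: "cball (of_real t * x) (t * e) \<subseteq> - \<real>\<^sub>\<le>\<^sub>0"
    proof -
      have "(\<lambda>u. of_real t * u) ` cball x e \<subseteq> - \<real>\<^sub>\<le>\<^sub>0"
      proof
        fix v assume "v \<in> (\<lambda>u. of_real t * u) ` cball x e"
        then obtain u where u: "u \<in> cball x e" "v = of_real t * u" by blast
        then have "u \<notin> \<real>\<^sub>\<le>\<^sub>0" using e(2) x by blast
        then show "v \<in> - \<real>\<^sub>\<le>\<^sub>0" using of_real_mult_not_nonpos_Reals[of t u] t u by simp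
      qed
      then show ?thesis using sub by blast
    qed
    have "cmod ((deriv ^^ 1) (legp \<nu>) (of_real t * x)) \<le> fact 1 * (C * t powr (Re \<nu> + \<delta>)) / (t * e) ^ 1"
    proof (rule Cauchy_inequality)
      show "legp \<nu> holomorphic_on ball (of_real t * x) (t * e)"
        using slit ball_subset_cball by (intro holomorphic_on_subset[OF holomorphic_on_legp]) blast
      show "continuous_on (cball (of_real t * x) (t * e)) (legp \<nu>)"
        using slit by (intro holomorphic_on_imp_continuous_on holomorphic_on_subset[OF holomorphic_on_legp])
      show "0 < t * e" using t e by simp
      fix u assume u: "cmod (of_real t * x - u) = t * e"
      then have "u \<in> cball (of_real t * x) (t * e)" by (simp add: dist_norm)
      then obtain v where "v \<in> cball x e" "u = of_real t * v" using sub by blast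
      then show "cmod (legp \<nu> u) \<le> C * t powr (Re \<nu> + \<delta>)" using C[of v t] x t by auto
    qed
    then have "cmod (deriv (legp \<nu>) (of_real t * x)) \<le> C / e * (t powr (Re \<nu> + \<delta>) / t)" by (simp add: field_simps)
    also have "t powr (Re \<nu> + \<delta>) / t = t powr (Re \<nu> + \<delta> - 1)" using t by (simp add: powr_diff)
    finally show ?thesis .
  qed
  then show ?thesis by blast
qed auto

section \<open>The Mellin transform of the Legendre function\<close>

text \<open>With \<open>y = 1 / Z\<close> this is the integral of
  \<open>Z powr (- \<mu> - 1) * P\<^sub>\<nu>(Z)\<close> over \<open>Z \<ge> 1\<close>.\<close>

definition legendre_mellin :: "complex \<Rightarrow> complex \<Rightarrow> complex" where
  "legendre_mellin \<nu> \<mu> = integral {0..1} (\<lambda>y. of_real y powr (\<mu> - 1) * legp \<nu> ((1 + 1 / of_real y) / 2))"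

text \<open>Reciprocal Gamma functions make it entire in both parameters; its zero at
  \<open>\<mu> = \<nu>\<close> is used below.\<close>

definition product_const :: "complex \<Rightarrow> complex \<Rightarrow> complex" where
  "product_const \<nu> \<mu> = 2 powr (1 - \<mu>) * of_real (sqrt pi) * (rGamma ((\<mu> - \<nu>) / 2) * rGamma ((\<nu> + \<mu> + 1) / 2))"

lemma half_one_plus_not_nonpos:
  assumes "y \<in> {0<..1}"
  shows "(1 + 1 / complex_of_real y) / 2 \<notin> \<real>\<^sub>\<le>\<^sub>0"
proof -
  have "(1 + 1 / complex_of_real y) / 2 = of_real ((1 + 1 / y) / 2)" by simp
  moreover have "(1 + 1 / y) / 2 > 0" using assms by (simp add: add_pos_pos)
  moreover have "complex_of_real r \<notin> \<real>\<^sub>\<le>\<^sub>0" if "r > 0" for r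
    using that by (simp add: complex_nonpos_Reals_iff)
  ultimately show ?thesis by (metis (no_types, lifting))
qed

text \<open>The point is \<open>1 / y\<close> times \<open>(1 + y) / 2\<close>, and the latter
  ranges over a compact piece of the positive axis.\<close>

lemma ray_bound_on_unit_interval:
  fixes f :: "complex \<Rightarrow> complex"
  assumes "\<And>W. compact W \<Longrightarrow> W \<inter> \<real>\<^sub>\<le>\<^sub>0 = {} \<Longrightarrow> \<exists>C. \<forall>x\<in>W. \<forall>t\<ge>1. cmod (f (of_real t * x)) \<le> C * t powr e"
  shows "\<exists>C\<ge>0. \<forall>y\<in>{0<..1}. cmod (f ((1 + 1 / of_real y) / 2)) \<le> C * y powr (- e)"
proof -
  let ?W = "complex_of_real ` {1/2..1}"
  have "compact ?W" by (intro compact_continuous_image continuous_intros) auto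
  moreover have "?W \<inter> \<real>\<^sub>\<le>\<^sub>0 = {}" by auto
  ultimately obtain C where C: "\<And>x t. x \<in> ?W \<Longrightarrow> t \<ge> 1 \<Longrightarrow> cmod (f (of_real t * x)) \<le> C * t powr e"
    using assms by meson
  have "cmod (f ((1 + 1 / of_real y) / 2)) \<le> \<bar>C\<bar> * y powr (- e)" if y: "y \<in> {0<..1}" for y
  proof -
    have "(1 + 1 / complex_of_real y) / 2 = of_real (1 / y) * of_real ((1 + y) / 2)"
      using y by (simp add: field_simps)
    moreover have "complex_of_real ((1 + y) / 2) \<in> ?W" using y by (intro imageI) auto
    ultimately have "cmod (f ((1 + 1 / of_real y) / 2)) \<le> C * (1 / y) powr e"
      by (simp only:) (rule C, use y in auto)
    also have "(1 / y) powr e = y powr (- e)" using y by (simp add: powr_minus_divide powr_divide)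
    also have "C * y powr (- e) \<le> \<bar>C\<bar> * y powr (- e)" by (intro mult_right_mono) auto
    finally show ?thesis .
  qed
  then show ?thesis by (intro exI[of _ "\<bar>C\<bar>"]) auto
qed

lemma norm_integral_powr_bound_1:
  fixes f :: "real \<Rightarrow> complex"
  assumes "continuous_on {0<..1} f" "\<gamma> > 0"
    and "\<And>y. y \<in> {0<..1} \<Longrightarrow> norm (f y) \<le> C * y powr (\<gamma> - 1)"
  shows "norm (integral {0..1} f) \<le> C / \<gamma>"
  using norm_integral_powr_bound(2)[OF assms, of 1] by simp

lemma legp_real_deriv:
  fixes f :: "complex \<Rightarrow> complex"
  assumes "\<And>z. z \<notin> \<real>\<^sub>\<le>\<^sub>0 \<Longrightarrow> (f has_field_derivative f' z) (at z)" and y: "y \<in> {0<..1}"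
  shows "((\<lambda>y. f ((1 + 1 / of_real y) / 2)) has_vector_derivative
     - f' ((1 + 1 / of_real y) / 2) / (2 * (of_real y)\<^sup>2)) (at y)"
proof -
  have y0: "complex_of_real y \<noteq> 0" using y by simp
  have "((\<lambda>y. (1 + 1 / y) / 2) has_field_derivative - 1 / (2 * (of_real y)\<^sup>2)) (at (complex_of_real y))"
    using y0 by (auto intro!: derivative_eq_intros simp: power2_eq_square)
  from DERIV_chain2[OF assms(1)[OF half_one_plus_not_nonpos[OF y]] this]
  have "((\<lambda>z. f ((1 + 1 / z) / 2)) has_field_derivative f' ((1 + 1 / of_real y) / 2) * (- 1 / (2 * (of_real y)\<^sup>2))) (at (complex_of_real y))" .
  from has_vector_derivative_real_field[OF this] show ?thesis by simp
qed

lemma powr_real_deriv: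
  assumes y: "y > 0"
  shows "((\<lambda>y. complex_of_real y powr s) has_vector_derivative s * of_real y powr (s - 1)) (at y)"
  by (rule has_vector_derivative_real_field, rule has_field_derivative_powr) (use y in auto)

context
  fixes \<nu> :: complex
  assumes \<nu>: "Re \<nu> \<ge> -1/2"
begin

lemma mellin_bounds:
  assumes "\<delta> > 0"
  obtains C where "C \<ge> 0"
    "\<forall>y\<in>{0<..1}. cmod (legp \<nu> ((1 + 1 / of_real y) / 2)) \<le> C * y powr (- (Re \<nu> + \<delta>))"
    "\<forall>y\<in>{0<..1}. cmod (deriv (legp \<nu>) ((1 + 1 / of_real y) / 2)) \<le> C * y powr (1 - (Re \<nu> + \<delta>))"
proof -
  obtain C1 where C1: "C1 \<ge> 0" "\<And>y. y \<in> {0<..1} \<Longrightarrow> cmod (legp \<nu> ((1 + 1 / of_real y) / 2)) \<le> C1 * y powr (- (Re \<nu> + \<delta>))"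
    using ray_bound_on_unit_interval[OF legp_growth[OF \<nu> assms]] by blast
  obtain C2 where C2: "C2 \<ge> 0" "\<And>y. y \<in> {0<..1} \<Longrightarrow> cmod (deriv (legp \<nu>) ((1 + 1 / of_real y) / 2)) \<le> C2 * y powr (- (Re \<nu> + \<delta> - 1))"
    using ray_bound_on_unit_interval[OF legp_deriv_growth[OF \<nu> assms]] by blast
  show thesis
  proof (rule that[of "C1 + C2"]; (intro ballI)?)
    fix y :: real assume y: "y \<in> {0<..1}"
    show "cmod (legp \<nu> ((1 + 1 / of_real y) / 2)) \<le> (C1 + C2) * y powr (- (Re \<nu> + \<delta>))"
      using C1(2)[OF y] C2(1) by (intro order_trans[OF C1(2)[OF y]] mult_right_mono) auto
    show "cmod (deriv (legp \<nu>) ((1 + 1 / of_real y) / 2)) \<le> (C1 + C2) * y powr (1 - (Re \<nu> + \<delta>))"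
      using order_trans[OF C2(2)[OF y], of "(C1 + C2) * y powr (1 - (Re \<nu> + \<delta>))"] C1(1)
      by (auto simp: algebra_simps)
  qed (use C1 C2 in auto)
qed

lemma continuous_on_mellin_integrand:
  "continuous_on {0<..1} (\<lambda>y. of_real y powr s * legp \<nu> ((1 + 1 / of_real y) / 2))"
  "continuous_on {0<..1} (\<lambda>y. of_real y powr s * deriv (legp \<nu>) ((1 + 1 / of_real y) / 2))"
  by (intro continuous_at_imp_continuous_on ballI continuous_mult
      has_vector_derivative_continuous[OF powr_real_deriv]
      has_vector_derivative_continuous[OF legp_real_deriv[OF legp_has_deriv]]
      has_vector_derivative_continuous[OF legp_real_deriv[OF legp_has_deriv2]]; simp)+

lemma mellin_integrand_bounds:
  assumes "Re \<nu> + \<delta> < Re \<mu>" and C: "C \<ge> 0"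
    "\<forall>y\<in>{0<..1}. cmod (legp \<nu> ((1 + 1 / of_real y) / 2)) \<le> C * y powr (- (Re \<nu> + \<delta>))"
    "\<forall>y\<in>{0<..1}. cmod (deriv (legp \<nu>) ((1 + 1 / of_real y) / 2)) \<le> C * y powr (1 - (Re \<nu> + \<delta>))"
    and y: "y \<in> {0<..1}"
  shows "cmod (of_real y powr s * legp \<nu> ((1 + 1 / of_real y) / 2)) \<le> C * y powr (Re s - (Re \<nu> + \<delta>))"
    "cmod (of_real y powr s * deriv (legp \<nu>) ((1 + 1 / of_real y) / 2)) \<le> C * y powr (Re s + 1 - (Re \<nu> + \<delta>))"
proof -
  have n: "cmod (of_real y powr s) = y powr Re s" using y by (simp add: norm_powr_real_powr)
  have "cmod (of_real y powr s * legp \<nu> ((1 + 1 / of_real y) / 2)) \<le> y powr Re s * (C * y powr (- (Re \<nu> + \<delta>)))"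
    unfolding norm_mult n using bspec[OF C(2) y] by (intro mult_left_mono) auto
  also have "\<dots> = C * (y powr Re s * y powr (- (Re \<nu> + \<delta>)))" by simp
  also have "y powr Re s * y powr (- (Re \<nu> + \<delta>)) = y powr (Re s - (Re \<nu> + \<delta>))"
    by (simp add: powr_add[symmetric] algebra_simps)
  finally show "cmod (of_real y powr s * legp \<nu> ((1 + 1 / of_real y) / 2)) \<le> C * y powr (Re s - (Re \<nu> + \<delta>))" .
  have "cmod (of_real y powr s * deriv (legp \<nu>) ((1 + 1 / of_real y) / 2)) \<le> y powr Re s * (C * y powr (1 - (Re \<nu> + \<delta>)))"
    unfolding norm_mult n using bspec[OF C(3) y] by (intro mult_left_mono) auto
  also have "\<dots> = C * (y powr Re s * y powr (1 - (Re \<nu> + \<delta>)))" by simp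
  also have "y powr Re s * y powr (1 - (Re \<nu> + \<delta>)) = y powr (Re s + 1 - (Re \<nu> + \<delta>))"
    by (simp add: powr_add[symmetric] algebra_simps)
  finally show "cmod (of_real y powr s * deriv (legp \<nu>) ((1 + 1 / of_real y) / 2)) \<le> C * y powr (Re s + 1 - (Re \<nu> + \<delta>))" .
qed

lemma tendsto_0_of_powr_bound:
  fixes f :: "real \<Rightarrow> complex"
  assumes "\<And>y. y \<in> {0<..1} \<Longrightarrow> cmod (f y) \<le> C * y powr \<gamma>" and "\<gamma> > 0"
  shows "(f \<longlongrightarrow> 0) (at 0 within {0..1})"
proof (rule Lim_null_comparison[of _ "\<lambda>y. C * y powr \<gamma>"])
  show "\<forall>\<^sub>F y in at 0 within {0..1}. cmod (f y) \<le> C * y powr \<gamma>"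
    unfolding eventually_at_filter by (rule always_eventually) (use assms in auto)
  have "continuous_on {0..1} (\<lambda>y. C * y powr \<gamma>)"
    using assms(2) by (intro continuous_intros continuous_on_powr') auto
  then have "((\<lambda>y. C * y powr \<gamma>) \<longlongrightarrow> C * 0 powr \<gamma>) (at 0 within {0..1})"
    unfolding continuous_on_def by (rule bspec) auto
  then show "((\<lambda>y. C * y powr \<gamma>) \<longlongrightarrow> 0) (at 0 within {0..1})" by simp
qed

lemma continuous_on_unit_interval_extend:
  fixes f :: "real \<Rightarrow> complex"
  assumes "\<And>y. y \<in> {0<..1} \<Longrightarrow> isCont f y" "(f \<longlongrightarrow> f 0) (at 0 within {0..1})"
  shows "continuous_on {0..1} f"
  unfolding continuous_on_eq_continuous_within
proof
  fix y :: real assume "y \<in> {0..1}"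
  then show "continuous (at y within {0..1}) f"
    using assms by (cases "y = 0") (auto simp: continuous_within intro: continuous_at_imp_continuous_at_within[unfolded continuous_within])
qed

text \<open>Legendre's equation is tested against a power of \<open>Z = 1 / y\<close> and integrated
  by parts twice; the operator maps that power to itself and to the one shifted by 2.\<close>

lemma mellin_recurrence:
  assumes \<mu>: "Re \<nu> < Re \<mu>"
  shows "(\<mu> - \<nu>) * (\<mu> + \<nu> + 1) * legendre_mellin \<nu> \<mu> = (\<mu> + 1) * (\<mu> + 2) * legendre_mellin \<nu> (\<mu> + 2)"
proof -
  define \<delta> where "\<delta> = (Re \<mu> - Re \<nu>) / 2"
  have \<delta>: "\<delta> > 0" "Re \<nu> + \<delta> < Re \<mu>" using \<mu> by (auto simp: \<delta>_def field_simps)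
  obtain C where C: "C \<ge> 0"
    "\<forall>y\<in>{0<..1}. cmod (legp \<nu> ((1 + 1 / of_real y) / 2)) \<le> C * y powr (- (Re \<nu> + \<delta>))"
    "\<forall>y\<in>{0<..1}. cmod (deriv (legp \<nu>) ((1 + 1 / of_real y) / 2)) \<le> C * y powr (1 - (Re \<nu> + \<delta>))"
    using mellin_bounds[OF \<delta>(1)] by blast
  let ?p = "\<lambda>y. legp \<nu> ((1 + 1 / complex_of_real y) / 2)"
  let ?q = "\<lambda>y. deriv (legp \<nu>) ((1 + 1 / complex_of_real y) / 2)"
  let ?r = "\<lambda>y. deriv (deriv (legp \<nu>)) ((1 + 1 / complex_of_real y) / 2)"
  \<comment> \<open>Up to sign, the boundary terms of the two integrations by parts. The factor
    \<open>1 - y^2\<close> kills them at \<open>y = 1\<close>, and the growth bounds do so at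
    \<open>y = 0\<close>.\<close>
  define \<Phi> where "\<Phi> y = (1 - (of_real y)\<^sup>2) * (of_real y powr (\<mu> - 1) * ?q y / 2 + (\<mu> + 1) * (of_real y powr \<mu> * ?p y))" for y
  define \<Phi>' where "\<Phi>' y = (\<mu> * (\<mu> + 1) - \<nu> * (\<nu> + 1)) * (of_real y powr (\<mu> - 1) * ?p y) - (\<mu> + 1) * (\<mu> + 2) * (of_real y powr (\<mu> + 1) * ?p y)" for y
  have d\<Phi>: "(\<Phi> has_vector_derivative \<Phi>' y) (at y)" if y: "y \<in> {0<..1}" for y
  proof -
    define Y where "Y = complex_of_real y"
    have Y: "Y \<noteq> 0" using y by (simp add: Y_def)
    define s where "s = Y powr (\<mu> - 2)"
    have s1: "Y powr (\<mu> - 1) = s * Y" "Y powr \<mu> = s * Y\<^sup>2" "Y powr (\<mu> + 1) = s * Y^3" "Y powr (\<mu> - 1 - 1) = s"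
    proof -
      have "Y powr (\<mu> - 2 + of_nat n) = s * Y ^ n" for n
        unfolding powr_add s_def using Y by (simp add: powr_nat)
      from this[of 1] this[of 2] this[of 3] show "Y powr (\<mu> - 1) = s * Y" "Y powr \<mu> = s * Y\<^sup>2" "Y powr (\<mu> + 1) = s * Y^3"
        by (simp_all add: algebra_simps)
      show "Y powr (\<mu> - 1 - 1) = s" by (simp add: s_def)
    qed
    have dp: "(?p has_vector_derivative - ?q y / (2 * Y\<^sup>2)) (at y)"
      unfolding Y_def by (rule legp_real_deriv[OF legp_has_deriv y])
    have dq: "(?q has_vector_derivative - ?r y / (2 * Y\<^sup>2)) (at y)"
      unfolding Y_def by (rule legp_real_deriv[OF legp_has_deriv2 y])
    have y0: "y > 0" using y by simp
    have d1: "((\<lambda>y. 1 - (complex_of_real y)\<^sup>2) has_vector_derivative - (2 * Y)) (at y)"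
      unfolding Y_def by (rule has_vector_derivative_real_field) (auto intro!: derivative_eq_intros)
    have "(\<Phi> has_vector_derivative
       ((1 - Y\<^sup>2) * ((Y powr (\<mu> - 1) * (- ?r y / (2 * Y\<^sup>2)) + (\<mu> - 1) * Y powr (\<mu> - 1 - 1) * ?q y) / 2 + (\<mu> + 1) * (Y powr \<mu> * (- ?q y / (2 * Y\<^sup>2)) + \<mu> * Y powr (\<mu> - 1) * ?p y))
        + (- (2 * Y)) * (Y powr (\<mu> - 1) * ?q y / 2 + (\<mu> + 1) * (Y powr \<mu> * ?p y)))) (at y)"
      unfolding \<Phi>_def[abs_def] Y_def
      by (intro has_vector_derivative_mult has_vector_derivative_add has_vector_derivative_divide
          has_vector_derivative_mult_right d1[unfolded Y_def] dp[unfolded Y_def] dq[unfolded Y_def] powr_real_deriv y0)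
    moreover have "((1 - Y\<^sup>2) * ((Y powr (\<mu> - 1) * (- ?r y / (2 * Y\<^sup>2)) + (\<mu> - 1) * Y powr (\<mu> - 1 - 1) * ?q y) / 2 + (\<mu> + 1) * (Y powr \<mu> * (- ?q y / (2 * Y\<^sup>2)) + \<mu> * Y powr (\<mu> - 1) * ?p y))
        + (- (2 * Y)) * (Y powr (\<mu> - 1) * ?q y / 2 + (\<mu> + 1) * (Y powr \<mu> * ?p y))) = \<Phi>' y"
    proof -
      have ode0: "((1 + 1/Y) / 2) * (1 - (1 + 1/Y) / 2) * ?r y + (1 - 2 * ((1 + 1/Y) / 2)) * ?q y + \<nu> * (\<nu> + 1) * ?p y = 0"
        unfolding Y_def by (rule legp_ode[OF half_one_plus_not_nonpos[OF y]])
      have alg: "4 * Y\<^sup>2 * (a * r + b * q + l * p) = (4 * Y\<^sup>2 * a) * r + (4 * Y\<^sup>2 * b) * q + 4 * Y\<^sup>2 * l * p" for a b l r q p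
        by (simp add: algebra_simps)
      from ode0 have "0 = 4 * Y\<^sup>2 * (((1 + 1/Y) / 2) * (1 - (1 + 1/Y) / 2) * ?r y + (1 - 2 * ((1 + 1/Y) / 2)) * ?q y + \<nu> * (\<nu> + 1) * ?p y)"
        by simp
      also have "\<dots> = (4 * Y\<^sup>2 * (((1 + 1/Y) / 2) * (1 - (1 + 1/Y) / 2))) * ?r y + (4 * Y\<^sup>2 * (1 - 2 * ((1 + 1/Y) / 2))) * ?q y + 4 * Y\<^sup>2 * (\<nu> * (\<nu> + 1)) * ?p y"
        by (rule alg)
      also have "4 * Y\<^sup>2 * (((1 + 1/Y) / 2) * (1 - (1 + 1/Y) / 2)) = Y\<^sup>2 - 1"
        using Y by (simp add: field_simps power2_eq_square)
      also have "4 * Y\<^sup>2 * (1 - 2 * ((1 + 1/Y) / 2)) = - 4 * Y"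
        using Y by (simp add: field_simps power2_eq_square)
      finally have ode: "(1 - Y\<^sup>2) * ?r y = 4 * Y\<^sup>2 * (\<nu> * (\<nu> + 1)) * ?p y - 4 * Y * ?q y"
        by (simp add: algebra_simps)
      have "((1 - Y\<^sup>2) * ((s * Y * (- ?r y / (2 * Y\<^sup>2)) + (\<mu> - 1) * s * ?q y) / 2 + (\<mu> + 1) * (s * Y\<^sup>2 * (- ?q y / (2 * Y\<^sup>2)) + \<mu> * (s * Y) * ?p y))
        + (- (2 * Y)) * (s * Y * ?q y / 2 + (\<mu> + 1) * (s * Y\<^sup>2 * ?p y)))
        = - (s / (4 * Y)) * ((1 - Y\<^sup>2) * ?r y) + (1 - Y\<^sup>2) * ((\<mu> - 1) * s * ?q y / 2 + (\<mu> + 1) * (- s * ?q y / 2 + \<mu> * (s * Y) * ?p y))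
        + (- (2 * Y)) * (s * Y * ?q y / 2 + (\<mu> + 1) * (s * Y\<^sup>2 * ?p y))"
        using Y by (simp add: field_simps power2_eq_square)
      also have "\<dots> = (\<mu> * (\<mu> + 1) - \<nu> * (\<nu> + 1)) * (s * Y * ?p y) - (\<mu> + 1) * (\<mu> + 2) * (s * Y^3 * ?p y)"
        unfolding ode using Y by (simp add: field_simps power2_eq_square power3_eq_cube)
      finally show ?thesis unfolding \<Phi>'_def Y_def[symmetric] s1 by (simp only: mult.assoc)
    qed
    ultimately show ?thesis by simp
  qed
  have bnd: "cmod (\<Phi> y) \<le> (C / 2 + cmod (\<mu> + 1) * C) * y powr (Re \<mu> - (Re \<nu> + \<delta>))" if y: "y \<in> {0<..1}" for y
  proof -
    note b = mellin_integrand_bounds[OF \<delta>(2) C y]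
    have 1: "cmod (of_real y powr (\<mu> - 1) * ?q y / 2) \<le> C / 2 * y powr (Re \<mu> - (Re \<nu> + \<delta>))"
      using b(2)[of "\<mu> - 1"] by (simp add: norm_divide)
    have 2: "cmod ((\<mu> + 1) * (of_real y powr \<mu> * ?p y)) \<le> cmod (\<mu> + 1) * (C * y powr (Re \<mu> - (Re \<nu> + \<delta>)))"
      unfolding norm_mult[of "\<mu> + 1"] by (intro mult_left_mono b) auto
    have y2: "0 \<le> 1 - y\<^sup>2" "1 - y\<^sup>2 \<le> 1" using y by (auto simp: power_le_one)
    have "1 - (complex_of_real y)\<^sup>2 = of_real (1 - y\<^sup>2)" by simp
    then have "cmod (1 - (complex_of_real y)\<^sup>2) \<le> 1" using y2 by (simp only: norm_of_real)
    then have "cmod (\<Phi> y) \<le> 1 * cmod (of_real y powr (\<mu> - 1) * ?q y / 2 + (\<mu> + 1) * (of_real y powr \<mu> * ?p y))"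
      unfolding \<Phi>_def norm_mult[of "1 - _"] by (intro mult_right_mono) auto
    also have "\<dots> \<le> C / 2 * y powr (Re \<mu> - (Re \<nu> + \<delta>)) + cmod (\<mu> + 1) * (C * y powr (Re \<mu> - (Re \<nu> + \<delta>)))"
      using norm_triangle_mono[OF 1 2] by simp
    finally show ?thesis by (simp add: algebra_simps)
  qed
  have "(\<Phi>' has_integral (\<Phi> 1 - \<Phi> 0)) {0..1}"
  proof (rule fundamental_theorem_of_calculus_interior)
    have "(\<Phi> \<longlongrightarrow> \<Phi> 0) (at 0 within {0..1})"
      using tendsto_0_of_powr_bound[OF bnd] \<delta>(2) by (simp add: \<Phi>_def[abs_def])
    then show "continuous_on {0..1} \<Phi>"
      by (intro continuous_on_unit_interval_extend) (auto intro: has_vector_derivative_continuous[OF d\<Phi>])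
    show "(\<Phi> has_vector_derivative \<Phi>' y) (at y)" if "y \<in> {0<..<1}" for y using d\<Phi> that by simp
  qed auto
  then have "(\<Phi>' has_integral 0) {0..1}" by (simp add: \<Phi>_def)
  moreover have "(\<Phi>' has_integral ((\<mu> * (\<mu> + 1) - \<nu> * (\<nu> + 1)) * legendre_mellin \<nu> \<mu> - (\<mu> + 1) * (\<mu> + 2) * legendre_mellin \<nu> (\<mu> + 2))) {0..1}"
  proof -
    have i1: "(\<lambda>y. of_real y powr (\<mu> - 1) * ?p y) integrable_on {0..1}"
      by (rule norm_integral_powr_bound(1)[where \<gamma> = "Re \<mu> - (Re \<nu> + \<delta>)" and C = C])
        (use \<delta> mellin_integrand_bounds(1)[OF \<delta>(2) C, of _ "\<mu> - 1"] in \<open>auto intro!: continuous_on_mellin_integrand simp: algebra_simps\<close>)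
    have i2: "(\<lambda>y. of_real y powr (\<mu> + 1) * ?p y) integrable_on {0..1}"
      by (rule norm_integral_powr_bound(1)[where \<gamma> = "Re \<mu> + 2 - (Re \<nu> + \<delta>)" and C = C])
        (use \<delta> mellin_integrand_bounds(1)[OF \<delta>(2) C, of _ "\<mu> + 1"] in \<open>auto intro!: continuous_on_mellin_integrand simp: algebra_simps\<close>)
    have e: "\<mu> + 2 - 1 = \<mu> + 1" by simp
    show ?thesis unfolding \<Phi>'_def[abs_def] legendre_mellin_def e
      by (intro has_integral_diff has_integral_mult_right integrable_integral i1 i2)
  qed
  ultimately have "(\<mu> * (\<mu> + 1) - \<nu> * (\<nu> + 1)) * legendre_mellin \<nu> \<mu> - (\<mu> + 1) * (\<mu> + 2) * legendre_mellin \<nu> (\<mu> + 2) = 0"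
    using has_integral_unique by blast
  then show ?thesis by (simp add: algebra_simps)
qed

text \<open>For large Re \<mu> the weight concentrates at \<open>y = 1\<close>, where the Legendre
  function is 1. One integration by parts isolates this value and leaves an integral of the
  derivative.\<close>

lemma mellin_asymptotics:
  "\<exists>C m. \<forall>\<mu>. Re \<mu> > m \<longrightarrow> cmod (\<mu> * legendre_mellin \<nu> \<mu> - 1) \<le> C / (Re \<mu> - m)"
proof -
  obtain C where C: "C \<ge> 0"
    "\<forall>y\<in>{0<..1}. cmod (legp \<nu> ((1 + 1 / of_real y) / 2)) \<le> C * y powr (- (Re \<nu> + 1))"
    "\<forall>y\<in>{0<..1}. cmod (deriv (legp \<nu>) ((1 + 1 / of_real y) / 2)) \<le> C * y powr (1 - (Re \<nu> + 1))"
    using mellin_bounds[of 1] by (metis zero_less_one)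
  let ?p = "\<lambda>y. legp \<nu> ((1 + 1 / complex_of_real y) / 2)"
  let ?q = "\<lambda>y. deriv (legp \<nu>) ((1 + 1 / complex_of_real y) / 2)"
  have "cmod (\<mu> * legendre_mellin \<nu> \<mu> - 1) \<le> (C / 2) / (Re \<mu> - (Re \<nu> + 1))" if \<mu>: "Re \<mu> > Re \<nu> + 1" for \<mu>
  proof -
    have \<mu>': "Re \<nu> + 1 < Re \<mu>" using \<mu> by simp
    note b = mellin_integrand_bounds[OF \<mu>' C]
    define \<Phi> where "\<Phi> y = of_real y powr \<mu> * ?p y" for y
    have "((\<lambda>y. \<mu> * (of_real y powr (\<mu> - 1) * ?p y) - of_real y powr (\<mu> - 2) * ?q y / 2) has_integral (\<Phi> 1 - \<Phi> 0)) {0..1}"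
    proof (rule fundamental_theorem_of_calculus_interior)
      have d\<Phi>: "(\<Phi> has_vector_derivative (\<mu> * (of_real y powr (\<mu> - 1) * ?p y) - of_real y powr (\<mu> - 2) * ?q y / 2)) (at y)" if y: "y \<in> {0<..1}" for y
      proof -
        have "(\<Phi> has_vector_derivative (of_real y powr \<mu> * (- ?q y / (2 * (of_real y)\<^sup>2)) + \<mu> * of_real y powr (\<mu> - 1) * ?p y)) (at y)"
          unfolding \<Phi>_def[abs_def] using y
          by (intro has_vector_derivative_mult legp_real_deriv[OF legp_has_deriv] powr_real_deriv) auto
        moreover have "complex_of_real y powr \<mu> = of_real y powr (\<mu> - 2) * (of_real y)\<^sup>2"
        proof -
          have "complex_of_real y powr (\<mu> - 2 + of_nat 2) = of_real y powr (\<mu> - 2) * (of_real y)\<^sup>2"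
            unfolding powr_add using y by (simp add: powr_nat)
          then show ?thesis by simp
        qed
        ultimately show ?thesis using y by (simp add: algebra_simps)
      qed
      have "(\<Phi> \<longlongrightarrow> \<Phi> 0) (at 0 within {0..1})"
        using tendsto_0_of_powr_bound[OF b(1)[of _ \<mu>]] \<mu> by (simp add: \<Phi>_def[abs_def])
      then show "continuous_on {0..1} \<Phi>"
        by (intro continuous_on_unit_interval_extend) (auto intro: has_vector_derivative_continuous[OF d\<Phi>])
      show "(\<Phi> has_vector_derivative (\<mu> * (of_real y powr (\<mu> - 1) * ?p y) - of_real y powr (\<mu> - 2) * ?q y / 2)) (at y)" if "y \<in> {0<..<1}" for y
        using d\<Phi> that by simp
    qed auto
    then have 1: "((\<lambda>y. \<mu> * (of_real y powr (\<mu> - 1) * ?p y) - of_real y powr (\<mu> - 2) * ?q y / 2) has_integral 1) {0..1}"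
      by (simp add: \<Phi>_def)
    have i1: "(\<lambda>y. of_real y powr (\<mu> - 1) * ?p y) integrable_on {0..1}"
      by (rule norm_integral_powr_bound(1)[where \<gamma> = "Re \<mu> - (Re \<nu> + 1)" and C = C])
        (use \<mu> b(1)[of _ "\<mu> - 1"] in \<open>auto intro!: continuous_on_mellin_integrand simp: algebra_simps\<close>)
    have qb: "cmod (of_real y powr (\<mu> - 2) * ?q y) \<le> C * y powr (Re \<mu> - (Re \<nu> + 1) - 1)" if "y \<in> {0<..1}" for y
      using b(2)[OF that, of "\<mu> - 2"] by (simp add: algebra_simps)
    have i2: "(\<lambda>y. of_real y powr (\<mu> - 2) * ?q y) integrable_on {0..1}"
      by (rule norm_integral_powr_bound(1)[OF continuous_on_mellin_integrand(2) _ qb]) (use \<mu> in auto)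
    have i3: "((\<lambda>y. of_real y powr (\<mu> - 2) * ?q y / 2) has_integral (integral {0..1} (\<lambda>y. of_real y powr (\<mu> - 2) * ?q y) / 2)) {0..1}"
      by (intro has_integral_divide integrable_integral i2)
    have "((\<lambda>y. \<mu> * (of_real y powr (\<mu> - 1) * ?p y) - of_real y powr (\<mu> - 2) * ?q y / 2) has_integral
      (\<mu> * legendre_mellin \<nu> \<mu> - integral {0..1} (\<lambda>y. of_real y powr (\<mu> - 2) * ?q y) / 2)) {0..1}"
      unfolding legendre_mellin_def by (intro has_integral_diff has_integral_mult_right integrable_integral i1 i3)
    with 1 have "\<mu> * legendre_mellin \<nu> \<mu> - integral {0..1} (\<lambda>y. of_real y powr (\<mu> - 2) * ?q y) / 2 = 1"
      using has_integral_unique by blast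
    then have "\<mu> * legendre_mellin \<nu> \<mu> - 1 = integral {0..1} (\<lambda>y. of_real y powr (\<mu> - 2) * ?q y) / 2"
      by (simp add: algebra_simps)
    moreover have "cmod (integral {0..1} (\<lambda>y. of_real y powr (\<mu> - 2) * ?q y)) \<le> C / (Re \<mu> - (Re \<nu> + 1))"
      by (rule norm_integral_powr_bound_1[OF continuous_on_mellin_integrand(2) _ qb]) (use \<mu> in auto)
    ultimately have "cmod (\<mu> * legendre_mellin \<nu> \<mu> - 1) \<le> C / (Re \<mu> - (Re \<nu> + 1)) / 2"
      by (simp only: norm_divide norm_numeral) (rule divide_right_mono, simp_all)
    also have "\<dots> = C / 2 / (Re \<mu> - (Re \<nu> + 1))" by simp
    finally show ?thesis .
  qed
  then show ?thesis by blast
qed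

text \<open>The recursion moves \<mu> by 2, so halving its factors gives Pochhammer symbols. The two
  on the right differ by \<open>1 / 2\<close> in their base, ready for the duplication
  formula.\<close>

lemma mellin_iterated:
  assumes \<mu>: "Re \<nu> < Re \<mu>"
  shows "pochhammer ((\<mu> - \<nu>) / 2) n * pochhammer ((\<nu> + \<mu> + 1) / 2) n * legendre_mellin \<nu> \<mu> =
    pochhammer ((\<mu> + 1) / 2) n * pochhammer ((\<mu> + 1) / 2 + 1 / 2) n * legendre_mellin \<nu> (\<mu> + 2 * of_nat n)"
proof (induction n)
  case (Suc n)
  let ?m = "\<mu> + 2 * of_nat n"
  have "Re \<nu> < Re ?m" using \<mu> by simp
  from mellin_recurrence[OF this]
  have r: "((\<mu> - \<nu>) / 2 + of_nat n) * ((\<nu> + \<mu> + 1) / 2 + of_nat n) * legendre_mellin \<nu> ?m =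
     ((\<mu> + 1) / 2 + of_nat n) * ((\<mu> + 1) / 2 + 1 / 2 + of_nat n) * legendre_mellin \<nu> (\<mu> + 2 * of_nat (Suc n))"
    by (simp add: field_simps)
  have "pochhammer ((\<mu> - \<nu>) / 2) (Suc n) * pochhammer ((\<nu> + \<mu> + 1) / 2) (Suc n) * legendre_mellin \<nu> \<mu> =
    ((\<mu> - \<nu>) / 2 + of_nat n) * ((\<nu> + \<mu> + 1) / 2 + of_nat n) * (pochhammer ((\<mu> - \<nu>) / 2) n * pochhammer ((\<nu> + \<mu> + 1) / 2) n * legendre_mellin \<nu> \<mu>)"
    unfolding pochhammer_Suc by (simp only: mult_ac)
  also have "\<dots> = pochhammer ((\<mu> + 1) / 2) n * pochhammer ((\<mu> + 1) / 2 + 1 / 2) n *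
     (((\<mu> - \<nu>) / 2 + of_nat n) * ((\<nu> + \<mu> + 1) / 2 + of_nat n) * legendre_mellin \<nu> ?m)"
    unfolding Suc by (simp only: mult_ac)
  also have "\<dots> = pochhammer ((\<mu> + 1) / 2) (Suc n) * pochhammer ((\<mu> + 1) / 2 + 1 / 2) (Suc n) * legendre_mellin \<nu> (\<mu> + 2 * of_nat (Suc n))"
    unfolding r pochhammer_Suc by (simp only: mult_ac)
  finally show ?case .
qed simp

text \<open>Divided by the right factorials and powers of \<open>n\<close>, the Pochhammer symbols
  of the iterated recursion become Gauss's products for \<open>1 / Gamma\<close>. The limit
  determines the transform, since its behaviour for large \<mu> is known; duplication then merges
  the two Gamma factors on the right.\<close>

theorem product_const_mellin:
  assumes \<mu>: "Re \<nu> < Re \<mu>"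
  shows "product_const \<nu> \<mu> * legendre_mellin \<nu> \<mu> = rGamma (1 + \<mu>)"
proof -
  define A D E where "A = (\<mu> + 1) / 2" "D = (\<nu> + \<mu> + 1) / 2" "E = (\<mu> - \<nu>) / 2"
  obtain C m where Cm: "\<And>\<mu>. Re \<mu> > m \<Longrightarrow> cmod (\<mu> * legendre_mellin \<nu> \<mu> - 1) \<le> C / (Re \<mu> - m)"
    using mellin_asymptotics by blast
  let ?G = "\<lambda>n. legendre_mellin \<nu> (\<mu> + 2 * of_nat (Suc n))"
  have lim1: "(\<lambda>n. (\<mu> + 2 * of_nat (Suc n)) * ?G n - 1) \<longlonglongrightarrow> 0"
  proof (rule Lim_null_comparison)
    show "(\<lambda>n. C / (Re \<mu> + 2 * real (Suc n) - m)) \<longlonglongrightarrow> 0" by real_asymp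
    have "\<forall>\<^sub>F n in sequentially. Re \<mu> + 2 * real (Suc n) > m" by real_asymp
    then show "\<forall>\<^sub>F n in sequentially. cmod ((\<mu> + 2 * of_nat (Suc n)) * ?G n - 1) \<le> C / (Re \<mu> + 2 * real (Suc n) - m)"
    proof eventually_elim
      case (elim n)
      then show ?case using Cm[of "\<mu> + 2 * of_nat (Suc n)"] by simp
    qed
  qed
  have lim2: "(\<lambda>n. of_nat n / (\<mu> + 2 * of_nat (Suc n))) \<longlonglongrightarrow> 1 / 2"
  proof -
    have "(\<lambda>n. 1 / ((\<mu> + 2) * (1 / of_nat n) + 2)) \<longlonglongrightarrow> 1 / ((\<mu> + 2) * 0 + 2)"
      by (intro tendsto_intros lim_1_over_n) auto
    moreover have "\<forall>\<^sub>F n in sequentially. 1 / ((\<mu> + 2) * (1 / of_nat n) + 2) = of_nat n / (\<mu> + 2 * of_nat (Suc n))"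
      using eventually_gt_at_top[of 0] by eventually_elim (simp add: divide_simps, simp add: algebra_simps)
    ultimately show ?thesis by (simp add: tendsto_cong)
  qed
  have lim3: "(\<lambda>n. of_nat n * ?G n) \<longlonglongrightarrow> 1 / 2"
  proof -
    have "(\<lambda>n. of_nat n / (\<mu> + 2 * of_nat (Suc n)) * (((\<mu> + 2 * of_nat (Suc n)) * ?G n - 1) + 1)) \<longlonglongrightarrow> 1 / 2 * (0 + 1)"
      by (intro tendsto_intros lim1 lim2)
    moreover have "\<forall>\<^sub>F n in sequentially. of_nat n / (\<mu> + 2 * of_nat (Suc n)) * (((\<mu> + 2 * of_nat (Suc n)) * ?G n - 1) + 1) = of_nat n * ?G n"
    proof -
      have "\<forall>\<^sub>F n in sequentially. Re \<mu> + 2 * real (Suc n) > 0" by real_asymp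
      then show ?thesis
      proof eventually_elim
        case (elim n)
        have "\<mu> + 2 * of_nat (Suc n) \<noteq> 0"
        proof
          assume "\<mu> + 2 * of_nat (Suc n) = 0"
          then have "Re (\<mu> + 2 * of_nat (Suc n)) = 0" by (simp only: zero_complex.sel)
          with elim show False by simp
        qed
        then show ?case by simp
      qed
    qed
    ultimately show ?thesis using tendsto_cong by force
  qed
  have ev: "\<forall>\<^sub>F n in sequentially. rGamma_series E n * rGamma_series D n * legendre_mellin \<nu> \<mu> =
     rGamma_series A n * rGamma_series (A + 1/2) n * (of_nat n * ?G n)"
    using eventually_gt_at_top[of 0]
  proof eventually_elim
    case (elim n)
    let ?l = "complex_of_real (ln (real n))"
    \<comment> \<open>The exponents satisfy \<open>A + (A + 1/2) = E + D + 1\<close>; the extra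
      factor \<open>n\<close> is what \<open>n * ?G n\<close>, with limit \<open>1 / 2\<close>,
      needs.\<close>
    have "exp (E * ?l) * exp (D * ?l) * exp ?l = exp (A * ?l) * exp ((A + 1/2) * ?l)"
      unfolding exp_add[symmetric] by (rule arg_cong[of _ _ exp]) (simp add: A_D_E_def field_simps)
    moreover have "exp ?l = of_nat n" using elim by (simp add: exp_of_real)
    ultimately have ex: "exp (A * ?l) * exp ((A + 1/2) * ?l) = exp (E * ?l) * exp (D * ?l) * of_nat n" by simp
    have p: "pochhammer E (Suc n) * pochhammer D (Suc n) * legendre_mellin \<nu> \<mu> = pochhammer A (Suc n) * pochhammer (A + 1/2) (Suc n) * ?G n"
      unfolding A_D_E_def by (rule mellin_iterated[OF \<mu>])
    have "rGamma_series E n * rGamma_series D n * legendre_mellin \<nu> \<mu> =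
      (pochhammer E (Suc n) * pochhammer D (Suc n) * legendre_mellin \<nu> \<mu>) / (fact n * fact n * (exp (E * ?l) * exp (D * ?l)))"
      by (simp add: rGamma_series_def)
    also have "\<dots> = pochhammer A (Suc n) * pochhammer (A + 1/2) (Suc n) * (of_nat n * ?G n) / (fact n * fact n * (exp (E * ?l) * exp (D * ?l) * of_nat n))"
      unfolding p using elim by (simp add: mult.assoc)
    also have "\<dots> = rGamma_series A n * rGamma_series (A + 1/2) n * (of_nat n * ?G n)"
      unfolding ex[symmetric] by (simp add: rGamma_series_def)
    finally show ?case .
  qed
  have l1: "(\<lambda>n. rGamma_series E n * rGamma_series D n * legendre_mellin \<nu> \<mu>) \<longlonglongrightarrow> rGamma E * rGamma D * legendre_mellin \<nu> \<mu>"
    by (intro tendsto_intros)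
  have l2: "(\<lambda>n. rGamma_series A n * rGamma_series (A + 1/2) n * (of_nat n * ?G n)) \<longlonglongrightarrow> rGamma A * rGamma (A + 1/2) * (1/2)"
    by (intro tendsto_intros lim3)
  have key: "rGamma E * rGamma D * legendre_mellin \<nu> \<mu> = rGamma A * rGamma (A + 1/2) * (1/2)"
    by (rule LIMSEQ_unique[OF Lim_transform_eventually[OF l1 ev] l2])
  have "Re A > 0" using \<mu> \<nu> by (simp add: A_D_E_def)
  then have An: "A \<notin> \<int>\<^sub>\<le>\<^sub>0" "A + 1/2 \<notin> \<int>\<^sub>\<le>\<^sub>0"
    by (auto elim!: nonpos_Ints_cases simp: complex_eq_iff)
  have "Gamma A * Gamma (A + 1/2) = exp ((1 - 2 * A) * of_real (ln 2)) * of_real (sqrt pi) * Gamma (2 * A)"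
    by (rule Gamma_legendre_duplication[OF An])
  also have "exp ((1 - 2 * A) * of_real (ln 2)) = 2 powr (- \<mu>)"
  proof -
    have "1 - 2 * A = - \<mu>" by (simp add: A_D_E_def field_simps)
    then show ?thesis by (simp add: powr_def Ln_of_real[of 2, simplified])
  qed
  also have "2 * A = 1 + \<mu>" by (simp add: A_D_E_def)
  finally have "inverse (Gamma A * Gamma (A + 1/2)) = inverse (2 powr (- \<mu>) * of_real (sqrt pi) * Gamma (1 + \<mu>))" by simp
  then have dup: "rGamma A * rGamma (A + 1/2) * (2 powr (- \<mu>) * of_real (sqrt pi)) = rGamma (1 + \<mu>)"
    by (simp add: rGamma_inverse_Gamma field_simps)
  have p2: "2 powr (1 - \<mu>) = 2 * 2 powr (- \<mu>)"
    using powr_add[of 2 1 "-\<mu>"] by simp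
  have "product_const \<nu> \<mu> * legendre_mellin \<nu> \<mu> =
      2 * 2 powr (- \<mu>) * of_real (sqrt pi) * (rGamma E * rGamma D * legendre_mellin \<nu> \<mu>)"
    by (simp only: product_const_def p2 A_D_E_def mult_ac)
  also have "\<dots> = rGamma A * rGamma (A + 1/2) * (2 powr (- \<mu>) * of_real (sqrt pi))"
    unfolding key by simp
  finally show ?thesis unfolding dup .
qed

end

text \<open>If \<open>legp\<close> decayed, its Mellin transform would stay bounded as \<mu> tends
  to \<nu> from the right. There \<open>product_const\<close> tends to 0, while its product with the
  transform tends to \<open>rGamma (1 + \<nu>)\<close>, which is not 0.\<close>

lemma legp_leading_coeff_nonzero:
  assumes \<nu>: "Re \<nu> > -1/2"
    and decay: "\<And>W \<beta>. \<beta> > 0 \<Longrightarrow> compact W \<Longrightarrow> W \<inter> \<real>\<^sub>\<le>\<^sub>0 = {} \<Longrightarrow>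
       \<exists>C. \<forall>x\<in>W. \<forall>t\<ge>1. cmod (legp \<nu> (of_real t * x)) \<le> C * t powr (\<beta> - Re \<nu> - 1)"
  shows False
proof -
  \<comment> \<open>With this choice the assumed decay is \<open>t powr (-1/2)\<close>, and the
    Mellin integrands are bounded by \<open>y powr (\<gamma> - 1)\<close> uniformly in
    \<open>n\<close>.\<close>
  define \<gamma> where "\<gamma> = (2 * Re \<nu> + 1) / 2"
  have \<gamma>: "\<gamma> > 0" using \<nu> by (simp add: \<gamma>_def)
  have \<nu>': "Re \<nu> \<ge> -1/2" using \<nu> by simp
  obtain C where C: "C \<ge> 0" "\<And>y. y \<in> {0<..1} \<Longrightarrow> cmod (legp \<nu> ((1 + 1 / of_real y) / 2)) \<le> C * y powr (- (\<gamma> - Re \<nu> - 1))"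
    using ray_bound_on_unit_interval[OF decay[OF \<gamma>]] by blast
  define \<mu> where "\<mu> n = \<nu> + of_real (1 / real (Suc n))" for n
  have \<mu>: "Re (\<mu> n) = Re \<nu> + 1 / real (Suc n)" for n by (simp add: \<mu>_def)
  have bd: "cmod (legendre_mellin \<nu> (\<mu> n)) \<le> C / \<gamma>" for n
    unfolding legendre_mellin_def
  proof (rule norm_integral_powr_bound_1[OF continuous_on_mellin_integrand(1)[OF \<nu>'] \<gamma>])
    fix y :: real assume y: "y \<in> {0<..1}"
    have "cmod (of_real y powr (\<mu> n - 1) * legp \<nu> ((1 + 1 / of_real y) / 2)) \<le> y powr (Re (\<mu> n) - 1) * (C * y powr (- (\<gamma> - Re \<nu> - 1)))"
      unfolding norm_mult using C(2)[OF y] y by (intro mult_mono) (auto simp: norm_powr_real_powr)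
    also have "\<dots> = C * (y powr (Re (\<mu> n) - 1) * y powr (- (\<gamma> - Re \<nu> - 1)))" by simp
    also have "y powr (Re (\<mu> n) - 1) * y powr (- (\<gamma> - Re \<nu> - 1)) = y powr (Re (\<mu> n) - 1 - (\<gamma> - Re \<nu> - 1))"
      by (simp add: powr_add[symmetric])
    also have "C * \<dots> \<le> C * y powr (\<gamma> - 1)"
      using y C(1) by (intro mult_left_mono powr_mono') (auto simp: \<mu> \<gamma>_def field_simps)
    finally show "cmod (of_real y powr (\<mu> n - 1) * legp \<nu> ((1 + 1 / of_real y) / 2)) \<le> C * y powr (\<gamma> - 1)" .
  qed
  have lim: "\<mu> \<longlonglongrightarrow> \<nu>"
  proof -
    have "(\<lambda>n. 1 / real (Suc n)) \<longlonglongrightarrow> 0" by real_asymp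
    then have "(\<lambda>n. \<nu> + of_real (1 / real (Suc n))) \<longlonglongrightarrow> \<nu> + of_real 0" by (intro tendsto_intros)
    then show ?thesis by (simp add: \<mu>_def[abs_def])
  qed
  have "isCont (product_const \<nu>) \<nu>"
    unfolding product_const_def[abs_def]
    by (intro continuous_intros continuous_at_imp_continuous_on) (auto intro!: continuous_intros)
  then have "(\<lambda>n. product_const \<nu> (\<mu> n)) \<longlonglongrightarrow> product_const \<nu> \<nu>"
    using lim isCont_tendsto_compose by blast
  then have c0: "(\<lambda>n. product_const \<nu> (\<mu> n)) \<longlonglongrightarrow> 0" by (simp add: product_const_def)
  have "(\<lambda>n. product_const \<nu> (\<mu> n) * legendre_mellin \<nu> (\<mu> n)) \<longlonglongrightarrow> 0"
  proof (rule Lim_null_comparison)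
    show "\<forall>\<^sub>F n in sequentially. cmod (product_const \<nu> (\<mu> n) * legendre_mellin \<nu> (\<mu> n)) \<le> cmod (product_const \<nu> (\<mu> n)) * (C / \<gamma>)"
      unfolding norm_mult by (intro always_eventually allI mult_left_mono bd) auto
    show "(\<lambda>n. cmod (product_const \<nu> (\<mu> n)) * (C / \<gamma>)) \<longlonglongrightarrow> 0"
      using tendsto_mult_right[OF tendsto_norm[OF c0], of "C / \<gamma>"] by simp
  qed
  moreover have "(\<lambda>n. rGamma (1 + \<mu> n)) \<longlonglongrightarrow> rGamma (1 + \<nu>)"
  proof -
    have "isCont (\<lambda>\<mu>. rGamma (1 + \<mu>)) \<nu>"
      by (intro continuous_intros continuous_at_imp_continuous_on)
    then show ?thesis using lim isCont_tendsto_compose by blast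
  qed
  moreover have "product_const \<nu> (\<mu> n) * legendre_mellin \<nu> (\<mu> n) = rGamma (1 + \<mu> n)" for n
    by (rule product_const_mellin[OF \<nu>']) (simp add: \<mu>)
  ultimately have "rGamma (1 + \<nu>) = 0" using LIMSEQ_unique by fastforce
  moreover have "1 + \<nu> \<notin> \<int>\<^sub>\<le>\<^sub>0"
    using \<nu> by (auto elim!: nonpos_Ints_cases simp: complex_eq_iff)
  ultimately show False by (simp add: rGamma_eq_zero_iff)
qed

section \<open>The integral near the cusp\<close>

definition hypF :: "complex \<Rightarrow> complex \<Rightarrow> complex \<Rightarrow> complex" where
  "hypF \<nu> \<mu> = hyp2F1_reg (-\<nu>) (\<nu> + 1) (1 + \<mu>)"

lemma hypF_holomorphic: "hypF \<nu> \<mu> holomorphic_on hyp_domain"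
  unfolding hypF_def by (rule hyp2F1_reg_holomorphic) simp

lemma hypF_0: "hypF \<nu> \<mu> 0 = rGamma (1 + \<mu>)"
  unfolding hypF_def by (rule hyp2F1_reg_0) simp

lemma hypF_ode:
  assumes "z \<in> hyp_domain"
  shows "z * (1 - z) * deriv (deriv (hypF \<nu> \<mu>)) z + (1 + \<mu> - 2 * z) * deriv (hypF \<nu> \<mu>) z + \<nu> * (\<nu> + 1) * hypF \<nu> \<mu> z = 0"
  using hyp2F1_reg_ode[of "-\<nu>" "\<nu> + 1" z "1 + \<mu>"] assms by (simp add: hyp_op_def hypF_def algebra_simps)

text \<open>
  With \<open>q\<^sub>i = e\<^sup>-\<^sup>2\<^sup>t\<^sup>i\<close> and \<open>y = e\<^sup>-\<^sup>u\<close>, \<open>kernel_arg q\<^sub>1 q\<^sub>2 y / y\<close> is the argument of the Legendre function at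
  \<open>(t\<^sub>1, t\<^sub>2, t\<^sub>1 + t\<^sub>2 + u)\<close>. It is regular at \<open>q\<^sub>1 = q\<^sub>2 = 0\<close>, that is, at \<open>t\<^sub>1 = t\<^sub>2 = \<infinity>\<close>.
\<close>
definition kernel_arg :: "complex \<Rightarrow> complex \<Rightarrow> complex \<Rightarrow> complex" where
  "kernel_arg q1 q2 y = ((1 + q1 * q2 * y\<^sup>2) + (q1 + q2) * y\<^sup>2 * (1 + q1 * q2) / (1 + q1 * q2 * y\<^sup>2)) / ((1 + q1) * (1 + q2))"

text \<open>Here \<open>q1 * q2 * y^2 = exp (-2 * s)\<close>, so the argument of \<open>hypF\<close>
  is \<open>1 / (1 + exp (2 * s))\<close>. The multivalued factor
  \<open>exp (- \<mu> * (t1 + t2))\<close> has been removed, which leaves an expression holomorphic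
  at \<open>q1 = 0\<close> and \<open>q2 = 0\<close>.\<close>

definition cusp_integrand :: "complex \<Rightarrow> complex \<Rightarrow> complex \<Rightarrow> complex \<Rightarrow> real \<Rightarrow> complex" where
  "cusp_integrand \<nu> \<mu> q1 q2 y = of_real y powr (\<mu> - 1) *
     (hypF \<nu> \<mu> (q1 * q2 * (of_real y)\<^sup>2 / (1 + q1 * q2 * (of_real y)\<^sup>2)) *
      legp \<nu> ((kernel_arg q1 q2 (of_real y) + of_real y) / (2 * of_real y)))"

definition cusp_integral :: "complex \<Rightarrow> complex \<Rightarrow> complex \<Rightarrow> complex \<Rightarrow> complex" where
  "cusp_integral \<nu> \<mu> q1 q2 = integral {0..1} (cusp_integrand \<nu> \<mu> q1 q2)"

lemma cusp_integral_commute: "cusp_integral \<nu> \<mu> q1 q2 = cusp_integral \<nu> \<mu> q2 q1"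
proof -
  have "cusp_integrand \<nu> \<mu> q1 q2 = cusp_integrand \<nu> \<mu> q2 q1"
    by (rule ext) (simp add: cusp_integrand_def kernel_arg_def mult.commute[of q1 q2] add.commute[of q1 q2] mult.commute[of "1 + q1"])
  then show ?thesis by (simp add: cusp_integral_def)
qed

lemma cusp_integral_0: "cusp_integral \<nu> \<mu> 0 0 = rGamma (1 + \<mu>) * legendre_mellin \<nu> \<mu>"
proof -
  have "cusp_integral \<nu> \<mu> 0 0 = integral {0..1} (\<lambda>y. rGamma (1 + \<mu>) * (of_real y powr (\<mu> - 1) * legp \<nu> ((1 + 1 / of_real y) / 2)))"
    unfolding cusp_integral_def
  proof (rule integral_cong)
    fix y :: real
    show "cusp_integrand \<nu> \<mu> 0 0 y = rGamma (1 + \<mu>) * (of_real y powr (\<mu> - 1) * legp \<nu> ((1 + 1 / of_real y) / 2))"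
    proof (cases "y = 0")
      case False
      then have eq: "(1 + complex_of_real y) / (2 * of_real y) = (1 + 1 / of_real y) / 2" by (simp add: field_simps)
      have "cusp_integrand \<nu> \<mu> 0 0 y = of_real y powr (\<mu> - 1) * (rGamma (1 + \<mu>) * legp \<nu> ((1 + of_real y) / (2 * of_real y)))"
        by (simp add: cusp_integrand_def kernel_arg_def hypF_0)
      then show ?thesis unfolding eq by (simp only: mult_ac)
    qed (simp add: cusp_integrand_def)
  qed
  then show ?thesis by (simp add: legendre_mellin_def)
qed

lemma small_prod:
  assumes "cmod q1 < 1/10" "cmod q2 < 1/10" "y \<in> {0..1}"
  shows "cmod (q1 * q2 * (of_real y)\<^sup>2) \<le> 1/100" "1 + q1 * q2 * (of_real y)\<^sup>2 \<noteq> 0" "1 + q1 \<noteq> 0"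
    "cmod (1 + q1 * q2 * (of_real y)\<^sup>2) \<ge> 99/100"
    "cmod (q1 * q2 * (of_real y)\<^sup>2 / (1 + q1 * q2 * (of_real y)\<^sup>2)) \<le> 1/50"
proof -
  have "cmod q1 * cmod q2 \<le> (1/10) * (1/10)" using assms by (intro mult_mono) auto
  moreover have "y\<^sup>2 \<le> 1" using assms by (simp add: power_le_one)
  ultimately have "(cmod q1 * cmod q2) * y\<^sup>2 \<le> (1/10 * (1/10)) * 1" by (rule mult_mono) auto
  then show 1: "cmod (q1 * q2 * (of_real y)\<^sup>2) \<le> 1/100" by (simp add: norm_mult norm_power)
  show 2: "cmod (1 + q1 * q2 * (of_real y)\<^sup>2) \<ge> 99/100"
    using 1 norm_diff_ineq[of 1 "q1 * q2 * (of_real y)\<^sup>2"] by simp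
  then show "1 + q1 * q2 * (of_real y)\<^sup>2 \<noteq> 0" by auto
  show "1 + q1 \<noteq> 0"
  proof
    assume "1 + q1 = 0"
    then have "q1 = -1" by (simp add: add_eq_0_iff)
    then show False using assms(1) by simp
  qed
  have "cmod (q1 * q2 * (of_real y)\<^sup>2) / cmod (1 + q1 * q2 * (of_real y)\<^sup>2) \<le> (1/100) / (99/100)"
    using 1 2 by (intro frac_le) auto
  then show "cmod (q1 * q2 * (of_real y)\<^sup>2 / (1 + q1 * q2 * (of_real y)\<^sup>2)) \<le> 1/50" by (simp add: norm_divide)
qed

text \<open>This is what the radius \<open>1/10\<close> is for: the real part stays above
  \<open>2/5\<close>, so the Legendre argument remains off the cut for every \<open>y\<close>, even
  for complex \<open>q1\<close> and \<open>q2\<close>.\<close>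

lemma kernel_arg_near_1:
  assumes q: "cmod q1 < 1/10" "cmod q2 < 1/10" and y: "y \<in> {0..1}"
  shows "cmod (kernel_arg q1 q2 (of_real y) - 1) \<le> 3/5"
proof -
  let ?y = "complex_of_real y"
  note s = small_prod[OF q y]
  have s1: "cmod (q1 * q2) \<le> 1/100" using small_prod(1)[OF q, of 1] by simp
  have y2: "y\<^sup>2 \<le> 1" using y by (simp add: power_le_one)
  have sum: "cmod (q1 + q2) \<le> 1/5" using norm_triangle_ineq[of q1 q2] q by linarith
  have "cmod (q1 + q2) * y\<^sup>2 \<le> 1/5 * 1" using sum y2 by (intro mult_mono) auto
  moreover have "cmod (1 + q1 * q2) \<le> 101/100" using norm_triangle_ineq[of 1 "q1 * q2"] s1 by simp
  ultimately have "(cmod (q1 + q2) * y\<^sup>2) * cmod (1 + q1 * q2) \<le> (1/5 * 1) * (101/100)" by (rule mult_mono) auto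
  then have "(cmod (q1 + q2) * y\<^sup>2) * cmod (1 + q1 * q2) / cmod (1 + q1 * q2 * ?y\<^sup>2) \<le> ((1/5 * 1) * (101/100)) / (99/100)"
    using s(4) by (intro frac_le) auto
  then have T: "cmod ((q1 + q2) * ?y\<^sup>2 * (1 + q1 * q2) / (1 + q1 * q2 * ?y\<^sup>2)) \<le> 21/100"
    by (simp add: norm_mult norm_divide norm_power)
  have den: "cmod ((1 + q1) * (1 + q2) - 1) \<le> 21/100"
  proof -
    have "(1 + q1) * (1 + q2) - 1 = (q1 + q2) + q1 * q2" by (simp add: algebra_simps)
    then show ?thesis using norm_triangle_ineq[of "q1 + q2" "q1 * q2"] sum s1 by simp
  qed
  have den': "cmod ((1 + q1) * (1 + q2)) \<ge> 79/100"
    using den norm_triangle_ineq2[of 1 "1 - (1 + q1) * (1 + q2)"] by (simp add: norm_minus_commute)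
  define N where "N = (1 + q1 * q2 * ?y\<^sup>2) + (q1 + q2) * ?y\<^sup>2 * (1 + q1 * q2) / (1 + q1 * q2 * ?y\<^sup>2)"
  have "cmod (N - 1) \<le> 1/100 + 21/100"
  proof -
    have "N - 1 = q1 * q2 * ?y\<^sup>2 + (q1 + q2) * ?y\<^sup>2 * (1 + q1 * q2) / (1 + q1 * q2 * ?y\<^sup>2)" by (simp add: N_def)
    then show ?thesis using norm_triangle_mono[OF s(1) T] by simp
  qed
  then have "cmod ((N - 1) - ((1 + q1) * (1 + q2) - 1)) \<le> 43/100"
    using norm_triangle_ineq4[of "N - 1" "(1 + q1) * (1 + q2) - 1"] den by linarith
  then have "cmod (N - (1 + q1) * (1 + q2)) / cmod ((1 + q1) * (1 + q2)) \<le> (43/100) / (79/100)"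
    using den' by (intro frac_le) auto
  moreover have "kernel_arg q1 q2 ?y - 1 = (N - (1 + q1) * (1 + q2)) / ((1 + q1) * (1 + q2))"
  proof -
    have "(1 + q1) * (1 + q2) \<noteq> 0" using den' by auto
    then show ?thesis unfolding kernel_arg_def N_def[symmetric] diff_divide_distrib by simp
  qed
  ultimately show ?thesis by (simp add: norm_divide)
qed

text \<open>A compact set off the cut on which the ray bounds are uniform: all Legendre arguments
  near the cusp are \<open>1 / y\<close> times its points.\<close>

definition cusp_wedge :: "complex set" where "cusp_wedge = {w. Re w \<ge> 1/5 \<and> cmod w \<le> 2}"

lemma compact_cusp_wedge: "compact cusp_wedge"
proof -
  have eq: "cusp_wedge = {w. Re w \<ge> 1/5} \<inter> cball 0 2" by (auto simp: cusp_wedge_def)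
  show ?thesis unfolding eq by (rule closed_Int_compact[OF closed_halfspace_Re_ge compact_cball])
qed

lemma cusp_wedge_slit: "cusp_wedge \<inter> \<real>\<^sub>\<le>\<^sub>0 = {}"
  by (auto simp: cusp_wedge_def complex_nonpos_Reals_iff)

lemma kernel_arg_wedge:
  assumes q: "cmod q1 < 1/10" "cmod q2 < 1/10" and y: "y \<in> {0..1}"
  shows "(kernel_arg q1 q2 (of_real y) + of_real y) / 2 \<in> cusp_wedge"
proof -
  let ?X = "kernel_arg q1 q2 (of_real y)"
  have b: "cmod (?X - 1) \<le> 3/5" by (rule kernel_arg_near_1[OF assms])
  have "Re ?X \<ge> 2/5" using abs_Re_le_cmod[of "?X - 1"] b by (auto simp: abs_le_iff)
  moreover have "cmod (?X + of_real y) \<le> 4"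
  proof -
    have "cmod ?X \<le> 8/5" using norm_triangle_sub[of ?X 1] b by simp
    then show ?thesis using norm_triangle_ineq[of ?X "of_real y"] y by simp
  qed
  ultimately show ?thesis using y by (simp add: cusp_wedge_def norm_divide)
qed

lemma cusp_legp_arg:
  assumes q: "cmod q1 < 1/10" "cmod q2 < 1/10" and y: "y \<in> {0<..1}"
  shows "(kernel_arg q1 q2 (of_real y) + of_real y) / (2 * of_real y) = of_real (1 / y) * ((kernel_arg q1 q2 (of_real y) + of_real y) / 2)"
    "(kernel_arg q1 q2 (of_real y) + of_real y) / (2 * of_real y) \<notin> \<real>\<^sub>\<le>\<^sub>0"
proof -
  show eq: "(kernel_arg q1 q2 (of_real y) + of_real y) / (2 * of_real y) = of_real (1 / y) * ((kernel_arg q1 q2 (of_real y) + of_real y) / 2)"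
    using y by (simp add: field_simps)
  have "(kernel_arg q1 q2 (of_real y) + of_real y) / 2 \<notin> \<real>\<^sub>\<le>\<^sub>0"
    using kernel_arg_wedge[OF q, of y] y cusp_wedge_slit by auto
  then show "(kernel_arg q1 q2 (of_real y) + of_real y) / (2 * of_real y) \<notin> \<real>\<^sub>\<le>\<^sub>0"
    unfolding eq using y by (intro of_real_mult_not_nonpos_Reals) auto
qed

lemma cusp_hyp_arg:
  assumes q: "cmod q1 < 1/10" "cmod q2 < 1/10" and y: "y \<in> {0..1}"
  shows "q1 * q2 * (of_real y)\<^sup>2 / (1 + q1 * q2 * (of_real y)\<^sup>2) \<in> hyp_domain"
proof -
  have "q1 * q2 * (of_real y)\<^sup>2 / (1 + q1 * q2 * (of_real y)\<^sup>2) \<in> ball 0 1"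
    using small_prod(5)[OF assms] by simp
  then show ?thesis using ball_subset_hyp_domain by blast
qed

lemma holomorphic_cusp_integrand:
  assumes q2: "cmod q2 < 1/10" and y: "y \<in> {0<..1}"
  shows "(\<lambda>q1. cusp_integrand \<nu> \<mu> q1 q2 y) holomorphic_on ball 0 (1/10)"
proof -
  have y': "y \<in> {0..1}" using y by simp
  have nz: "1 + q1 * q2 * (of_real y)\<^sup>2 \<noteq> 0" "1 + q1 \<noteq> 0" "1 + q2 \<noteq> 0" if "q1 \<in> ball 0 (1/10)" for q1
    using small_prod[of q1 q2 y] small_prod(3)[of q2 q2 y] that q2 y' by auto
  have "(hypF \<nu> \<mu> \<circ> (\<lambda>q1. q1 * q2 * (of_real y)\<^sup>2 / (1 + q1 * q2 * (of_real y)\<^sup>2))) holomorphic_on ball 0 (1/10)"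
    using nz cusp_hyp_arg[OF _ q2 y'] by (intro holomorphic_on_compose_gen[OF _ hypF_holomorphic] holomorphic_intros) auto
  moreover have "(legp \<nu> \<circ> (\<lambda>q1. (kernel_arg q1 q2 (of_real y) + of_real y) / (2 * of_real y))) holomorphic_on ball 0 (1/10)"
    unfolding kernel_arg_def using nz cusp_legp_arg(2)[OF _ q2 y, unfolded kernel_arg_def] y
    by (intro holomorphic_on_compose_gen[OF _ holomorphic_on_legp] holomorphic_intros) auto
  ultimately show ?thesis unfolding cusp_integrand_def o_def by (intro holomorphic_intros)
qed

lemma continuous_cusp_integrand:
  assumes q2: "cmod q2 < 1/10"
  shows "continuous_on (ball 0 (1/10) \<times> {0<..1}) (\<lambda>(q1, y). cusp_integrand \<nu> \<mu> q1 q2 y)"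
proof -
  have nz: "1 + q1 * q2 * (of_real y)\<^sup>2 \<noteq> 0" "1 + q1 \<noteq> 0" "1 + q2 \<noteq> 0" if "q1 \<in> ball 0 (1/10)" "y \<in> {0<..1}" for q1 and y :: real
    using small_prod[of q1 q2 y] small_prod(3)[of q2 q2 y] that q2 by auto
  let ?S = "ball (0::complex) (1/10) \<times> {0<..1::real}"
  have 1: "continuous_on ?S (\<lambda>p. hypF \<nu> \<mu> (fst p * q2 * (of_real (snd p))\<^sup>2 / (1 + fst p * q2 * (of_real (snd p))\<^sup>2)))"
    by (rule continuous_on_compose2[OF holomorphic_on_imp_continuous_on[OF hypF_holomorphic]])
      (use nz cusp_hyp_arg[OF _ q2] in \<open>auto intro!: continuous_intros\<close>)
  have 2: "continuous_on ?S (\<lambda>p. legp \<nu> ((kernel_arg (fst p) q2 (of_real (snd p)) + of_real (snd p)) / (2 * of_real (snd p))))"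
    by (rule continuous_on_compose2[OF holomorphic_on_imp_continuous_on[OF holomorphic_on_legp]])
      (use nz cusp_legp_arg(2)[OF _ q2] in \<open>auto intro!: continuous_intros simp: kernel_arg_def\<close>)
  have "continuous_on ?S (\<lambda>p. of_real (snd p) powr (\<mu> - 1))"
  proof (rule continuous_on_compose2[of "- \<real>\<^sub>\<le>\<^sub>0" "\<lambda>z. z powr (\<mu> - 1)"])
    show "continuous_on (- \<real>\<^sub>\<le>\<^sub>0) (\<lambda>z. z powr (\<mu> - 1))"
      by (intro holomorphic_on_imp_continuous_on holomorphic_intros) auto
  qed (auto intro!: continuous_intros)
  from continuous_on_mult[OF this continuous_on_mult[OF 1 2]] show ?thesis
    unfolding cusp_integrand_def by (simp add: split_beta)
qed

lemma norm_hypF_bound: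
  obtains C where "C \<ge> 0" "\<And>z. cmod z \<le> 1/2 \<Longrightarrow> cmod (hypF \<nu> \<mu> z) \<le> C"
proof -
  have "cball 0 (1/2) \<subseteq> hyp_domain" using ball_subset_hyp_domain by (auto simp: subset_iff)
  then have "continuous_on (cball 0 (1/2)) (hypF \<nu> \<mu>)"
    by (intro holomorphic_on_imp_continuous_on holomorphic_on_subset[OF hypF_holomorphic])
  then have "compact (hypF \<nu> \<mu> ` cball 0 (1/2))" by (rule compact_continuous_image) simp
  then obtain C where C: "\<And>z. z \<in> cball 0 (1/2) \<Longrightarrow> cmod (hypF \<nu> \<mu> z) \<le> C"
    by (meson bounded_iff compact_imp_bounded imageI)
  have "C \<ge> 0" using order_trans[OF norm_ge_zero C[of 0]] by simp
  then show thesis using that C by simp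
qed

section \<open>Bounds uniform up to the cusp\<close>

context
  fixes \<nu> \<mu> :: complex
  assumes \<nu>: "Re \<nu> \<ge> -1/2" and \<mu>: "Re \<nu> < Re \<mu>"
begin

text \<open>The midpoint of Re \<nu> and Re \<mu>, and half their distance: the Legendre function
  grows at most like \<open>t powr growth_exp\<close>, and against the weight of order \<mu> this
  leaves the integrable majorant \<open>y powr (decay_exp - 1)\<close>.\<close>

definition "growth_exp = (Re \<nu> + Re \<mu>) / 2"
definition "decay_exp = (Re \<mu> - Re \<nu>) / 2"

lemma growth_decay: "decay_exp > 0" "Re \<mu> - growth_exp = decay_exp" "growth_exp = Re \<nu> + decay_exp"
  using \<mu> by (auto simp: growth_exp_def decay_exp_def field_simps)

lemma cusp_integrand_bound:
  "\<exists>C. \<forall>q1 q2 y. cmod q1 < 1/10 \<longrightarrow> cmod q2 < 1/10 \<longrightarrow> y \<in> {0<..1} \<longrightarrow>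
       cmod (cusp_integrand \<nu> \<mu> q1 q2 y) \<le> C * y powr (decay_exp - 1)"
proof -
  obtain C1 where C1: "C1 \<ge> 0" "\<And>z. cmod z \<le> 1/2 \<Longrightarrow> cmod (hypF \<nu> \<mu> z) \<le> C1"
    using norm_hypF_bound[of \<nu> \<mu>] by blast
  obtain C2 where C2: "\<And>w t. w \<in> cusp_wedge \<Longrightarrow> t \<ge> 1 \<Longrightarrow> cmod (legp \<nu> (of_real t * w)) \<le> C2 * t powr growth_exp"
    using legp_growth[OF \<nu> growth_decay(1) compact_cusp_wedge cusp_wedge_slit] growth_decay(3) by metis
  have "cmod (cusp_integrand \<nu> \<mu> q1 q2 y) \<le> C1 * \<bar>C2\<bar> * y powr (decay_exp - 1)"
    if q: "cmod q1 < 1/10" "cmod q2 < 1/10" and y: "y \<in> {0<..1}" for q1 q2 y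
  proof -
    have y': "y \<in> {0..1}" using y by simp
    have "cmod (legp \<nu> ((kernel_arg q1 q2 (of_real y) + of_real y) / (2 * of_real y))) \<le> C2 * (1 / y) powr growth_exp"
      unfolding cusp_legp_arg(1)[OF q y] using kernel_arg_wedge[OF q y'] y by (intro C2) auto
    also have "\<dots> \<le> \<bar>C2\<bar> * (1 / y) powr growth_exp" by (intro mult_right_mono) auto
    also have "(1 / y) powr growth_exp = y powr (- growth_exp)" using y by (simp add: powr_minus_divide powr_divide)
    finally have 2: "cmod (legp \<nu> ((kernel_arg q1 q2 (of_real y) + of_real y) / (2 * of_real y))) \<le> \<bar>C2\<bar> * y powr (- growth_exp)" .
    have 1: "cmod (hypF \<nu> \<mu> (q1 * q2 * (of_real y)\<^sup>2 / (1 + q1 * q2 * (of_real y)\<^sup>2))) \<le> C1"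
      using small_prod(5)[OF q y'] by (intro C1) simp
    have "cmod (cusp_integrand \<nu> \<mu> q1 q2 y) \<le> y powr (Re \<mu> - 1) * (C1 * (\<bar>C2\<bar> * y powr (- growth_exp)))"
      unfolding cusp_integrand_def norm_mult using y 1 2 C1(1) by (intro mult_mono) (auto simp: norm_powr_real_powr)
    also have "\<dots> = C1 * \<bar>C2\<bar> * (y powr (Re \<mu> - 1) * y powr (- growth_exp))" by simp
    also have "y powr (Re \<mu> - 1) * y powr (- growth_exp) = y powr (decay_exp - 1)"
      unfolding growth_decay(2)[symmetric] by (simp add: powr_add[symmetric] algebra_simps)
    finally show ?thesis .
  qed
  then show ?thesis by blast
qed

lemma holomorphic_cusp_integral:
  assumes q2: "cmod q2 < 1/10"
  shows "(\<lambda>q1. cusp_integral \<nu> \<mu> q1 q2) holomorphic_on ball 0 (1/10)"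
  unfolding cusp_integral_def
proof (rule holomorphic_on_improper_integral[OF _ continuous_cusp_integrand[OF q2] holomorphic_cusp_integrand[OF q2] growth_decay(1)])
  fix K :: "complex set" assume "compact K" "K \<subseteq> ball 0 (1/10)"
  show "\<exists>C. \<forall>x\<in>K. \<forall>y\<in>{0<..1}. cmod (cusp_integrand \<nu> \<mu> x q2 y) \<le> C * y powr (decay_exp - 1)"
  proof -
    obtain C where "\<forall>q1 q2 y. cmod q1 < 1/10 \<longrightarrow> cmod q2 < 1/10 \<longrightarrow> y \<in> {0<..1} \<longrightarrow>
       cmod (cusp_integrand \<nu> \<mu> q1 q2 y) \<le> C * y powr (decay_exp - 1)"
      using cusp_integrand_bound by blast
    then show ?thesis using q2 \<open>K \<subseteq> _\<close> by (intro exI[of _ C] ballI) auto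
  qed
qed auto

text \<open>Uniformity on the whole disc makes the derivatives of the truncated integrals converge
  as well.\<close>

lemma cusp_integral_truncated_limit:
  assumes q2: "cmod q2 < 1/10"
  shows "uniform_limit (ball 0 (1/10)) (\<lambda>n q1. integral {1 / real (Suc n)..1} (cusp_integrand \<nu> \<mu> q1 q2)) (\<lambda>q1. cusp_integral \<nu> \<mu> q1 q2) sequentially"
proof -
  obtain C where C: "\<And>q1 q2 y. cmod q1 < 1/10 \<Longrightarrow> cmod q2 < 1/10 \<Longrightarrow> y \<in> {0<..1} \<Longrightarrow>
       cmod (cusp_integrand \<nu> \<mu> q1 q2 y) \<le> C * y powr (decay_exp - 1)"
    using cusp_integrand_bound by blast
  show ?thesis unfolding cusp_integral_def
  proof (rule uniform_limit_integral_powr_bound[OF _ growth_decay(1)])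
    fix q1 :: complex assume q1: "q1 \<in> ball 0 (1/10)"
    have "continuous_on {0<..1} (\<lambda>y. (\<lambda>(q1, y). cusp_integrand \<nu> \<mu> q1 q2 y) (q1, y))"
      by (rule continuous_on_compose2[OF continuous_cusp_integrand[OF q2]]) (use q1 in \<open>auto intro!: continuous_intros\<close>)
    then show "continuous_on {0<..1} (cusp_integrand \<nu> \<mu> q1 q2)" by simp
    show "cmod (cusp_integrand \<nu> \<mu> q1 q2 y) \<le> C * y powr (decay_exp - 1)" if "y \<in> {0<..1}" for y
      using C q1 q2 that by simp
  qed
qed

end

section \<open>Differential equations of the factors and of the kernel\<close>

text \<open>Since \<open>1 - 1 / (1 + exp (2 * t)) = 1 / (1 + exp (-2 * t))\<close>, these are the
  \<open>t\<close> whose hypergeometric argument avoids the cut.\<close>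

definition phi_dom :: "complex set" where "phi_dom = {t. 1 + exp (-2 * t) \<notin> \<real>\<^sub>\<le>\<^sub>0}"

lemma open_phi_dom: "open phi_dom"
proof -
  have eq: "phi_dom = (\<lambda>t. 1 + exp (-2 * t)) -` (- \<real>\<^sub>\<le>\<^sub>0)" by (auto simp: phi_dom_def)
  show ?thesis unfolding eq by (intro open_vimage open_slit continuous_intros)
qed

lemma Re_pos_phi_dom: "Re t > 0 \<Longrightarrow> t \<in> phi_dom"
proof -
  assume "Re t > 0"
  then have "cmod (exp (-2 * t)) < 1" by simp
  then have "Re (1 + exp (-2 * t)) > 0" using abs_Re_le_cmod[of "exp (-2 * t)"]
    unfolding plus_complex.sel one_complex.sel by linarith
  then show "t \<in> phi_dom" by (auto simp: phi_dom_def complex_nonpos_Reals_iff)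
qed

lemma phi_dom_strip:
  assumes "\<bar>Im t\<bar> < pi / 2"
  shows "t \<in> phi_dom"
proof -
  have "cos (Im t) > 0" using assms by (intro cos_gt_zero_pi) auto
  have "1 + exp (-2 * t) \<notin> \<real>\<^sub>\<le>\<^sub>0"
  proof
    assume a: "1 + exp (-2 * t) \<in> \<real>\<^sub>\<le>\<^sub>0"
    then have 1: "1 + exp (-2 * Re t) * cos (2 * Im t) \<le> 0" and 2: "exp (-2 * Re t) * sin (2 * Im t) = 0"
      by (auto simp: complex_nonpos_Reals_iff Re_exp Im_exp)
    have "sin (2 * Im t) = 0" using 2 by simp
    then have "sin (Im t) = 0" using \<open>cos (Im t) > 0\<close> by (simp add: sin_double)
    then have "cos (2 * Im t) = 1" by (simp add: cos_double_sin)
    then have "1 + exp (-2 * Re t) \<le> 0" using 1 by (simp only: mult_1_right)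
    then show False using exp_gt_zero[of "-2 * Re t"] by linarith
  qed
  then show ?thesis by (simp add: phi_dom_def)
qed

lemma phi_dom_arg:
  assumes "t \<in> phi_dom"
  shows "1 + exp (2 * t) \<noteq> 0" "1 / (1 + exp (2 * t)) \<in> hyp_domain" "cosh t \<noteq> 0"
    "4 * (1 / (1 + exp (2 * t))) * (1 - 1 / (1 + exp (2 * t))) = (1 / cosh t)\<^sup>2"
proof -
  define e where "e = exp t"
  have e: "e \<noteq> 0" "exp (2 * t) = e\<^sup>2" "exp (-2 * t) = 1 / e\<^sup>2" "exp (- t) = 1 / e"
    by (simp_all add: e_def exp_double exp_minus divide_inverse power_inverse)
  have slit: "1 + 1 / e\<^sup>2 \<notin> \<real>\<^sub>\<le>\<^sub>0" using assms unfolding phi_dom_def mem_Collect_eq e .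
  then have "1 + 1 / e\<^sup>2 \<noteq> 0" by auto
  then have n: "1 + e\<^sup>2 \<noteq> 0" using e by (simp add: field_simps)
  then show "1 + exp (2 * t) \<noteq> 0" by (simp add: e)
  have "1 - 1 / (1 + e\<^sup>2) = 1 / (1 + 1 / e\<^sup>2)" using n e by (simp add: field_simps)
  moreover have "1 / (1 + 1 / e\<^sup>2) \<notin> \<real>\<^sub>\<le>\<^sub>0"
    using slit nonpos_Reals_inverse_iff[of "1 + 1 / e\<^sup>2"] by (simp add: divide_inverse)
  ultimately show "1 / (1 + exp (2 * t)) \<in> hyp_domain" by (simp add: mem_hyp_domain_iff e)
  have c: "cosh t = (1 + e\<^sup>2) / (2 * e)"
    using e by (simp add: cosh_field_def e_def[symmetric] field_simps power2_eq_square)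
  show "cosh t \<noteq> 0" using n e by (simp add: c)
  show "4 * (1 / (1 + exp (2 * t))) * (1 - 1 / (1 + exp (2 * t))) = (1 / cosh t)\<^sup>2"
    unfolding c e(2) using n e(1) by (simp add: field_simps power2_eq_square)
qed

definition phi :: "complex \<Rightarrow> complex \<Rightarrow> complex \<Rightarrow> complex" where
  "phi \<nu> \<mu> t = exp (- \<mu> * t) * hypF \<nu> \<mu> (1 / (1 + exp (2 * t)))"

lemma hypF_derivs:
  assumes "z \<in> hyp_domain"
  shows "(hypF \<nu> \<mu> has_field_derivative deriv (hypF \<nu> \<mu>) z) (at z)"
    "(deriv (hypF \<nu> \<mu>) has_field_derivative deriv (deriv (hypF \<nu> \<mu>)) z) (at z)"
  using holomorphic_derivI[OF hypF_holomorphic open_hyp_domain assms]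
    holomorphic_derivI[OF holomorphic_deriv[OF hypF_holomorphic open_hyp_domain] open_hyp_domain assms] by blast+

text \<open>The variable \<open>z = 1 / (1 + exp (2 * t))\<close> is logistic, with derivative
  \<open>-2 * z * (1 - z)\<close>, and \<open>4 * z * (1 - z)\<close> is the square of the
  hyperbolic secant. The hypergeometric equation thus becomes a Schroedinger equation without first
  order term.\<close>

lemma phi_has_deriv_aux:
  fixes \<nu> \<mu> :: complex
  defines "phi1 \<equiv> \<lambda>t. exp (- \<mu> * t) * (- \<mu> * hypF \<nu> \<mu> (1 / (1 + exp (2 * t))) -
      2 * ((1 / (1 + exp (2 * t))) * (1 - 1 / (1 + exp (2 * t))) * deriv (hypF \<nu> \<mu>) (1 / (1 + exp (2 * t)))))"
  assumes t: "t \<in> phi_dom"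
  shows "(phi \<nu> \<mu> has_field_derivative phi1 t) (at t)"
    "(phi1 has_field_derivative (\<mu>\<^sup>2 - \<nu> * (\<nu> + 1) * (1 / cosh t)\<^sup>2) * phi \<nu> \<mu> t) (at t)"
proof -
  define z where "z = (\<lambda>t::complex. 1 / (1 + exp (2 * t)))"
  have zt: "z t \<in> hyp_domain" using phi_dom_arg[OF t] by (simp add: z_def)
  have dz: "(z has_field_derivative - 2 * (z t * (1 - z t))) (at t)"
    unfolding z_def using phi_dom_arg(1)[OF t]
    by (auto intro!: derivative_eq_intros simp: field_simps power2_eq_square)
  let ?f = "hypF \<nu> \<mu>" let ?f1 = "deriv (hypF \<nu> \<mu>)" let ?f2 = "deriv (deriv (hypF \<nu> \<mu>))"
  have f: "((\<lambda>t. ?f (z t)) has_field_derivative ?f1 (z t) * (- 2 * (z t * (1 - z t)))) (at t)"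
    by (rule DERIV_chain2[OF hypF_derivs(1)[OF zt] dz])
  have f1: "((\<lambda>t. ?f1 (z t)) has_field_derivative ?f2 (z t) * (- 2 * (z t * (1 - z t)))) (at t)"
    by (rule DERIV_chain2[OF hypF_derivs(2)[OF zt] dz])
  have ex: "((\<lambda>t. exp (- \<mu> * t)) has_field_derivative - \<mu> * exp (- \<mu> * t)) (at t)"
    by (auto intro!: derivative_eq_intros)
  show "(phi \<nu> \<mu> has_field_derivative phi1 t) (at t)"
    unfolding phi_def[abs_def] phi1_def z_def[THEN fun_cong, symmetric]
    by (rule DERIV_cong[OF DERIV_mult[OF ex f]]) (simp add: algebra_simps)
  have zz: "((\<lambda>t. z t * (1 - z t)) has_field_derivative - 2 * (z t * (1 - z t)) * (1 - 2 * z t)) (at t)"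
    by (rule DERIV_cong[OF DERIV_mult[OF dz DERIV_diff[OF DERIV_const dz]]]) (simp add: algebra_simps)
  have ode: "z t * (1 - z t) * ?f2 (z t) + (1 + \<mu> - 2 * z t) * ?f1 (z t) + \<nu> * (\<nu> + 1) * ?f (z t) = 0"
    by (rule hypF_ode[OF zt])
  have sech: "(1 / cosh t)\<^sup>2 = 4 * z t * (1 - z t)" using phi_dom_arg(4)[OF t] by (simp add: z_def)
  have "(phi1 has_field_derivative
     (- \<mu> * exp (- \<mu> * t)) * (- \<mu> * ?f (z t) - 2 * (z t * (1 - z t) * ?f1 (z t))) +
     (- \<mu> * (?f1 (z t) * (- 2 * (z t * (1 - z t)))) - 2 * ((- 2 * (z t * (1 - z t)) * (1 - 2 * z t)) * ?f1 (z t) + (?f2 (z t) * (- 2 * (z t * (1 - z t)))) * (z t * (1 - z t)))) * exp (- \<mu> * t)) (at t)"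
    unfolding phi1_def z_def[THEN fun_cong, symmetric]
    by (intro DERIV_mult[OF ex] DERIV_diff DERIV_cmult f DERIV_mult[OF zz f1])
  moreover have "(- \<mu> * exp (- \<mu> * t)) * (- \<mu> * ?f (z t) - 2 * (z t * (1 - z t) * ?f1 (z t))) +
     (- \<mu> * (?f1 (z t) * (- 2 * (z t * (1 - z t)))) - 2 * ((- 2 * (z t * (1 - z t)) * (1 - 2 * z t)) * ?f1 (z t) + (?f2 (z t) * (- 2 * (z t * (1 - z t)))) * (z t * (1 - z t)))) * exp (- \<mu> * t)
     = (\<mu>\<^sup>2 - \<nu> * (\<nu> + 1) * (1 / cosh t)\<^sup>2) * phi \<nu> \<mu> t"
    unfolding sech phi_def z_def[THEN fun_cong, symmetric] using ode by algebra
  ultimately show "(phi1 has_field_derivative (\<mu>\<^sup>2 - \<nu> * (\<nu> + 1) * (1 / cosh t)\<^sup>2) * phi \<nu> \<mu> t) (at t)"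
    by simp
qed

lemma phi_deriv: "t \<in> phi_dom \<Longrightarrow> (phi \<nu> \<mu> has_field_derivative deriv (phi \<nu> \<mu>) t) (at t)"
  using phi_has_deriv_aux(1)[of t \<nu> \<mu>] DERIV_imp_deriv by fastforce

lemma phi_holomorphic: "phi \<nu> \<mu> holomorphic_on phi_dom"
  using phi_deriv open_phi_dom by (auto simp: holomorphic_on_open)

lemma phi_deriv2:
  assumes t: "t \<in> phi_dom"
  shows "(deriv (phi \<nu> \<mu>) has_field_derivative (\<mu>\<^sup>2 - \<nu> * (\<nu> + 1) * (1 / cosh t)\<^sup>2) * phi \<nu> \<mu> t) (at t)"
proof (rule has_field_derivative_transform_within_open[OF phi_has_deriv_aux(2)[OF t] open_phi_dom t])
  fix u assume "u \<in> phi_dom"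
  from DERIV_imp_deriv[OF phi_has_deriv_aux(1)[OF this]] show
    "exp (- \<mu> * u) * (- \<mu> * hypF \<nu> \<mu> (1 / (1 + exp (2 * u))) -
      2 * ((1 / (1 + exp (2 * u))) * (1 - 1 / (1 + exp (2 * u))) * deriv (hypF \<nu> \<mu>) (1 / (1 + exp (2 * u))))) = deriv (phi \<nu> \<mu>) u" by simp
qed

definition csech :: "complex \<Rightarrow> complex" where "csech t = 1 / cosh t"

lemma DERIV_csech: "cosh t \<noteq> 0 \<Longrightarrow> (csech has_field_derivative - (sinh t * (csech t)\<^sup>2)) (at t)"
  unfolding csech_def[abs_def] by (auto intro!: derivative_eq_intros simp: power2_eq_square)

lemma DERIV_csech_chain [derivative_intros]:
  "(g has_field_derivative g') (at x) \<Longrightarrow> cosh (g x) \<noteq> 0 \<Longrightarrow>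
   ((\<lambda>x. csech (g x)) has_field_derivative - (sinh (g x) * (csech (g x))\<^sup>2) * g') (at x)"
  by (rule DERIV_chain2[OF DERIV_csech])

text \<open>
  All derivatives of \<open>Z = (cosh\<^sup>2 t + cosh\<^sup>2 t\<^sub>2 + cosh\<^sup>2 s - 1) / (2 cosh t cosh t\<^sub>2 cosh s)\<close> are kept polynomial in
  \<open>cosh\<close>, \<open>sinh\<close> and \<open>1 / cosh\<close>, so that the identities between them are ideal membership problems.
\<close>
definition kerZ :: "complex \<Rightarrow> complex \<Rightarrow> complex \<Rightarrow> complex" where
  "kerZ t2 t s = (cosh t * csech t2 * csech s + cosh t2 * csech t * csech s + cosh s * csech t * csech t2 - csech t * csech t2 * csech s) / 2"

definition kerZ1 :: "complex \<Rightarrow> complex \<Rightarrow> complex \<Rightarrow> complex" where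
  "kerZ1 t2 t s = (sinh t * csech t2 * csech s - sinh t * (csech t)\<^sup>2 * (cosh t2 * csech s + cosh s * csech t2 - csech t2 * csech s)) / 2"

definition kerZ3 :: "complex \<Rightarrow> complex \<Rightarrow> complex \<Rightarrow> complex" where
  "kerZ3 t2 t s = (sinh s * csech t2 * csech t - sinh s * (csech s)\<^sup>2 * (cosh t2 * csech t + cosh t * csech t2 - csech t2 * csech t)) / 2"

definition kerZ11 :: "complex \<Rightarrow> complex \<Rightarrow> complex \<Rightarrow> complex" where
  "kerZ11 t2 t s = (cosh t * csech t2 * csech s - (cosh t * (csech t)\<^sup>2 - 2 * (sinh t)\<^sup>2 * (csech t) ^ 3) * (cosh t2 * csech s + cosh s * csech t2 - csech t2 * csech s)) / 2"

definition kerZ33 :: "complex \<Rightarrow> complex \<Rightarrow> complex \<Rightarrow> complex" where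
  "kerZ33 t2 t s = (cosh s * csech t2 * csech t - (cosh s * (csech s)\<^sup>2 - 2 * (sinh s)\<^sup>2 * (csech s) ^ 3) * (cosh t2 * csech t + cosh t * csech t2 - csech t2 * csech t)) / 2"

definition kerZ13 :: "complex \<Rightarrow> complex \<Rightarrow> complex \<Rightarrow> complex" where
  "kerZ13 t2 t s = (- sinh t * csech t2 * sinh s * (csech s)\<^sup>2 - sinh t * (csech t)\<^sup>2 * (- cosh t2 * sinh s * (csech s)\<^sup>2 + sinh s * csech t2 + csech t2 * sinh s * (csech s)\<^sup>2)) / 2"

text \<open>The derivative of \<open>Z\<close> when \<open>s\<close> moves along with
  \<open>t\<close>. It enters because the variable \<open>y\<close> measures \<open>s\<close> from
  the moving lower limit.\<close>

definition kerV :: "complex \<Rightarrow> complex \<Rightarrow> complex \<Rightarrow> complex" where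
  "kerV t2 t s = kerZ1 t2 t s + kerZ3 t2 t s"

lemma kerZ_derivs:
  assumes "cosh t \<noteq> 0" "cosh s \<noteq> 0"
  shows "((\<lambda>s. kerZ t2 t s) has_field_derivative kerZ3 t2 t s) (at s)"
    "((\<lambda>s. kerV t2 t s) has_field_derivative kerZ13 t2 t s + kerZ33 t2 t s) (at s)"
    "s = t + k \<Longrightarrow> ((\<lambda>t. kerZ t2 t (t + k)) has_field_derivative kerV t2 t s) (at t)"
    "s = t + k \<Longrightarrow> ((\<lambda>t. kerV t2 t (t + k)) has_field_derivative kerZ11 t2 t s + 2 * kerZ13 t2 t s + kerZ33 t2 t s) (at t)"
  using assms unfolding kerV_def[abs_def] kerZ_def[abs_def] kerZ1_def[abs_def] kerZ3_def[abs_def] kerZ11_def kerZ13_def kerZ33_def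
  by (auto intro!: derivative_eq_intros simp: field_simps power2_eq_square power3_eq_cube)

text \<open>With Legendre's equation, the two identities say that the second
  \<open>t\<close>-derivative minus the second \<open>s\<close>-derivative of
  \<open>P\<^sub>\<nu>(Z)\<close> is
  \<open>- \<nu> * (\<nu> + 1) * ((csech t)^2 - (csech s)^2)\<close> times
  \<open>P\<^sub>\<nu>(Z)\<close>: the kernel intertwines the equations of \<phi> in
  \<open>t\<close> and in \<open>s\<close>.\<close>

lemma kernel_pde_coeffs:
  assumes "cosh t \<noteq> 0" "cosh s \<noteq> 0" "cosh t2 \<noteq> 0"
  shows "(kerZ1 t2 t s)\<^sup>2 - (kerZ3 t2 t s)\<^sup>2 = (1 - (kerZ t2 t s)\<^sup>2) * ((csech t)\<^sup>2 - (csech s)\<^sup>2)"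
    "kerZ11 t2 t s - kerZ33 t2 t s = - 2 * kerZ t2 t s * ((csech t)\<^sup>2 - (csech s)\<^sup>2)"
proof -
  define c1 c2 c3 s1 s3 i j k where "c1 = cosh t" "c2 = cosh t2" "c3 = cosh s" "s1 = sinh t" "s3 = sinh s"
    "i = csech t" "j = csech t2" "k = csech s"
  have r: "c1 * i = 1" "c2 * j = 1" "c3 * k = 1" using assms by (simp_all add: c1_c2_c3_s1_s3_i_j_k_def csech_def)
  have h: "s1\<^sup>2 = c1\<^sup>2 - 1" "s3\<^sup>2 = c3\<^sup>2 - 1"
    using hyperbolic_pythagoras[of t] hyperbolic_pythagoras[of s] by (auto simp: c1_c2_c3_s1_s3_i_j_k_def algebra_simps)
  note fold = c1_c2_c3_s1_s3_i_j_k_def[symmetric]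
  define A where "A = s1 * j * k - s1 * i\<^sup>2 * (c2 * k + c3 * j - j * k)"
  define B where "B = s3 * j * i - s3 * k\<^sup>2 * (c2 * i + c1 * j - j * i)"
  define Z where "Z = c1 * j * k + c2 * i * k + c3 * i * j - i * j * k"
  have "A\<^sup>2 - B\<^sup>2 = (4 - Z\<^sup>2) * (i\<^sup>2 - k\<^sup>2)"
    unfolding A_def B_def Z_def using r h by algebra
  then show "(kerZ1 t2 t s)\<^sup>2 - (kerZ3 t2 t s)\<^sup>2 = (1 - (kerZ t2 t s)\<^sup>2) * ((csech t)\<^sup>2 - (csech s)\<^sup>2)"
    unfolding kerZ1_def kerZ3_def kerZ_def fold A_def[symmetric] B_def[symmetric] Z_def[symmetric]
  proof -
    assume eq: "A\<^sup>2 - B\<^sup>2 = (4 - Z\<^sup>2) * (i\<^sup>2 - k\<^sup>2)"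
    have "(A / 2)\<^sup>2 - (B / 2)\<^sup>2 = (A\<^sup>2 - B\<^sup>2) / 4" by (simp add: power_divide diff_divide_distrib)
    also have "\<dots> = (1 - (Z / 2)\<^sup>2) * (i\<^sup>2 - k\<^sup>2)" unfolding eq by (simp add: power_divide diff_divide_distrib left_diff_distrib)
    finally show "(A / 2)\<^sup>2 - (B / 2)\<^sup>2 = (1 - (Z / 2)\<^sup>2) * (i\<^sup>2 - k\<^sup>2)" .
  qed
  define A2 where "A2 = c1 * j * k - (c1 * i\<^sup>2 - 2 * s1\<^sup>2 * i ^ 3) * (c2 * k + c3 * j - j * k)"
  define B2 where "B2 = c3 * j * i - (c3 * k\<^sup>2 - 2 * s3\<^sup>2 * k ^ 3) * (c2 * i + c1 * j - j * i)"
  have "A2 - B2 = - 2 * Z * (i\<^sup>2 - k\<^sup>2)"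
    unfolding A2_def B2_def Z_def using r h by algebra
  then show "kerZ11 t2 t s - kerZ33 t2 t s = - 2 * kerZ t2 t s * ((csech t)\<^sup>2 - (csech s)\<^sup>2)"
    unfolding kerZ11_def kerZ33_def kerZ_def fold A2_def[symmetric] B2_def[symmetric] Z_def[symmetric]
    by (simp add: field_simps)
qed

lemma kerZ_eq_kernel_arg:
  assumes n: "1 + exp (-2 * t) \<noteq> 0" "1 + exp (-2 * t2) \<noteq> 0" "1 + exp (-2 * t) * exp (-2 * t2) * y\<^sup>2 \<noteq> 0"
    and y: "y \<noteq> 0" and s: "exp s = exp t * exp t2 / y"
  shows "kerZ t2 t s = kernel_arg (exp (-2 * t)) (exp (-2 * t2)) y / y"
proof -
  define a b where "a = exp (- t)" "b = exp (- t2)"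
  have ab: "a \<noteq> 0" "b \<noteq> 0" by (simp_all add: a_b_def)
  have e: "exp (-2 * t) = a\<^sup>2" "exp (-2 * t2) = b\<^sup>2" "exp t = 1 / a" "exp t2 = 1 / b"
    using exp_double[of "- t"] exp_double[of "- t2"] by (simp_all add: a_b_def exp_minus divide_inverse)
  have es: "exp s = 1 / (a * b * y)" "exp (- s) = a * b * y" using s by (simp_all add: e exp_minus)
  have c: "cosh t = (1 + a\<^sup>2) / (2 * a)" "cosh t2 = (1 + b\<^sup>2) / (2 * b)" "cosh s = (1 + a\<^sup>2 * b\<^sup>2 * y\<^sup>2) / (2 * (a * b * y))"
    unfolding cosh_field_def es e a_b_def[symmetric] using ab y by (simp_all add: field_simps power2_eq_square)
  have n': "1 + a\<^sup>2 \<noteq> 0" "1 + b\<^sup>2 \<noteq> 0" "1 + a\<^sup>2 * b\<^sup>2 * y\<^sup>2 \<noteq> 0" using n unfolding e by (simp_all add: mult.assoc)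
  define d1 d2 d3 where "d1 = 1 + a\<^sup>2" "d2 = 1 + b\<^sup>2" "d3 = 1 + a\<^sup>2 * b\<^sup>2 * y\<^sup>2"
  have dn: "d1 \<noteq> 0" "d2 \<noteq> 0" "d3 \<noteq> 0" using n' by (simp_all add: d1_d2_d3_def)
  have "kerZ t2 t s = (d1\<^sup>2 * b\<^sup>2 * y\<^sup>2 + d2\<^sup>2 * a\<^sup>2 * y\<^sup>2 + d3\<^sup>2 - 4 * a\<^sup>2 * b\<^sup>2 * y\<^sup>2) / (d1 * d2 * d3 * y)"
    unfolding kerZ_def csech_def c d1_d2_d3_def[symmetric] using dn ab y
    by (simp add: field_simps power2_eq_square)
  also have "d1\<^sup>2 * b\<^sup>2 * y\<^sup>2 + d2\<^sup>2 * a\<^sup>2 * y\<^sup>2 + d3\<^sup>2 - 4 * a\<^sup>2 * b\<^sup>2 * y\<^sup>2 = d3\<^sup>2 + (a\<^sup>2 + b\<^sup>2) * y\<^sup>2 * (1 + a\<^sup>2 * b\<^sup>2)"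
    unfolding d1_d2_d3_def by algebra
  also have "(d3\<^sup>2 + (a\<^sup>2 + b\<^sup>2) * y\<^sup>2 * (1 + a\<^sup>2 * b\<^sup>2)) / (d1 * d2 * d3 * y) = (d3 + (a\<^sup>2 + b\<^sup>2) * y\<^sup>2 * (1 + a\<^sup>2 * b\<^sup>2) / d3) / (d1 * d2) / y"
    using dn y by (simp add: field_simps power2_eq_square)
  finally show ?thesis unfolding kernel_arg_def e d1_d2_d3_def .
qed

text \<open>The preimage of the disc of radius \<open>1/10\<close> under
  \<open>exp (-2 * t)\<close>.\<close>

definition cusp_halfplane :: "complex set" where "cusp_halfplane = {t. Re t > ln 10 / 2}"

lemma open_cusp_halfplane: "open cusp_halfplane"
  unfolding cusp_halfplane_def by (rule open_halfspace_Re_gt)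

lemma convex_cusp_halfplane: "convex cusp_halfplane"
  unfolding cusp_halfplane_def by (rule convex_halfspace_Re_gt)

lemma cusp_halfplaneD:
  assumes "t \<in> cusp_halfplane"
  shows "Re t > 0" "cmod (exp (-2 * t)) < 1/10" "t \<in> phi_dom" "cosh t \<noteq> 0"
proof -
  have "ln 10 / 2 > (0::real)" by simp
  then show r: "Re t > 0" using assms unfolding cusp_halfplane_def by (simp del: ln_gt_zero_iff)
  show "t \<in> phi_dom" by (rule Re_pos_phi_dom[OF r])
  then show "cosh t \<noteq> 0" by (rule phi_dom_arg)
  have "-2 * Re t < - ln 10" using assms by (simp add: cusp_halfplane_def)
  then have "exp (-2 * Re t) < exp (- ln 10)" by (simp only: exp_less_cancel_iff)
  also have "exp (- ln 10) = (1/10::real)" by (simp add: exp_minus)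
  finally show "cmod (exp (-2 * t)) < 1/10" by simp
qed

section \<open>The integral as a function of \<open>t\<close> near the cusp\<close>

lemma continuous_on_csech [continuous_intros]:
  "continuous_on A f \<Longrightarrow> (\<And>x. x \<in> A \<Longrightarrow> cosh (f x) \<noteq> 0) \<Longrightarrow> continuous_on A (\<lambda>x. csech (f x))"
  unfolding csech_def by (intro continuous_intros) auto

definition cuspS :: "complex \<Rightarrow> complex \<Rightarrow> real \<Rightarrow> complex" where
  "cuspS t2 t y = t + (t2 - of_real (ln y))"

definition cuspA :: "complex \<Rightarrow> complex \<Rightarrow> real \<Rightarrow> complex" where
  "cuspA t2 t y = (1 + kerZ t2 t (cuspS t2 t y)) / 2"

lemma cuspS_props:
  assumes t: "t \<in> cusp_halfplane" and t2: "t2 \<in> cusp_halfplane" and y: "y \<in> {0<..1}"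
  shows "Re (cuspS t2 t y) > 0" "cuspS t2 t y \<in> phi_dom" "cosh (cuspS t2 t y) \<noteq> 0"
    "exp (cuspS t2 t y) = exp t * exp t2 / of_real y"
    "kerZ t2 t (cuspS t2 t y) = kernel_arg (exp (-2 * t)) (exp (-2 * t2)) (of_real y) / of_real y"
    "cuspA t2 t y = (kernel_arg (exp (-2 * t)) (exp (-2 * t2)) (of_real y) + of_real y) / (2 * of_real y)"
    "cuspA t2 t y \<notin> \<real>\<^sub>\<le>\<^sub>0"
proof -
  note T = cusp_halfplaneD[OF t] and T2 = cusp_halfplaneD[OF t2]
  have "ln y \<le> 0" using y by simp
  then show r: "Re (cuspS t2 t y) > 0" using T(1) T2(1) by (simp add: cuspS_def)
  show d: "cuspS t2 t y \<in> phi_dom" by (rule Re_pos_phi_dom[OF r])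
  show "cosh (cuspS t2 t y) \<noteq> 0" using d by (rule phi_dom_arg)
  have "exp (complex_of_real (ln y)) = of_real y" using y by (simp add: exp_of_real)
  then show e: "exp (cuspS t2 t y) = exp t * exp t2 / of_real y"
    by (simp add: cuspS_def exp_add exp_diff)
  have y': "y \<in> {0..1}" using y by simp
  note sp = small_prod[OF T(2) T2(2) y'] small_prod(3)[OF T2(2) T2(2) y']
  show kz: "kerZ t2 t (cuspS t2 t y) = kernel_arg (exp (-2 * t)) (exp (-2 * t2)) (of_real y) / of_real y"
    using y by (intro kerZ_eq_kernel_arg sp e) auto
  show a: "cuspA t2 t y = (kernel_arg (exp (-2 * t)) (exp (-2 * t2)) (of_real y) + of_real y) / (2 * of_real y)"
    unfolding cuspA_def kz using y by (simp add: field_simps)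
  show "cuspA t2 t y \<notin> \<real>\<^sub>\<le>\<^sub>0" unfolding a by (rule cusp_legp_arg(2)[OF T(2) T2(2) y])
qed

text \<open>On \<open>s = t + t2\<close> the argument \<open>Z\<close> is 1 for every
  \<open>t\<close>, so its derivative along this line vanishes. This removes the boundary term at
  \<open>y = 1\<close>.\<close>

lemma kerV_diagonal:
  assumes t: "t \<in> cusp_halfplane" and t2: "t2 \<in> cusp_halfplane"
  shows "kerV t2 t (t + t2) = 0"
proof -
  have one: "kerZ t2 u (u + t2) = 1" if u: "u \<in> cusp_halfplane" for u
  proof -
    note T = cusp_halfplaneD[OF u] and T2 = cusp_halfplaneD[OF t2]
    note sp = small_prod[OF T(2) T2(2), of 1] small_prod(3)[OF T2(2) T2(2), of 1]
    have n: "1 + exp (-2 * u) * exp (-2 * t2) \<noteq> 0" using sp(2) by simp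
    have "kernel_arg (exp (-2 * u)) (exp (-2 * t2)) 1 = 1"
    proof -
      define q1 q2 where "q1 = exp (-2 * u)" "q2 = exp (-2 * t2)"
      have "1 + q1 * q2 \<noteq> 0" "1 + q1 \<noteq> 0" "1 + q2 \<noteq> 0" using n sp by (simp_all add: q1_q2_def)
      then show ?thesis unfolding kernel_arg_def q1_q2_def[symmetric] by (simp add: divide_simps) (simp add: algebra_simps)
    qed
    moreover have "kerZ t2 u (cuspS t2 u 1) = kernel_arg (exp (-2 * u)) (exp (-2 * t2)) (of_real 1) / of_real 1"
      by (rule cuspS_props(5)[OF u t2]) simp
    ultimately show ?thesis by (simp add: cuspS_def)
  qed
  have s: "t + t2 = cuspS t2 t 1" by (simp add: cuspS_def)
  have "((\<lambda>t. kerZ t2 t (t + t2)) has_field_derivative kerV t2 t (t + t2)) (at t)"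
    using cusp_halfplaneD[OF t] cuspS_props(3)[OF t t2, of 1]
    by (intro kerZ_derivs(3)) (auto simp: s)
  moreover have "((\<lambda>t. kerZ t2 t (t + t2)) has_field_derivative 0) (at t)"
    by (rule has_field_derivative_transform_within_open[OF DERIV_const open_cusp_halfplane t]) (simp add: one)
  ultimately show ?thesis by (rule DERIV_unique)
qed

context
  fixes \<nu> \<mu> t2 :: complex
  assumes t2: "t2 \<in> cusp_halfplane"
begin

abbreviation "lp \<equiv> legp \<nu>"
abbreviation "lp1 \<equiv> deriv (legp \<nu>)"
abbreviation "lp2 \<equiv> deriv (deriv (legp \<nu>))"
abbreviation "ph \<equiv> phi \<nu> \<mu>"
abbreviation "ph1 \<equiv> deriv (phi \<nu> \<mu>)"
abbreviation "Sy \<equiv> cuspS t2"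
abbreviation "Ay \<equiv> cuspA t2"

text \<open>
  \<open>F0\<close> is the integrand at \<open>s = t + t\<^sub>2 - ln y\<close>, and \<open>F1\<close>, \<open>F2\<close> are its first two \<open>t\<close>-derivatives. The defect of
  \<open>F0\<close> in the differential equation of \<open>\<phi>\<close> is the \<open>y\<close>-derivative of \<open>- FB\<close>.
\<close>
definition "F0 t y = ph (Sy t y) * lp (Ay t y) / of_real y"
definition "F1 t y = (ph1 (Sy t y) * lp (Ay t y) + ph (Sy t y) * (lp1 (Ay t y) * (kerV t2 t (Sy t y) / 2))) / of_real y"
definition "F2 t y = ((\<mu>\<^sup>2 - \<nu> * (\<nu> + 1) * (1 / cosh (Sy t y))\<^sup>2) * ph (Sy t y) * lp (Ay t y)
   + 2 * (ph1 (Sy t y) * (lp1 (Ay t y) * (kerV t2 t (Sy t y) / 2)))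
   + ph (Sy t y) * (lp2 (Ay t y) * (kerV t2 t (Sy t y) / 2)\<^sup>2 + lp1 (Ay t y) *
       ((kerZ11 t2 t (Sy t y) + 2 * kerZ13 t2 t (Sy t y) + kerZ33 t2 t (Sy t y)) / 2))) / of_real y"
definition "FB t y = ph (Sy t y) * (lp1 (Ay t y) * kerV t2 t (Sy t y))"

lemma phi_cuspS:
  assumes t: "t \<in> cusp_halfplane" and y: "y \<in> {0<..1}"
  shows "ph (Sy t y) = exp (- \<mu> * (t + t2)) * of_real y powr \<mu> *
    hypF \<nu> \<mu> (exp (-2 * t) * exp (-2 * t2) * (of_real y)\<^sup>2 / (1 + exp (-2 * t) * exp (-2 * t2) * (of_real y)\<^sup>2))"
proof -
  note sp = cuspS_props[OF t t2 y]
  have y0: "complex_of_real y \<noteq> 0" using y by simp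
  define q where "q = exp (-2 * t) * exp (-2 * t2) * (of_real y)\<^sup>2"
  have "exp (2 * Sy t y) = (exp t * exp t2 / of_real y)\<^sup>2" using sp(4) by (simp add: exp_double)
  also have "\<dots> = 1 / q"
    using exp_double[of "-t"] exp_double[of "-t2"] y0
    by (simp add: q_def exp_minus field_simps power2_eq_square)
  finally have e2: "exp (2 * Sy t y) = 1 / q" .
  have q0: "q \<noteq> 0" using y0 by (simp add: q_def)
  have "1 + q \<noteq> 0" using small_prod(2)[of "exp (-2 * t)" "exp (-2 * t2)" y] cusp_halfplaneD[OF t] cusp_halfplaneD[OF t2] y by (simp add: q_def)
  then have z: "1 / (1 + exp (2 * Sy t y)) = q / (1 + q)" unfolding e2 using q0 by (simp add: field_simps)
  have "exp (- \<mu> * Sy t y) = exp (- \<mu> * (t + t2)) * exp (\<mu> * of_real (ln y))"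
    by (simp add: cuspS_def exp_add[symmetric] algebra_simps)
  also have "exp (\<mu> * of_real (ln y)) = of_real y powr \<mu>" using y by (simp add: powr_def Ln_of_real)
  finally have ex: "exp (- \<mu> * Sy t y) = exp (- \<mu> * (t + t2)) * of_real y powr \<mu>" .
  show ?thesis unfolding phi_def z ex q_def by simp
qed

lemma cusp_integrand_eq_F0:
  assumes t: "t \<in> cusp_halfplane" and y: "y \<in> {0<..1}"
  shows "cusp_integrand \<nu> \<mu> (exp (-2 * t)) (exp (-2 * t2)) y = exp (\<mu> * (t + t2)) * F0 t y"
proof -
  note sp = cuspS_props[OF t t2 y]
  have y0: "complex_of_real y \<noteq> 0" using y by simp
  define q where "q = exp (-2 * t) * exp (-2 * t2) * (of_real y)\<^sup>2"
  note ph = phi_cuspS[OF t y, folded q_def]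
  have one: "exp (\<mu> * (t + t2)) * exp (- \<mu> * (t + t2)) = 1" by (simp add: exp_add[symmetric])
  have "cusp_integrand \<nu> \<mu> (exp (-2 * t)) (exp (-2 * t2)) y = of_real y powr (\<mu> - 1) * (hypF \<nu> \<mu> (q / (1 + q)) * lp (Ay t y))"
    unfolding cusp_integrand_def sp(6) q_def by simp
  also have "of_real y powr (\<mu> - 1) = of_real y powr \<mu> / of_real y" using y0 by (simp add: powr_diff)
  also have "of_real y powr \<mu> / of_real y * (hypF \<nu> \<mu> (q / (1 + q)) * lp (Ay t y)) =
     (exp (\<mu> * (t + t2)) * exp (- \<mu> * (t + t2))) * (of_real y powr \<mu> / of_real y * (hypF \<nu> \<mu> (q / (1 + q)) * lp (Ay t y)))"
    unfolding one by simp
  also have "\<dots> = exp (\<mu> * (t + t2)) * F0 t y" unfolding F0_def ph by (simp only: times_divide_eq_left times_divide_eq_right mult_ac)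
  finally show ?thesis .
qed

lemma cusp_t_derivs:
  assumes t: "t \<in> cusp_halfplane" and y: "y \<in> {0<..1}"
  shows "((\<lambda>t. F0 t y) has_field_derivative F1 t y) (at t)"
    "((\<lambda>t. F1 t y) has_field_derivative F2 t y) (at t)"
proof -
  note sp = cuspS_props[OF t t2 y]
  have ct: "cosh t \<noteq> 0" using cusp_halfplaneD[OF t] by blast
  have dS: "((\<lambda>t. Sy t y) has_field_derivative 1) (at t)"
    unfolding cuspS_def by (auto intro!: derivative_eq_intros)
  have dph: "((\<lambda>t. ph (Sy t y)) has_field_derivative ph1 (Sy t y)) (at t)"
    using DERIV_chain2[OF phi_deriv[OF sp(2)] dS] by simp
  have dph1: "((\<lambda>t. ph1 (Sy t y)) has_field_derivative (\<mu>\<^sup>2 - \<nu> * (\<nu> + 1) * (1 / cosh (Sy t y))\<^sup>2) * ph (Sy t y)) (at t)"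
    using DERIV_chain2[OF phi_deriv2[OF sp(2)] dS] by simp
  have dZ: "((\<lambda>t. kerZ t2 t (Sy t y)) has_field_derivative kerV t2 t (Sy t y)) (at t)"
    unfolding cuspS_def using ct sp(3) by (intro kerZ_derivs(3)) (auto simp: cuspS_def)
  have dV: "((\<lambda>t. kerV t2 t (Sy t y)) has_field_derivative (kerZ11 t2 t (Sy t y) + 2 * kerZ13 t2 t (Sy t y) + kerZ33 t2 t (Sy t y))) (at t)"
    unfolding cuspS_def using ct sp(3) by (intro kerZ_derivs(4)) (auto simp: cuspS_def)
  have dA: "((\<lambda>t. Ay t y) has_field_derivative kerV t2 t (Sy t y) / 2) (at t)"
    unfolding cuspA_def[abs_def] by (rule DERIV_cong[OF DERIV_cdivide[OF DERIV_add[OF DERIV_const dZ]]]) simp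
  have dp: "((\<lambda>t. lp (Ay t y)) has_field_derivative lp1 (Ay t y) * (kerV t2 t (Sy t y) / 2)) (at t)"
    by (rule DERIV_chain2[OF legp_has_deriv[OF sp(7)] dA])
  have dp1: "((\<lambda>t. lp1 (Ay t y)) has_field_derivative lp2 (Ay t y) * (kerV t2 t (Sy t y) / 2)) (at t)"
    by (rule DERIV_chain2[OF legp_has_deriv2[OF sp(7)] dA])
  show "((\<lambda>t. F0 t y) has_field_derivative F1 t y) (at t)"
    unfolding F0_def[abs_def] F1_def
    by (rule DERIV_cong[OF DERIV_cdivide[OF DERIV_mult[OF dph dp]]]) (simp add: algebra_simps)
  show "((\<lambda>t. F1 t y) has_field_derivative F2 t y) (at t)"
    unfolding F1_def[abs_def] F2_def
    by (rule DERIV_cong[OF DERIV_cdivide[OF DERIV_add[OF DERIV_mult[OF dph1 dp] DERIV_mult[OF dph DERIV_mult[OF dp1 DERIV_cdivide[OF dV]]]]]])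
      (simp add: algebra_simps power2_eq_square)
qed

text \<open>Let \<open>D\<close> be the \<open>t\<close>-derivative with \<open>s\<close> moving
  along, so that \<open>FB = 2 * \<phi> * D P\<close>. Then \<open>D^2\<close> is the difference of
  the second \<open>t\<close>- and \<open>s\<close>-derivatives plus twice the
  \<open>s\<close>-derivative of \<open>D\<close>. By the intertwining property the difference
  cancels the change of the potential between \<open>t\<close> and \<open>s\<close>; what remains is
  the \<open>s\<close>-derivative of \<open>FB\<close>, and \<open>s\<close>-differentiation is
  \<open>- y * d/dy\<close>.\<close>

lemma cusp_y_deriv:
  assumes t: "t \<in> cusp_halfplane" and y: "y \<in> {0<..1}"
  shows "(FB t has_vector_derivative - (F2 t y - (\<mu>\<^sup>2 - \<nu> * (\<nu> + 1) * (csech t)\<^sup>2) * F0 t y)) (at y)"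
proof -
  note sp = cuspS_props[OF t t2 y]
  have ct: "cosh t \<noteq> 0" "cosh t2 \<noteq> 0" using cusp_halfplaneD[OF t] cusp_halfplaneD[OF t2] by blast+
  define Y where "Y = complex_of_real y"
  have dS: "(Sy t has_vector_derivative - (1 / Y)) (at y)"
  proof -
    have "((\<lambda>y. t + (t2 - of_real (ln y))) has_vector_derivative - of_real (1 / y)) (at y)"
      using y by (auto intro!: derivative_eq_intros has_vector_derivative_of_real simp: has_real_derivative_iff_has_vector_derivative[symmetric] divide_inverse)
    then show ?thesis by (simp add: cuspS_def[abs_def] Y_def)
  qed
  note ch = field_vector_diff_chain_at[OF dS, unfolded o_def]
  have dph: "((\<lambda>y. ph (Sy t y)) has_vector_derivative - (1 / Y) * ph1 (Sy t y)) (at y)"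
    by (rule ch[OF phi_deriv[OF sp(2)]])
  have dZ: "((\<lambda>y. kerZ t2 t (Sy t y)) has_vector_derivative - (1 / Y) * kerZ3 t2 t (Sy t y)) (at y)"
    by (rule ch[OF kerZ_derivs(1)[OF ct(1) sp(3)]])
  have dV: "((\<lambda>y. kerV t2 t (Sy t y)) has_vector_derivative - (1 / Y) * (kerZ13 t2 t (Sy t y) + kerZ33 t2 t (Sy t y))) (at y)"
    by (rule ch[OF kerZ_derivs(2)[OF ct(1) sp(3)]])
  have dA: "(Ay t has_vector_derivative (- (1 / Y) * kerZ3 t2 t (Sy t y)) / 2) (at y)"
  proof -
    have "((\<lambda>y. 1 + kerZ t2 t (Sy t y)) has_vector_derivative (0 + - (1 / Y) * kerZ3 t2 t (Sy t y))) (at y)"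
      by (rule has_vector_derivative_add[OF has_vector_derivative_const dZ])
    then show ?thesis unfolding cuspA_def[abs_def] by (intro has_vector_derivative_divide) simp
  qed
  have dp1: "((\<lambda>y. lp1 (Ay t y)) has_vector_derivative ((- (1 / Y) * kerZ3 t2 t (Sy t y)) / 2) * lp2 (Ay t y)) (at y)"
    using field_vector_diff_chain_at[OF dA legp_has_deriv2[OF sp(7)]] by (simp add: o_def)
  have d: "(FB t has_vector_derivative
     (ph (Sy t y) * (lp1 (Ay t y) * (- (1 / Y) * (kerZ13 t2 t (Sy t y) + kerZ33 t2 t (Sy t y))) + ((- (1 / Y) * kerZ3 t2 t (Sy t y)) / 2) * lp2 (Ay t y) * kerV t2 t (Sy t y))
      + (- (1 / Y) * ph1 (Sy t y)) * (lp1 (Ay t y) * kerV t2 t (Sy t y)))) (at y)"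
    unfolding FB_def[abs_def] by (intro has_vector_derivative_mult dph dp1 dV)
  define s A where "s = Sy t y" "A = Ay t y"
  define i k where "i = csech t" "k = csech s"
  define P P1 P2 f f1 where "P = lp A" "P1 = lp1 A" "P2 = lp2 A" "f = ph s" "f1 = ph1 s"
  define Z Z1 Z3 Z11 Z13 Z33 where "Z = kerZ t2 t s" "Z1 = kerZ1 t2 t s" "Z3 = kerZ3 t2 t s" "Z11 = kerZ11 t2 t s" "Z13 = kerZ13 t2 t s" "Z33 = kerZ33 t2 t s"
  have A: "A = (1 + Z) / 2" by (simp add: s_A_def Z_Z1_Z3_Z11_Z13_Z33_def cuspA_def)
  have "A * (1 - A) * P2 + (1 - 2 * A) * P1 + \<nu> * (\<nu> + 1) * P = 0"
    unfolding P_P1_P2_f_f1_def by (rule legp_ode) (use sp(7) in \<open>simp add: s_A_def\<close>)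
  moreover have "A * (1 - A) = (1 - Z\<^sup>2) / 4" "1 - 2 * A = - Z" unfolding A by (simp_all add: field_simps power2_eq_square)
  ultimately have ode: "(1 - Z\<^sup>2) / 4 * P2 - Z * P1 + \<nu> * (\<nu> + 1) * P = 0" by simp
  have k1: "Z1\<^sup>2 - Z3\<^sup>2 = (1 - Z\<^sup>2) * (i\<^sup>2 - k\<^sup>2)" and k2: "Z11 - Z33 = - 2 * Z * (i\<^sup>2 - k\<^sup>2)"
    unfolding Z_Z1_Z3_Z11_Z13_Z33_def i_k_def by (rule kernel_pde_coeffs; use ct sp in \<open>simp add: s_A_def\<close>)+
  have V: "kerV t2 t s = Z1 + Z3" by (simp add: kerV_def Z_Z1_Z3_Z11_Z13_Z33_def)
  have "(1 - Z\<^sup>2) * P2 - 4 * Z * P1 + 4 * \<nu> * (\<nu> + 1) * P = 0"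
  proof -
    have "4 * (r / 4 * P2 - Z * P1 + l * P) = r * P2 - 4 * Z * P1 + 4 * l * P" for r l
      by (simp add: algebra_simps)
    from this[of "1 - Z\<^sup>2" "\<nu> * (\<nu> + 1)"] show ?thesis
      unfolding ode by (simp only: mult_zero_right mult.assoc)
  qed
  \<comment> \<open>Four times the intertwining equation, with Legendre's equation already
    substituted.\<close>
  then have main: "(Z1\<^sup>2 - Z3\<^sup>2) * P2 + 2 * (Z11 - Z33) * P1 + 4 * \<nu> * (\<nu> + 1) * (i\<^sup>2 - k\<^sup>2) * P = 0"
    using k1 k2 by algebra
  have m2: "- (4 * (f * (P1 * (Z13 + Z33)) + f * (Z3 / 2 * P2 * (Z1 + Z3)) + f1 * (P1 * (Z1 + Z3)))) =
     - (4 * ((\<mu>\<^sup>2 - \<nu> * (\<nu> + 1) * k\<^sup>2) * f * P + 2 * (f1 * (P1 * ((Z1 + Z3) / 2))) + f * (P2 * ((Z1 + Z3) / 2)\<^sup>2 + P1 * ((Z11 + 2 * Z13 + Z33) / 2))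
      - (\<mu>\<^sup>2 - \<nu> * (\<nu> + 1) * i\<^sup>2) * (f * P)))"
  proof -
    have e1: "f * ((Z1\<^sup>2 - Z3\<^sup>2) * P2 + 2 * (Z11 - Z33) * P1 + 4 * \<nu> * (\<nu> + 1) * (i\<^sup>2 - k\<^sup>2) * P) = 0" unfolding main by simp
    have e2: "f * ((Z1\<^sup>2 - Z3\<^sup>2) * P2 + 2 * (Z11 - Z33) * P1 + 4 * \<nu> * (\<nu> + 1) * (i\<^sup>2 - k\<^sup>2) * P) =
      4 * ((\<mu>\<^sup>2 - \<nu> * (\<nu> + 1) * k\<^sup>2) * f * P + 2 * (f1 * (P1 * ((Z1 + Z3) / 2))) + f * (P2 * ((Z1 + Z3) / 2)\<^sup>2 + P1 * ((Z11 + 2 * Z13 + Z33) / 2))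
      - (\<mu>\<^sup>2 - \<nu> * (\<nu> + 1) * i\<^sup>2) * (f * P)) - 4 * (f * (P1 * (Z13 + Z33)) + f * (Z3 / 2 * P2 * (Z1 + Z3)) + f1 * (P1 * (Z1 + Z3)))"
      by (simp add: field_simps power2_eq_square)
    show ?thesis using trans[OF e2[symmetric] e1] by (simp only: right_minus_eq)
  qed
  have canc: "- X = - X'" if "- (4 * X) = - (4 * X')" for X X' :: complex
    using that by simp
  have m3: "- (f * (P1 * (Z13 + Z33)) + f * (Z3 / 2 * P2 * (Z1 + Z3)) + f1 * (P1 * (Z1 + Z3))) =
     - ((\<mu>\<^sup>2 - \<nu> * (\<nu> + 1) * k\<^sup>2) * f * P + 2 * (f1 * (P1 * ((Z1 + Z3) / 2))) + f * (P2 * ((Z1 + Z3) / 2)\<^sup>2 + P1 * ((Z11 + 2 * Z13 + Z33) / 2))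
      - (\<mu>\<^sup>2 - \<nu> * (\<nu> + 1) * i\<^sup>2) * (f * P))"
    by (rule canc[OF m2])
  have "f * (P1 * (- (1 / Y) * (Z13 + Z33)) + ((- (1 / Y) * Z3) / 2) * P2 * (Z1 + Z3)) + (- (1 / Y) * f1) * (P1 * (Z1 + Z3)) =
     (- (f * (P1 * (Z13 + Z33)) + f * (Z3 / 2 * P2 * (Z1 + Z3)) + f1 * (P1 * (Z1 + Z3)))) / Y"
  proof -
    have alg: "f * (P1 * (- w * u) + (- w * h) * P2 * v) + (- w * f1) * (P1 * v) = w * (- (f * (P1 * u) + f * (h * P2 * v) + f1 * (P1 * v)))" for w h u v
      by algebra
    have "(- (1 / Y) * Z3) / 2 = - (1 / Y) * (Z3 / 2)" by simp
    then show ?thesis using alg[of "1 / Y" "Z13 + Z33" "Z3 / 2" "Z1 + Z3"] by (simp only: times_divide_eq_left mult_1_left)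
  qed
  also have "\<dots> = - (((\<mu>\<^sup>2 - \<nu> * (\<nu> + 1) * k\<^sup>2) * f * P + 2 * (f1 * (P1 * ((Z1 + Z3) / 2))) + f * (P2 * ((Z1 + Z3) / 2)\<^sup>2 + P1 * ((Z11 + 2 * Z13 + Z33) / 2))) / Y
      - (\<mu>\<^sup>2 - \<nu> * (\<nu> + 1) * i\<^sup>2) * (f * P / Y))"
    unfolding m3 by (simp add: diff_divide_distrib)
  finally have "(ph (Sy t y) * (lp1 (Ay t y) * (- (1 / Y) * (kerZ13 t2 t (Sy t y) + kerZ33 t2 t (Sy t y))) + ((- (1 / Y) * kerZ3 t2 t (Sy t y)) / 2) * lp2 (Ay t y) * kerV t2 t (Sy t y))
      + (- (1 / Y) * ph1 (Sy t y)) * (lp1 (Ay t y) * kerV t2 t (Sy t y))) = - (F2 t y - (\<mu>\<^sup>2 - \<nu> * (\<nu> + 1) * (csech t)\<^sup>2) * F0 t y)"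
    unfolding F2_def F0_def s_A_def[symmetric] V P_P1_P2_f_f1_def[symmetric] Y_def[symmetric] Z_Z1_Z3_Z11_Z13_Z33_def[symmetric] i_k_def[symmetric]
      csech_def[of s, symmetric] .
  then show ?thesis using d by (simp only:)
qed

lemma cusp_continuity:
  assumes a: "a > 0"
  shows "continuous_on (cusp_halfplane \<times> {a..1}) (\<lambda>(t, y). F0 t y)"
    "continuous_on (cusp_halfplane \<times> {a..1}) (\<lambda>(t, y). F1 t y)"
    "continuous_on (cusp_halfplane \<times> {a..1}) (\<lambda>(t, y). F2 t y)"
proof -
  let ?S = "cusp_halfplane \<times> {a..1}"
  have mem: "fst p \<in> cusp_halfplane" "snd p \<in> {0<..1}" if "p \<in> ?S" for p using that a by auto
  note sp = cuspS_props[OF mem(1) t2 mem(2)]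
  have nz: "cosh (fst p) \<noteq> 0" "cosh t2 \<noteq> 0" "cosh (Sy (fst p) (snd p)) \<noteq> 0" "complex_of_real (snd p) \<noteq> 0" if "p \<in> ?S" for p
    using cusp_halfplaneD[OF mem(1)[OF that]] cusp_halfplaneD[OF t2] sp(3)[OF that that] mem(2)[OF that] by auto
  have cS: "continuous_on ?S (\<lambda>p. Sy (fst p) (snd p))"
    unfolding cuspS_def using a by (intro continuous_intros) auto
  have cA: "continuous_on ?S (\<lambda>p. Ay (fst p) (snd p))"
    unfolding cuspA_def kerZ_def using nz by (intro continuous_intros cS) auto
  have cV: "continuous_on ?S (\<lambda>p. kerV t2 (fst p) (Sy (fst p) (snd p)))"
    "continuous_on ?S (\<lambda>p. kerZ11 t2 (fst p) (Sy (fst p) (snd p)))"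
    "continuous_on ?S (\<lambda>p. kerZ13 t2 (fst p) (Sy (fst p) (snd p)))"
    "continuous_on ?S (\<lambda>p. kerZ33 t2 (fst p) (Sy (fst p) (snd p)))"
    unfolding kerV_def kerZ1_def kerZ3_def kerZ11_def kerZ13_def kerZ33_def using nz
    by (intro continuous_intros cS; simp)+
  have cph: "continuous_on ?S (\<lambda>p. ph (Sy (fst p) (snd p)))"
    by (rule continuous_on_compose2[OF holomorphic_on_imp_continuous_on[OF phi_holomorphic] cS]) (use sp(2) in auto)
  have cph1: "continuous_on ?S (\<lambda>p. ph1 (Sy (fst p) (snd p)))"
    by (rule continuous_on_compose2[OF holomorphic_on_imp_continuous_on[OF holomorphic_deriv[OF phi_holomorphic open_phi_dom]] cS]) (use sp(2) in auto)
  have cl: "continuous_on ?S (\<lambda>p. lp (Ay (fst p) (snd p)))"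
    by (rule continuous_on_compose2[OF holomorphic_on_imp_continuous_on[OF holomorphic_on_legp] cA]) (use sp(7) in auto)
  have cl1: "continuous_on ?S (\<lambda>p. lp1 (Ay (fst p) (snd p)))"
    by (rule continuous_on_compose2[OF holomorphic_on_imp_continuous_on[OF holomorphic_deriv[OF holomorphic_on_legp open_slit]] cA]) (use sp(7) in auto)
  have cl2: "continuous_on ?S (\<lambda>p. lp2 (Ay (fst p) (snd p)))"
    by (rule continuous_on_compose2[OF holomorphic_on_imp_continuous_on[OF holomorphic_deriv[OF holomorphic_deriv[OF holomorphic_on_legp open_slit] open_slit]] cA]) (use sp(7) in auto)
  have cc: "continuous_on ?S (\<lambda>p. 1 / cosh (Sy (fst p) (snd p)))"
    using nz by (intro continuous_intros cS) auto
  show "continuous_on ?S (\<lambda>(t, y). F0 t y)"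
    unfolding split_beta F0_def using nz by (intro continuous_intros cph cl) auto
  show "continuous_on ?S (\<lambda>(t, y). F1 t y)"
    unfolding split_beta F1_def using nz by (intro continuous_intros cph cph1 cl cl1 cV) auto
  show "continuous_on ?S (\<lambda>(t, y). F2 t y)"
    unfolding split_beta F2_def using nz by (intro continuous_on_divide continuous_on_add continuous_on_diff continuous_on_mult continuous_on_const continuous_on_power continuous_on_of_real continuous_on_snd continuous_on_id cc cph cph1 cl cl1 cl2 cV) auto
qed

text \<open>The Wronskian with \<phi> of the integral truncated at \<open>a\<close>. Away from
  \<open>y = 0\<close> all integrands are continuous, so differentiation under the integral is
  unproblematic.\<close>

definition "cuspW a t = integral {a..1} (F1 t) * ph t - integral {a..1} (F0 t) * ph1 t"

lemma cusp_integral_derivs: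
  assumes a: "0 < a" and t: "t \<in> cusp_halfplane"
  shows "((\<lambda>t. integral {a..1} (F0 t)) has_field_derivative integral {a..1} (F1 t)) (at t)"
    "((\<lambda>t. integral {a..1} (F1 t)) has_field_derivative integral {a..1} (F2 t)) (at t)"
    "F0 t integrable_on {a..1}" "F2 t integrable_on {a..1}"
proof -
  note c = cusp_continuity[OF a]
  have mem: "y \<in> {0<..1}" if "y \<in> cbox a 1" for y using that a by auto
  have int: "f t integrable_on {a..1}" if "continuous_on (cusp_halfplane \<times> {a..1}) (\<lambda>(t, y). f t y)" "t \<in> cusp_halfplane" for f :: "complex \<Rightarrow> real \<Rightarrow> complex" and t
  proof -
    have "continuous_on {a..1} (\<lambda>y. (\<lambda>(t, y). f t y) (t, y))"
      by (rule continuous_on_compose2[OF that(1)]) (use that(2) in \<open>auto intro!: continuous_intros\<close>)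
    then show ?thesis by (simp add: integrable_continuous_real)
  qed
  show "F0 t integrable_on {a..1}" "F2 t integrable_on {a..1}" using int c t by blast+
  have w: "at t within cusp_halfplane = at t" using t open_cusp_halfplane by (rule at_within_open)
  have "((\<lambda>t. integral (cbox a 1) (F0 t)) has_field_derivative integral (cbox a 1) (F1 t)) (at t within cusp_halfplane)"
    by (rule leibniz_rule_field_derivative[OF _ _ _ t convex_cusp_halfplane])
      (use c int mem cusp_t_derivs(1) in \<open>auto intro: has_field_derivative_at_within\<close>)
  then show "((\<lambda>t. integral {a..1} (F0 t)) has_field_derivative integral {a..1} (F1 t)) (at t)" by (simp add: w)
  have "((\<lambda>t. integral (cbox a 1) (F1 t)) has_field_derivative integral (cbox a 1) (F2 t)) (at t within cusp_halfplane)"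
    by (rule leibniz_rule_field_derivative[OF _ _ _ t convex_cusp_halfplane])
      (use c int mem cusp_t_derivs(2) in \<open>auto intro: has_field_derivative_at_within\<close>)
  then show "((\<lambda>t. integral {a..1} (F1 t)) has_field_derivative integral {a..1} (F2 t)) (at t)" by (simp add: w)
qed

text \<open>The truncated integral satisfies the equation of \<phi> up to the boundary values of
  \<open>FB\<close>; the one at \<open>y = 1\<close> is zero by
  \<open>kerV_diagonal\<close>.\<close>

lemma cuspW_deriv:
  assumes a: "0 < a" "a \<le> 1" and t: "t \<in> cusp_halfplane"
  shows "(cuspW a has_field_derivative ph t * FB t a) (at t)"
proof -
  note td = cusp_halfplaneD[OF t]
  note cd = cusp_integral_derivs[OF a(1) t]
  define c where "c = \<mu>\<^sup>2 - \<nu> * (\<nu> + 1) * (csech t)\<^sup>2"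
  have h1: "((\<lambda>y. - (F2 t y - c * F0 t y)) has_integral (FB t 1 - FB t a)) {a..1}"
  proof (rule fundamental_theorem_of_calculus[OF a(2)])
    fix y assume "y \<in> {a..1}"
    then have "y \<in> {0<..1}" using a by simp
    from cusp_y_deriv[OF t this] show "(FB t has_vector_derivative - (F2 t y - c * F0 t y)) (at y within {a..1})"
      unfolding c_def by (rule has_vector_derivative_at_within)
  qed
  have h2: "FB t 1 = 0" using kerV_diagonal[OF t t2] by (simp add: FB_def cuspS_def)
  have h3: "((\<lambda>y. - (F2 t y - c * F0 t y)) has_integral - (integral {a..1} (F2 t) - c * integral {a..1} (F0 t))) {a..1}"
    by (intro has_integral_neg has_integral_diff has_integral_mult_right integrable_integral cd)
  have "- (integral {a..1} (F2 t) - c * integral {a..1} (F0 t)) = - FB t a"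
    using has_integral_unique[OF h1 h3] h2 by simp
  then have e: "FB t a = integral {a..1} (F2 t) - c * integral {a..1} (F0 t)" by (simp only: neg_equal_iff_equal)
  have "(cuspW a has_field_derivative
    (integral {a..1} (F2 t) * ph t + ph1 t * integral {a..1} (F1 t)) - (integral {a..1} (F1 t) * ph1 t + (\<mu>\<^sup>2 - \<nu> * (\<nu> + 1) * (1 / cosh t)\<^sup>2) * ph t * integral {a..1} (F0 t))) (at t)"
    unfolding cuspW_def[abs_def] by (intro DERIV_diff DERIV_mult cd phi_deriv phi_deriv2 td)
  then show ?thesis
    by (rule DERIV_cong) (simp add: e c_def csech_def algebra_simps)
qed

end

section \<open>The product formula near the cusp\<close>

lemma Re_pos_not_nonpos_Int:
  fixes z :: complex
  assumes "Re z > 0"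
  shows "z \<notin> \<int>\<^sub>\<le>\<^sub>0"
proof
  assume "z \<in> \<int>\<^sub>\<le>\<^sub>0"
  then obtain n where "z = of_int n" "n \<le> 0" by (auto elim: nonpos_Ints_cases)
  then show False using assms by simp
qed

lemma kernel_arg_holomorphic:
  assumes q2: "cmod q2 < 1/10" and y: "y \<in> {0..1}"
  shows "(\<lambda>q. kernel_arg q q2 (of_real y)) holomorphic_on ball 0 (1/10)"
proof -
  have nz: "1 + q * q2 * (of_real y)\<^sup>2 \<noteq> 0" "1 + q \<noteq> 0" "1 + q2 \<noteq> 0" if "q \<in> ball 0 (1/10)" for q
    using small_prod[of q q2 y] small_prod(3)[of q2 q2 y] that q2 y by auto
  show ?thesis unfolding kernel_arg_def using nz by (intro holomorphic_intros) auto
qed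

lemma kernel_arg_deriv_bound:
  assumes K: "compact K" "K \<subseteq> ball 0 (1/10)" and q2: "cmod q2 < 1/10"
  shows "\<exists>C. \<forall>q\<in>K. \<forall>y\<in>{0..1}. cmod (deriv (\<lambda>q. kernel_arg q q2 (of_real y)) q) \<le> C"
proof -
  obtain e where e: "e > 0" "(\<Union>q\<in>K. cball q e) \<subseteq> ball 0 (1/10)"
    using compact_subset_open_imp_cball_epsilon_subset[OF K(1) open_ball K(2)] by blast
  have "cmod (deriv (\<lambda>q. kernel_arg q q2 (of_real y)) q) \<le> 2 / e" if q: "q \<in> K" and y: "y \<in> {0..1}" for q y
  proof -
    have sub: "cball q e \<subseteq> ball 0 (1/10)" using e q by blast
    have hol: "(\<lambda>q. kernel_arg q q2 (of_real y)) holomorphic_on cball q e"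
      using kernel_arg_holomorphic[OF q2 y] sub by (rule holomorphic_on_subset)
    have "cmod ((deriv ^^ 1) (\<lambda>q. kernel_arg q q2 (of_real y)) q) \<le> fact 1 * 2 / e ^ 1"
    proof (rule Cauchy_inequality)
      show "(\<lambda>q. kernel_arg q q2 (of_real y)) holomorphic_on ball q e"
        using hol ball_subset_cball by (rule holomorphic_on_subset)
      show "continuous_on (cball q e) (\<lambda>q. kernel_arg q q2 (of_real y))"
        using hol by (rule holomorphic_on_imp_continuous_on)
      show "0 < e" by fact
      fix x assume "cmod (q - x) = e"
      then have "x \<in> ball 0 (1/10)" using sub by (auto simp: dist_norm subset_iff)
      then have "cmod (kernel_arg x q2 (of_real y) - 1) \<le> 3/5" using q2 y by (intro kernel_arg_near_1) auto
      then show "cmod (kernel_arg x q2 (of_real y)) \<le> 2" using norm_triangle_sub[of "kernel_arg x q2 (of_real y)" 1] by simp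
    qed
    then show ?thesis by simp
  qed
  then show ?thesis by blast
qed

text \<open>In the variable \<open>q = exp (-2 * t)\<close>, \<open>kerV\<close> is
  \<open>-2 * q / y\<close> times the \<open>q\<close>-derivative of \<open>kernel_arg\<close>,
  which Cauchy's inequality bounds. The explicit formula would hide this through large terms that
  cancel.\<close>

lemma kerV_bound:
  assumes K: "compact K" "K \<subseteq> cusp_halfplane" and t2: "t2 \<in> cusp_halfplane"
  shows "\<exists>C\<ge>0. \<forall>t\<in>K. \<forall>y\<in>{0<..1}. cmod (kerV t2 t (cuspS t2 t y)) \<le> C / y"
proof -
  note T2 = cusp_halfplaneD[OF t2]
  let ?E = "\<lambda>t. exp (-2 * t)"
  have cK: "compact (?E ` K)" using K(1) by (intro compact_continuous_image continuous_intros)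
  moreover have "?E ` K \<subseteq> ball 0 (1/10)" using K(2) cusp_halfplaneD(2) by auto
  ultimately obtain C where C: "\<And>q y. q \<in> ?E ` K \<Longrightarrow> y \<in> {0..1} \<Longrightarrow> cmod (deriv (\<lambda>q. kernel_arg q (?E t2) (of_real y)) q) \<le> C"
    using kernel_arg_deriv_bound[OF _ _ T2(2)] by meson
  have "cmod (kerV t2 t (cuspS t2 t y)) \<le> \<bar>C\<bar> / y" if t: "t \<in> K" and y: "y \<in> {0<..1}" for t y
  proof -
    have tU: "t \<in> cusp_halfplane" using t K by blast
    note T = cusp_halfplaneD[OF tU]
    have y': "y \<in> {0..1}" using y by simp
    let ?d = "deriv (\<lambda>q. kernel_arg q (?E t2) (of_real y)) (?E t)"
    have dk: "((\<lambda>q. kernel_arg q (?E t2) (of_real y)) has_field_derivative ?d) (at (?E t))"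
      by (rule holomorphic_derivI[OF kernel_arg_holomorphic[OF T2(2) y'] open_ball]) (use T in auto)
    have de: "(?E has_field_derivative -2 * ?E t) (at t)" by (auto intro!: derivative_eq_intros)
    have "((\<lambda>u. kernel_arg (?E u) (?E t2) (of_real y) / of_real y) has_field_derivative ?d * (-2 * ?E t) / of_real y) (at t)"
      by (intro DERIV_cdivide DERIV_chain2[OF dk de])
    then have "((\<lambda>u. kerZ t2 u (cuspS t2 u y)) has_field_derivative ?d * (-2 * ?E t) / of_real y) (at t)"
      by (rule has_field_derivative_transform_within_open[OF _ open_cusp_halfplane tU])
        (use cuspS_props(5)[OF _ t2 y] in auto)
    moreover have "((\<lambda>u. kerZ t2 u (cuspS t2 u y)) has_field_derivative kerV t2 t (cuspS t2 t y)) (at t)"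
      unfolding cuspS_def using T(4) cuspS_props(3)[OF tU t2 y] by (intro kerZ_derivs(3)) (auto simp: cuspS_def)
    ultimately have "kerV t2 t (cuspS t2 t y) = ?d * (-2 * ?E t) / of_real y" using DERIV_unique by blast
    then have "cmod (kerV t2 t (cuspS t2 t y)) = cmod ?d * (2 * cmod (?E t)) / y" using y by (simp add: norm_mult norm_divide)
    also have "\<dots> \<le> \<bar>C\<bar> * 1 / y"
    proof (rule divide_right_mono[OF mult_mono])
      show "cmod ?d \<le> \<bar>C\<bar>" using C[of "?E t" y] t y' by force
    qed (use T y in auto)
    finally show ?thesis by simp
  qed
  then show ?thesis by (intro exI[of _ "\<bar>C\<bar>"]) auto
qed

lemma hypF_q_holomorphic: "(\<lambda>q. hypF \<nu> \<mu> (q / (1 + q))) holomorphic_on ball 0 (1/10)"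
proof -
  have "q / (1 + q) \<in> hyp_domain" "1 + q \<noteq> 0" if "q \<in> ball 0 (1/10)" for q :: complex
  proof -
    have q: "cmod q < 1/10" using that by simp
    then have c: "cmod (1 + q) > 9/10" using norm_diff_ineq[of 1 q] by simp
    then show "1 + q \<noteq> 0" by auto
    have "cmod q < cmod (1 + q)" "0 < cmod (1 + q)" using q c by linarith+
    then have "cmod q / cmod (1 + q) < 1" by simp
    then have "q / (1 + q) \<in> ball 0 1" by (simp add: norm_divide)
    then show "q / (1 + q) \<in> hyp_domain" using ball_subset_hyp_domain by blast
  qed
  then have "(hypF \<nu> \<mu> \<circ> (\<lambda>q. q / (1 + q))) holomorphic_on ball 0 (1/10)"
    by (intro holomorphic_on_compose_gen[OF _ hypF_holomorphic] holomorphic_intros) auto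
  then show ?thesis by (simp add: o_def)
qed

lemma phi_eq_hypF_q: "phi \<nu> \<mu> t = exp (- \<mu> * t) * hypF \<nu> \<mu> (exp (-2 * t) / (1 + exp (-2 * t)))"
proof -
  have "1 / (1 + exp (2 * t)) = exp (-2 * t) / (1 + exp (-2 * t))"
    by (simp add: exp_minus field_simps)
  then show ?thesis by (simp add: phi_def)
qed

section \<open>The Wronskian in the variable q\<close>

context
  fixes \<nu> \<mu> t2 :: complex
  assumes \<nu>: "Re \<nu> \<ge> -1/2" and \<mu>: "Re \<nu> < Re \<mu>" and t2: "t2 \<in> cusp_halfplane"
begin

abbreviation "dex \<equiv> decay_exp \<nu> \<mu>"
abbreviation "gex \<equiv> growth_exp \<nu> \<mu>"

text \<open>Count of exponents: \<phi> contributes Re \<mu>, the derivative of \<open>legp\<close>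
  contributes \<open>1 - gex\<close>, and \<open>kerV\<close> contributes -1; the sum is
  \<open>dex > 0\<close>. The boundary term therefore vanishes as \<open>y\<close> tends to
  0.\<close>

lemma FB_bound:
  assumes K: "compact K" "K \<subseteq> cusp_halfplane"
  shows "\<exists>C. \<forall>t\<in>K. \<forall>y\<in>{0<..1}. cmod (FB \<nu> \<mu> t2 t y) \<le> C * y powr dex"
proof -
  obtain CV where CV: "CV \<ge> 0" "\<forall>t\<in>K. \<forall>y\<in>{0<..1}. cmod (kerV t2 t (cuspS t2 t y)) \<le> CV / y"
    using kerV_bound[OF K t2] by blast
  obtain CH where CH: "CH \<ge> 0" "\<And>z. cmod z \<le> 1/2 \<Longrightarrow> cmod (hypF \<nu> \<mu> z) \<le> CH"
    using norm_hypF_bound[of \<nu> \<mu>] by blast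
  note gd = growth_decay[OF \<nu> \<mu>]
  obtain CL where CL: "\<forall>w\<in>cusp_wedge. \<forall>t\<ge>1. cmod (deriv (legp \<nu>) (of_real t * w)) \<le> CL * t powr (gex - 1)"
    using legp_deriv_growth[OF \<nu> gd(1) compact_cusp_wedge cusp_wedge_slit] unfolding gd(3)[symmetric] by blast
  have "compact ((\<lambda>t. exp (- \<mu> * (t + t2))) ` K)" using K(1) by (intro compact_continuous_image continuous_intros)
  then obtain CE where CE: "\<And>t. t \<in> K \<Longrightarrow> cmod (exp (- \<mu> * (t + t2))) \<le> CE"
    by (meson bounded_iff compact_imp_bounded imageI)
  have "cmod (FB \<nu> \<mu> t2 t y) \<le> (\<bar>CE\<bar> * CH * (\<bar>CL\<bar> * CV)) * y powr dex" if t: "t \<in> K" and y: "y \<in> {0<..1}" for t y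
  proof -
    have tU: "t \<in> cusp_halfplane" using t K by blast
    note T = cusp_halfplaneD[OF tU] and T2 = cusp_halfplaneD[OF t2]
    have y': "y \<in> {0..1}" using y by simp
    have "cmod (phi \<nu> \<mu> (cuspS t2 t y)) = cmod (exp (- \<mu> * (t + t2))) * y powr Re \<mu> *
        cmod (hypF \<nu> \<mu> (exp (-2 * t) * exp (-2 * t2) * (of_real y)\<^sup>2 / (1 + exp (-2 * t) * exp (-2 * t2) * (of_real y)\<^sup>2)))"
      unfolding phi_cuspS[OF t2 tU y] norm_mult using y by (simp add: norm_powr_real_powr)
    also have "\<dots> \<le> \<bar>CE\<bar> * y powr Re \<mu> * CH"
    proof (intro mult_mono CH(2))
      show "cmod (exp (- \<mu> * (t + t2))) \<le> \<bar>CE\<bar>" using CE[OF t] by linarith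
      show "cmod (exp (-2 * t) * exp (-2 * t2) * (of_real y)\<^sup>2 / (1 + exp (-2 * t) * exp (-2 * t2) * (of_real y)\<^sup>2)) \<le> 1/2"
        using small_prod(5)[OF T(2) T2(2) y'] by linarith
    qed (use CH in auto)
    finally have 1: "cmod (phi \<nu> \<mu> (cuspS t2 t y)) \<le> \<bar>CE\<bar> * y powr Re \<mu> * CH" .
    have A: "cuspA t2 t y = of_real (1 / y) * ((kernel_arg (exp (-2 * t)) (exp (-2 * t2)) (of_real y) + of_real y) / 2)"
      unfolding cuspS_props(6)[OF tU t2 y] by (rule cusp_legp_arg(1)[OF T(2) T2(2) y])
    have "cmod (deriv (legp \<nu>) (cuspA t2 t y)) \<le> CL * (1 / y) powr (gex - 1)"
      unfolding A by (rule CL[rule_format]) (use kernel_arg_wedge[OF T(2) T2(2) y'] y in simp_all)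
    also have "\<dots> \<le> \<bar>CL\<bar> * (1 / y) powr (gex - 1)" by (intro mult_right_mono) auto
    also have "(1 / y) powr (gex - 1) = y powr (1 - gex)"
      using y powr_minus_divide[of y "gex - 1"] by (simp add: powr_divide)
    finally have 2: "cmod (deriv (legp \<nu>) (cuspA t2 t y)) \<le> \<bar>CL\<bar> * y powr (1 - gex)" .
    have 3: "cmod (kerV t2 t (cuspS t2 t y)) \<le> CV / y" using CV t y by blast
    have "cmod (FB \<nu> \<mu> t2 t y) \<le> (\<bar>CE\<bar> * y powr Re \<mu> * CH) * ((\<bar>CL\<bar> * y powr (1 - gex)) * (CV / y))"
      unfolding FB_def[OF t2] norm_mult using 1 2 3 CV(1) CH(1) y by (intro mult_mono) auto
    also have "\<dots> = (\<bar>CE\<bar> * CH * (\<bar>CL\<bar> * CV)) * (y powr Re \<mu> * y powr (1 - gex) * (1 / y))" by simp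
    also have "y powr Re \<mu> * y powr (1 - gex) * (1 / y) = y powr (Re \<mu> + (1 - gex) + (- 1))"
      unfolding powr_add using y by (simp add: powr_minus divide_inverse)
    also have "Re \<mu> + (1 - gex) + (- 1) = dex" using gd by simp
    finally show ?thesis .
  qed
  then show ?thesis by blast
qed

text \<open>The integral and \<phi>, stripped of their exponential factors and read in
  \<open>q\<close>; \<open>cuspE\<close> is their Wronskian in that variable.\<close>

definition "cuspH q = cusp_integral \<nu> \<mu> q (exp (-2 * t2))"
definition "cuspF q = hypF \<nu> \<mu> (q / (1 + q))"
definition "cuspE q = deriv cuspH q * cuspF q - cuspH q * deriv cuspF q"

lemma cuspH_holomorphic: "cuspH holomorphic_on ball 0 (1/10)"
  unfolding cuspH_def[abs_def] by (rule holomorphic_cusp_integral[OF \<nu> \<mu> cusp_halfplaneD(2)[OF t2]])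

lemma cuspF_holomorphic: "cuspF holomorphic_on ball 0 (1/10)"
  unfolding cuspF_def[abs_def] by (rule hypF_q_holomorphic)

text \<open>The integral and \<phi> carry exponentials in \<open>t\<close> with the same rate, so
  the derivatives of these factors cancel in the Wronskian; \<open>-2 * q\<close> is the derivative
  of \<open>q\<close>. The derivatives of the truncated integrals converge because the convergence
  is uniform on the disc.\<close>

lemma cuspW_limit:
  assumes t: "t \<in> cusp_halfplane"
  shows "(\<lambda>n. cuspW \<nu> \<mu> t2 (1 / real (Suc n)) t) \<longlonglongrightarrow> exp (- \<mu> * t2) * exp (- 2 * \<mu> * t) * (-2 * exp (-2 * t)) * cuspE (exp (-2 * t))"
proof -
  define I where "I n q = integral {1 / real (Suc n)..1} (cusp_integrand \<nu> \<mu> q (exp (-2 * t2)))" for n q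
  note T2 = cusp_halfplaneD[OF t2]
  have sub: "{1 / real (Suc n)..1} \<subseteq> {0<..1}" for n
  proof
    fix t assume "t \<in> {1 / real (Suc n)..1}"
    moreover have "0 < 1 / real (Suc n)" by simp
    ultimately show "t \<in> {0<..1}" by (meson atLeastAtMost_iff greaterThanAtMost_iff less_le_trans)
  qed
  have Ihol: "I n holomorphic_on ball 0 (1/10)" for n
    unfolding I_def[abs_def]
  proof (rule holomorphic_on_integral_param)
    show "continuous_on (ball 0 (1/10) \<times> {1 / real (Suc n)..1}) (\<lambda>(q, y). cusp_integrand \<nu> \<mu> q (exp (-2 * t2)) y)"
      by (rule continuous_on_subset[OF continuous_cusp_integrand[OF T2(2)]]) (use sub in auto)
    show "(\<lambda>q. cusp_integrand \<nu> \<mu> q (exp (-2 * t2)) y) holomorphic_on ball 0 (1/10)" if "y \<in> {1 / real (Suc n)..1}" for y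
      using holomorphic_cusp_integrand[OF T2(2)] sub that by blast
  qed auto
  have Ilim: "uniform_limit (ball 0 (1/10)) I cuspH sequentially"
    unfolding I_def[abs_def] cuspH_def[abs_def] by (rule cusp_integral_truncated_limit[OF \<nu> \<mu> T2(2)])
  have "\<exists>g'. \<forall>x\<in>ball 0 (1/10). (cuspH has_field_derivative g' x) (at x) \<and> (\<lambda>n. deriv (I n) x) \<longlonglongrightarrow> g' x"
  proof (rule has_complex_derivative_uniform_sequence[OF open_ball])
    show "(I n has_field_derivative deriv (I n) x) (at x)" if "x \<in> ball 0 (1/10)" for n x
      by (rule holomorphic_derivI[OF Ihol open_ball that])
    fix x :: complex assume "x \<in> ball 0 (1/10)"
    then obtain d where "d > 0" "cball x d \<subseteq> ball 0 (1/10)" using open_contains_cball open_ball by metis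
    then show "\<exists>d>0. cball x d \<subseteq> ball 0 (1/10) \<and> uniform_limit (cball x d) I cuspH sequentially"
      using uniform_limit_on_subset[OF Ilim] by blast
  qed
  then have dlim: "(\<lambda>n. deriv (I n) x) \<longlonglongrightarrow> deriv cuspH x" if "x \<in> ball 0 (1/10)" for x
    using that DERIV_imp_deriv by metis
  define q where "q = exp (-2 * t)"
  have q: "q \<in> ball 0 (1/10)" using cusp_halfplaneD[OF t] by (simp add: q_def)
  have Wn: "cuspW \<nu> \<mu> t2 (1 / real (Suc n)) t = exp (- \<mu> * t2) * exp (- 2 * \<mu> * t) * (-2 * q) * (deriv (I n) q * cuspF q - I n q * deriv cuspF q)" for n
  proof -
    have a: "0 < 1 / real (Suc n)" by simp
    have F0I: "integral {1 / real (Suc n)..1} (F0 \<nu> \<mu> t2 u) = exp (- \<mu> * (u + t2)) * I n (exp (-2 * u))" if u: "u \<in> cusp_halfplane" for u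
    proof -
      have "I n (exp (-2 * u)) = integral {1 / real (Suc n)..1} (\<lambda>y. exp (\<mu> * (u + t2)) * F0 \<nu> \<mu> t2 u y)"
        unfolding I_def by (rule integral_cong) (use cusp_integrand_eq_F0[OF t2 u] sub in blast)
      also have "\<dots> = exp (\<mu> * (u + t2)) * integral {1 / real (Suc n)..1} (F0 \<nu> \<mu> t2 u)" by simp
      finally have "exp (- \<mu> * (u + t2)) * I n (exp (-2 * u)) = (exp (- \<mu> * (u + t2)) * exp (\<mu> * (u + t2))) * integral {1 / real (Suc n)..1} (F0 \<nu> \<mu> t2 u)"
        by (simp only: mult.assoc)
      then show ?thesis by (simp add: exp_add[symmetric])
    qed
    have de: "((\<lambda>t. exp (-2 * t)) has_field_derivative -2 * q) (at t)" unfolding q_def by (auto intro!: derivative_eq_intros)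
    have dI: "((\<lambda>u. I n (exp (-2 * u))) has_field_derivative deriv (I n) q * (-2 * q)) (at t)"
      by (rule DERIV_chain2[OF _ de]) (use holomorphic_derivI[OF Ihol open_ball q] in \<open>simp add: q_def\<close>)
    have dF: "((\<lambda>u. cuspF (exp (-2 * u))) has_field_derivative deriv cuspF q * (-2 * q)) (at t)"
      by (rule DERIV_chain2[OF _ de]) (use holomorphic_derivI[OF cuspF_holomorphic open_ball q] in \<open>simp add: q_def\<close>)
    have ex: "((\<lambda>u. exp (- \<mu> * (u + c))) has_field_derivative - \<mu> * exp (- \<mu> * (t + c))) (at t)" for c
      by (auto intro!: derivative_eq_intros)
    have "((\<lambda>u. integral {1 / real (Suc n)..1} (F0 \<nu> \<mu> t2 u)) has_field_derivative
       (- \<mu> * exp (- \<mu> * (t + t2))) * I n q + (deriv (I n) q * (-2 * q)) * exp (- \<mu> * (t + t2))) (at t)"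
      by (rule has_field_derivative_transform_within_open[OF DERIV_mult[OF ex dI, folded q_def] open_cusp_halfplane t]) (rule F0I[symmetric])
    then have F1I: "integral {1 / real (Suc n)..1} (F1 \<nu> \<mu> t2 t) = (- \<mu> * exp (- \<mu> * (t + t2))) * I n q + (deriv (I n) q * (-2 * q)) * exp (- \<mu> * (t + t2))"
      using cusp_integral_derivs(1)[OF t2 a t] DERIV_unique by blast
    have phe: "phi \<nu> \<mu> u = exp (- \<mu> * (u + 0)) * cuspF (exp (-2 * u))" for u
      by (simp add: phi_eq_hypF_q cuspF_def)
    have "(phi \<nu> \<mu> has_field_derivative (- \<mu> * exp (- \<mu> * (t + 0))) * cuspF q + (deriv cuspF q * (-2 * q)) * exp (- \<mu> * (t + 0))) (at t)"
      unfolding phe[abs_def] by (rule DERIV_mult[OF ex dF, folded q_def])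
    then have ph1: "deriv (phi \<nu> \<mu>) t = (- \<mu> * exp (- \<mu> * t)) * cuspF q + (deriv cuspF q * (-2 * q)) * exp (- \<mu> * t)"
      using DERIV_imp_deriv by fastforce
    have ee: "exp (- \<mu> * (t + t2)) = exp (- \<mu> * t) * exp (- \<mu> * t2)" "exp (- 2 * \<mu> * t) = exp (- \<mu> * t) * exp (- \<mu> * t)"
      by (simp_all add: exp_add[symmetric] algebra_simps)
    have ph: "phi \<nu> \<mu> t = exp (- \<mu> * t) * cuspF q" by (simp add: phe q_def)
    show ?thesis
      unfolding cuspW_def[OF t2] F1I F0I[OF t] ph1 ph q_def[symmetric] ee by (simp add: algebra_simps)
  qed
  have "(\<lambda>n. I n q) \<longlonglongrightarrow> cuspH q" using Ilim q by (rule tendsto_uniform_limitI)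
  then have "(\<lambda>n. exp (- \<mu> * t2) * exp (- 2 * \<mu> * t) * (-2 * q) * (deriv (I n) q * cuspF q - I n q * deriv cuspF q)) \<longlonglongrightarrow>
     exp (- \<mu> * t2) * exp (- 2 * \<mu> * t) * (-2 * q) * (deriv cuspH q * cuspF q - cuspH q * deriv cuspF q)"
    by (intro tendsto_intros dlim q)
  then show ?thesis unfolding Wn cuspE_def q_def .
qed

text \<open>The derivative of the truncated Wronskian is of order \<open>a powr dex\<close>
  uniformly on the segment from \<open>r0\<close> to \<open>r1\<close>, so its limit takes the same
  value at both ends.\<close>

lemma cuspE_real_eq:
  assumes "r0 > ln 10 / 2" "r1 > ln 10 / 2"
  defines "L \<equiv> \<lambda>r. exp (- \<mu> * t2) * exp (- 2 * \<mu> * of_real r) * (-2 * exp (-2 * of_real r)) * cuspE (exp (-2 * of_real r))"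
  shows "L r0 = L r1"
proof -
  let ?K = "closed_segment (complex_of_real r0) (of_real r1)"
  have h: "complex_of_real r0 \<in> cusp_halfplane" "complex_of_real r1 \<in> cusp_halfplane" using assms by (auto simp: cusp_halfplane_def)
  have K: "?K \<subseteq> cusp_halfplane" using h convex_cusp_halfplane by (rule closed_segment_subset)
  have cK: "compact ?K" by (rule compact_segment)
  obtain C where C: "\<And>t y. t \<in> ?K \<Longrightarrow> y \<in> {0<..1} \<Longrightarrow> cmod (FB \<nu> \<mu> t2 t y) \<le> C * y powr dex"
    using FB_bound[OF cK K] by blast
  have "?K \<subseteq> phi_dom" using K cusp_halfplaneD(3) by blast
  then have "compact (phi \<nu> \<mu> ` ?K)"
    using cK by (intro compact_continuous_image holomorphic_on_imp_continuous_on holomorphic_on_subset[OF phi_holomorphic])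
  then obtain D where D: "\<And>t. t \<in> ?K \<Longrightarrow> cmod (phi \<nu> \<mu> t) \<le> D"
    by (meson bounded_iff compact_imp_bounded imageI)
  have D0: "D \<ge> 0" using order_trans[OF norm_ge_zero D[OF ends_in_segment(1)]] .
  have bd: "cmod (cuspW \<nu> \<mu> t2 (1 / real (Suc n)) (of_real r1) - cuspW \<nu> \<mu> t2 (1 / real (Suc n)) (of_real r0)) \<le> D * (C * (1 / real (Suc n)) powr dex) * cmod (complex_of_real r1 - of_real r0)" for n
  proof (rule field_differentiable_bound[where S = ?K and f' = "\<lambda>t. phi \<nu> \<mu> t * FB \<nu> \<mu> t2 t (1 / real (Suc n))"])
    fix t assume t: "t \<in> ?K"
    show "(cuspW \<nu> \<mu> t2 (1 / real (Suc n)) has_field_derivative phi \<nu> \<mu> t * FB \<nu> \<mu> t2 t (1 / real (Suc n))) (at t within ?K)"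
    proof -
      have "t \<in> cusp_halfplane" using t K by blast
      moreover have "0 < 1 / real (Suc n)" "1 / real (Suc n) \<le> 1" by simp_all
      ultimately show ?thesis by (intro has_field_derivative_at_within[OF cuspW_deriv[OF t2]])
    qed
    have "cmod (FB \<nu> \<mu> t2 t (1 / real (Suc n))) \<le> C * (1 / real (Suc n)) powr dex" using t by (intro C) auto
    then show "cmod (phi \<nu> \<mu> t * FB \<nu> \<mu> t2 t (1 / real (Suc n))) \<le> D * (C * (1 / real (Suc n)) powr dex)"
      unfolding norm_mult using D[OF t] D0 by (intro mult_mono) auto
  qed auto
  have lim: "(\<lambda>n. D * (C * (1 / real (Suc n)) powr dex) * cmod (complex_of_real r1 - of_real r0)) \<longlonglongrightarrow> 0"
  proof -
    have "(\<lambda>n. (1 / real (Suc n)) powr d) \<longlonglongrightarrow> 0" if "d > 0" for d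
      using that by real_asymp
    then show ?thesis
      using growth_decay(1)[OF \<nu> \<mu>] by (auto intro!: tendsto_mult_left_zero tendsto_mult_right_zero)
  qed
  have "(\<lambda>n. cuspW \<nu> \<mu> t2 (1 / real (Suc n)) (of_real r1) - cuspW \<nu> \<mu> t2 (1 / real (Suc n)) (of_real r0)) \<longlonglongrightarrow> 0"
    by (rule Lim_null_comparison[OF always_eventually[OF allI] lim]) (rule bd)
  moreover have "(\<lambda>n. cuspW \<nu> \<mu> t2 (1 / real (Suc n)) (of_real r1) - cuspW \<nu> \<mu> t2 (1 / real (Suc n)) (of_real r0)) \<longlonglongrightarrow> L r1 - L r0"
    unfolding L_def by (intro tendsto_diff cuspW_limit h)
  ultimately have "L r1 - L r0 = 0" using LIMSEQ_unique by blast
  then show ?thesis by simp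
qed

text \<open>\<open>cuspE\<close> is bounded near \<open>q = 0\<close>, so the constant Wronskian is
  at most a multiple of \<open>exp (- 2 * (Re \<mu> + 1) * r)\<close>. This tends to 0, since Re
  \<mu> > Re \<nu> \<ge> -1/2.\<close>

lemma cuspE_eq_0:
  assumes r: "r > ln 10 / 2"
  shows "cuspE (exp (-2 * of_real r)) = 0"
proof -
  define L where "L r = exp (- \<mu> * t2) * exp (- 2 * \<mu> * of_real r) * (-2 * exp (-2 * of_real r)) * cuspE (exp (-2 * of_real r))" for r :: real
  have cont: "continuous_on (cball 0 (1/20)) cuspE"
    unfolding cuspE_def[abs_def]
    by (intro holomorphic_on_imp_continuous_on holomorphic_intros holomorphic_on_subset[OF cuspH_holomorphic] holomorphic_on_subset[OF cuspF_holomorphic]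
       holomorphic_on_subset[OF holomorphic_deriv[OF cuspH_holomorphic]] holomorphic_on_subset[OF holomorphic_deriv[OF cuspF_holomorphic]]) auto
  then have "compact (cuspE ` cball 0 (1/20))" by (rule compact_continuous_image) simp
  then obtain B where B: "\<And>q. q \<in> cball 0 (1/20) \<Longrightarrow> cmod (cuspE q) \<le> B"
    by (meson bounded_iff compact_imp_bounded imageI)
  have "(L \<longlongrightarrow> 0) at_top"
  proof (rule Lim_null_comparison)
    have "\<forall>\<^sub>F r in at_top. exp (-2 * r) \<le> (1/20::real)" by real_asymp
    then show "\<forall>\<^sub>F r in at_top. cmod (L r) \<le> cmod (exp (- \<mu> * t2)) * 2 * B * exp (- 2 * (Re \<mu> + 1) * r)"
    proof eventually_elim
      case (elim r)
      have "cmod (cuspE (exp (-2 * of_real r))) \<le> B" using elim by (intro B) simp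
      then have "cmod (exp (- \<mu> * t2)) * 2 * exp (- 2 * (Re \<mu> + 1) * r) * cmod (cuspE (exp (-2 * of_real r))) \<le> cmod (exp (- \<mu> * t2)) * 2 * exp (- 2 * (Re \<mu> + 1) * r) * B"
        by (intro mult_left_mono) auto
      moreover have Lr: "cmod (L r) = cmod (exp (- \<mu> * t2)) * 2 * (exp (- 2 * Re \<mu> * r) * exp (-2 * r)) * cmod (cuspE (exp (-2 * of_real r)))"
        by (simp add: L_def norm_mult)
      moreover have ee: "exp (- 2 * Re \<mu> * r) * exp (-2 * r) = exp (- 2 * (Re \<mu> + 1) * r)"
        by (simp add: exp_add[symmetric] algebra_simps)
      ultimately show ?case unfolding Lr ee by (simp only: mult_ac)
    qed
    have "Re \<mu> + 1 > 0" using \<nu> \<mu> by simp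
    then show "((\<lambda>r. cmod (exp (- \<mu> * t2)) * 2 * B * exp (- 2 * (Re \<mu> + 1) * r)) \<longlongrightarrow> 0) at_top"
      by real_asymp
  qed
  moreover have "\<forall>\<^sub>F x in at_top. L x = L r"
    using eventually_gt_at_top[of "ln 10 / 2"]
  proof eventually_elim
    case (elim x)
    show ?case unfolding L_def by (rule cuspE_real_eq[OF elim r])
  qed
  then have "(L \<longlongrightarrow> L r) at_top" by (rule tendsto_eventually)
  ultimately have "L r = 0" using tendsto_unique trivial_limit_at_top_linorder by blast
  then show ?thesis by (simp add: L_def)
qed

text \<open>The Wronskian vanishes on a real segment, hence on the disc. Near 0, where
  \<open>cuspF\<close> has the nonzero value \<open>rGamma (1 + \<mu>)\<close>, the quotient is
  constant; the cross-multiplied form then extends over possible zeros of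
  \<open>cuspF\<close>.\<close>

lemma cuspH_proportional:
  assumes q: "q \<in> ball 0 (1/10)"
  shows "cuspH q * rGamma (1 + \<mu>) = cuspF q * cuspH 0"
proof -
  have Ehol: "cuspE holomorphic_on ball 0 (1/10)"
    unfolding cuspE_def[abs_def]
    by (intro holomorphic_intros cuspH_holomorphic cuspF_holomorphic open_ball)
  have E0: "cuspE q = 0" if "q \<in> ball 0 (1/10)" for q
  proof (rule analytic_continuation[OF Ehol open_ball connected_ball _ _ _ _ that])
    let ?U = "complex_of_real ` {0<..<1/10}"
    show "?U \<subseteq> ball 0 (1/10)" by auto
    show "(0::complex) \<in> ball 0 (1/10)" by simp
    show "(0::complex) islimpt ?U"
    proof (rule islimptI)
      fix T :: "complex set" assume "0 \<in> T" "open T"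
      then obtain e where e: "e > 0" "ball 0 e \<subseteq> T" using open_contains_ball by blast
      let ?x = "min e (1/10) / 2"
      have x: "0 < ?x" "?x < 1/10" "?x < e" using e by (auto simp: min_def)
      then have "complex_of_real ?x \<in> ?U" by (intro imageI) auto
      moreover have "cmod (complex_of_real ?x) = ?x" using x by (simp only: norm_of_real abs_of_pos)
      then have "complex_of_real ?x \<in> ball (0::complex) e" using x by (simp only: mem_ball_0)
      moreover have "complex_of_real ?x \<noteq> 0" using e by simp
      ultimately show "\<exists>y\<in>?U. y \<in> T \<and> y \<noteq> 0" using e(2) by blast
    qed
    fix z assume "z \<in> ?U"
    then obtain x where x: "z = of_real x" "0 < x" "x < 1/10" by auto
    define r where "r = - ln x / 2"
    have "ln x < ln (1/10)" using x by (subst ln_less_cancel_iff) auto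
    then have "r > ln 10 / 2" by (simp add: r_def ln_div)
    moreover have "exp (-2 * complex_of_real r) = z"
    proof -
      have "exp (-2 * complex_of_real r) = of_real (exp (-2 * r))" by (simp add: exp_of_real[symmetric])
      also have "exp (-2 * r) = x" using x by (simp add: r_def)
      finally show ?thesis using x by simp
    qed
    ultimately show "cuspE z = 0" using cuspE_eq_0 by metis
  qed
  have F0: "cuspF 0 = rGamma (1 + \<mu>)" by (simp add: cuspF_def hypF_0)
  have "Re (1 + \<mu>) > 0" using \<nu> \<mu> by simp
  then have "1 + \<mu> \<notin> \<int>\<^sub>\<le>\<^sub>0" by (rule Re_pos_not_nonpos_Int)
  then have F0n: "cuspF 0 \<noteq> 0" by (simp add: F0 rGamma_eq_zero_iff)
  have "isCont cuspF 0"
    using cuspF_holomorphic by (metis centre_in_ball continuous_on_eq_continuous_at holomorphic_on_imp_continuous_on open_ball zero_less_divide_1_iff zero_less_numeral)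
  then have "\<forall>\<^sub>F z in at 0. cuspF z \<noteq> 0"
    using F0n by (intro tendsto_imp_eventually_ne[of cuspF "cuspF 0"]) (simp add: isCont_def)
  then obtain r0 where r0: "r0 > 0" "\<And>z. z \<noteq> 0 \<Longrightarrow> dist z 0 < r0 \<Longrightarrow> cuspF z \<noteq> 0"
    by (auto simp: eventually_at)
  define r where "r = min r0 (1/10)"
  have r: "r > 0" "r \<le> 1/10" using r0 by (auto simp: r_def)
  have Fn: "cuspF z \<noteq> 0" if "z \<in> ball 0 r" for z
    using r0(2)[of z] that F0n by (cases "z = 0") (auto simp: r_def)
  have sub: "ball 0 r \<subseteq> ball (0::complex) (1/10)" using r by auto
  have "\<exists>c. \<forall>z\<in>ball 0 r. cuspH z / cuspF z = c"
  proof (rule has_field_derivative_zero_constant)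
    fix z assume z: "z \<in> ball (0::complex) r"
    then have z': "z \<in> ball 0 (1/10)" using sub by blast
    have "((\<lambda>z. cuspH z / cuspF z) has_field_derivative (deriv cuspH z * cuspF z - cuspH z * deriv cuspF z) / (cuspF z * cuspF z)) (at z)"
      by (intro DERIV_divide holomorphic_derivI[OF cuspH_holomorphic open_ball z'] holomorphic_derivI[OF cuspF_holomorphic open_ball z'] Fn[OF z])
    then show "((\<lambda>z. cuspH z / cuspF z) has_field_derivative 0) (at z within ball 0 r)"
      using E0[OF z'] unfolding cuspE_def by (simp only: div_0 has_field_derivative_at_within)
  qed simp
  then obtain c where c: "\<And>z. z \<in> ball 0 r \<Longrightarrow> cuspH z / cuspF z = c" by blast
  have small: "cuspH z * cuspF 0 = cuspF z * cuspH 0" if "z \<in> ball 0 r" for z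
    using c[OF that] c[of 0] Fn[OF that] F0n r by (simp add: field_simps)
  have "cuspH q * cuspF 0 = cuspF q * cuspH 0"
    by (rule analytic_continuation_open[of "ball 0 r" "ball 0 (1/10)" "\<lambda>q. cuspH q * cuspF 0" "\<lambda>q. cuspF q * cuspH 0" q])
      (use r sub q small in \<open>auto intro!: holomorphic_intros cuspH_holomorphic cuspF_holomorphic\<close>)
  then show ?thesis unfolding F0 .
qed

end

text \<open>
  Since \<open>cusp_integral\<close> is symmetric, proportionality to \<open>hypF\<close> in each variable leaves only a
  constant, which is read off at the cusp \<open>q\<^sub>1 = q\<^sub>2 = 0\<close>.
\<close>
lemma cusp_product_formula:
  assumes \<nu>: "Re \<nu> \<ge> -1/2" and \<mu>: "Re \<nu> < Re \<mu>"
    and q1: "0 < q1" "q1 < 1/10" and q2: "0 < q2" "q2 < (1/10 :: real)"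
  shows "product_const \<nu> \<mu> * cusp_integral \<nu> \<mu> (of_real q1) (of_real q2) =
     hypF \<nu> \<mu> (of_real q1 / (1 + of_real q1)) * hypF \<nu> \<mu> (of_real q2 / (1 + of_real q2))"
proof -
  define H where "H x y = cusp_integral \<nu> \<mu> (complex_of_real x) (of_real y)" for x y
  define F where "F x = hypF \<nu> \<mu> (complex_of_real x / (1 + of_real x))" for x
  define g where "g = rGamma (1 + \<mu>)"
  have propt: "H x y * g = F x * H 0 y" if "0 \<le> x" "x < 1/10" "0 < y" "y < 1/10" for x y
  proof -
    define r where "r = - ln y / 2"
    have "ln y < ln (1/10)" using that by (subst ln_less_cancel_iff) auto
    then have r: "complex_of_real r \<in> cusp_halfplane" by (simp add: r_def ln_div cusp_halfplane_def)
    have e: "exp (-2 * complex_of_real r) = of_real y"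
    proof -
      have "exp (-2 * complex_of_real r) = of_real (exp (-2 * r))" by (simp add: exp_of_real[symmetric])
      also have "exp (-2 * r) = y" using that by (simp add: r_def)
      finally show ?thesis .
    qed
    show ?thesis
      using cuspH_proportional[OF \<nu> \<mu> r, of "of_real x"] that
      unfolding cuspH_def[OF \<nu> \<mu> r] cuspF_def[OF \<nu> \<mu> r] e H_def F_def g_def by simp
  qed
  have sym: "H x y = H y x" for x y unfolding H_def by (rule cusp_integral_commute)
  \<comment> \<open>\<open>propt\<close> requires its second variable positive, that is, a finite
    \<open>t2\<close>. The value at the cusp is reached by symmetry and the limit of
    \<open>x\<close> to 0.\<close>
  have cross: "F x * H y 0 = F y * H x 0" if "0 < x" "x < 1/10" "0 < y" "y < 1/10" for x y
    using propt[of x y] propt[of y x] that sym by (metis less_imp_le)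
  have lim0: "((\<lambda>x. complex_of_real x) \<longlongrightarrow> of_real 0) (at_right 0)"
    by (intro tendsto_intros)
  have cH: "((\<lambda>x. H x 0) \<longlongrightarrow> H 0 0) (at_right 0)"
  proof -
    have "(\<lambda>q. cusp_integral \<nu> \<mu> q 0) holomorphic_on ball 0 (1/10)" by (rule holomorphic_cusp_integral[OF \<nu> \<mu>]) simp
    then have "isCont (\<lambda>q. cusp_integral \<nu> \<mu> q 0) 0"
      by (metis centre_in_ball continuous_on_eq_continuous_at holomorphic_on_imp_continuous_on open_ball zero_less_divide_1_iff zero_less_numeral)
    then show ?thesis using isCont_tendsto_compose[OF _ lim0] by (simp add: H_def)
  qed
  have cF: "(F \<longlongrightarrow> F 0) (at_right 0)"
  proof -
    have "isCont (\<lambda>q. hypF \<nu> \<mu> (q / (1 + q))) 0"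
      using hypF_q_holomorphic by (metis centre_in_ball continuous_on_eq_continuous_at holomorphic_on_imp_continuous_on open_ball zero_less_divide_1_iff zero_less_numeral)
    then have "((\<lambda>x. hypF \<nu> \<mu> (complex_of_real x / (1 + of_real x))) \<longlongrightarrow> hypF \<nu> \<mu> (0 / (1 + 0))) (at_right 0)"
      using lim0 by (intro isCont_tendsto_compose[of 0 "\<lambda>q. hypF \<nu> \<mu> (q / (1 + q))"]) simp_all
    then show ?thesis unfolding F_def[abs_def] by simp
  qed
  have F0: "F 0 = g" by (simp add: F_def g_def hypF_0)
  have "((\<lambda>x. F x * H q2 0) \<longlongrightarrow> F 0 * H q2 0) (at_right 0)" by (intro tendsto_intros cF)
  moreover have "((\<lambda>x. F q2 * H x 0) \<longlongrightarrow> F q2 * H 0 0) (at_right 0)" by (intro tendsto_intros cH)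
  moreover have "\<forall>\<^sub>F x in at_right 0. F x * H q2 0 = F q2 * H x 0"
    unfolding eventually_at_right_field using cross q2 by (intro exI[of _ "1/10"]) auto
  ultimately have "((\<lambda>x. F x * H q2 0) \<longlongrightarrow> F q2 * H 0 0) (at_right 0)" by (subst tendsto_cong)
  then have e: "F 0 * H q2 0 = F q2 * H 0 0"
    using \<open>((\<lambda>x. F x * H q2 0) \<longlongrightarrow> F 0 * H q2 0) (at_right 0)\<close> by (intro tendsto_unique[OF trivial_limit_at_right_real])
  have H00: "H 0 0 = g * legendre_mellin \<nu> \<mu>" unfolding H_def g_def of_real_0 by (rule cusp_integral_0)
  have "g * H 0 q2 = F q2 * (g * legendre_mellin \<nu> \<mu>)"
    using e unfolding F0 H00 sym[of q2 0] .
  moreover have "Re (1 + \<mu>) > 0" using \<nu> \<mu> by simp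
  then have "1 + \<mu> \<notin> \<int>\<^sub>\<le>\<^sub>0" by (rule Re_pos_not_nonpos_Int)
  then have gn: "g \<noteq> 0" by (simp add: g_def rGamma_eq_zero_iff)
  ultimately have "H 0 q2 = F q2 * legendre_mellin \<nu> \<mu>" by simp
  then have "product_const \<nu> \<mu> * (H q1 q2 * g) = F q1 * F q2 * (product_const \<nu> \<mu> * legendre_mellin \<nu> \<mu>)"
    using propt[of q1 q2] q1 q2 by simp
  also have "\<dots> = F q1 * F q2 * g" using product_const_mellin[OF \<nu> \<mu>] by (simp add: g_def)
  finally show ?thesis using gn by (simp add: H_def F_def mult.assoc[symmetric])
qed

section \<open>The Legendre argument along the segment\<close>

lemma Re_cosh: "Re (cosh z) = cosh (Re z) * cos (Im z)"
  by (simp add: cosh_def Re_exp algebra_simps)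

lemma Im_cosh: "Im (cosh z) = sinh (Re z) * sin (Im z)"
  by (simp add: cosh_def sinh_def Im_exp algebra_simps)

text \<open>The scaled Joukowski map: it sends the ray of argument \<open>b\<close> to the branch of
  the hyperbola with semi-axes \<open>s * cos b\<close> and \<open>s * sin b\<close>. The cone
  condition says that the argument of \<open>r\<close> is at most \<open>b\<close> in modulus, and
  the conclusion that the image lies inside the branch.\<close>

lemma hyperbola_region_intro:
  fixes r :: complex and s b :: real
  assumes r: "Re r > 0" and cone: "(Im r)\<^sup>2 * (cos b)\<^sup>2 \<le> (Re r)\<^sup>2 * (sin b)\<^sup>2"
    and b: "0 < b" "b < pi / 2"
  defines "z \<equiv> (r + (of_real s)\<^sup>2 / r) / 2"
  shows "cos b * cmod (Complex (s * sin b) (Im z)) \<le> Re z * sin b"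
proof -
  define x y where "x = Re r" "y = Im r"
  define \<rho> where "\<rho> = x\<^sup>2 + y\<^sup>2"
  have x: "x > 0" using r by (simp add: x_y_def)
  have \<rho>: "\<rho> > 0" using x by (simp add: \<rho>_def add_pos_nonneg)
  define k where "k = s\<^sup>2 / \<rho>"
  have k: "k \<ge> 0" using \<rho> by (simp add: k_def)
  have z: "Re z = x * (1 + k) / 2" "Im z = y * (1 - k) / 2"
    using \<rho> by (simp_all add: z_def k_def x_y_def \<rho>_def Re_divide Im_divide field_simps flip: of_real_power)
  have sc: "(sin b)\<^sup>2 = 1 - (cos b)\<^sup>2" by (rule sin_squared_eq)
  have c: "y\<^sup>2 * (cos b)\<^sup>2 \<le> x\<^sup>2 * (sin b)\<^sup>2" using cone by (simp add: x_y_def)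
  then have c2: "(cos b)\<^sup>2 * \<rho> \<le> x\<^sup>2" unfolding sc \<rho>_def by (simp add: algebra_simps)
  have pos: "cos b > 0" "sin b > 0" using b by (auto intro!: cos_gt_zero_pi sin_gt_zero)
  have "(cos b)\<^sup>2 * (s\<^sup>2 * (sin b)\<^sup>2 + (Im z)\<^sup>2) \<le> (Re z)\<^sup>2 * (sin b)\<^sup>2"
  proof -
    have "(1 - k)\<^sup>2 / 4 * (x\<^sup>2 * (sin b)\<^sup>2 - y\<^sup>2 * (cos b)\<^sup>2) + (sin b)\<^sup>2 * k * (x\<^sup>2 - (cos b)\<^sup>2 * \<rho>) \<ge> 0"
      using c c2 k by (intro add_nonneg_nonneg mult_nonneg_nonneg) auto
    moreover have "s\<^sup>2 = k * \<rho>" using \<rho> by (simp add: k_def)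
    ultimately show ?thesis unfolding z by (simp add: power2_eq_square field_simps)
  qed
  then have "(cos b * cmod (Complex (s * sin b) (Im z)))\<^sup>2 \<le> (Re z * sin b)\<^sup>2"
    by (simp add: power_mult_distrib cmod_power2)
  moreover have "0 \<le> Re z * sin b" unfolding z using x k pos by simp
  ultimately show ?thesis by (rule power2_le_imp_le)
qed

text \<open>The region consists of the values of \<open>cosh\<close> at points with
  \<open>\<bar>Im\<bar> \<le> b\<close>. Now \<open>- cosh d\<close> is \<open>cosh\<close> at
  \<open>d\<close> shifted by \<open>\<i> * pi\<close> towards the real axis or past it, and the
  shifted point has imaginary part larger than \<open>b\<close> in modulus.\<close>

lemma not_in_hyperbola_region:
  assumes b: "0 < b" "b < pi / 2" and d: "\<bar>Im d\<bar> < pi - b"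
  shows "\<not> cos b * cmod (Complex (sin b) (Im (- cosh d))) \<le> Re (- cosh d) * sin b"
proof
  assume *: "cos b * cmod (Complex (sin b) (Im (- cosh d))) \<le> Re (- cosh d) * sin b"
  define u v where "u = Re d" "v = Im d"
  have e: "Re (cosh d) = cosh u * cos v" "Im (cosh d) = sinh u * sin v"
    by (simp_all add: u_v_def Re_cosh Im_cosh)
  have pos: "cos b > 0" "sin b > 0" using b by (auto intro!: cos_gt_zero_pi sin_gt_zero)
  have "0 < cos b * cmod (Complex (sin b) (Im (- cosh d)))"
    using pos by (intro mult_pos_pos) (auto simp: complex_eq_iff)
  then have "0 < Re (- cosh d) * sin b" using * by linarith
  then have cv: "cos v < 0" using pos cosh_real_pos[of u] by (simp add: e zero_less_mult_iff mult_less_0_iff del: cosh_real_pos)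
  have "(cos b * cmod (Complex (sin b) (Im (- cosh d))))\<^sup>2 \<le> (Re (- cosh d) * sin b)\<^sup>2"
    using * pos by (intro power_mono) auto
  then have "(cos b)\<^sup>2 * ((sin b)\<^sup>2 + (sinh u)\<^sup>2 * (sin v)\<^sup>2) \<le> (cosh u)\<^sup>2 * (cos v)\<^sup>2 * (sin b)\<^sup>2"
    by (simp add: power_mult_distrib cmod_power2 e)
  then have "0 \<le> ((cos v)\<^sup>2 - (cos b)\<^sup>2) * ((sin b)\<^sup>2 + (sinh u)\<^sup>2)"
    unfolding sin_squared_eq cosh_square_eq by (simp add: algebra_simps)
  moreover have "(sin b)\<^sup>2 + (sinh u)\<^sup>2 > 0" using pos by (simp add: add_pos_nonneg)
  ultimately have "(cos b)\<^sup>2 \<le> (cos v)\<^sup>2" by (simp add: zero_le_mult_iff)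
  then have "cos b \<le> - cos v" using pos cv by (metis abs_le_square_iff abs_of_neg abs_of_pos)
  moreover have "cos (pi - b) < cos \<bar>v\<bar>" using b d by (intro cos_monotone_0_pi) (auto simp: u_v_def)
  ultimately show False by simp
qed

text \<open>
  If the quotient were \<open>-k\<close> with \<open>k \<ge> 0\<close>, then \<open>-D\<close> would be a combination \<open>\<alpha> c + \<beta> S\<close> with
  \<open>\<alpha>, \<beta> \<ge> 0\<close> and \<open>\<alpha> s + \<beta> \<ge> 1\<close>, and hence lie in the convex region
  \<open>cos b \<bar>sin b + \<i> Im z\<bar> \<le> sin b Re z\<close>, one side of a branch of a hyperbola.
\<close>
lemma wedge_not_nonpos:
  fixes c S D :: complex
  assumes b: "0 < b" "b < pi / 2" and s: "0 \<le> s"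
    and c: "cos b * cmod (Complex (s * sin b) (Im c)) \<le> Re c * sin b" "c \<noteq> 0"
    and S: "cos b * cmod (Complex (sin b) (Im S)) \<le> Re S * sin b"
    and D: "\<not> cos b * cmod (Complex (sin b) (Im (- D))) \<le> Re (- D) * sin b"
    and SD: "S + D \<noteq> 0"
  shows "(c + of_real s * S) * (c + of_real s * D) / (c * (S + D)) \<notin> \<real>\<^sub>\<le>\<^sub>0"
proof
  assume "(c + of_real s * S) * (c + of_real s * D) / (c * (S + D)) \<in> \<real>\<^sub>\<le>\<^sub>0"
  then obtain k0 where k0: "(c + of_real s * S) * (c + of_real s * D) / (c * (S + D)) = of_real k0" "k0 \<le> 0"
    by (auto elim: nonpos_Reals_cases)
  define m where "m = s - k0"
  have m: "m \<ge> s" using k0 by (simp add: m_def)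
  have pos: "cos b > 0" "sin b > 0" using b by (auto intro!: cos_gt_zero_pi sin_gt_zero)
  have "(c + of_real s * S) * (c + of_real s * D) = of_real k0 * (c * (S + D))"
    using k0(1) c(2) SD by (subst (asm) nonzero_divide_eq_eq) auto
  then have eq: "- D * (of_real m * c + of_real (s\<^sup>2) * S) = c * (c + of_real m * S)"
    unfolding m_def by (simp add: algebra_simps power2_eq_square)
  define d where "d = of_real m * c + of_real (s\<^sup>2) * S"
  have ReS: "Re S > 0"
  proof -
    have "0 < cos b * cmod (Complex (sin b) (Im S))" using pos by (intro mult_pos_pos) (auto simp: complex_eq_iff)
    then have "0 < Re S * sin b" using S by linarith
    then show ?thesis using pos by (simp add: zero_less_mult_iff)
  qed
  have Rec: "Re c > 0"
  proof -
    have "0 \<le> cos b * cmod (Complex (s * sin b) (Im c))" using pos by simp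
    then have "0 \<le> Re c" using c(1) pos by (smt (verit, best) mult_neg_pos)
    moreover have "Re c \<noteq> 0"
    proof
      assume "Re c = 0"
      then have "cmod (Complex (s * sin b) (Im c)) \<le> 0" using c(1) pos by (simp add: mult_le_0_iff)
      then have "Im c = 0" by (simp add: complex_eq_iff)
      then show False using \<open>Re c = 0\<close> c(2) by (simp add: complex_eq_iff)
    qed
    ultimately show ?thesis by simp
  qed
  have m0: "m > 0"
  proof (rule ccontr)
    assume "\<not> m > 0"
    then have "m = 0" "s = 0" using m s by auto
    then show False using eq c(2) by simp
  qed
  have "Re d > 0" unfolding d_def using ReS Rec m0 by (simp add: add_pos_nonneg)
  then have d0: "(cmod d)\<^sup>2 > 0" by auto
  define h where "h = Re (c * cnj S)"
  \<comment> \<open>The coefficients of \<open>c\<close> and \<open>S\<close> after expanding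
    \<open>c * (c + m * S) * cnj d\<close> with
    \<open>c * cnj S = 2 * h - cnj c * S\<close>.\<close>
  define \<alpha> where "\<alpha> = (m * (cmod c)\<^sup>2 + 2 * s\<^sup>2 * h + m * s\<^sup>2 * (cmod S)\<^sup>2) / (cmod d)\<^sup>2"
  define \<beta> where "\<beta> = (cmod c)\<^sup>2 * (m\<^sup>2 - s\<^sup>2) / (cmod d)\<^sup>2"
  have d2: "(cmod d)\<^sup>2 = m\<^sup>2 * (cmod c)\<^sup>2 + s ^ 4 * (cmod S)\<^sup>2 + 2 * m * s\<^sup>2 * h"
    unfolding d_def h_def cmod_power2 by (simp add: power2_eq_square algebra_simps power4_eq_xxxx)
  have h: "\<bar>h\<bar> \<le> cmod c * cmod S" unfolding h_def by (metis abs_Re_le_cmod complex_mod_cnj norm_mult)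
  have \<alpha>: "\<alpha> \<ge> 0"
  proof -
    have "0 \<le> m * (cmod c - s * cmod S)\<^sup>2 + 2 * s * (m - s) * (cmod c * cmod S) + 2 * s\<^sup>2 * (h + cmod c * cmod S)"
    proof -
      have "h + cmod c * cmod S \<ge> 0" using h by linarith
      then show ?thesis using m0 m s by simp
    qed
    also have "\<dots> = m * (cmod c)\<^sup>2 + 2 * s\<^sup>2 * h + m * s\<^sup>2 * (cmod S)\<^sup>2"
      by (simp add: power2_eq_square algebra_simps)
    finally show ?thesis unfolding \<alpha>_def by simp
  qed
  have "s\<^sup>2 \<le> m\<^sup>2" using m s by (intro power_mono) auto
  then have \<beta>: "\<beta> \<ge> 0" unfolding \<beta>_def by simp
  \<comment> \<open>The excess over 1 is
    \<open>s * (m - s) * (cmod (c - s * S))^2 / (cmod d)^2\<close>.\<close>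
  have ab: "\<alpha> * s + \<beta> \<ge> 1"
  proof -
    have "(cmod (c - of_real s * S))\<^sup>2 = (cmod c)\<^sup>2 + s\<^sup>2 * (cmod S)\<^sup>2 - 2 * s * h"
      unfolding h_def cmod_power2 by (simp add: power2_eq_square algebra_simps)
    moreover have "0 \<le> s * (m - s) * (cmod (c - of_real s * S))\<^sup>2" using m s by simp
    ultimately have "0 \<le> s * (m - s) * ((cmod c)\<^sup>2 + s\<^sup>2 * (cmod S)\<^sup>2 - 2 * s * h)" by (simp only:)
    then have "(cmod d)\<^sup>2 \<le> (m * (cmod c)\<^sup>2 + 2 * s\<^sup>2 * h + m * s\<^sup>2 * (cmod S)\<^sup>2) * s + (cmod c)\<^sup>2 * (m\<^sup>2 - s\<^sup>2)"
      unfolding d2 by (simp add: algebra_simps power2_eq_square power4_eq_xxxx)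
    then show ?thesis using d0 unfolding \<alpha>_def \<beta>_def by (simp add: divide_simps)
  qed
  have "- D = of_real \<alpha> * c + of_real \<beta> * S"
  proof -
    have "- D * of_real ((cmod d)\<^sup>2) = - D * d * cnj d" unfolding complex_norm_square by (simp add: mult.assoc)
    also have "\<dots> = c * (c + of_real m * S) * cnj d" using eq by (simp add: d_def)
    also have "\<dots> = of_real (m * (cmod c)\<^sup>2 + 2 * s\<^sup>2 * h + m * s\<^sup>2 * (cmod S)\<^sup>2) * c + of_real ((cmod c)\<^sup>2 * (m\<^sup>2 - s\<^sup>2)) * S"
      unfolding d_def h_def cmod_power2 complex_eq_iff
      by (simp add: power2_eq_square algebra_simps)
    finally show ?thesis using d0 by (simp add: \<alpha>_def \<beta>_def field_simps)
  qed
  then have z: "Re (- D) = \<alpha> * Re c + \<beta> * Re S" "Im (- D) = \<alpha> * Im c + \<beta> * Im S" by (auto simp: complex_eq_iff)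
  have "cmod (Complex (sin b) (Im (- D))) \<le> cmod (Complex ((\<alpha> * s + \<beta>) * sin b) (Im (- D)))"
  proof -
    have "(sin b)\<^sup>2 \<le> ((\<alpha> * s + \<beta>) * sin b)\<^sup>2"
      using ab pos by (intro power_mono) auto
    then show ?thesis by (simp add: cmod_def)
  qed
  also have "Complex ((\<alpha> * s + \<beta>) * sin b) (Im (- D)) = of_real \<alpha> * Complex (s * sin b) (Im c) + of_real \<beta> * Complex (sin b) (Im S)"
    unfolding z by (simp add: complex_eq_iff algebra_simps)
  also have "cmod \<dots> \<le> \<alpha> * cmod (Complex (s * sin b) (Im c)) + \<beta> * cmod (Complex (sin b) (Im S))"
    using \<alpha> \<beta> by (intro order_trans[OF norm_triangle_ineq]) (simp add: norm_mult)
  finally have "cos b * cmod (Complex (sin b) (Im (- D))) \<le> cos b * (\<alpha> * cmod (Complex (s * sin b) (Im c)) + \<beta> * cmod (Complex (sin b) (Im S)))"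
    using pos by (intro mult_left_mono) auto
  also have "\<dots> = \<alpha> * (cos b * cmod (Complex (s * sin b) (Im c))) + \<beta> * (cos b * cmod (Complex (sin b) (Im S)))"
    by (simp add: algebra_simps)
  also have "\<dots> \<le> \<alpha> * (Re c * sin b) + \<beta> * (Re S * sin b)"
    using \<alpha> \<beta> c(1) S by (intro add_mono mult_left_mono)
  also have "\<dots> = Re (- D) * sin b" unfolding z by (simp add: algebra_simps)
  finally show False using D by simp
qed

text \<open>
  On the segment, \<open>x\<^sub>3 = 1 - 2 y / (1 + e\<^sup>2\<^sup>\<sigma>)\<close> and \<open>cosh t\<^sub>3 = line_cosh \<sigma> y / \<surd>y\<close> with \<open>\<sigma> = t\<^sub>1 + t\<^sub>2\<close>; the factor
  \<open>1 / \<surd>y\<close> is split off because the rest is continuous up to the end point \<open>y = 0\<close>.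
\<close>
definition line_cosh :: "complex \<Rightarrow> real \<Rightarrow> complex" where
  "line_cosh \<sigma> y = (1 + exp (2 * \<sigma>)) / (2 * csqrt (exp (2 * \<sigma>) + 1 - of_real y))"

lemma exp_strip_not_nonpos:
  assumes "\<bar>Im \<sigma>\<bar> < pi / 2"
  shows "exp (2 * \<sigma>) \<notin> \<real>\<^sub>\<le>\<^sub>0"
proof -
  have "Re (exp \<sigma>) > 0" using assms by (simp add: Re_exp cos_gt_zero_pi)
  then have "exp \<sigma> ^ 2 \<notin> \<real>\<^sub>\<le>\<^sub>0"
    by (auto elim!: nonpos_Reals_cases simp: complex_eq_iff power2_eq_square mult_le_0_iff sum_squares_gt_zero_iff not_less[symmetric])
  then show ?thesis by (simp add: exp_double)
qed

lemma line_radicand_not_nonpos: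
  assumes "\<bar>Im \<sigma>\<bar> < pi / 2" "y \<le> 1"
  shows "exp (2 * \<sigma>) + 1 - of_real y \<notin> \<real>\<^sub>\<le>\<^sub>0"
proof
  assume "exp (2 * \<sigma>) + 1 - of_real y \<in> \<real>\<^sub>\<le>\<^sub>0"
  then obtain r where "exp (2 * \<sigma>) + 1 - of_real y = of_real r" "r \<le> 0" by (auto elim: nonpos_Reals_cases)
  then have "exp (2 * \<sigma>) = of_real (r + y - 1)" "r + y - 1 \<le> 0" using assms by (auto simp: algebra_simps)
  then show False using exp_strip_not_nonpos[OF assms(1)] by (metis nonpos_Reals_of_real_iff)
qed

text \<open>An angle \<open>b\<close> is chosen so that \<open>cosh (t1 + t2)\<close> and
  \<open>c\<close> lie in the hyperbola regions of opening \<open>b\<close> while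
  \<open>- cosh (t1 - t2)\<close> does not; then \<open>wedge_not_nonpos\<close> applies. The first
  is a Joukowski value at \<open>exp (t1 + t2)\<close> with scale 1, and \<open>c\<close> is one at
  the root \<open>r\<close> of \<open>exp (2 * \<sigma>) + 1 - y\<close> with scale
  \<open>sqrt y\<close>.\<close>

lemma line_kernel_not_nonpos:
  assumes t: "\<bar>Im t1\<bar> < pi / 2" "\<bar>Im t2\<bar> < pi / 2" "\<bar>Im (t1 + t2)\<bar> < pi / 2" and y: "0 \<le> y" "y \<le> 1"
  defines "c \<equiv> line_cosh (t1 + t2) y"
  shows "(c + of_real (sqrt y) * cosh (t1 + t2)) * (c + of_real (sqrt y) * cosh (t1 - t2)) / (c * (cosh (t1 + t2) + cosh (t1 - t2))) \<notin> \<real>\<^sub>\<le>\<^sub>0"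
proof -
  define \<sigma> where "\<sigma> = t1 + t2"
  define P where "P = exp (2 * \<sigma>)"
  \<comment> \<open>The interval for \<open>b\<close> is nonempty:
    \<open>\<bar>Im (t1 + t2)\<bar> + \<bar>Im (t1 - t2)\<bar>\<close> is twice the larger of
    \<open>\<bar>Im t1\<bar>\<close> and \<open>\<bar>Im t2\<bar>\<close>, hence less than
    \<open>pi\<close>.\<close>
  have "max 0 \<bar>Im \<sigma>\<bar> < min (pi / 2) (pi - \<bar>Im (t1 - t2)\<bar>)"
    using t unfolding \<sigma>_def by (auto simp: abs_if split: if_splits)
  then obtain b where b': "max 0 \<bar>Im \<sigma>\<bar> < b" "b < min (pi / 2) (pi - \<bar>Im (t1 - t2)\<bar>)" using dense by blast
  then have b: "0 < b" "b < pi / 2" "\<bar>Im \<sigma>\<bar> < b" "\<bar>Im (t1 - t2)\<bar> < pi - b" by auto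
  have pos: "cos b > 0" "sin b > 0" using b by (auto intro!: cos_gt_zero_pi sin_gt_zero)
  define w where "w = P + 1 - of_real y"
  define r where "r = csqrt w"
  have w: "w \<notin> \<real>\<^sub>\<le>\<^sub>0" unfolding w_def P_def using line_radicand_not_nonpos t y \<sigma>_def by blast
  have r: "Re r > 0" "r\<^sup>2 = w" "r \<noteq> 0" unfolding r_def using Re_csqrt_pos[OF w] w by auto
  have rw: "Re w = (Re r)\<^sup>2 - (Im r)\<^sup>2" "cmod w = (Re r)\<^sup>2 + (Im r)\<^sup>2"
    unfolding r(2)[symmetric] by (simp_all add: norm_power cmod_power2 Re_power2)
  have P2: "Re P = cmod P * cos (2 * Im \<sigma>)" by (simp add: P_def Re_exp)
  have "cos (2 * b) \<le> cos \<bar>2 * Im \<sigma>\<bar>" using b by (intro cos_monotone_0_pi_le) auto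
  then have P1: "cmod P * cos (2 * b) \<le> Re P" unfolding P2 by (intro mult_left_mono) auto
  \<comment> \<open>\<open>w\<close> is \<open>P\<close> plus the nonnegative number
    \<open>1 - y\<close>, so it stays in the sector of half-angle \<open>2 * b\<close> that contains
    \<open>P\<close>. The sector need not be convex, so the sign of \<open>cos (2 * b)\<close>
    decides which triangle inequality is used.\<close>
  have cone0: "cos (2 * b) * cmod w \<le> Re w"
  proof (cases "cos (2 * b) \<ge> 0")
    case True
    have "cmod w \<le> cmod P + (1 - y)" unfolding w_def using y norm_triangle_ineq[of P "of_real (1 - y)"] by (simp only: norm_of_real) (simp add: add_diff_eq)
    then have "cos (2 * b) * cmod w \<le> cos (2 * b) * (cmod P + (1 - y))" using True by (intro mult_left_mono)
    also have "\<dots> \<le> Re P + (1 - y)" using P1 y mult_right_mono[OF cos_le_one[of "2*b"], of "1 - y"] by (simp add: algebra_simps)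
    finally show ?thesis by (simp add: w_def)
  next
    case False
    have "cmod P - (1 - y) \<le> cmod w" unfolding w_def using y norm_diff_ineq[of P "of_real (1 - y)"] by (simp only: norm_of_real) (simp add: add_diff_eq)
    then have "cos (2 * b) * cmod w \<le> cos (2 * b) * (cmod P - (1 - y))" using False by (intro mult_left_mono_neg) auto
    also have "\<dots> \<le> Re P + (1 - y)" using P1 y mult_right_mono[OF cos_ge_minus_one[of "2*b"], of "1 - y"] by (simp add: algebra_simps)
    finally show ?thesis by (simp add: w_def)
  qed
  have cone: "(Im r)\<^sup>2 * (cos b)\<^sup>2 \<le> (Re r)\<^sup>2 * (sin b)\<^sup>2"
    using cone0 unfolding rw cos_double sin_squared_eq by (simp add: algebra_simps)
  have cr: "c = (r + (of_real (sqrt y))\<^sup>2 / r) / 2"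
  proof -
    have "(of_real (sqrt y))\<^sup>2 = complex_of_real y" using y by (simp flip: of_real_power)
    moreover have "c = (w + of_real y) / (2 * r)" by (simp add: c_def line_cosh_def r_def w_def P_def \<sigma>_def)
    ultimately show ?thesis using r(3) unfolding r(2)[symmetric] by (simp add: field_simps power2_eq_square)
  qed
  have c1: "cos b * cmod (Complex (sqrt y * sin b) (Im c)) \<le> Re c * sin b"
    unfolding cr by (rule hyperbola_region_intro[OF r(1) cone b(1,2)])
  have c0: "c \<noteq> 0"
  proof -
    have "1 + P \<noteq> 0" using line_radicand_not_nonpos[of \<sigma> 0] t by (auto simp: P_def \<sigma>_def add.commute)
    then show ?thesis using r(3) by (simp add: c_def line_cosh_def r_def w_def P_def \<sigma>_def)
  qed
  have S: "cos b * cmod (Complex (sin b) (Im (cosh \<sigma>))) \<le> Re (cosh \<sigma>) * sin b"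
  proof -
    have "(sin (Im \<sigma>))\<^sup>2 \<le> (sin b)\<^sup>2"
    proof -
      have "cos b \<le> cos \<bar>Im \<sigma>\<bar>" using b by (intro cos_monotone_0_pi_le) auto
      then have "(cos b)\<^sup>2 \<le> (cos (Im \<sigma>))\<^sup>2" using pos by (intro power_mono) auto
      then show ?thesis by (simp add: sin_squared_eq)
    qed
    then have "(exp (Re \<sigma>))\<^sup>2 * ((sin (Im \<sigma>))\<^sup>2 * (cos b)\<^sup>2) \<le> (exp (Re \<sigma>))\<^sup>2 * ((cos (Im \<sigma>))\<^sup>2 * (sin b)\<^sup>2)"
      unfolding cos_squared_eq by (intro mult_left_mono) (auto simp: algebra_simps)
    then have "(Im (exp \<sigma>))\<^sup>2 * (cos b)\<^sup>2 \<le> (Re (exp \<sigma>))\<^sup>2 * (sin b)\<^sup>2"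
      by (simp add: Im_exp Re_exp power_mult_distrib mult.assoc)
    moreover have "Re (exp \<sigma>) > 0" using b by (simp add: Re_exp cos_gt_zero_pi)
    ultimately have "cos b * cmod (Complex (1 * sin b) (Im ((exp \<sigma> + (of_real 1)\<^sup>2 / exp \<sigma>) / 2))) \<le> Re ((exp \<sigma> + (of_real 1)\<^sup>2 / exp \<sigma>) / 2) * sin b"
      using b by (intro hyperbola_region_intro)
    moreover have e: "(exp \<sigma> + (of_real 1)\<^sup>2 / exp \<sigma>) / 2 = cosh \<sigma>" by (simp add: cosh_field_def exp_minus inverse_eq_divide)
    ultimately show ?thesis unfolding e mult_1 by simp
  qed
  have SD: "cosh \<sigma> + cosh (t1 - t2) = 2 * cosh t1 * cosh t2" by (simp add: \<sigma>_def cosh_add cosh_diff)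
  have "Re (cosh t1) > 0" "Re (cosh t2) > 0" using t by (auto simp: Re_cosh intro!: mult_pos_pos cos_gt_zero_pi)
  then have "cosh \<sigma> + cosh (t1 - t2) \<noteq> 0" unfolding SD by auto
  from wedge_not_nonpos[OF b(1,2) _ c1 c0 S not_in_hyperbola_region[OF b(1,2,4)] this] y
  show ?thesis by (simp add: \<sigma>_def)
qed

section \<open>The integral over the segment\<close>

definition line_strip :: "complex \<Rightarrow> complex set" where
  "line_strip t2 = {t. \<bar>Im t\<bar> < pi / 2 \<and> \<bar>Im (t + t2)\<bar> < pi / 2}"

lemma line_strip_alt: "line_strip t2 = {t. Im t < pi / 2} \<inter> {t. Im t > - (pi / 2)} \<inter> {t. Im t < pi / 2 - Im t2} \<inter> {t. Im t > - (pi / 2) - Im t2}"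
  unfolding line_strip_def abs_less_iff
  by (rule set_eqI, simp only: Int_iff mem_Collect_eq plus_complex.sel, arith)

lemma open_line_strip: "open (line_strip t2)" and convex_line_strip: "convex (line_strip t2)"
  unfolding line_strip_alt
  by (intro open_Int open_halfspace_Im_lt open_halfspace_Im_gt convex_Int convex_halfspace_Im_lt convex_halfspace_Im_gt)+

text \<open>\<open>sqrt y\<close> times the Legendre argument. This part extends continuously to
  \<open>y = 0\<close> and stays off the cut there, so on compact sets of \<open>t1\<close> it has a
  compact range to which the ray bounds apply.\<close>

definition line_arg :: "complex \<Rightarrow> complex \<Rightarrow> real \<Rightarrow> complex" where
  "line_arg t1 t2 y = (line_cosh (t1 + t2) y + of_real (sqrt y) * cosh (t1 + t2)) *
     (line_cosh (t1 + t2) y + of_real (sqrt y) * cosh (t1 - t2)) /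
     (2 * (line_cosh (t1 + t2) y * (cosh (t1 + t2) + cosh (t1 - t2))))"

text \<open>The Ferrers function, the weight and the Jacobian without their powers of
  \<open>y\<close>; it is continuous up to \<open>y = 0\<close>.\<close>

definition line_factor :: "complex \<Rightarrow> complex \<Rightarrow> complex \<Rightarrow> real \<Rightarrow> complex" where
  "line_factor \<nu> \<mu> \<sigma> y = (1 + exp (2 * \<sigma>)) / 2 * (exp (2 * \<sigma>) + 1 - of_real y) powr (- \<mu> / 2 - 1) *
     hypF \<nu> \<mu> (of_real y / (1 + exp (2 * \<sigma>)))"

definition line_integrand :: "complex \<Rightarrow> complex \<Rightarrow> complex \<Rightarrow> complex \<Rightarrow> real \<Rightarrow> complex" where
  "line_integrand \<nu> \<mu> t1 t2 y = of_real y powr (\<mu> / 2 - 1) *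
     (line_factor \<nu> \<mu> (t1 + t2) y * legp \<nu> (of_real (1 / sqrt y) * line_arg t1 t2 y))"

lemma line_integrand_commute: "line_integrand \<nu> \<mu> t1 t2 = line_integrand \<nu> \<mu> t2 t1"
proof -
  have "cosh (t1 - t2) = cosh (t2 - t1)" by (metis cosh_minus minus_diff_eq)
  then show ?thesis by (auto simp: line_integrand_def line_arg_def add.commute[of t1 t2])
qed

lemma line_nonzero:
  assumes \<sigma>: "\<bar>Im \<sigma>\<bar> < pi / 2" and y: "y \<in> {0..1}"
  shows "1 + exp (2 * \<sigma>) \<noteq> 0" "csqrt (exp (2 * \<sigma>) + 1 - of_real y) \<noteq> 0"
    "line_cosh \<sigma> y \<noteq> 0" "of_real y / (1 + exp (2 * \<sigma>)) \<in> hyp_domain"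
proof -
  have r: "exp (2 * \<sigma>) + 1 - of_real y \<notin> \<real>\<^sub>\<le>\<^sub>0" using line_radicand_not_nonpos[OF \<sigma>] y by simp
  show n: "1 + exp (2 * \<sigma>) \<noteq> 0" using line_radicand_not_nonpos[OF \<sigma>, of 0] by (auto simp: add.commute)
  show m: "csqrt (exp (2 * \<sigma>) + 1 - of_real y) \<noteq> 0" using r by (metis csqrt_eq_0 nonpos_Reals_zero_I)
  then show "line_cosh \<sigma> y \<noteq> 0" using n by (simp add: line_cosh_def)
  have "1 - of_real y / (1 + exp (2 * \<sigma>)) \<notin> \<real>\<^sub>\<le>\<^sub>0"
  proof
    assume "1 - of_real y / (1 + exp (2 * \<sigma>)) \<in> \<real>\<^sub>\<le>\<^sub>0"
    then obtain k where k: "1 - of_real y / (1 + exp (2 * \<sigma>)) = of_real k" "k \<le> 0" by (auto elim: nonpos_Reals_cases)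
    have "of_real y = of_real (1 - k) * (1 + exp (2 * \<sigma>))"
      using k(1) n by (simp add: field_simps)
    moreover have "complex_of_real (1 - k) \<noteq> 0" using k(2) by (simp only: of_real_eq_0_iff)
    ultimately have "1 + exp (2 * \<sigma>) = of_real y / of_real (1 - k)" by (metis nonzero_mult_div_cancel_left)
    also have "\<dots> = of_real (y / (1 - k))" by simp
    finally have "exp (2 * \<sigma>) = of_real (y / (1 - k) - 1)" by (simp add: algebra_simps)
    moreover have "y / (1 - k) - 1 \<le> 0" using y k(2) by (simp add: field_simps)
    ultimately show False using exp_strip_not_nonpos[OF \<sigma>] by (metis nonpos_Reals_of_real_iff)
  qed
  then show "of_real y / (1 + exp (2 * \<sigma>)) \<in> hyp_domain" by (simp add: mem_hyp_domain_iff)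
qed

lemma cosh_sum_nonzero:
  fixes t1 t2 :: complex
  assumes "\<bar>Im t1\<bar> < pi / 2" "\<bar>Im t2\<bar> < pi / 2"
  shows "cosh (t1 + t2) + cosh (t1 - t2) \<noteq> 0" "cosh (t1 + t2) + cosh (t1 - t2) = 2 * (cosh t1 * cosh t2)"
proof -
  show e: "cosh (t1 + t2) + cosh (t1 - t2) = 2 * (cosh t1 * cosh t2)" by (simp add: cosh_add cosh_diff)
  show "cosh (t1 + t2) + cosh (t1 - t2) \<noteq> 0" unfolding e using phi_dom_arg(3)[OF phi_dom_strip] assms by simp
qed

lemma line_arg_not_nonpos:
  assumes t: "\<bar>Im t2\<bar> < pi / 2" "t1 \<in> line_strip t2" and y: "y \<in> {0..1}"
  shows "line_arg t1 t2 y \<notin> \<real>\<^sub>\<le>\<^sub>0"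
proof -
  have "of_real (1/2) * ((line_cosh (t1 + t2) y + of_real (sqrt y) * cosh (t1 + t2)) *
     (line_cosh (t1 + t2) y + of_real (sqrt y) * cosh (t1 - t2)) /
     (line_cosh (t1 + t2) y * (cosh (t1 + t2) + cosh (t1 - t2)))) \<notin> \<real>\<^sub>\<le>\<^sub>0"
    using t y by (intro of_real_mult_not_nonpos_Reals line_kernel_not_nonpos) (auto simp: line_strip_def)
  also have "of_real (1/2) * ((line_cosh (t1 + t2) y + of_real (sqrt y) * cosh (t1 + t2)) *
     (line_cosh (t1 + t2) y + of_real (sqrt y) * cosh (t1 - t2)) /
     (line_cosh (t1 + t2) y * (cosh (t1 + t2) + cosh (t1 - t2)))) = line_arg t1 t2 y" by (simp add: line_arg_def)
  finally show ?thesis .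
qed

lemma line_legp_arg_not_nonpos:
  assumes t: "\<bar>Im t2\<bar> < pi / 2" "t1 \<in> line_strip t2" and y: "0 < y" "y \<le> 1"
  shows "complex_of_real (1 / sqrt y) * line_arg t1 t2 y \<notin> \<real>\<^sub>\<le>\<^sub>0"
  using y by (intro of_real_mult_not_nonpos_Reals line_arg_not_nonpos t) auto

lemma continuous_line:
  assumes t2: "\<bar>Im t2\<bar> < pi / 2"
  shows "continuous_on (line_strip t2 \<times> {0..1}) (\<lambda>p. line_arg (fst p) t2 (snd p))"
    "continuous_on (line_strip t2 \<times> {0..1}) (\<lambda>p. line_factor \<nu> \<mu> (fst p + t2) (snd p))"
proof -
  let ?S = "line_strip t2 \<times> {0..1::real}"
  have d: "\<bar>Im (fst p)\<bar> < pi / 2" "\<bar>Im (fst p + t2)\<bar> < pi / 2" "snd p \<in> {0..1}" if "p \<in> ?S" for p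
    using that by (auto simp: line_strip_def)
  have r: "exp (2 * (fst p + t2)) + 1 - of_real (snd p) \<notin> \<real>\<^sub>\<le>\<^sub>0" if "p \<in> ?S" for p
    using line_radicand_not_nonpos[OF d(2)[OF that], of "snd p"] d(3)[OF that] by simp
  note n = line_nonzero[OF d(2,3)]
  have 0: "continuous_on ?S (\<lambda>p. exp (2 * (fst p + t2)) + 1 - of_real (snd p))"
    by (intro continuous_intros)
  have 1: "continuous_on ?S (\<lambda>p. csqrt (exp (2 * (fst p + t2)) + 1 - of_real (snd p)))"
    by (rule continuous_on_compose2[OF holomorphic_on_imp_continuous_on[OF holomorphic_on_csqrt] 0]) (use r in auto)
  have 2: "continuous_on ?S (\<lambda>p. line_cosh (fst p + t2) (snd p))"
    unfolding line_cosh_def by (intro continuous_intros 1) (use n(2) in auto)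
  show "continuous_on ?S (\<lambda>p. line_arg (fst p) t2 (snd p))"
    unfolding line_arg_def
    by (intro continuous_intros 2) (use n(3) cosh_sum_nonzero(1)[OF d(1) t2] in auto)
  have 3: "continuous_on ?S (\<lambda>p. (exp (2 * (fst p + t2)) + 1 - of_real (snd p)) powr (- \<mu> / 2 - 1))"
    by (rule continuous_on_compose2[of "- \<real>\<^sub>\<le>\<^sub>0" "\<lambda>z. z powr (- \<mu> / 2 - 1)", OF _ 0])
      (use r in \<open>auto intro!: holomorphic_on_imp_continuous_on holomorphic_intros\<close>)
  have 4: "continuous_on ?S (\<lambda>p. hypF \<nu> \<mu> (of_real (snd p) / (1 + exp (2 * (fst p + t2)))))"
    by (rule continuous_on_compose2[OF holomorphic_on_imp_continuous_on[OF hypF_holomorphic]])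
      (use n(1,4) in \<open>auto intro!: continuous_intros\<close>)
  show "continuous_on ?S (\<lambda>p. line_factor \<nu> \<mu> (fst p + t2) (snd p))"
    unfolding line_factor_def by (intro continuous_intros 3 4) auto
qed

lemma continuous_line_integrand:
  assumes t2: "\<bar>Im t2\<bar> < pi / 2"
  shows "continuous_on (line_strip t2 \<times> {0<..1}) (\<lambda>(t, y). line_integrand \<nu> \<mu> t t2 y)"
proof -
  let ?S = "line_strip t2 \<times> {0<..1::real}"
  note c = continuous_line[OF t2, THEN continuous_on_subset, of ?S]
  have 1: "continuous_on ?S (\<lambda>p. of_real (1 / sqrt (snd p)) * line_arg (fst p) t2 (snd p))"
    by (intro continuous_intros c) auto
  have 2: "continuous_on ?S (\<lambda>p. legp \<nu> (of_real (1 / sqrt (snd p)) * line_arg (fst p) t2 (snd p)))"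
    by (rule continuous_on_compose2[OF holomorphic_on_imp_continuous_on[OF holomorphic_on_legp] 1])
      (auto simp: line_legp_arg_not_nonpos[OF t2] simp del: of_real_divide of_real_1)
  have 3: "continuous_on ?S (\<lambda>p. of_real (snd p) powr (\<mu> / 2 - 1) :: complex)"
    by (rule continuous_on_compose2[of "- \<real>\<^sub>\<le>\<^sub>0" "\<lambda>z. z powr (\<mu> / 2 - 1)"])
      (auto intro!: holomorphic_on_imp_continuous_on holomorphic_intros continuous_intros)
  show ?thesis unfolding line_integrand_def split_beta
    by (intro continuous_intros 2 3 c) auto
qed

lemma holomorphic_line_integrand:
  assumes t2: "\<bar>Im t2\<bar> < pi / 2" and y: "y \<in> {0<..1}"
  shows "(\<lambda>t. line_integrand \<nu> \<mu> t t2 y) holomorphic_on line_strip t2"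
proof -
  have y': "y \<in> {0..1}" using y by simp
  have d: "\<bar>Im t\<bar> < pi / 2" "\<bar>Im (t + t2)\<bar> < pi / 2" if "t \<in> line_strip t2" for t
    using that by (auto simp: line_strip_def)
  have r: "exp (2 * (t + t2)) + 1 - of_real y \<notin> \<real>\<^sub>\<le>\<^sub>0" if "t \<in> line_strip t2" for t
    using line_radicand_not_nonpos[OF d(2)[OF that], of y] y by simp
  note n = line_nonzero[OF d(2) y']
  have 2: "(\<lambda>t. line_cosh (t + t2) y) holomorphic_on line_strip t2"
    unfolding line_cosh_def by (intro holomorphic_intros) (use r n(2) in auto)
  have 3: "(\<lambda>t. line_arg t t2 y) holomorphic_on line_strip t2"
    unfolding line_arg_def cosh_field_def by (intro holomorphic_intros 2) (use n(3) cosh_sum_nonzero(1)[OF d(1) t2] in \<open>auto simp: cosh_field_def\<close>)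
  have "(legp \<nu> \<circ> (\<lambda>t. of_real (1 / sqrt y) * line_arg t t2 y)) holomorphic_on line_strip t2"
    by (rule holomorphic_on_compose_gen[OF _ holomorphic_on_legp])
      (use y in \<open>auto intro!: holomorphic_intros 3 simp: line_legp_arg_not_nonpos[OF t2] simp del: of_real_divide of_real_1\<close>)
  then have 4: "(\<lambda>t. legp \<nu> (of_real (1 / sqrt y) * line_arg t t2 y)) holomorphic_on line_strip t2" by (simp only: o_def)
  have "(hypF \<nu> \<mu> \<circ> (\<lambda>t. of_real y / (1 + exp (2 * (t + t2))))) holomorphic_on line_strip t2"
    by (rule holomorphic_on_compose_gen[OF _ hypF_holomorphic]) (use n(1,4) in \<open>auto intro!: holomorphic_intros\<close>)
  then have 5: "(\<lambda>t. hypF \<nu> \<mu> (of_real y / (1 + exp (2 * (t + t2))))) holomorphic_on line_strip t2" by (simp only: o_def)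
  show ?thesis unfolding line_integrand_def line_factor_def
    by (intro holomorphic_intros 4 5) (use r in auto)
qed

definition "line_integral \<nu> \<mu> t1 t2 = integral {0..1} (line_integrand \<nu> \<mu> t1 t2)"

context
  fixes \<nu> \<mu> :: complex
  assumes \<nu>: "Re \<nu> \<ge> -1/2" and \<mu>: "Re \<nu> < Re \<mu>"
begin

text \<open>The Legendre argument is \<open>1 / sqrt y\<close> times a point of a compact set, so
  the exponents of the cusp estimate appear halved.\<close>

lemma line_integrand_bound:
  assumes t2: "\<bar>Im t2\<bar> < pi / 2" and K: "compact K" "K \<subseteq> line_strip t2"
  shows "\<exists>C. \<forall>t\<in>K. \<forall>y\<in>{0<..1}. cmod (line_integrand \<nu> \<mu> t t2 y) \<le> C * y powr (decay_exp \<nu> \<mu> / 2 - 1)"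
proof -
  note c = continuous_line[OF t2, THEN continuous_on_subset, of "K \<times> {0..1}"]
  have cK: "compact (K \<times> {0..1::real})" using K by (intro compact_Times) auto
  let ?W = "(\<lambda>p. line_arg (fst p) t2 (snd p)) ` (K \<times> {0..1})"
  have W: "compact ?W" using K by (intro compact_continuous_image cK c) auto
  have W2: "?W \<inter> \<real>\<^sub>\<le>\<^sub>0 = {}" using line_arg_not_nonpos[OF t2] K by auto
  obtain C1 where C1: "\<And>x t. x \<in> ?W \<Longrightarrow> t \<ge> 1 \<Longrightarrow> cmod (legp \<nu> (of_real t * x)) \<le> C1 * t powr (growth_exp \<nu> \<mu>)"
    using legp_growth[OF \<nu> growth_decay(1)[OF \<nu> \<mu>] W W2] unfolding growth_decay(3)[OF \<nu> \<mu>, symmetric] by blast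
  have "compact ((\<lambda>p. line_factor \<nu> \<mu> (fst p + t2) (snd p)) ` (K \<times> {0..1}))"
    using K by (intro compact_continuous_image cK c) auto
  then obtain C2 where C2: "\<And>p. p \<in> K \<times> {0..1} \<Longrightarrow> cmod (line_factor \<nu> \<mu> (fst p + t2) (snd p)) \<le> C2"
    by (meson bounded_iff compact_imp_bounded imageI)
  have "cmod (line_integrand \<nu> \<mu> t t2 y) \<le> (C2 * C1) * y powr (decay_exp \<nu> \<mu> / 2 - 1)" if t: "t \<in> K" and y: "y \<in> {0<..1}" for t y
  proof -
    have "y powr (- (1/2)) = 1 / sqrt y" unfolding powr_minus using y by (simp add: powr_half_sqrt inverse_eq_divide)
    then have s: "1 / sqrt y = y powr (-1/2)" by (simp only: minus_divide_left)
    have "1 / sqrt y \<ge> 1" using y by simp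
    then have 1: "cmod (legp \<nu> (of_real (1 / sqrt y) * line_arg t t2 y)) \<le> C1 * (1 / sqrt y) powr (growth_exp \<nu> \<mu>)"
      by (intro C1) (use t y in \<open>auto intro!: image_eqI[of _ _ "(t, y)"]\<close>)
    have 2: "cmod (line_factor \<nu> \<mu> (t + t2) y) \<le> C2" using C2[of "(t, y)"] t y by simp
    have "cmod (line_integrand \<nu> \<mu> t t2 y) = y powr (Re \<mu> / 2 - 1) * (cmod (line_factor \<nu> \<mu> (t + t2) y) * cmod (legp \<nu> (of_real (1 / sqrt y) * line_arg t t2 y)))"
      unfolding line_integrand_def norm_mult using y by (simp add: norm_powr_real_powr)
    also have "\<dots> \<le> y powr (Re \<mu> / 2 - 1) * (C2 * (C1 * (1 / sqrt y) powr (growth_exp \<nu> \<mu>)))"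
      using 1 2 order_trans[OF norm_ge_zero 2] by (intro mult_left_mono mult_mono) auto
    also have "\<dots> = C2 * C1 * (y powr (Re \<mu> / 2 - 1) * y powr (- growth_exp \<nu> \<mu> / 2))"
      unfolding s powr_powr by (simp add: algebra_simps)
    also have "y powr (Re \<mu> / 2 - 1) * y powr (- growth_exp \<nu> \<mu> / 2) = y powr (decay_exp \<nu> \<mu> / 2 - 1)"
      unfolding powr_add[symmetric] growth_decay(2)[OF \<nu> \<mu>, symmetric] by (rule arg_cong[of _ _ "(powr) y"]) (simp add: field_simps)
    finally show ?thesis .
  qed
  then show ?thesis by blast
qed

lemma holomorphic_line_integral:
  assumes t2: "\<bar>Im t2\<bar> < pi / 2"
  shows "(\<lambda>t. line_integral \<nu> \<mu> t t2) holomorphic_on line_strip t2"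
  unfolding line_integral_def
  using growth_decay(1)[OF \<nu> \<mu>]
  by (intro holomorphic_on_improper_integral[where \<gamma> = "decay_exp \<nu> \<mu> / 2"] open_line_strip continuous_line_integrand
      holomorphic_line_integrand line_integrand_bound t2) auto

lemma integrable_line_integrand:
  assumes t2: "\<bar>Im t2\<bar> < pi / 2" and t1: "t1 \<in> line_strip t2"
  shows "line_integrand \<nu> \<mu> t1 t2 integrable_on {0..1}"
proof -
  obtain C where C: "\<And>y. y \<in> {0<..1} \<Longrightarrow> cmod (line_integrand \<nu> \<mu> t1 t2 y) \<le> C * y powr (decay_exp \<nu> \<mu> / 2 - 1)"
    using line_integrand_bound[OF t2, of "{t1}"] t1 by (auto simp del: greaterThanAtMost_iff)
  have "continuous_on {0<..1} (\<lambda>y. (\<lambda>(t, y). line_integrand \<nu> \<mu> t t2 y) (t1, y))"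
    by (rule continuous_on_compose2[OF continuous_line_integrand[OF t2]]) (use t1 in \<open>auto intro!: continuous_intros\<close>)
  then show ?thesis using growth_decay(1)[OF \<nu> \<mu>] C by (intro norm_integral_powr_bound(1)[of _ "decay_exp \<nu> \<mu> / 2" C]) auto
qed

end

section \<open>Analytic continuation of the product formula\<close>

text \<open>The numerator is quadratic in \<open>c\<close>, and \<open>cosh (t1 + t2)\<close> and
  \<open>cosh (t1 - t2)\<close> have product \<open>(cosh t1)^2 + (cosh t2)^2 - 1\<close> and sum
  \<open>2 * cosh t1 * cosh t2\<close>. This factorization is what makes the cut tractable.\<close>

lemma kernel_factor:
  fixes t1 t2 c :: complex
  assumes "cosh t1 \<noteq> 0" "cosh t2 \<noteq> 0" "c \<noteq> 0"
  shows "(1 + ((cosh t1)\<^sup>2 + (cosh t2)\<^sup>2 + c\<^sup>2 - 1) / (2 * (cosh t1 * cosh t2 * c))) / 2 =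
     (c + cosh (t1 + t2)) * (c + cosh (t1 - t2)) / (2 * (c * (cosh (t1 + t2) + cosh (t1 - t2))))"
proof -
  have "cosh (t1 + t2) * cosh (t1 - t2) = (cosh t1 * cosh t2)\<^sup>2 - (sinh t1)\<^sup>2 * (sinh t2)\<^sup>2"
    by (simp add: cosh_add cosh_diff algebra_simps power2_eq_square)
  also have "\<dots> = (cosh t1)\<^sup>2 + (cosh t2)\<^sup>2 - 1" unfolding sinh_square_eq by (simp add: algebra_simps)
  finally have SD: "cosh (t1 + t2) * cosh (t1 - t2) = (cosh t1)\<^sup>2 + (cosh t2)\<^sup>2 - 1" .
  have S: "cosh (t1 + t2) + cosh (t1 - t2) = 2 * (cosh t1 * cosh t2)" by (simp add: cosh_add cosh_diff)
  have "(c + cosh (t1 + t2)) * (c + cosh (t1 - t2)) = c\<^sup>2 + c * (cosh (t1 + t2) + cosh (t1 - t2)) + cosh (t1 + t2) * cosh (t1 - t2)"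
    by (simp add: algebra_simps power2_eq_square)
  then show ?thesis unfolding SD S using assms by (simp add: field_simps)
qed

lemma line_legp_arg_eq:
  assumes t: "\<bar>Im t2\<bar> < pi / 2" "t1 \<in> line_strip t2" and y: "0 < y" "y \<le> 1"
  shows "of_real (1 / sqrt y) * line_arg t1 t2 y =
    (1 + ((cosh t1)\<^sup>2 + (cosh t2)\<^sup>2 + (line_cosh (t1 + t2) y / of_real (sqrt y))\<^sup>2 - 1) /
      (2 * (cosh t1 * cosh t2 * (line_cosh (t1 + t2) y / of_real (sqrt y))))) / 2"
proof -
  define c s where "c = line_cosh (t1 + t2) y" "s = complex_of_real (sqrt y)"
  define S D where "S = cosh (t1 + t2)" "D = cosh (t1 - t2)"
  have t1: "\<bar>Im t1\<bar> < pi / 2" "\<bar>Im (t1 + t2)\<bar> < pi / 2" using t by (auto simp: line_strip_def)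
  have nz: "c \<noteq> 0" "s \<noteq> 0" "S + D \<noteq> 0"
    using line_nonzero(3)[OF t1(2), of y] y cosh_sum_nonzero(1)[OF t1(1) t(1)] by (auto simp: c_s_def S_D_def)
  have co: "cosh t1 \<noteq> 0" "cosh t2 \<noteq> 0" using phi_dom_arg(3)[OF phi_dom_strip] t1 t by auto
  have "(c / s + S) * (c / s + D) / (2 * (c / s * (S + D))) = (c + s * S) * (c + s * D) / (2 * (c * (S + D))) / s"
    using nz by (simp add: divide_simps) (simp add: algebra_simps)
  also have "\<dots> = of_real (1 / sqrt y) * line_arg t1 t2 y"
    by (simp add: line_arg_def c_s_def S_D_def)
  finally show ?thesis using kernel_factor[OF co, of "c / s"] nz by (simp add: c_s_def S_D_def)
qed

text \<open>
  For real \<open>t\<^sub>i\<close> and \<open>P = e\<^sup>2\<^sup>\<sigma>\<close>, this turns the parameter of the segment into the variable \<open>e\<^sup>\<sigma>\<^sup>-\<^sup>s\<close> of \<open>cusp_integral\<close>.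
\<close>
definition line_subst :: "real \<Rightarrow> real \<Rightarrow> real" where
  "line_subst P y = sqrt (P * y / (P + 1 - y))"

text \<open>The last factor is the derivative of \<open>line_subst P\<close>. The rest follows from
  \<open>(1 + x\<^sub>3) / (1 - x\<^sub>3) = (P + 1 - y) / y = exp (2 * s)\<close>, which gives
  \<open>k^2 = P * y / (P + 1 - y)\<close>.\<close>

lemma line_integrand_real:
  assumes r: "r1 > ln 10 / 2" "r2 > ln 10 / 2" and y: "0 < y" "y \<le> 1"
  defines "P \<equiv> exp (2 * (r1 + r2))"
  defines "k \<equiv> line_subst P y"
  shows "line_integrand \<nu> \<mu> (of_real r1) (of_real r2) y =
    exp (- \<mu> * of_real (r1 + r2)) * cusp_integrand \<nu> \<mu> (exp (-2 * of_real r1)) (exp (-2 * of_real r2)) k *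
    of_real (k * (P + 1) / (2 * y * (P + 1 - y)))"
proof -
  define A where "A = P + 1 - y"
  have P: "P > 0" by (simp add: P_def)
  then have A: "A > 0" using y by (simp add: A_def)
  have k: "k > 0" unfolding k_def line_subst_def using P y A[unfolded A_def] by simp
  have k2: "k\<^sup>2 = P * y / A" unfolding k_def line_subst_def using P y A by (simp add: A_def[symmetric])
  have lnP: "ln P = 2 * (r1 + r2)" by (simp add: P_def)
  have lnk: "ln k = (2 * (r1 + r2) + ln y - ln A) / 2"
  proof -
    have "2 * ln k = ln (k\<^sup>2)" using k by (simp add: ln_realpow)
    also have "\<dots> = ln P + ln y - ln A" unfolding k2 using P y A by (simp add: ln_div ln_mult)
    finally show ?thesis using lnP by simp
  qed
  have eP: "exp (2 * (complex_of_real r1 + of_real r2)) = of_real P" by (simp add: P_def exp_of_real[symmetric])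
  have pw: "complex_of_real x powr s = exp (s * of_real (ln x))" if "x > 0" for x s
    using that by (simp add: powr_def Ln_of_real)
  have ey: "complex_of_real x = exp (of_real (ln x))" if "x > 0" for x using that by (simp add: exp_of_real)
  have 1: "(1 + of_real P) / 2 * of_real y powr (\<mu> / 2 - 1) * (of_real P + 1 - of_real y) powr (- \<mu> / 2 - 1) =
     exp (- \<mu> * of_real (r1 + r2)) * of_real k powr (\<mu> - 1) * of_real (k * (P + 1) / (2 * y * (P + 1 - y)))"
  proof -
    have a: "of_real P + 1 - of_real y = complex_of_real A" by (simp add: A_def)
    have b: "of_real k powr (\<mu> - 1) * of_real (k * (P + 1) / (2 * y * (P + 1 - y))) = (1 + of_real P) / 2 * (of_real k powr (\<mu> - 1) * of_real k / (of_real y * of_real A))"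
      unfolding A_def[symmetric] by (simp add: mult_ac add_ac)
    have c: "exp (- \<mu> * of_real (r1 + r2)) * (of_real k powr (\<mu> - 1) * of_real k / (of_real y * of_real A)) =
       of_real y powr (\<mu> / 2 - 1) * of_real A powr (- \<mu> / 2 - 1)"
    proof -
      have "exp (- \<mu> * of_real (r1 + r2)) * (of_real k powr (\<mu> - 1) * of_real k / (of_real y * of_real A)) =
        exp (- \<mu> * of_real (r1 + r2) + (\<mu> - 1) * of_real (ln k) + of_real (ln k) - of_real (ln y) - of_real (ln A))"
        unfolding exp_add exp_diff pw[OF k] ey[OF k, symmetric] ey[OF y(1), symmetric] ey[OF A, symmetric]
        by (simp add: mult.assoc)
      also have "\<dots> = exp ((\<mu> / 2 - 1) * of_real (ln y) + (- \<mu> / 2 - 1) * of_real (ln A))"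
        unfolding lnk by (rule arg_cong[of _ _ exp]) (simp add: field_simps)
      also have "\<dots> = of_real y powr (\<mu> / 2 - 1) * of_real A powr (- \<mu> / 2 - 1)"
        using pw y A by (simp add: exp_add)
      finally show ?thesis .
    qed
    show ?thesis unfolding a mult.assoc b[unfolded mult.assoc] c[symmetric] by (rule mult.left_commute)
  qed
  have q: "exp (-2 * complex_of_real r1) * exp (-2 * of_real r2) = 1 / of_real P"
    by (simp add: P_def exp_of_real[symmetric] exp_add exp_minus exp_double field_simps)
  have 2: "exp (-2 * complex_of_real r1) * exp (-2 * of_real r2) * (of_real k)\<^sup>2 / (1 + exp (-2 * complex_of_real r1) * exp (-2 * of_real r2) * (of_real k)\<^sup>2)
     = of_real y / (1 + of_real P)"
  proof -
    have "1 / of_real P * (complex_of_real k)\<^sup>2 = of_real (y / A)" unfolding of_real_power[symmetric] k2 using P by simp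
    moreover have "of_real (y / A) / (1 + of_real (y / A)) = complex_of_real (y / A / (1 + y / A))" by simp
    moreover have "y / A / (1 + y / A) = y / (A + y)" using A y by (simp add: field_simps)
    then have "y / A / (1 + y / A) = y / (1 + P)" by (simp add: A_def add.commute)
    ultimately show ?thesis unfolding q by (simp only: of_real_divide of_real_add of_real_1)
  qed
  have h: "complex_of_real r1 \<in> cusp_halfplane" "complex_of_real r2 \<in> cusp_halfplane" using r by (auto simp: cusp_halfplane_def)
  note T = cusp_halfplaneD[OF h(1)] cusp_halfplaneD[OF h(2)]
  define s where "s = complex_of_real (r1 + r2 - ln k)"
  have es: "exp s = exp (of_real r1) * exp (of_real r2) / of_real k"
    unfolding s_def using ey[OF k] by (simp add: exp_add exp_diff)
  have cs: "cosh s = line_cosh (of_real r1 + of_real r2) y / of_real (sqrt y)"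
  proof -
    define E where "E = exp (r1 + r2)"
    have E: "E > 0" "P = E\<^sup>2" unfolding E_def P_def exp_double by auto
    have kE: "k = E * sqrt y / sqrt A"
      unfolding k_def line_subst_def A_def[symmetric] unfolding E(2) using E(1) by (simp add: real_sqrt_mult real_sqrt_divide)
    have "cosh (r1 + r2 - ln k) = (E / k + k / E) / 2"
      unfolding cosh_field_def exp_diff exp_minus E_def using k by (simp add: field_simps)
    also have "\<dots> = (sqrt A / sqrt y + sqrt y / sqrt A) / 2" unfolding kE using E(1) A y by (simp add: field_simps)
    also have "\<dots> = (1 + P) / (2 * sqrt A) / sqrt y" using A y by (simp add: field_simps A_def)
    finally have "cosh s = of_real ((1 + P) / (2 * sqrt A) / sqrt y)"
      by (simp only: s_def complex_eq_iff Re_cosh Im_cosh) simp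
    moreover have "of_real P + 1 - of_real y = complex_of_real A" by (simp add: A_def)
    then have "csqrt (of_real P + 1 - of_real y) = of_real (sqrt A)" using A by (simp only: of_real_sqrt[OF less_imp_le])
    ultimately show ?thesis unfolding line_cosh_def eP by simp
  qed
  have n: "1 + exp (-2 * complex_of_real r1) \<noteq> 0" "1 + exp (-2 * complex_of_real r2) \<noteq> 0"
    using T(3,7) by (auto simp: phi_dom_def)
  have n3: "1 + exp (-2 * complex_of_real r1) * exp (-2 * of_real r2) * (of_real k)\<^sup>2 \<noteq> 0"
  proof -
    have "1 + 1 / P * k\<^sup>2 > 0" using P k by (intro add_pos_nonneg) auto
    then have "complex_of_real (1 + 1 / P * k\<^sup>2) \<noteq> 0" by (simp only: of_real_eq_0_iff)
    then show ?thesis unfolding q by simp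
  qed
  have k0: "complex_of_real k \<noteq> 0" using k by simp
  have strip: "complex_of_real r1 \<in> line_strip (of_real r2)" "\<bar>Im (complex_of_real r2)\<bar> < pi / 2" by (auto simp: line_strip_def)
  have 3: "(kernel_arg (exp (-2 * of_real r1)) (exp (-2 * of_real r2)) (of_real k) + of_real k) / (2 * of_real k) = of_real (1 / sqrt y) * line_arg (of_real r1) (of_real r2) y"
  proof -
    have "cosh s \<noteq> 0" unfolding cs using line_nonzero(3)[of "of_real r1 + of_real r2" y] y by simp
    then have kz: "kerZ (of_real r2) (of_real r1) s = ((cosh (of_real r1))\<^sup>2 + (cosh (of_real r2))\<^sup>2 + (cosh s)\<^sup>2 - 1) / (2 * (cosh (of_real r1) * cosh (of_real r2) * cosh s))"
      using T(4,8) by (simp add: kerZ_def csech_def field_simps power2_eq_square)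
    have "(kernel_arg (exp (-2 * of_real r1)) (exp (-2 * of_real r2)) (of_real k) + of_real k) / (2 * of_real k) = (1 + kerZ (of_real r2) (of_real r1) s) / 2"
      unfolding kerZ_eq_kernel_arg[OF n n3 k0 es] using k0 by (simp add: field_simps)
    also have "\<dots> = of_real (1 / sqrt y) * line_arg (of_real r1) (of_real r2) y"
      unfolding kz cs line_legp_arg_eq[OF strip(2,1) y] ..
    finally show ?thesis .
  qed
  show ?thesis
    unfolding cusp_integrand_def line_integrand_def line_factor_def 2 3 eP
    using arg_cong[OF 1, of "\<lambda>x. x * (hypF \<nu> \<mu> (of_real y / (1 + of_real P)) * legp \<nu> (of_real (1 / sqrt y) * line_arg (of_real r1) (of_real r2) y))"]
    by (simp only: mult_ac)
qed

lemma line_subst_props: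
  assumes P: "P > 0"
  shows "line_subst P 0 = 0" "line_subst P 1 = 1" "continuous_on {0..1} (line_subst P)"
    "y \<in> {0..1} \<Longrightarrow> line_subst P y \<in> {0..1}" "y \<in> {0<..<1} \<Longrightarrow> line_subst P y \<in> {0<..<1}"
    "y \<in> {0<..<1} \<Longrightarrow> (line_subst P has_real_derivative line_subst P y * (P + 1) / (2 * y * (P + 1 - y))) (at y)"
proof -
  show "line_subst P 0 = 0" "line_subst P 1 = 1" using P by (auto simp: line_subst_def)
  show "continuous_on {0..1} (line_subst P)"
    unfolding line_subst_def using P by (auto intro!: continuous_intros)
  show "line_subst P y \<in> {0..1}" if "y \<in> {0..1}"
  proof -
    have "0 \<le> (P + 1) * (1 - y)" "P + 1 - y > 0" using that P by auto
    then have "P * y / (P + 1 - y) \<le> 1" by (simp add: divide_simps) (simp add: algebra_simps)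
    then show ?thesis using that P by (simp add: line_subst_def)
  qed
  assume y: "y \<in> {0<..<1}"
  then have p: "P + 1 - y > 0" "P * y / (P + 1 - y) > 0" using P by auto
  have "0 < (P + 1) * (1 - y)" using y P by auto
  then have "P * y / (P + 1 - y) < 1" using p by (simp add: divide_simps) (simp add: algebra_simps)
  then show "line_subst P y \<in> {0<..<1}" using p by (simp add: line_subst_def)
  define u where "u = P * y / (P + 1 - y)"
  have u: "u > 0" using p by (simp add: u_def)
  have d: "((\<lambda>y. P * y / (P + 1 - y)) has_real_derivative (P * (P + 1) / (P + 1 - y)\<^sup>2)) (at y)"
    using p by (auto intro!: derivative_eq_intros simp: power2_eq_square divide_simps) (simp add: algebra_simps)
  have "((\<lambda>y. sqrt (P * y / (P + 1 - y))) has_real_derivative inverse (sqrt u) / 2 * (P * (P + 1) / (P + 1 - y)\<^sup>2)) (at y)"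
    using DERIV_chain2[OF DERIV_real_sqrt[OF p(2)] d] by (simp only: u_def)
  moreover have "inverse (sqrt u) / 2 * (P * (P + 1) / (P + 1 - y)\<^sup>2) = sqrt u * (P + 1) / (2 * y * (P + 1 - y))"
  proof -
    have "inverse (sqrt u) = sqrt u / u" using u real_sqrt_mult_self[of u] by (simp add: field_simps)
    moreover have "w / (P * y / B) / 2 * (P * (P + 1) / B\<^sup>2) = w * (P + 1) / (2 * y * B)" if "B > 0" for w B
      using that y P by (simp add: field_simps power2_eq_square)
    from this[OF p(1)] have "sqrt u / u / 2 * (P * (P + 1) / (P + 1 - y)\<^sup>2) = sqrt u * (P + 1) / (2 * y * (P + 1 - y))"
      unfolding u_def .
    ultimately show ?thesis by simp
  qed
  ultimately show "(line_subst P has_real_derivative line_subst P y * (P + 1) / (2 * y * (P + 1 - y))) (at y)"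
    unfolding line_subst_def[abs_def] u_def by (simp only:)
qed

lemma holomorphic_eq_0_from_reals:
  assumes S: "open S" "convex S" and f: "f holomorphic_on S"
    and r: "\<And>r. r > c \<Longrightarrow> complex_of_real r \<in> S" "\<And>r. r > c \<Longrightarrow> f (complex_of_real r) = 0" and z: "z \<in> S"
  shows "f z = 0"
proof (rule analytic_continuation[OF f S(1) convex_connected[OF S(2)] _ _ _ _ z])
  show "complex_of_real ` {c<..} \<subseteq> S" using r by auto
  show "complex_of_real (c + 1) \<in> S" by (rule r(1)) simp
  show "complex_of_real (c + 1) islimpt (complex_of_real ` {c<..})"
  proof (rule islimptI)
    fix T assume "complex_of_real (c + 1) \<in> T" "open T"
    then obtain e where e: "e > 0" "ball (complex_of_real (c + 1)) e \<subseteq> T" using open_contains_ball by blast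
    let ?x = "complex_of_real (c + 1 + e / 2)"
    have "?x \<in> complex_of_real ` {c<..}" using e by (intro imageI) auto
    moreover have "?x \<in> T" using e by (intro subsetD[OF e(2)]) (simp add: dist_norm flip: of_real_diff of_real_add)
    ultimately show "\<exists>y\<in>complex_of_real ` {c<..}. y \<in> T \<and> y \<noteq> complex_of_real (c + 1)"
      using e by (intro bexI[of _ ?x]) (auto simp only: of_real_eq_iff)
  qed
qed (use r in auto)

context
  fixes \<nu> \<mu> :: complex
  assumes \<nu>: "Re \<nu> \<ge> -1/2" and \<mu>: "Re \<nu> < Re \<mu>"
begin

lemma cusp_integrand_regular:
  assumes q: "cmod q1 < 1/10" "cmod q2 < 1/10"
  shows "continuous_on {0<..1} (cusp_integrand \<nu> \<mu> q1 q2)" "cusp_integrand \<nu> \<mu> q1 q2 integrable_on {0..1}"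
proof -
  obtain C where C: "\<And>q1 q2 y. cmod q1 < 1/10 \<Longrightarrow> cmod q2 < 1/10 \<Longrightarrow> y \<in> {0<..1} \<Longrightarrow>
       cmod (cusp_integrand \<nu> \<mu> q1 q2 y) \<le> C * y powr (decay_exp \<nu> \<mu> - 1)"
    using cusp_integrand_bound[OF \<nu> \<mu>] by blast
  have "continuous_on {0<..1} (\<lambda>y. (\<lambda>(q1, y). cusp_integrand \<nu> \<mu> q1 q2 y) (q1, y))"
    by (rule continuous_on_compose2[OF continuous_cusp_integrand[OF q(2)]]) (use q in \<open>auto intro!: continuous_intros\<close>)
  then show c: "continuous_on {0<..1} (cusp_integrand \<nu> \<mu> q1 q2)" by simp
  show "cusp_integrand \<nu> \<mu> q1 q2 integrable_on {0..1}"
    using C[OF q] by (rule norm_integral_powr_bound(1)[OF c growth_decay(1)[OF \<nu> \<mu>]])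
qed

text \<open>The substitution is carried out on the indefinite integral \<open>J\<close>, which is
  continuous at 0 although the integrand need not be; \<open>J\<close> composed with
  \<open>line_subst\<close> is then a primitive in the interior.\<close>

lemma line_integral_real:
  assumes r: "r1 > ln 10 / 2" "r2 > ln 10 / 2"
  shows "line_integral \<nu> \<mu> (of_real r1) (of_real r2) =
    exp (- \<mu> * of_real (r1 + r2)) * cusp_integral \<nu> \<mu> (exp (-2 * of_real r1)) (exp (-2 * of_real r2))"
proof -
  define P where "P = exp (2 * (r1 + r2))"
  have P: "P > 0" by (simp add: P_def)
  note k = line_subst_props[OF P]
  define f where "f = cusp_integrand \<nu> \<mu> (exp (-2 * of_real r1)) (exp (-2 * of_real r2))"
  have h: "complex_of_real r1 \<in> cusp_halfplane" "complex_of_real r2 \<in> cusp_halfplane" using r by (auto simp: cusp_halfplane_def)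
  have f: "continuous_on {0<..1} f" "f integrable_on {0..1}"
    unfolding f_def by (rule cusp_integrand_regular; intro cusp_halfplaneD(2) h)+
  define J where "J u = integral {0..u} f" for u
  have J: "continuous_on {0..1} J" unfolding J_def by (rule indefinite_integral_continuous_1[OF f(2)])
  have dJ: "(J has_vector_derivative f u) (at u)" if u: "u \<in> {0<..<1}" for u
  proof -
    have "continuous_on {0<..<1} f" by (rule continuous_on_subset[OF f(1)]) auto
    then have "isCont f u" using u by (simp add: continuous_on_eq_continuous_at)
    then have "(J has_vector_derivative f u) (at u within {0..1})"
      unfolding J_def using u integral_has_vector_derivative_continuous_at[OF f(2), of u "{}"] continuous_at_imp_continuous_within[of u f "{0..1}"] by simp
    then show ?thesis using u by (simp add: at_within_Icc_at)
  qed
  define e where "e = exp (- \<mu> * of_real (r1 + r2))"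
  have "((line_integrand \<nu> \<mu> (of_real r1) (of_real r2)) has_integral (e * J (line_subst P 1) - e * J (line_subst P 0))) {0..1}"
  proof (rule fundamental_theorem_of_calculus_interior)
    show "continuous_on {0..1} (\<lambda>y. e * J (line_subst P y))"
      by (intro continuous_intros continuous_on_compose2[OF J k(3)]) (use k(4) in auto)
    fix y :: real assume y: "y \<in> {0<..<1}"
    let ?k' = "line_subst P y * (P + 1) / (2 * y * (P + 1 - y))"
    have "(line_subst P has_vector_derivative ?k') (at y)"
      using k(6)[OF y] by (simp add: has_real_derivative_iff_has_vector_derivative)
    from vector_diff_chain_at[OF this dJ[OF k(5)[OF y]]]
    have "((\<lambda>y. J (line_subst P y)) has_vector_derivative ?k' *\<^sub>R f (line_subst P y)) (at y)" by (simp only: o_def)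
    then have "((\<lambda>y. e * J (line_subst P y)) has_vector_derivative e * (?k' *\<^sub>R f (line_subst P y))) (at y)"
      by (rule has_vector_derivative_mult_right)
    moreover have "e * (?k' *\<^sub>R f (line_subst P y)) = line_integrand \<nu> \<mu> (of_real r1) (of_real r2) y"
      using line_integrand_real[OF r, of y \<nu> \<mu>] y unfolding P_def[symmetric] f_def[symmetric] e_def[symmetric]
      by (simp add: scaleR_conv_of_real mult_ac)
    ultimately show "((\<lambda>y. e * J (line_subst P y)) has_vector_derivative line_integrand \<nu> \<mu> (of_real r1) (of_real r2) y) (at y)" by simp
  qed simp
  then have "line_integral \<nu> \<mu> (of_real r1) (of_real r2) = e * J 1 - e * J 0"
    unfolding line_integral_def k(1,2) by (rule integral_unique)
  then show ?thesis by (simp add: J_def f_def e_def cusp_integral_def)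
qed

lemma line_product_formula_real:
  assumes r: "r1 > ln 10 / 2" "r2 > ln 10 / 2"
  shows "phi \<nu> \<mu> (of_real r1) * phi \<nu> \<mu> (of_real r2) = product_const \<nu> \<mu> * line_integral \<nu> \<mu> (of_real r1) (of_real r2)"
proof -
  have q: "exp (-2 * complex_of_real r) = of_real (exp (-2 * r))" "0 < exp (-2 * r)" "exp (-2 * r) < 1/10"
    "of_real (exp (-2 * r)) / (1 + of_real (exp (-2 * r))) = 1 / (1 + exp (2 * complex_of_real r))" if "r > ln 10 / 2" for r
  proof -
    show e: "exp (-2 * complex_of_real r) = of_real (exp (-2 * r))" by (simp add: exp_of_real[symmetric])
    show "0 < exp (-2 * r)" by simp
    have "complex_of_real r \<in> cusp_halfplane" using that by (simp add: cusp_halfplane_def)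
    from cusp_halfplaneD(2)[OF this] show "exp (-2 * r) < 1/10" unfolding e by simp
    have "1 + exp (2 * complex_of_real r) \<noteq> 0" by (rule phi_dom_arg(1)[OF phi_dom_strip]) simp
    moreover have "1 + exp (-2 * complex_of_real r) \<noteq> 0" using phi_dom_strip[of "of_real r"] by (auto simp: phi_dom_def)
    moreover have "exp (-2 * complex_of_real r) = 1 / exp (2 * of_real r)" by (simp add: exp_minus divide_inverse)
    ultimately show "of_real (exp (-2 * r)) / (1 + of_real (exp (-2 * r))) = 1 / (1 + exp (2 * complex_of_real r))"
      unfolding e[symmetric] by (simp only:) (simp add: field_simps)
  qed
  from cusp_product_formula[OF \<nu> \<mu> q(2,3)[OF r(1)] q(2,3)[OF r(2)]]
  have "product_const \<nu> \<mu> * cusp_integral \<nu> \<mu> (exp (-2 * of_real r1)) (exp (-2 * of_real r2)) =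
    hypF \<nu> \<mu> (1 / (1 + exp (2 * of_real r1))) * hypF \<nu> \<mu> (1 / (1 + exp (2 * of_real r2)))"
    unfolding q(4)[OF r(1)] q(4)[OF r(2)] q(1)[OF r(1)] q(1)[OF r(2)] .
  note c = this
  have "phi \<nu> \<mu> (of_real r1) * phi \<nu> \<mu> (of_real r2) = (exp (- \<mu> * of_real r1) * exp (- \<mu> * of_real r2)) *
     (hypF \<nu> \<mu> (1 / (1 + exp (2 * of_real r1))) * hypF \<nu> \<mu> (1 / (1 + exp (2 * of_real r2))))"
    by (simp only: phi_def mult_ac)
  also have "exp (- \<mu> * of_real r1) * exp (- \<mu> * of_real r2) = exp (- \<mu> * of_real (r1 + r2))"
    by (simp add: distrib_left flip: exp_add)
  finally show ?thesis unfolding line_integral_real[OF r] c[symmetric] by (simp only: mult.left_commute)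
qed

lemma phi_holomorphic_strip: "phi \<nu> \<mu> holomorphic_on line_strip t"
  by (rule holomorphic_on_subset[OF phi_holomorphic]) (auto simp: line_strip_def intro: phi_dom_strip)

text \<open>Continuation in one variable at a time. With \<open>t2\<close> real the condition on
  \<open>t1 + t2\<close> adds nothing, so \<open>t1\<close> reaches any point of its strip; with
  that \<open>t1\<close> fixed, the admissible strip for \<open>t2\<close> is convex and still
  contains all large reals.\<close>

theorem line_product_formula:
  assumes t: "\<bar>Im t1\<bar> < pi / 2" "\<bar>Im t2\<bar> < pi / 2" "\<bar>Im (t1 + t2)\<bar> < pi / 2"
  shows "phi \<nu> \<mu> t1 * phi \<nu> \<mu> t2 = product_const \<nu> \<mu> * line_integral \<nu> \<mu> t1 t2"
proof -
  have one: "phi \<nu> \<mu> t1 * phi \<nu> \<mu> (of_real r) - product_const \<nu> \<mu> * line_integral \<nu> \<mu> t1 (of_real r) = 0" if r: "r > ln 10 / 2" for r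
  proof (rule holomorphic_eq_0_from_reals[OF open_line_strip convex_line_strip, where f = "\<lambda>t1. phi \<nu> \<mu> t1 * phi \<nu> \<mu> (of_real r) - product_const \<nu> \<mu> * line_integral \<nu> \<mu> t1 (of_real r)" and z = t1 and c = "ln 10 / 2"])
    show "(\<lambda>t1. phi \<nu> \<mu> t1 * phi \<nu> \<mu> (of_real r) - product_const \<nu> \<mu> * line_integral \<nu> \<mu> t1 (of_real r)) holomorphic_on line_strip (of_real r)"
      by (intro holomorphic_intros phi_holomorphic_strip holomorphic_line_integral[OF \<nu> \<mu>]) simp
    show "t1 \<in> line_strip (of_real r)" using t by (simp add: line_strip_def)
  qed (use r line_product_formula_real in \<open>auto simp: line_strip_def\<close>)
  have "phi \<nu> \<mu> t1 * phi \<nu> \<mu> t2 - product_const \<nu> \<mu> * line_integral \<nu> \<mu> t2 t1 = 0"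
  proof (rule holomorphic_eq_0_from_reals[OF open_line_strip convex_line_strip, where f = "\<lambda>t2. phi \<nu> \<mu> t1 * phi \<nu> \<mu> t2 - product_const \<nu> \<mu> * line_integral \<nu> \<mu> t2 t1" and z = t2 and c = "ln 10 / 2"])
    show "(\<lambda>t2. phi \<nu> \<mu> t1 * phi \<nu> \<mu> t2 - product_const \<nu> \<mu> * line_integral \<nu> \<mu> t2 t1) holomorphic_on line_strip t1"
      by (intro holomorphic_intros phi_holomorphic_strip holomorphic_line_integral[OF \<nu> \<mu>] t)
    show "t2 \<in> line_strip t1" using t by (simp add: line_strip_def add.commute)
    fix r :: real assume "r > ln 10 / 2"
    from one[OF this] show "phi \<nu> \<mu> t1 * phi \<nu> \<mu> (of_real r) - product_const \<nu> \<mu> * line_integral \<nu> \<mu> (of_real r) t1 = 0"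
      by (simp add: line_integral_def line_integrand_commute[of _ _ t1])
  qed (use t in \<open>auto simp: line_strip_def\<close>)
  then show ?thesis by (simp add: line_integral_def line_integrand_commute[of _ _ t1])
qed

end

section \<open>Divergence and the exceptional order\<close>

lemma hyp_coeff_0_2:
  assumes ab: "a + b = 1"
  shows "hyp_coeff a b 0 (Suc n) - hyp_coeff a b 0 n = a * b * hyp_coeff a b 2 n"
proof -
  let ?n = "of_nat n :: complex"
  define p where "p = pochhammer a n * pochhammer b n * rGamma (2 + ?n) / fact n"
  have r1: "rGamma (?n + 1) = (?n + 1) * rGamma (2 + ?n)" using rGamma_plus1[of "?n + 1"] by (simp add: add_ac)
  have r0: "rGamma ?n = ?n * ((?n + 1) * rGamma (2 + ?n))" using rGamma_plus1[of ?n] r1 by simp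
  have nz: "?n + 1 \<noteq> 0" by (metis of_nat_Suc of_nat_eq_0_iff nat.distinct(1) add.commute)
  have "hyp_coeff a b 0 (Suc n) = (a + ?n) * (b + ?n) * p"
  proof -
    have e: "rGamma (0 + of_nat (Suc n)) = (?n + 1) * rGamma (2 + ?n)" "fact (Suc n) = (?n + 1) * fact n"
      using r1 by (simp_all add: add.commute distrib_right)
    show ?thesis unfolding hyp_coeff_def p_def pochhammer_Suc e using nz by (simp add: mult_ac)
  qed
  moreover have "hyp_coeff a b 0 n = ?n * (?n + 1) * p"
    unfolding hyp_coeff_def p_def using r0 by simp
  ultimately have "hyp_coeff a b 0 (Suc n) - hyp_coeff a b 0 n = (a * b + ?n * (a + b) - ?n) * p"
    by (simp add: algebra_simps)
  then show ?thesis by (simp add: ab hyp_coeff_def p_def)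
qed

text \<open>Two classical facts combined: at lower parameter 0 the regularized series is
  \<open>a * b * z\<close> times the one with parameters \<open>a + 1\<close>, \<open>b + 1\<close>,
  \<open>2\<close>, and Euler's transformation turns the latter into the one with \<open>a\<close>,
  \<open>b\<close>, \<open>2\<close> over \<open>1 - z\<close> when \<open>a + b = 1\<close>. The
  check is on coefficients.\<close>

lemma hyp2F1_reg_0_eq_2:
  assumes ab: "a + b = 1" and z: "z \<in> hyp_domain"
  shows "(1 - z) * hyp2F1_reg a b 0 z = a * b * z * hyp2F1_reg a b 2 z"
proof (rule hyp_domain_identity[OF _ _ _ z])
  show "(\<lambda>z. (1 - z) * hyp2F1_reg a b 0 z) holomorphic_on hyp_domain"
    "(\<lambda>z. a * b * z * hyp2F1_reg a b 2 z) holomorphic_on hyp_domain"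
    by (intro holomorphic_intros hyp2F1_reg_holomorphic ab)+
  fix z :: complex assume z: "z \<in> ball 0 1"
  have n: "ereal (cmod z) < fps_conv_radius (hyp_fps a b c)" for c
    using z less_le_trans[OF _ hyp_fps_conv_radius, of "ereal (cmod z)" a b c] by simp
  have X: "ereal (cmod z) < fps_conv_radius (1 - fps_X :: complex fps)" "ereal (cmod z) < fps_conv_radius (fps_const (a * b) * fps_X :: complex fps)"
    "ereal (cmod z) < fps_conv_radius (fps_X :: complex fps)"
    by (auto intro: less_le_trans[OF _ fps_conv_radius_mult] less_le_trans[OF _ fps_conv_radius_diff])
  have "(1 - fps_X) * hyp_fps a b 0 = fps_const (a * b) * fps_X * hyp_fps a b 2"
  proof (rule fps_ext)
    fix n
    have "hyp_coeff a b 0 0 = 0" by (simp add: hyp_coeff_def)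
    then show "fps_nth ((1 - fps_X) * hyp_fps a b 0) n = fps_nth (fps_const (a * b) * fps_X * hyp_fps a b 2) n"
      using hyp_coeff_0_2[OF ab, of "n - 1"]
      by (cases n) (simp_all add: hyp_fps_def ring_distribs mult.assoc)
  qed
  then have "eval_fps ((1 - fps_X) * hyp_fps a b 0) z = eval_fps (fps_const (a * b) * fps_X * hyp_fps a b 2) z" by simp
  then have "(1 - z) * hyp2F1_reg_series a b 0 z = a * b * z * hyp2F1_reg_series a b 2 z"
    unfolding hyp2F1_reg_series_eq_eval_fps using n X
    by (simp add: eval_fps_mult eval_fps_diff)
  then show "(1 - z) * hyp2F1_reg a b 0 z = a * b * z * hyp2F1_reg a b 2 z"
    using hyp2F1_reg_eq_series[OF ab z] by simp
qed

lemma hypF_minus_1: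
  assumes "z \<in> hyp_domain"
  shows "hypF \<nu> (- 1) z = - (\<nu> * (\<nu> + 1)) * (z / (1 - z)) * hypF \<nu> 1 z"
proof -
  have "1 - z \<noteq> 0" using assms by (auto simp: mem_hyp_domain_iff)
  then show ?thesis using hyp2F1_reg_0_eq_2[of "- \<nu>" "\<nu> + 1" z] assms by (simp add: hypF_def field_simps)
qed

text \<open>Ferrers functions of opposite integer order are proportional; the factor
  \<open>z / (1 - z)\<close>, equal to \<open>exp (-2 * t)\<close>, converts the exponential factor
  of order -1 into that of order 1.\<close>

lemma phi_minus_1:
  assumes t: "\<bar>Im t\<bar> < pi / 2"
  shows "phi \<nu> (- 1) t = - (\<nu> * (\<nu> + 1)) * phi \<nu> 1 t"
proof -
  note d = phi_dom_arg[OF phi_dom_strip[OF t]]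
  have e: "exp (2 * t) = exp t * exp t" by (simp add: exp_double power2_eq_square)
  have z: "1 / (1 + exp (2 * t)) / (1 - 1 / (1 + exp (2 * t))) = 1 / (exp t * exp t)"
    using d(1) unfolding e by (simp add: field_simps)
  show ?thesis unfolding phi_def hypF_minus_1[OF d(2)] z by (simp add: exp_minus divide_inverse)
qed

lemma line_integrand_minus_1:
  assumes t: "\<bar>Im (t1 + t2)\<bar> < pi / 2" and y: "y \<in> {0<..1}"
  shows "line_integrand \<nu> (- 1) t1 t2 y = - (\<nu> * (\<nu> + 1)) * line_integrand \<nu> 1 t1 t2 y"
proof -
  have y': "y \<in> {0..1}" using y by simp
  note n = line_nonzero[OF t y']
  define A where "A = exp (2 * (t1 + t2)) + 1 - of_real y"
  have A: "A \<noteq> 0" using n(2) by (auto simp: A_def)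
  have z: "of_real y / (1 + exp (2 * (t1 + t2))) / (1 - of_real y / (1 + exp (2 * (t1 + t2)))) = of_real y / A"
  proof -
    have "a / Q / (1 - a / Q) = a / (Q - a)" if "Q \<noteq> 0" "Q - a \<noteq> 0" for a Q :: complex
      using that by (simp add: field_simps)
    from this[OF n(1), of "of_real y"] show ?thesis using A by (simp add: A_def add.commute)
  qed
  have "of_real y powr (1 / 2 - 1) = complex_of_real y * of_real y powr (- 1 / 2 - 1)"
    using powr_add[of "complex_of_real y" 1 "- 1 / 2 - 1"] y by simp
  moreover have "A powr (- (- 1) / 2 - 1) = A * A powr (- 1 / 2 - 1)"
    using powr_add[of A 1 "- 1 / 2 - 1"] A by simp
  ultimately show ?thesis
    unfolding line_integrand_def line_factor_def hypF_minus_1[OF n(4)] z A_def[symmetric]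
    using A by (simp add: field_simps)
qed

text \<open>Passing from order 1 to order -1 multiplies the left side of the formula by the square
  of \<open>- (\<nu> * (\<nu> + 1))\<close>. One factor is matched by the integral, the other by
  this constant.\<close>

lemma product_const_minus_1: "product_const \<nu> (- 1) = - (\<nu> * (\<nu> + 1)) * product_const \<nu> 1"
proof -
  have "(- 1 - \<nu>) / 2 + 1 = (1 - \<nu>) / 2" by (simp add: field_simps)
  then have 1: "rGamma ((- 1 - \<nu>) / 2) = (- 1 - \<nu>) / 2 * rGamma ((1 - \<nu>) / 2)"
    using rGamma_plus1[of "(- 1 - \<nu>) / 2"] by (simp only:)
  have "\<nu> / 2 + 1 = (\<nu> + 1 + 1) / 2" by (simp add: field_simps)
  then have 2: "rGamma ((\<nu> + - 1 + 1) / 2) = \<nu> / 2 * rGamma ((\<nu> + 1 + 1) / 2)"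
    using rGamma_plus1[of "\<nu> / 2"] by (simp only: add.assoc) simp
  have 3: "2 powr (1 - - 1) = (4 :: complex)" using powr_add[of "2 :: complex" 1 1] by simp
  have 4: "2 powr (1 - 1) = (1 :: complex)" by simp
  show ?thesis unfolding product_const_def 1 2 3 4 by (simp add: field_simps)
qed

text \<open>The reflection exchanges the two upper parameters of every hypergeometric function
  involved and the two Gamma factors of the constant.\<close>

lemma reflect_degree:
  "hypF (- 1 - \<nu>) \<mu> = hypF \<nu> \<mu>" "legp (- 1 - \<nu>) = legp \<nu>" "phi (- 1 - \<nu>) \<mu> = phi \<nu> \<mu>"
  "line_integrand (- 1 - \<nu>) \<mu> = line_integrand \<nu> \<mu>" "product_const (- 1 - \<nu>) \<mu> = product_const \<nu> \<mu>"
proof -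
  have c: "hyp2F1_reg (- (- 1 - \<nu>)) (- 1 - \<nu> + 1) = hyp2F1_reg (- \<nu>) (\<nu> + 1)"
    using hyp2F1_reg_commute[of "\<nu> + 1" "- \<nu>"] by (simp add: add.commute)
  show h: "hypF (- 1 - \<nu>) \<mu> = hypF \<nu> \<mu>" unfolding hypF_def c ..
  show l: "legp (- 1 - \<nu>) = legp \<nu>" unfolding legp_def[abs_def] c ..
  show "phi (- 1 - \<nu>) \<mu> = phi \<nu> \<mu>" by (rule ext) (simp add: phi_def h)
  show "line_integrand (- 1 - \<nu>) \<mu> = line_integrand \<nu> \<mu>"
    by (intro ext) (simp add: line_integrand_def line_factor_def h l)
  show "product_const (- 1 - \<nu>) \<mu> = product_const \<nu> \<mu>"
    by (simp add: product_const_def algebra_simps)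
qed

lemma line_product:
  assumes c: "Re (\<mu> + \<nu>) > -1" "Re (\<mu> - \<nu>) > 0"
    and t: "\<bar>Im t1\<bar> < pi / 2" "\<bar>Im t2\<bar> < pi / 2" "\<bar>Im (t1 + t2)\<bar> < pi / 2"
  shows "line_integrand \<nu> \<mu> t1 t2 integrable_on {0..1}"
    "phi \<nu> \<mu> t1 * phi \<nu> \<mu> t2 = product_const \<nu> \<mu> * line_integral \<nu> \<mu> t1 t2"
proof -
  have s: "t1 \<in> line_strip t2" using t by (simp add: line_strip_def)
  have "line_integrand \<nu> \<mu> t1 t2 integrable_on {0..1} \<and> phi \<nu> \<mu> t1 * phi \<nu> \<mu> t2 = product_const \<nu> \<mu> * line_integral \<nu> \<mu> t1 t2"
  proof (cases "Re \<nu> \<ge> -1/2")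
    case True
    then show ?thesis using c integrable_line_integrand[OF True _ t(2) s] line_product_formula[OF True _ t] by auto
  next
    case False
    \<comment> \<open>Under the reflection the condition Re (\<mu> + \<nu>) > -1 takes the role of
      Re \<nu> < Re \<mu>.\<close>
    have "Re (- 1 - \<nu>) \<ge> -1/2" "Re (- 1 - \<nu>) < Re \<mu>" using False c by auto
    from integrable_line_integrand[OF this t(2) s] line_product_formula[OF this t]
    show ?thesis by (simp add: line_integral_def reflect_degree)
  qed
  then show "line_integrand \<nu> \<mu> t1 t2 integrable_on {0..1}"
    "phi \<nu> \<mu> t1 * phi \<nu> \<mu> t2 = product_const \<nu> \<mu> * line_integral \<nu> \<mu> t1 t2" by blast+
qed

text \<open>The exponent combines \<open>\<mu> / 2 - 1\<close> from the weight with
  \<open>- \<nu> / 2\<close> from the leading term of the Legendre function at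
  \<open>1 / sqrt y\<close>. The limit contains the nonzero coefficient \<open>a\<close> and, from
  \<open>line_factor\<close> at 0, the factor \<open>rGamma (1 + \<mu>)\<close>.\<close>

lemma line_integrand_asymptotics:
  assumes \<nu>: "Re \<nu> > -1/2" and \<mu>: "rGamma (1 + \<mu>) \<noteq> 0"
    and t: "\<bar>Im t2\<bar> < pi / 2" "t1 \<in> line_strip t2"
  shows "\<exists>e0. e0 \<noteq> 0 \<and> ((\<lambda>y. of_real y powr (1 - (\<mu> - \<nu>) / 2) * line_integrand \<nu> \<mu> t1 t2 y) \<longlongrightarrow> e0) (at_right 0)"
proof (rule legp_asymptotics[OF \<nu>])
  fix a \<gamma> assume \<gamma>: "\<gamma> > 0"
    and as: "\<And>W. compact W \<Longrightarrow> W \<inter> \<real>\<^sub>\<le>\<^sub>0 = {} \<Longrightarrow>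
       \<exists>C. \<forall>x\<in>W. \<forall>t\<ge>1. cmod (legp \<nu> (of_real t * x) - a * (of_real t * x) powr \<nu>) \<le> C * t powr (Re \<nu> - \<gamma>)"
    and a0: "\<And>W \<beta>. a = 0 \<Longrightarrow> \<beta> > 0 \<Longrightarrow> compact W \<Longrightarrow> W \<inter> \<real>\<^sub>\<le>\<^sub>0 = {} \<Longrightarrow>
       \<exists>C. \<forall>x\<in>W. \<forall>t\<ge>1. cmod (legp \<nu> (of_real t * x)) \<le> C * t powr (\<beta> - Re \<nu> - 1)"
  have a: "a \<noteq> 0" using legp_leading_coeff_nonzero[OF \<nu>] a0 by blast
  have c: "continuous_on {0..1} (line_arg t1 t2)" "continuous_on {0..1} (line_factor \<nu> \<mu> (t1 + t2))"
    using continuous_on_Pair[OF continuous_on_const continuous_on_id, of "{0..1}" t1]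
      continuous_on_compose2[OF continuous_line(1)[OF t(1)], of "{0..1}" "\<lambda>y. (t1, y)"]
      continuous_on_compose2[OF continuous_line(2)[OF t(1)], of "{0..1}" "\<lambda>y. (t1, y)"] t(2)
    by (simp_all add: image_subset_iff)
  have W: "(line_arg t1 t2 \<longlongrightarrow> line_arg t1 t2 0) (at_right 0)" "(line_factor \<nu> \<mu> (t1 + t2) \<longlongrightarrow> line_factor \<nu> \<mu> (t1 + t2) 0) (at_right 0)"
    using c[unfolded continuous_on_def] by (auto simp: at_within_Icc_at_right dest!: bspec[of _ _ 0])
  define K where "K = line_arg t1 t2 ` {0..1}"
  have K: "compact K" "K \<inter> \<real>\<^sub>\<le>\<^sub>0 = {}"
    unfolding K_def using c line_arg_not_nonpos[OF t] by (auto intro!: compact_continuous_image)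
  obtain C where C: "\<And>x t. x \<in> K \<Longrightarrow> t \<ge> 1 \<Longrightarrow> cmod (legp \<nu> (of_real t * x) - a * (of_real t * x) powr \<nu>) \<le> C * t powr (Re \<nu> - \<gamma>)"
    using as[OF K] by blast
  define g where "g y = of_real y powr (\<nu> / 2) * legp \<nu> (of_real (1 / sqrt y) * line_arg t1 t2 y)" for y
  have ev: "\<forall>\<^sub>F y in at_right 0. (y::real) \<in> {0<..1}" unfolding eventually_at_right_field by (intro exI[of _ 1]) auto
  have g: "(g \<longlongrightarrow> a * line_arg t1 t2 0 powr \<nu>) (at_right 0)"
  proof -
    have "((\<lambda>y. g y - a * line_arg t1 t2 y powr \<nu>) \<longlongrightarrow> 0) (at_right 0)"
    proof (rule Lim_null_comparison)
      show "\<forall>\<^sub>F y in at_right 0. cmod (g y - a * line_arg t1 t2 y powr \<nu>) \<le> C * y powr (\<gamma> / 2)"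
        using ev
      proof eventually_elim
        case (elim y)
        let ?W = "line_arg t1 t2 y"
        have s: "1 / sqrt y = y powr (-1/2)"
        proof -
          have "y powr (- (1/2)) = 1 / sqrt y" unfolding powr_minus using elim by (simp add: powr_half_sqrt inverse_eq_divide)
          then show ?thesis by (simp only: minus_divide_left)
        qed
        have W: "?W \<in> K" "?W \<noteq> 0" using elim line_arg_not_nonpos[OF t, of y] by (auto simp: K_def)
        have "complex_of_real (1 / sqrt y) powr \<nu> = of_real y powr (- \<nu> / 2)"
        proof -
          have "ln (1 / sqrt y) = - ln y / 2" using elim by (simp add: ln_div ln_sqrt)
          moreover have "complex_of_real (1 / sqrt y) powr \<nu> = exp (\<nu> * of_real (ln (1 / sqrt y)))"
            using elim by (simp add: powr_def Ln_of_real del: of_real_divide)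
          ultimately show ?thesis using elim by (simp add: powr_def Ln_of_real)
        qed
        then have p: "of_real y powr (\<nu> / 2) * (of_real (1 / sqrt y) * ?W) powr \<nu> = ?W powr \<nu>"
          using elim W(2) powr_add[of "of_real y" "\<nu> / 2" "- \<nu> / 2"] by (subst powr_real_mult) (auto simp: mult.assoc[symmetric])
        have "g y - a * ?W powr \<nu> = of_real y powr (\<nu> / 2) * (legp \<nu> (of_real (1 / sqrt y) * ?W) - a * (of_real (1 / sqrt y) * ?W) powr \<nu>)"
          unfolding g_def p[symmetric] by (simp add: algebra_simps)
        also have "cmod \<dots> \<le> y powr (Re \<nu> / 2) * (C * (1 / sqrt y) powr (Re \<nu> - \<gamma>))"
          unfolding norm_mult using elim W(1) by (intro mult_mono C) (auto simp: norm_powr_real_powr)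
        also have "\<dots> = C * (y powr (Re \<nu> / 2) * y powr ((-1/2) * (Re \<nu> - \<gamma>)))" unfolding s powr_powr by simp
        also have "y powr (Re \<nu> / 2) * y powr ((-1/2) * (Re \<nu> - \<gamma>)) = y powr (\<gamma> / 2)"
          unfolding powr_add[symmetric] by (rule arg_cong[of _ _ "(powr) y"]) (simp add: field_simps)
        finally show ?case .
      qed
      show "((\<lambda>y. C * y powr (\<gamma> / 2)) \<longlongrightarrow> 0) (at_right 0)" using \<gamma> by real_asymp
    qed
    moreover have "((\<lambda>y. a * line_arg t1 t2 y powr \<nu>) \<longlongrightarrow> a * line_arg t1 t2 0 powr \<nu>) (at_right 0)"
      using line_arg_not_nonpos[OF t, of 0] by (intro tendsto_intros W(1)) auto
    ultimately show ?thesis by (auto dest: tendsto_add)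
  qed
  have "((\<lambda>y. line_factor \<nu> \<mu> (t1 + t2) y * g y) \<longlongrightarrow> line_factor \<nu> \<mu> (t1 + t2) 0 * (a * line_arg t1 t2 0 powr \<nu>)) (at_right 0)"
    by (intro tendsto_intros W(2) g)
  moreover have "\<forall>\<^sub>F y in at_right 0. line_factor \<nu> \<mu> (t1 + t2) y * g y = of_real y powr (1 - (\<mu> - \<nu>) / 2) * line_integrand \<nu> \<mu> t1 t2 y"
    using ev
  proof eventually_elim
    case (elim y)
    have "of_real y powr (1 - (\<mu> - \<nu>) / 2) * of_real y powr (\<mu> / 2 - 1) = complex_of_real y powr (\<nu> / 2)"
      unfolding powr_add[symmetric] by (rule arg_cong[of _ _ "(powr) (of_real y)"]) (simp add: field_simps)
    then show ?case unfolding g_def line_integrand_def by (simp add: mult_ac)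
  qed
  ultimately have "((\<lambda>y. of_real y powr (1 - (\<mu> - \<nu>) / 2) * line_integrand \<nu> \<mu> t1 t2 y) \<longlongrightarrow>
     line_factor \<nu> \<mu> (t1 + t2) 0 * (a * line_arg t1 t2 0 powr \<nu>)) (at_right 0)"
    by (rule Lim_transform_eventually)
  moreover have "line_factor \<nu> \<mu> (t1 + t2) 0 \<noteq> 0" "line_arg t1 t2 0 \<noteq> 0"
    using line_nonzero(1)[of "t1 + t2" 0] t \<mu> line_arg_not_nonpos[OF t, of 0]
    by (auto simp: line_factor_def hypF_0 line_strip_def add.commute)
  ultimately show ?thesis using a by (intro exI conjI) auto
qed

text \<open>When Re (\<mu> - \<nu>) \<le> 0 the integrand has a nonintegrable power singularity
  unless \<open>rGamma (1 + \<mu>)\<close> vanishes; the conditions on \<mu> and \<nu> leave only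
  order -1, which is transferred from order 1.\<close>

lemma line_product_if_integrable:
  assumes c: "Re (\<mu> + \<nu>) > -1" "Re (\<mu> - \<nu>) > -2"
    and t: "\<bar>Im t1\<bar> < pi / 2" "\<bar>Im t2\<bar> < pi / 2" "\<bar>Im (t1 + t2)\<bar> < pi / 2"
    and int: "line_integrand \<nu> \<mu> t1 t2 integrable_on {0..1}"
  shows "phi \<nu> \<mu> t1 * phi \<nu> \<mu> t2 = product_const \<nu> \<mu> * line_integral \<nu> \<mu> t1 t2"
proof (cases "Re (\<mu> - \<nu>) > 0")
  case True
  then show ?thesis using line_product(2)[OF c(1) _ t] by blast
next
  case False
  have s: "t1 \<in> line_strip t2" using t by (simp add: line_strip_def)
  have \<nu>: "Re \<nu> > -1/2" using c False by simp
  have "rGamma (1 + \<mu>) = 0"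
  proof (rule ccontr)
    assume "rGamma (1 + \<mu>) \<noteq> 0"
    from line_integrand_asymptotics[OF \<nu> this t(2) s] obtain e0 where "e0 \<noteq> 0"
      "((\<lambda>y. of_real y powr (1 - (\<mu> - \<nu>) / 2) * line_integrand \<nu> \<mu> t1 t2 y) \<longlongrightarrow> e0) (at_right 0)" by blast
    from power_singularity_not_integrable[OF this(2,1)] int False show False by simp
  qed
  then obtain n where n: "1 + \<mu> = of_int n" "n \<le> 0" by (auto simp: rGamma_eq_zero_iff elim: nonpos_Ints_cases)
  have "Re (1 + \<mu>) = of_int n" unfolding n(1) by simp
  \<comment> \<open>The sum of the two conditions gives Re \<mu> > -3/2, so
    \<open>n > -1/2\<close>.\<close>
  then have "real_of_int n > -1" using c unfolding plus_complex.sel minus_complex.sel one_complex.sel by linarith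
  then have "n = 0" using n(2) by linarith
  then have m: "\<mu> = - 1" using n(1) by (simp add: add_eq_0_iff)
  have "line_integral \<nu> (- 1) t1 t2 = integral {0..1} (\<lambda>y. - (\<nu> * (\<nu> + 1)) * line_integrand \<nu> 1 t1 t2 y)"
    unfolding line_integral_def
    by (rule integral_spike[of "{0}"]) (use line_integrand_minus_1[OF t(3), symmetric] in auto)
  then have "line_integral \<nu> (- 1) t1 t2 = - (\<nu> * (\<nu> + 1)) * line_integral \<nu> 1 t1 t2"
    by (simp add: line_integral_def)
  \<comment> \<open>With \<open>\<mu> = - 1\<close> the conditions read
    \<open>0 < Re \<nu> < 1\<close>, so order 1 lies in the range of absolute convergence.\<close>
  moreover have "phi \<nu> 1 t1 * phi \<nu> 1 t2 = product_const \<nu> 1 * line_integral \<nu> 1 t1 t2"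
    by (rule line_product(2)[OF _ _ t]) (use c m in auto)
  ultimately show ?thesis
    unfolding m phi_minus_1[OF t(1)] phi_minus_1[OF t(2)] product_const_minus_1 by (simp add: mult_ac)
qed

section \<open>Ferrers functions\<close>

lemma Re_inverse_pos:
  assumes "Re z > 0"
  shows "Re (1 / z) > 0"
proof -
  have "(Re z)\<^sup>2 + (Im z)\<^sup>2 > 0" using assms by (simp add: add_pos_nonneg)
  then show ?thesis using assms by (simp add: Re_divide)
qed

lemma Re_of_real_mult: "Re (of_real a * z) = a * Re z"
  by simp

text \<open>The coordinate \<open>t\<close> with \<open>x = tanh t\<close> and \<open>\<bar>Im t\<bar> < \<pi>/2\<close>.\<close>
definition ferrers_t :: "complex \<Rightarrow> complex" where "ferrers_t x = Ln ((1 + x) / (1 - x)) / 2"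

lemma ferrers_t_props:
  assumes x: "x \<in> ferrers_domain"
  shows "x \<noteq> 1" "x \<noteq> -1" "(1 + x) / (1 - x) \<notin> \<real>\<^sub>\<le>\<^sub>0" "exp (2 * ferrers_t x) = (1 + x) / (1 - x)"
    "\<bar>Im (ferrers_t x)\<bar> < pi / 2" "Im (ferrers_t x) = Arg ((1 + x) / (1 - x)) / 2"
    "x = 1 - 2 / (1 + exp (2 * ferrers_t x))" "csqrt (1 - x\<^sup>2) = 1 / cosh (ferrers_t x)"
proof -
  define u where "u = (1 + x) / (1 - x)"
  have nr: "x \<noteq> of_real r" if "r \<le> -1 \<or> r \<ge> 1" for r
    using x that by (auto simp: ferrers_domain_def image_iff)
  show x1: "x \<noteq> 1" "x \<noteq> -1" using nr[of 1] nr[of "-1"] by simp_all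
  show u: "(1 + x) / (1 - x) \<notin> \<real>\<^sub>\<le>\<^sub>0"
  proof
    assume "(1 + x) / (1 - x) \<in> \<real>\<^sub>\<le>\<^sub>0"
    then obtain k where k: "(1 + x) / (1 - x) = of_real k" "k \<le> 0" by (auto elim: nonpos_Reals_cases)
    have e: "x * of_real (1 + k) = of_real (k - 1)" using k(1) x1(1) by (simp add: divide_eq_eq algebra_simps)
    have "1 + k \<noteq> 0"
    proof
      assume "1 + k = 0"
      then have "complex_of_real (k - 1) = 0" using e by simp
      then show False using \<open>1 + k = 0\<close> by (simp only: of_real_eq_0_iff)
    qed
    then have "complex_of_real (1 + k) \<noteq> 0" by (simp only: of_real_eq_0_iff not_False_eq_True)
    then have "x = of_real ((k - 1) / (1 + k))" unfolding of_real_divide using e by (metis nonzero_eq_divide_eq)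
    moreover have "(k - 1) / (1 + k) \<le> -1 \<or> (k - 1) / (1 + k) \<ge> 1"
    proof (cases "1 + k > 0")
      case True
      then show ?thesis using k(2) by (intro disjI1) (simp add: divide_le_eq)
    next
      case False
      then have "1 + k < 0" using \<open>1 + k \<noteq> 0\<close> by simp
      then show ?thesis by (intro disjI2) (simp add: le_divide_eq)
    qed
    ultimately show False using nr by blast
  qed
  then have u0: "u \<noteq> 0" unfolding u_def by (metis nonpos_Reals_zero_I)
  have "2 * ferrers_t x = Ln u" by (simp add: ferrers_t_def u_def)
  then show e: "exp (2 * ferrers_t x) = (1 + x) / (1 - x)" using u0 by (simp add: u_def)
  show im: "Im (ferrers_t x) = Arg ((1 + x) / (1 - x)) / 2"
    using u0 by (simp add: ferrers_t_def u_def Arg_eq_Im_Ln)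
  have "\<bar>Im (Ln u)\<bar> < pi" using u u0 mpi_less_Im_Ln[OF u0] Im_Ln_le_pi[OF u0] Im_Ln_eq_pi[OF u0]
    by (fastforce simp: u_def complex_nonpos_Reals_iff abs_less_iff)
  then show st: "\<bar>Im (ferrers_t x)\<bar> < pi / 2" by (simp add: ferrers_t_def u_def)
  note d = phi_dom_arg[OF phi_dom_strip[OF st]]
  show xe: "x = 1 - 2 / (1 + exp (2 * ferrers_t x))"
    unfolding e using x1 by (simp add: field_simps)
  have "1 - x\<^sup>2 = (1 / cosh (ferrers_t x))\<^sup>2"
  proof -
    define z where "z = 1 / (1 + exp (2 * ferrers_t x))"
    have xz: "x = 1 - 2 * z" using xe by (simp add: z_def)
    have "1 - x\<^sup>2 = 4 * z * (1 - z)" unfolding xz by (simp add: power2_eq_square algebra_simps)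
    then show ?thesis unfolding z_def d(4) .
  qed
  \<comment> \<open>A positive real part singles out the principal square root.\<close>
  moreover have "Re (1 / cosh (ferrers_t x)) > 0"
  proof -
    have "Re (cosh (ferrers_t x)) > 0" unfolding Re_cosh using st by (intro mult_pos_pos cos_gt_zero_pi) (auto simp: abs_less_iff)
    then show ?thesis by (rule Re_inverse_pos)
  qed
  ultimately show "csqrt (1 - x\<^sup>2) = 1 / cosh (ferrers_t x)" by (intro csqrt_unique) auto
qed

lemma ferrersP_eq_phi:
  assumes "x \<in> ferrers_domain"
  shows "ferrersP \<nu> (- \<mu>) x = phi \<nu> \<mu> (ferrers_t x)"
proof -
  note p = ferrers_t_props[OF assms]
  have "(1 + x) / (1 - x) \<noteq> 0" using p(3) by auto
  then have "((1 + x) / (1 - x)) powr (- \<mu> / 2) = exp (- \<mu> * ferrers_t x)"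
    by (simp add: powr_def ferrers_t_def)
  moreover have "(1 - x) / 2 = 1 / (1 + exp (2 * ferrers_t x))" using p(7) by (simp add: field_simps)
  ultimately show ?thesis unfolding ferrersP_def phi_def hypF_def by (simp only: diff_minus_eq_add)
qed

text \<open>With \<open>E\<close> the root in its denominator, \<open>line_cosh\<close> is
  \<open>(E + y / E) / 2\<close>, and both terms have nonnegative real part. This identifies the
  branch of the root of \<open>1 - x\<^sub>3\<^sup>2\<close>.\<close>

lemma Re_line_cosh_pos:
  assumes \<sigma>: "\<bar>Im \<sigma>\<bar> < pi / 2" and y: "0 \<le> y" "y \<le> 1"
  shows "Re (line_cosh \<sigma> y) > 0"
proof -
  define E where "E = csqrt (exp (2 * \<sigma>) + 1 - of_real y)"
  have E: "Re E > 0" unfolding E_def by (rule Re_csqrt_pos[OF line_radicand_not_nonpos[OF \<sigma> y(2)]])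
  have "E\<^sup>2 = exp (2 * \<sigma>) + 1 - of_real y" by (simp add: E_def)
  then have "line_cosh \<sigma> y = (E\<^sup>2 + of_real y) / (2 * E)" by (simp add: line_cosh_def E_def)
  also have "\<dots> = (E + of_real y / E) / 2" using E by (auto simp: add_divide_distrib power2_eq_square)
  finally have e: "line_cosh \<sigma> y = (E + of_real y * (1 / E)) / 2" by simp
  have "0 \<le> y * Re (1 / E)" using Re_inverse_pos[OF E] y by simp
  then have "Re (E + of_real y * (1 / E)) > 0" using E unfolding plus_complex.sel Re_of_real_mult by linarith
  then show ?thesis unfolding e by simp
qed

lemma product_argument_eq:
  assumes x: "csqrt (1 - x1\<^sup>2) = 1 / c1" "csqrt (1 - x2\<^sup>2) = 1 / c2" "csqrt (1 - x3\<^sup>2) = 1 / c3"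
    and c: "c1 \<noteq> 0" "c2 \<noteq> 0" "c3 \<noteq> 0"
  shows "product_argument x1 x2 x3 = (c1\<^sup>2 + c2\<^sup>2 + c3\<^sup>2 - 1) / (2 * (c1 * c2 * c3))"
proof -
  have "1 - x\<^sup>2 = (1 / c)\<^sup>2" if "csqrt (1 - x\<^sup>2) = 1 / c" for x c using that by (metis power2_csqrt)
  from this[OF x(1)] this[OF x(2)] this[OF x(3)]
  have s: "x1\<^sup>2 = 1 - 1 / c1\<^sup>2" "x2\<^sup>2 = 1 - 1 / c2\<^sup>2" "x3\<^sup>2 = 1 - 1 / c3\<^sup>2" by (simp_all add: power_divide algebra_simps)
  have e: "2 - x1\<^sup>2 - x2\<^sup>2 - x3\<^sup>2 + x1\<^sup>2 * x2\<^sup>2 * x3\<^sup>2 = (c1\<^sup>2 + c2\<^sup>2 + c3\<^sup>2 - 1) / (c1 * c2 * c3)\<^sup>2"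
    unfolding s using c by (simp add: field_simps)
  have "K / (c1 * c2 * c3)\<^sup>2 / (2 * (1 / c1 * (1 / c2) * (1 / c3))) = K / (2 * (c1 * c2 * c3))" for K
    using c by (simp add: field_simps power2_eq_square)
  then show ?thesis unfolding product_argument_def x e .
qed

text \<open>The segment is run through from 1 to the lower limit, so \<open>2 / Q\<close> is minus
  the derivative of the parametrization. All factors follow from \<open>1 - x3 = 2 * y / Q\<close>
  and \<open>1 + x3 = 2 * A / Q\<close>.\<close>

lemma product_integrand_eq:
  assumes x: "x1 \<in> ferrers_domain" "x2 \<in> ferrers_domain" and pp: "principal_pair x1 x2" and y: "0 < y" "y \<le> 1"
  defines "Q \<equiv> 1 + exp (2 * (ferrers_t x1 + ferrers_t x2))"
  shows "product_integrand \<nu> \<mu> x1 x2 (1 - 2 * of_real y / Q) * (2 / Q) = line_integrand \<nu> \<mu> (ferrers_t x1) (ferrers_t x2) y"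
proof -
  define t1 t2 where "t1 = ferrers_t x1" "t2 = ferrers_t x2"
  note p1 = ferrers_t_props[OF x(1)] and p2 = ferrers_t_props[OF x(2)]
  have \<sigma>: "\<bar>Im (t1 + t2)\<bar> < pi / 2" using pp by (simp add: t1_t2_def p1(6) p2(6) principal_pair_def flip: add_divide_distrib)
  have strip: "t1 \<in> line_strip t2" using \<sigma> p1(5) by (simp add: line_strip_def t1_t2_def)
  have y': "y \<in> {0..1}" using y by simp
  note n = line_nonzero[OF \<sigma> y']
  define x3 where "x3 = 1 - 2 * of_real y / Q"
  define A where "A = exp (2 * (t1 + t2)) + 1 - of_real y"
  define c where "c = line_cosh (t1 + t2) y"
  have Q: "Q \<noteq> 0" using n(1) by (simp add: Q_def t1_t2_def)
  have QA: "Q = A + of_real y" by (simp add: Q_def A_def t1_t2_def)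
  have A: "A \<noteq> 0" using n(2) by (auto simp: A_def)
  have y0: "complex_of_real y \<noteq> 0" using y by simp
  have x3: "1 - x3\<^sup>2 = 4 * of_real y * A / Q\<^sup>2"
    using Q unfolding x3_def by (simp add: field_simps power2_eq_square) (simp add: QA algebra_simps)
  have "(1 + x3) / (1 - x3) = of_real (1 / y) * A"
    using Q y0 unfolding x3_def by (simp add: field_simps) (simp add: QA algebra_simps)
  \<comment> \<open>The power splits because \<open>1 / y\<close> is positive and leaves the
    argument of \<open>A\<close> unchanged.\<close>
  then have "((1 + x3) / (1 - x3)) powr (- \<mu> / 2) = (of_real (1 / y) * A) powr (- \<mu> / 2)" by (simp only:)
  also have "\<dots> = of_real (1 / y) powr (- \<mu> / 2) * A powr (- \<mu> / 2)"
    using y by (intro powr_real_mult A) simp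
  also have "complex_of_real (1 / y) powr (- \<mu> / 2) = of_real y powr (\<mu> / 2)"
  proof -
    have "complex_of_real (1 / y) powr (- \<mu> / 2) = exp (- \<mu> / 2 * of_real (ln (1 / y)))"
      using y by (simp add: powr_def Ln_of_real del: of_real_divide)
    then show ?thesis using y by (simp add: powr_def Ln_of_real ln_div)
  qed
  finally have F: "ferrersP \<nu> (- \<mu>) x3 = of_real y powr (\<mu> / 2) * A powr (- \<mu> / 2) * hypF \<nu> \<mu> (of_real y / Q)"
    by (simp add: ferrersP_def hypF_def x3_def)
  have c0: "c \<noteq> 0" using n(3) by (simp add: c_def)
  have cs: "csqrt (1 - x3\<^sup>2) = 1 / (c / of_real (sqrt y))"
  proof (rule csqrt_unique)
    have "c\<^sup>2 = Q\<^sup>2 / (4 * A)" by (simp add: c_def line_cosh_def power_divide power_mult_distrib Q_def A_def t1_t2_def)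
    moreover have "(complex_of_real (sqrt y))\<^sup>2 = of_real y" using y by (simp flip: of_real_power)
    ultimately show "(1 / (c / of_real (sqrt y)))\<^sup>2 = 1 - x3\<^sup>2" unfolding x3 by (simp add: power_divide)
    have "Re c > 0" unfolding c_def using y by (intro Re_line_cosh_pos \<sigma>) auto
    from Re_inverse_pos[OF this] have "0 < sqrt y * Re (1 / c)" using y by simp
    also have "\<dots> = Re (of_real (sqrt y) * (1 / c))" by (rule Re_of_real_mult[symmetric])
    also have "of_real (sqrt y) * (1 / c) = 1 / (c / of_real (sqrt y))" by simp
    finally show "0 < Re (1 / (c / of_real (sqrt y))) \<or> Re (1 / (c / of_real (sqrt y))) = 0 \<and> 0 \<le> Im (1 / (c / of_real (sqrt y)))" ..
  qed
  have co: "cosh t1 \<noteq> 0" "cosh t2 \<noteq> 0" using phi_dom_arg(3)[OF phi_dom_strip] p1(5) p2(5) by (auto simp: t1_t2_def)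
  have cy: "c / of_real (sqrt y) \<noteq> 0" using c0 y by simp
  have L: "legendreP \<nu> (product_argument x1 x2 x3) = legp \<nu> (of_real (1 / sqrt y) * line_arg t1 t2 y)"
    unfolding legendreP_eq_legp line_legp_arg_eq[OF p2(5)[folded t1_t2_def] strip y] c_def[symmetric]
      product_argument_eq[OF p1(8)[folded t1_t2_def] p2(8)[folded t1_t2_def] cs co cy] ..
  have 1: "complex_of_real y powr (\<mu> / 2 - 1) = of_real y powr (\<mu> / 2) / of_real y" using y0 by (simp add: powr_diff)
  have 2: "A powr (- \<mu> / 2 - 1) = A powr (- \<mu> / 2) / A" using A powr_diff[of A "- \<mu> / 2" 1] by simp
  have "product_integrand \<nu> \<mu> x1 x2 x3 * (2 / Q) = of_real y powr (\<mu> / 2) * A powr (- \<mu> / 2) * hypF \<nu> \<mu> (of_real y / Q) * (Q\<^sup>2 / (4 * of_real y * A)) *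
     legp \<nu> (of_real (1 / sqrt y) * line_arg t1 t2 y) * (2 / Q)"
    unfolding product_integrand_def F x3 L by (simp add: inverse_eq_divide)
  also have "\<dots> = of_real y powr (\<mu> / 2) / of_real y * ((Q / 2 * (A powr (- \<mu> / 2) / A) * hypF \<nu> \<mu> (of_real y / Q)) * legp \<nu> (of_real (1 / sqrt y) * line_arg t1 t2 y))"
    using Q by (simp add: power2_eq_square mult_ac)
  also have "\<dots> = line_integrand \<nu> \<mu> t1 t2 y"
    unfolding line_integrand_def line_factor_def 1 A_def[symmetric] 2 by (simp add: Q_def t1_t2_def)
  finally show ?thesis by (simp add: x3_def t1_t2_def)
qed

text \<open>An equivalence, so that integrability passes in both directions. The lower limit is
  \<open>tanh (t1 + t2) = 1 - 2 / Q\<close> by the addition theorem, and the singular end point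
  \<open>x\<^sub>3 = 1\<close> is a single parameter value.\<close>

lemma has_contour_integral_product_path:
  assumes x: "x1 \<in> ferrers_domain" "x2 \<in> ferrers_domain" and pp: "principal_pair x1 x2"
  shows "(product_integrand \<nu> \<mu> x1 x2 has_contour_integral i) (product_path x1 x2) \<longleftrightarrow>
    (line_integrand \<nu> \<mu> (ferrers_t x1) (ferrers_t x2) has_integral i) {0..1}"
proof -
  define t1 t2 where "t1 = ferrers_t x1" "t2 = ferrers_t x2"
  note p1 = ferrers_t_props[OF x(1)] and p2 = ferrers_t_props[OF x(2)]
  have \<sigma>: "\<bar>Im (t1 + t2)\<bar> < pi / 2" using pp by (simp add: t1_t2_def p1(6) p2(6) principal_pair_def flip: add_divide_distrib)
  define Q where "Q = 1 + exp (2 * (t1 + t2))"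
  define w where "w = (x1 + x2) / (1 + x1 * x2)"
  have Q: "Q \<noteq> 0" using line_nonzero(1)[OF \<sigma>, of 0] by (simp add: Q_def)
  have w: "w = 1 - 2 / Q"
  proof -
    define u1 u2 where "u1 = exp (2 * t1)" "u2 = exp (2 * t2)"
    have q: "Q = 1 + u1 * u2" by (simp add: Q_def u1_u2_def exp_add distrib_left)
    have n: "1 + u1 \<noteq> 0" "1 + u2 \<noteq> 0"
      using phi_dom_arg(1)[OF phi_dom_strip] p1(5) p2(5) by (auto simp: u1_u2_def t1_t2_def)
    have e: "x1 = (u1 - 1) / (1 + u1)" "x2 = (u2 - 1) / (1 + u2)"
      using p1(7) p2(7) n by (simp_all add: u1_u2_def t1_t2_def diff_divide_eq_iff)
    define M where "M = (1 + u1) * (1 + u2)"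
    have M: "M \<noteq> 0" using n by (simp add: M_def)
    have "1 + x1 * x2 = 2 * Q / M" "x1 + x2 = 2 * (Q - 2) / M"
      using n unfolding e q M_def by (simp_all add: divide_simps) (simp_all add: algebra_simps)
    then have "w = (2 * (Q - 2) / M) / (2 * Q / M)" by (simp only: w_def)
    also have "\<dots> = (Q - 2) / Q" using M Q by (simp add: divide_simps)
    finally have "w = (Q - 2) / Q" .
    then show ?thesis using Q by (simp add: diff_divide_distrib)
  qed
  \<comment> \<open>Reversing the path puts the singular end at parameter 0, where the estimates for
    \<open>line_integrand\<close> are made.\<close>
  have "(product_integrand \<nu> \<mu> x1 x2 has_contour_integral i) (product_path x1 x2) \<longleftrightarrow>
    (product_integrand \<nu> \<mu> x1 x2 has_contour_integral - i) (linepath 1 w)"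
    unfolding product_path_def w_def[symmetric]
    using has_contour_integral_reverse_linepath[of "product_integrand \<nu> \<mu> x1 x2" i w 1]
      has_contour_integral_reverse_linepath[of "product_integrand \<nu> \<mu> x1 x2" "- i" 1 w] by auto
  also have "\<dots> \<longleftrightarrow> ((\<lambda>y. product_integrand \<nu> \<mu> x1 x2 (linepath 1 w y) * (w - 1)) has_integral - i) {0..1}"
    by (rule has_contour_integral_linepath)
  also have "\<dots> \<longleftrightarrow> ((\<lambda>y. - (product_integrand \<nu> \<mu> x1 x2 (linepath 1 w y) * (w - 1))) has_integral i) {0..1}"
    by (rule has_integral_neg_iff[symmetric])
  also have "\<dots> \<longleftrightarrow> (line_integrand \<nu> \<mu> t1 t2 has_integral i) {0..1}"
  proof (rule has_integral_spike_finite_eq[of "{0}"])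
    fix y :: real assume "y \<in> {0..1} - {0}"
    then have y: "0 < y" "y \<le> 1" by auto
    have "linepath 1 w y = 1 - 2 * of_real y / Q" unfolding w linepath_def scaleR_conv_of_real by (simp add: algebra_simps)
    then show "line_integrand \<nu> \<mu> t1 t2 y = - (product_integrand \<nu> \<mu> x1 x2 (linepath 1 w y) * (w - 1))"
      using product_integrand_eq[OF x pp y, of \<nu> \<mu>] by (simp add: w Q_def t1_t2_def)
  qed simp
  finally show ?thesis by (simp add: t1_t2_def)
qed

text \<open>For a divergent integral \<open>contour_integral\<close> returns the default value 0, so
  the equation is asserted only under integrability, and integrability itself is asserted where the
  convergence is absolute.\<close>

theorem corollary40:
  fixes x1 x2 \<nu> \<mu> :: complex
  assumes "x1 \<in> ferrers_domain" and "x2 \<in> ferrers_domain"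
    and "principal_pair x1 x2"
    and "\<nu> \<noteq> 0" and "\<mu> \<noteq> 0"
    and "Re (\<mu> + \<nu>) > -1" and "Re (\<mu> - \<nu>) > -2"
  shows "(Re (\<mu> - \<nu>) > 0 \<longrightarrow>
            product_integrand \<nu> \<mu> x1 x2 contour_integrable_on product_path x1 x2) \<and>
         (product_integrand \<nu> \<mu> x1 x2 contour_integrable_on product_path x1 x2 \<longrightarrow>
            ferrersP \<nu> (- \<mu>) x1 * ferrersP \<nu> (- \<mu>) x2 =
              2 powr (1 - \<mu>) * complex_of_real (sqrt pi) /
                (Gamma ((\<mu> - \<nu>) / 2) * Gamma ((\<nu> + \<mu> + 1) / 2)) *
              contour_integral (product_path x1 x2) (product_integrand \<nu> \<mu> x1 x2))"
proof -
  note x = assms(1-3) and c = assms(6,7)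
  define t1 t2 where "t1 = ferrers_t x1" "t2 = ferrers_t x2"
  note p1 = ferrers_t_props[OF x(1)] and p2 = ferrers_t_props[OF x(2)]
  have t: "\<bar>Im t1\<bar> < pi / 2" "\<bar>Im t2\<bar> < pi / 2" "\<bar>Im (t1 + t2)\<bar> < pi / 2"
    using x(3) p1(5) p2(5) by (simp_all add: t1_t2_def p1(6) p2(6) principal_pair_def flip: add_divide_distrib)
  note h = has_contour_integral_product_path[OF x, of \<nu> \<mu>, folded t1_t2_def]
  have int: "product_integrand \<nu> \<mu> x1 x2 contour_integrable_on product_path x1 x2 \<longleftrightarrow> line_integrand \<nu> \<mu> t1 t2 integrable_on {0..1}"
    using h by (simp add: contour_integrable_on_def integrable_on_def)
  \<comment> \<open>At a pole \<open>Gamma\<close> has the value 0, and division by 0 gives 0, which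
    is also the value of \<open>rGamma\<close> there; the two forms of the constant agree without
    exceptions.\<close>
  have C: "2 powr (1 - \<mu>) * complex_of_real (sqrt pi) / (Gamma ((\<mu> - \<nu>) / 2) * Gamma ((\<nu> + \<mu> + 1) / 2)) = product_const \<nu> \<mu>"
    by (simp only: product_const_def rGamma_inverse_Gamma divide_inverse inverse_mult_distrib)
  show ?thesis
  proof (intro conjI impI)
    assume "Re (\<mu> - \<nu>) > 0"
    then show "product_integrand \<nu> \<mu> x1 x2 contour_integrable_on product_path x1 x2"
      unfolding int using line_product(1)[OF c(1) _ t] by blast
  next
    assume "product_integrand \<nu> \<mu> x1 x2 contour_integrable_on product_path x1 x2"
    then have i: "line_integrand \<nu> \<mu> t1 t2 integrable_on {0..1}" unfolding int .
    then have "(product_integrand \<nu> \<mu> x1 x2 has_contour_integral line_integral \<nu> \<mu> t1 t2) (product_path x1 x2)"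
      unfolding h line_integral_def by (rule integrable_integral)
    then have "contour_integral (product_path x1 x2) (product_integrand \<nu> \<mu> x1 x2) = line_integral \<nu> \<mu> t1 t2"
      by (rule contour_integral_unique)
    then show "ferrersP \<nu> (- \<mu>) x1 * ferrersP \<nu> (- \<mu>) x2 =
        2 powr (1 - \<mu>) * complex_of_real (sqrt pi) / (Gamma ((\<mu> - \<nu>) / 2) * Gamma ((\<nu> + \<mu> + 1) / 2)) *
        contour_integral (product_path x1 x2) (product_integrand \<nu> \<mu> x1 x2)"
      unfolding C ferrersP_eq_phi[OF x(1)] ferrersP_eq_phi[OF x(2)] t1_t2_def[symmetric]
      using line_product_if_integrable[OF c t i] by simp
  qed
qed

end
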